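(* Let $k$ be a number field, $n\ge1$ an integer, and $\theta$ a nonzero algebraic number; put $K=k(\theta)$. Then $g_k(\theta,n)\le 1$. Moreover, equality holds if and only if for every place $v$ of $k$ there is an $\alpha_v\in k_v$ such that $|\theta|_w=|\alpha_v|_v$ holds for all places $w$ of $K$ above $v$.
   Context: Let $k$ have degree $d$, $r$ real and $s$ pairs of complex embeddings. For each place $v$ of $k$ (resp. $w$ of $K$) let $|\cdot|_v$ (resp. $|\cdot|_w$) be the absolute value extending the usual Euclidean or $p$-adic absolute value on $\mathbb{Q}$ (extended to the completion $k_v$); fix completions $k_v$. For each Archimedean place $v$ of $k$ let $V_v$ be the Lebesgue volume (identifying $k_v$ with $\mathbb{R}$ or $\mathbb{C}\cong\mathbb{R}^2$) of the set of $(z_0,\dots,z_n)\in k_v^{n+1}$ with $\prod_{w\mid v}\max\{|z_0|_v,|\theta|_w|z_1|_v,\dots,|\theta|_w|z_n|_v\}^{[K_w:k_v]/[K:k]}<1$, and put $V=(2^r\pi^s)^{-(n+1)}\prod_{v\mid\infty}V_v$. Let $\mathfrak N_k$ (resp. $\mathfrak N_K$) be the absolute norm of fractional ideals, $\mathfrak N_k(\beta):=\mathfrak N_k(\beta O_k)$; $\mu_k$ the Möbius function on nonzero ideals of $O_k$; $(A,B):=A+B$. Choose a nonzero $\alpha\in O_k$ with $\alpha\theta\in O_K$, let $\mathfrak D:=\alpha\theta O_K$, $D:=\mathfrak D\cap O_k$, and \[g_k(\theta,n):=\frac{V}{\mathfrak N_k(\alpha)^n}\sum_{B\mid D}\frac{\mathfrak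 N_K(\mathfrak D,BO_K)^{\frac{n+1}{[K:k]}}}{\mathfrak N_kB}\sum_{A\mid B^{-1}D}\frac{\mu_k(A)}{\mathfrak N_kA}\prod_{P\mid AB}\frac{\mathfrak N_kP^{n+1}-\mathfrak N_kP}{\mathfrak N_kP^{n+1}-1},\] with $B$ over ideals of $O_k$ dividing $D$, $A$ over ideals of $O_k$ dividing $B^{-1}D$, $P$ over prime ideals of $O_k$ dividing $AB$. This is independent of the choice of $\alpha$. *)

theory Defs
  imports "HOL-Analysis.Analysis" "HOL-Computational_Algebra.Polynomial"
begin

definition subfield_C :: "complex set \<Rightarrow> bool" where
  "subfield_C F \<longleftrightarrow> 0 \<in> F \<and> 1 \<in> F \<and> (\<forall>x\<in>F. \<forall>y\<in>F. x + y \<in> F \<and> x - y \<in> F \<and> x * y \<in> F)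
     \<and> (\<forall>x\<in>F. x \<noteq> 0 \<longrightarrow> inverse x \<in> F)"

definition is_basis_over :: "complex set \<Rightarrow> complex set \<Rightarrow> complex set \<Rightarrow> bool" where
  "is_basis_over F L B \<longleftrightarrow> finite B \<and> B \<subseteq> L \<and>
     (\<forall>c. (\<forall>b\<in>B. c b \<in> F) \<longrightarrow> (\<Sum>b\<in>B. c b * b) = 0 \<longrightarrow> (\<forall>b\<in>B. c b = 0)) \<and>
     (\<forall>x\<in>L. \<exists>c. (\<forall>b\<in>B. c b \<in> F) \<and> x = (\<Sum>b\<in>B. c b * b))"

definition ext_degree :: "complex set \<Rightarrow> complex set \<Rightarrow> nat" where
  "ext_degree F L = card (SOME B. is_basis_over F L B)"

definition number_field :: "complex set \<Rightarrow> bool" where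
  "number_field k \<longleftrightarrow> subfield_C k \<and> (\<exists>B. is_basis_over \<rat> k B)"

definition adjoin :: "complex set \<Rightarrow> complex \<Rightarrow> complex set" where
  "adjoin k \<theta> = \<Inter>{F. subfield_C F \<and> k \<subseteq> F \<and> \<theta> \<in> F}"

definition ring_of_integers :: "complex set \<Rightarrow> complex set" where
  "ring_of_integers k = {x \<in> k. algebraic_int x}"

definition is_ideal :: "complex set \<Rightarrow> complex set \<Rightarrow> bool" where
  "is_ideal R I \<longleftrightarrow> I \<subseteq> R \<and> 0 \<in> I \<and> (\<forall>x\<in>I. \<forall>y\<in>I. x + y \<in> I) \<and> (\<forall>r\<in>R. \<forall>x\<in>I. r * x \<in> I)"

definition ideal_gen :: "complex set \<Rightarrow> complex set \<Rightarrow> complex set" where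
  "ideal_gen R S = \<Inter>{I. is_ideal R I \<and> S \<subseteq> I}"

definition ideal_mult :: "complex set \<Rightarrow> complex set \<Rightarrow> complex set \<Rightarrow> complex set" where
  "ideal_mult R I J = ideal_gen R {a * b |a b. a \<in> I \<and> b \<in> J}"

definition ideal_add :: "complex set \<Rightarrow> complex set \<Rightarrow> complex set" where
  "ideal_add I J = {a + b |a b. a \<in> I \<and> b \<in> J}"

fun ideal_pow :: "complex set \<Rightarrow> complex set \<Rightarrow> nat \<Rightarrow> complex set" where
  "ideal_pow R P 0 = R"
| "ideal_pow R P (Suc m) = ideal_mult R P (ideal_pow R P m)"

definition principal_ideal :: "complex set \<Rightarrow> complex \<Rightarrow> complex set" where
  "principal_ideal R a = {a * y |y. y \<in> R}"

definition is_prime_ideal :: "complex set \<Rightarrow> complex set \<Rightarrow> bool" where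
  "is_prime_ideal R P \<longleftrightarrow> is_ideal R P \<and> P \<noteq> R \<and> P \<noteq> {0} \<and>
     (\<forall>a\<in>R. \<forall>b\<in>R. a * b \<in> P \<longrightarrow> a \<in> P \<or> b \<in> P)"

definition ideal_norm :: "complex set \<Rightarrow> complex set \<Rightarrow> nat" where
  "ideal_norm R I = card ((\<lambda>x. {y \<in> R. x - y \<in> I}) ` R)"

definition ideal_dvd :: "complex set \<Rightarrow> complex set \<Rightarrow> bool" where
  "ideal_dvd B D \<longleftrightarrow> D \<subseteq> B"

definition ideal_quot :: "complex set \<Rightarrow> complex set \<Rightarrow> complex set \<Rightarrow> complex set" where
  "ideal_quot R D B = (SOME C. is_ideal R C \<and> ideal_mult R B C = D)"

definition ideal_moebius :: "complex set \<Rightarrow> complex set \<Rightarrow> int" where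
  "ideal_moebius R A =
     (if \<exists>P. is_prime_ideal R P \<and> ideal_dvd (ideal_mult R P P) A then 0
      else (-1) ^ card {P. is_prime_ideal R P \<and> ideal_dvd P A})"

definition embeddings :: "complex set \<Rightarrow> (complex \<Rightarrow> complex) set" where
  "embeddings k = {\<sigma>. (\<forall>x. x \<notin> k \<longrightarrow> \<sigma> x = 0) \<and> \<sigma> 1 = 1 \<and>
      (\<forall>x\<in>k. \<forall>y\<in>k. \<sigma> (x + y) = \<sigma> x + \<sigma> y \<and> \<sigma> (x * y) = \<sigma> x * \<sigma> y)}"

definition real_embedding :: "complex set \<Rightarrow> (complex \<Rightarrow> complex) \<Rightarrow> bool" where
  "real_embedding k \<sigma> \<longleftrightarrow> (\<forall>x\<in>k. \<sigma> x \<in> \<real>)"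

definition arch_places :: "complex set \<Rightarrow> (complex \<Rightarrow> complex) set set" where
  "arch_places k = (\<lambda>\<sigma>. {\<sigma>, cnj \<circ> \<sigma>}) ` embeddings k"

definition real_place :: "(complex \<Rightarrow> complex) set \<Rightarrow> bool" where
  "real_place v \<longleftrightarrow> card v = 1"

definition place_emb :: "(complex \<Rightarrow> complex) set \<Rightarrow> (complex \<Rightarrow> complex)" where
  "place_emb v = (SOME \<sigma>. \<sigma> \<in> v)"

definition arch_abs :: "(complex \<Rightarrow> complex) set \<Rightarrow> complex \<Rightarrow> real" where
  "arch_abs v x = cmod (place_emb v x)"

definition restrict_emb :: "complex set \<Rightarrow> (complex \<Rightarrow> complex) \<Rightarrow> (complex \<Rightarrow> complex)" where
  "restrict_emb k \<tau> = (\<lambda>x. if x \<in> k then \<tau> x else 0)"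

definition arch_above :: "complex set \<Rightarrow> (complex \<Rightarrow> complex) set \<Rightarrow> (complex \<Rightarrow> complex) set \<Rightarrow> bool" where
  "arch_above k w v \<longleftrightarrow> (\<exists>\<tau>\<in>w. restrict_emb k \<tau> \<in> v)"

definition arch_local_degree :: "(complex \<Rightarrow> complex) set \<Rightarrow> (complex \<Rightarrow> complex) set \<Rightarrow> nat" where
  "arch_local_degree w v = (if real_place v \<and> \<not> real_place w then 2 else 1)"

definition ival :: "complex set \<Rightarrow> complex set \<Rightarrow> complex \<Rightarrow> nat" where
  "ival R P a = (GREATEST m. a \<in> ideal_pow R P m)"

definition pval :: "complex set \<Rightarrow> complex set \<Rightarrow> complex \<Rightarrow> int" where
  "pval R P x = (let (a, b) = (SOME (a, b). a \<in> R \<and> b \<in> R \<and> b \<noteq> 0 \<and> x = a / b)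
                 in int (ival R P a) - int (ival R P b))"

definition prime_below :: "complex set \<Rightarrow> nat" where
  "prime_below P = (THE p. prime p \<and> of_nat p \<in> P)"

text \<open>Non-archimedean absolute value |x|_P = p^(-v_P(x)/e(P|p)), extending the usual p-adic one.\<close>
definition padic_abs :: "complex set \<Rightarrow> complex set \<Rightarrow> complex \<Rightarrow> real" where
  "padic_abs R P x = (if x = 0 then 0 else
     real (prime_below P) powr (- real_of_int (pval R P x) / real_of_int (pval R P (of_nat (prime_below P)))))"

text \<open>Values of the absolute value on the completion k_v, unfolded through the
  construction of the completion as Cauchy sequences in k: |alpha|_v = lim |a_j|_v.\<close>
definition completion_abs_values :: "complex set \<Rightarrow> (complex \<Rightarrow> real) \<Rightarrow> real set" where
  "completion_abs_values k absv = {x. \<exists>a. (\<forall>j. a j \<in> k) \<and>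
      (\<forall>e>0. \<exists>N. \<forall>m\<ge>N. \<forall>j\<ge>N. absv (a m - a j) < e) \<and> (\<lambda>j. absv (a j)) \<longlonglongrightarrow> x}"

definition V_arch :: "complex set \<Rightarrow> complex \<Rightarrow> nat \<Rightarrow> (complex \<Rightarrow> complex) set \<Rightarrow> real" where
  "V_arch k \<theta> n v =
    (let K = adjoin k \<theta>;
         F = (\<lambda>(az :: nat \<Rightarrow> real). \<Prod>w\<in>{w\<in>arch_places K. arch_above k w v}.
                (Max ({az 0} \<union> {arch_abs w \<theta> * az i |i. i \<in> {1..n}}))
                  powr (real (arch_local_degree w v) / real (ext_degree k K)))
     in if real_place v then
          measure (Pi\<^sub>M {0..n} (\<lambda>_. (lborel :: real measure)))
            {z \<in> {0..n} \<rightarrow>\<^sub>E UNIV. F (\<lambda>i. \<bar>z i\<bar>) < 1}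
        else
          measure (Pi\<^sub>M {0..n} (\<lambda>_. (lborel :: complex measure)))
            {z \<in> {0..n} \<rightarrow>\<^sub>E UNIV. F (\<lambda>i. cmod (z i)) < 1})"

definition V_const :: "complex set \<Rightarrow> complex \<Rightarrow> nat \<Rightarrow> real" where
  "V_const k \<theta> n =
     (\<Prod>v\<in>arch_places k. V_arch k \<theta> n v) /
     (2 ^ card {\<sigma>\<in>embeddings k. real_embedding k \<sigma>} *
      pi ^ card {v\<in>arch_places k. \<not> real_place v}) ^ (n + 1)"

definition g_k :: "complex set \<Rightarrow> complex \<Rightarrow> nat \<Rightarrow> complex \<Rightarrow> real" where
  "g_k k \<theta> n \<alpha> =
    (let K = adjoin k \<theta>; Ok = ring_of_integers k; OK = ring_of_integers K;
         DD = principal_ideal OK (\<alpha> * \<theta>); D = DD \<inter> Ok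
     in V_const k \<theta> n / real (ideal_norm Ok (principal_ideal Ok \<alpha>)) ^ n *
        (\<Sum>B\<in>{B. is_ideal Ok B \<and> ideal_dvd B D}.
           real (ideal_norm OK (ideal_add DD (ideal_gen OK B))) powr (real (n + 1) / real (ext_degree k K))
             / real (ideal_norm Ok B) *
           (\<Sum>A\<in>{A. is_ideal Ok A \<and> ideal_dvd A (ideal_quot Ok D B)}.
              real_of_int (ideal_moebius Ok A) / real (ideal_norm Ok A) *
              (\<Prod>P\<in>{P. is_prime_ideal Ok P \<and> ideal_dvd P (ideal_mult Ok A B)}.
                 (real (ideal_norm Ok P) ^ (n + 1) - real (ideal_norm Ok P)) /
                 (real (ideal_norm Ok P) ^ (n + 1) - 1)))))"

definition equality_condition :: "complex set \<Rightarrow> complex \<Rightarrow> bool" where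
  "equality_condition k \<theta> \<longleftrightarrow>
    (let K = adjoin k \<theta>; Ok = ring_of_integers k; OK = ring_of_integers K in
     (\<forall>v\<in>arch_places k. \<exists>x\<in>completion_abs_values k (arch_abs v).
         \<forall>w\<in>arch_places K. arch_above k w v \<longrightarrow> arch_abs w \<theta> = x) \<and>
     (\<forall>P. is_prime_ideal Ok P \<longrightarrow> (\<exists>x\<in>completion_abs_values k (padic_abs Ok P).
         \<forall>Q. is_prime_ideal OK Q \<and> Q \<inter> Ok = P \<longrightarrow> padic_abs OK Q \<theta> = x)))"

end

theory Submission
  imports Defs "HOL-Computational_Algebra.Fundamental_Theorem_Algebra" "Jordan_Normal_Form.Char_Poly"
begin

text \<open>
  The divisor sum is an Euler product. At a prime \<open>P\<close> of norm \<open>q\<close> let \<open>l(b)\<close> be the \<open>P\<close>-part of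
  the norm of \<open>(\<DD>, P\<^sup>b O\<^sub>K)\<close>, raised to the power \<open>1 / [K:k]\<close>. Then \<open>l(b + 1) / l(b)\<close> lies in
  \<open>[1, q]\<close>, and raising the exponent of \<open>P\<close> in \<open>D\<close> from \<open>b\<close> to \<open>b + 1\<close> increases the Euler factor by
  at most \<open>l(b + 1)\<^sup>n - l(b)\<^sup>n\<close>. Telescoping bounds the divisor sum by the norm of \<open>\<DD>\<close> to the power
  \<open>n / [K:k]\<close>; equality forces all the ratios to be \<open>1\<close> or \<open>q\<close>, which means that \<open>\<DD>\<close> is locally
  extended from \<open>k\<close>. At an Archimedean place \<open>v\<close>, let \<open>g\<close> be the weighted geometric mean of the
  \<open>|\<theta>|\<^sub>w\<close>. The body defining \<open>V\<^sub>v\<close> is contained in the product of a unit ball and \<open>n\<close> balls of radius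
  \<open>1 / g\<close>, and fills it up to a null set only if all \<open>|\<theta>|\<^sub>w\<close> equal \<open>g\<close>. Since the norm of the ideal
  \<open>\<DD> = \<alpha>\<theta> O\<^sub>K\<close> is the product of all conjugates of \<open>\<alpha>\<theta>\<close> in absolute value, the two bounds multiply
  to \<open>1\<close>.
\<close>

hide_const (open) module.smult

section \<open>Integral combinations\<close>

text \<open>The arithmetic of rings of integers is derived from one invariant, the index of additive
  subgroups of the complex numbers: the ideal norm is such an index, inductions on ideals run on it,
  and finite residue rings supply the chain conditions. Comparisons of norms are first obtained only
  up to a constant factor, from a free sublattice of finite index or from a pigeonhole argument;
  multiplicativity then removes the constant by passing to powers. Two identities found in this way
  carry the proof: the norm of a principal ideal in terms of conjugates, and the fact that the norm
  of I O_K is the [K:k]-th power of the norm of I. At a prime P the second one is sum e f = [K:k],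
  and this is why l(b + 1) / l(b) never exceeds q. The equality conditions differ in kind. An
  Archimedean completion takes every nonnegative absolute value, so only equality of the |theta|_w
  matters. A finite completion has the discrete value group of k, so the common normalized exponent
  must in addition be an integer.\<close>

definition lincomb :: "complex set \<Rightarrow> complex set \<Rightarrow> complex set" where
  "lincomb G B = {\<Sum>b\<in>B. c b * b |c. \<forall>b\<in>B. c b \<in> G}"

definition add_subgroup :: "complex set \<Rightarrow> bool" where
  "add_subgroup G \<longleftrightarrow> 0 \<in> G \<and> (\<forall>x\<in>G. \<forall>y\<in>G. x - y \<in> G)"

lemma add_subgroupD:
  assumes "add_subgroup G"
  shows "0 \<in> G" "x \<in> G \<Longrightarrow> y \<in> G \<Longrightarrow> x - y \<in> G" "x \<in> G \<Longrightarrow> - x \<in> G"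
    "x \<in> G \<Longrightarrow> y \<in> G \<Longrightarrow> x + y \<in> G"
proof -
  show z: "0 \<in> G" and d: "x \<in> G \<Longrightarrow> y \<in> G \<Longrightarrow> x - y \<in> G" for x y
    using assms by (auto simp: add_subgroup_def)
  show m: "- x \<in> G" if "x \<in> G" for x using d[OF z that] by simp
  show "x \<in> G \<Longrightarrow> y \<in> G \<Longrightarrow> x + y \<in> G" using d[OF _ m, of x y] by simp
qed

lemma add_subgroup_sum:
  assumes "add_subgroup G" "\<And>i. i \<in> A \<Longrightarrow> f i \<in> G" shows "sum f A \<in> G"
  using assms(2) by (induction A rule: infinite_finite_induct) (auto simp: add_subgroupD[OF assms(1)])

lemma add_subgroup_of_nat_mult: "add_subgroup G \<Longrightarrow> x \<in> G \<Longrightarrow> of_nat n * x \<in> G"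
  by (induction n) (auto simp: ring_distribs add_subgroupD)

lemma add_subgroup_of_int_mult: "add_subgroup G \<Longrightarrow> x \<in> G \<Longrightarrow> of_int n * x \<in> G"
  by (cases n rule: int_cases2) (auto simp: add_subgroupD add_subgroup_of_nat_mult)

lemma lincombI: "(\<And>b. b \<in> B \<Longrightarrow> c b \<in> G) \<Longrightarrow> (\<Sum>b\<in>B. c b * b) \<in> lincomb G B"
  by (auto simp: lincomb_def)

lemma lincombE:
  assumes "x \<in> lincomb G B"
  obtains c where "\<And>b. b \<in> B \<Longrightarrow> c b \<in> G" "x = (\<Sum>b\<in>B. c b * b)"
  using assms by (auto simp: lincomb_def)

lemma add_subgroup_lincomb:
  assumes "add_subgroup G" shows "add_subgroup (lincomb G B)"
  unfolding add_subgroup_def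
proof (intro conjI ballI)
  show "0 \<in> lincomb G B" using lincombI[of B "\<lambda>_. 0" G] add_subgroupD(1)[OF assms] by simp
next
  fix x y assume "x \<in> lincomb G B" "y \<in> lincomb G B"
  then obtain c d where *: "\<forall>b\<in>B. c b \<in> G" "x = (\<Sum>b\<in>B. c b * b)"
     "\<forall>b\<in>B. d b \<in> G" "y = (\<Sum>b\<in>B. d b * b)" unfolding lincomb_def by blast
  have "x - y = (\<Sum>b\<in>B. (c b - d b) * b)" unfolding * by (simp add: sum_subtractf ring_distribs)
  then show "x - y \<in> lincomb G B" using *(1,3) add_subgroupD(2)[OF assms] by (auto intro: lincombI)
qed

lemma lincomb_single:
  assumes "finite B" "b \<in> B" "c \<in> G" "0 \<in> G" shows "c * b \<in> lincomb G B"
proof -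
  have "(\<Sum>x\<in>B. (if x = b then c else 0) * x) = c * b"
    using assms by (simp add: if_distrib[of "\<lambda>u. u * _"] sum.delta cong: if_cong)
  then show ?thesis using lincombI[of B "\<lambda>x. if x = b then c else 0" G] assms by auto
qed

lemma lincomb_incl: "finite B \<Longrightarrow> 0 \<in> G \<Longrightarrow> 1 \<in> G \<Longrightarrow> B \<subseteq> lincomb G B"
  using lincomb_single[of B _ 1 G] by auto

lemma lincomb_subset:
  assumes "add_subgroup H" "\<And>c b. c \<in> G \<Longrightarrow> b \<in> B \<Longrightarrow> c * b \<in> H" shows "lincomb G B \<subseteq> H"
  using assms by (auto simp: lincomb_def intro!: add_subgroup_sum)

lemma add_subgroup_Ints: "add_subgroup \<int>" by (auto simp: add_subgroup_def)

lemma lincomb_Ints_subset: "add_subgroup H \<Longrightarrow> B \<subseteq> H \<Longrightarrow> lincomb \<int> B \<subseteq> H"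
  by (rule lincomb_subset) (auto elim!: Ints_cases intro: add_subgroup_of_int_mult)

lemma mult_lincomb_Ints:
  assumes "\<And>s. s \<in> S \<Longrightarrow> x * s \<in> lincomb \<int> S" "y \<in> lincomb \<int> S"
  shows "x * y \<in> lincomb \<int> S"
proof -
  obtain c where c: "\<And>b. b \<in> S \<Longrightarrow> c b \<in> \<int>" "y = (\<Sum>b\<in>S. c b * b)" using assms(2) by (metis lincombE)
  have "x * y = (\<Sum>b\<in>S. c b * (x * b))" unfolding c by (simp add: sum_distrib_left algebra_simps)
  also have "\<dots> \<in> lincomb \<int> S"
  proof (rule add_subgroup_sum)
    show ag: "add_subgroup (lincomb \<int> S)" by (simp add: add_subgroup_lincomb add_subgroup_Ints)
    show "c b * (x * b) \<in> lincomb \<int> S" if "b \<in> S" for b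
      using c(1)[OF that] assms(1)[OF that] add_subgroup_of_int_mult[OF ag] by (auto elim!: Ints_cases)
  qed
  finally show ?thesis .
qed

text \<open>The determinant trick: \<open>x\<close> is an eigenvalue of an integer matrix.\<close>
lemma algebraic_int_if_stable:
  assumes fin: "finite S" and nz: "s0 \<in> S" "s0 \<noteq> 0"
    and st: "\<And>s. s \<in> S \<Longrightarrow> x * s \<in> lincomb \<int> S"
  shows "algebraic_int x"
proof -
  have "\<exists>c. x * s = (\<Sum>t\<in>S. of_int (c t) * t)" if sS: "s \<in> S" for s
  proof -
    obtain c where c: "\<And>b. b \<in> S \<Longrightarrow> c b \<in> \<int>" "x * s = (\<Sum>b\<in>S. c b * b)"
      using st[OF sS] by (metis lincombE)
    from c(1) have "\<forall>b\<in>S. \<exists>m. c b = of_int m" by (metis Ints_cases)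
    then obtain m where "\<forall>b\<in>S. c b = of_int (m b)" by metis
    then show ?thesis using c by (auto intro!: exI[of _ m])
  qed
  then obtain c where c: "\<And>s. s \<in> S \<Longrightarrow> x * s = (\<Sum>t\<in>S. of_int (c s t) * t)" using nz by metis
  obtain g where g: "bij_betw g {0..<card S} S" using ex_bij_betw_nat_finite[OF fin] by blast
  define n where "n = card S"
  define A where "A = mat n n (\<lambda>(i,j). c (g i) (g j) :: int)"
  define B where "B = (map_mat of_int A :: complex mat)"
  define v where "v = vec n g"
  have gS: "g i \<in> S" if "i < n" for i using g that unfolding n_def bij_betw_def by auto
  have A: "A \<in> carrier_mat n n" and B: "B \<in> carrier_mat n n" and v: "v \<in> carrier_vec n"
    by (auto simp: A_def B_def v_def)
  have "v \<noteq> 0\<^sub>v n"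
  proof
    assume z: "v = 0\<^sub>v n"
    from nz g obtain i where "i < n" "g i = s0" unfolding bij_betw_def n_def by (metis atLeastLessThan_iff imageE)
    with z have "s0 = 0" unfolding v_def by (metis index_vec index_zero_vec(1))
    with nz show False by simp
  qed
  moreover have "B *\<^sub>v v = x \<cdot>\<^sub>v v"
  proof (rule eq_vecI)
    fix i assume "i < dim_vec (x \<cdot>\<^sub>v v)"
    then have i: "i < n" by (simp add: v_def)
    have "(B *\<^sub>v v) $ i = (\<Sum>j = 0..<n. of_int (c (g i) (g j)) * g j)"
      using i by (simp add: B_def A_def v_def scalar_prod_def)
    also have "\<dots> = (\<Sum>t\<in>S. of_int (c (g i) t) * t)"
      unfolding n_def by (rule sum.reindex_bij_betw[OF g])
    also have "\<dots> = x * g i" using c[OF gS[OF i]] by simp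
    finally show "(B *\<^sub>v v) $ i = (x \<cdot>\<^sub>v v) $ i" using i by (simp add: v_def)
  qed (simp add: B_def A_def v_def)
  ultimately have "eigenvalue B x" using v B unfolding eigenvalue_def eigenvector_def by auto
  then have "poly (char_poly B) x = 0" using eigenvalue_root_char_poly[OF B] by simp
  moreover have "char_poly B = map_poly of_int (char_poly A)"
    unfolding B_def by (rule of_int_hom.char_poly_hom[OF A])
  moreover have "lead_coeff (char_poly A) = 1" using degree_monic_char_poly[OF A] by simp
  ultimately show ?thesis unfolding algebraic_int_altdef_ipoly by auto
qed

text \<open>The monic equation solved for its top power. The degree is positive because a monic
  constant has no root.\<close>

lemma algebraic_int_power_reduce:
  assumes "algebraic_int (x::complex)"
  obtains r c where "r > 0" "x^r = (\<Sum>i<r. of_int (c i) * x^i)"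
proof -
  obtain p where p: "poly (map_poly of_int p) x = 0" "lead_coeff p = (1::int)"
    using assms unfolding algebraic_int_altdef_ipoly by auto
  define r where "r = degree p"
  have lc: "coeff p r = 1" using p unfolding r_def by simp
  have "r > 0" using p by (cases "r = 0") (auto simp: r_def map_poly_pCons elim!: degree_eq_zeroE)
  have deg: "degree (map_poly complex_of_int p) = r" unfolding r_def by (rule degree_map_poly) simp
  have "0 = (\<Sum>i\<le>r. of_int (coeff p i) * x^i)" using p(1) by (simp add: poly_altdef r_def degree_map_poly coeff_map_poly)
  also have "\<dots> = (\<Sum>i<r. of_int (coeff p i) * x^i) + x^r"
    using lc by (simp add: lessThan_Suc_atMost[symmetric])
  finally have e: "x^r = (\<Sum>i<r. of_int (- coeff p i) * x^i)"
    by (simp add: sum_negf eq_neg_iff_add_eq_0 add.commute)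
  with \<open>r > 0\<close> show ?thesis by (rule that)
qed

text \<open>The products \<open>x^i * y^j\<close> with exponents below the degrees of the two monic
  equations span a group stable under multiplication by \<open>x\<close> and by \<open>y\<close>. So
  one set \<open>S\<close> serves the determinant trick both for the sum and for the
  product.\<close>

lemma algebraic_int_add_mult:
  assumes "algebraic_int (x::complex)" "algebraic_int y"
  shows "algebraic_int (x + y)" "algebraic_int (x * y)"
proof -
  obtain r c where r: "r > 0" "x^r = (\<Sum>i<r. of_int (c i) * x^i)"
    using algebraic_int_power_reduce[OF assms(1)] by metis
  obtain t d where t: "t > 0" "y^t = (\<Sum>i<t. of_int (d i) * y^i)"
    using algebraic_int_power_reduce[OF assms(2)] by metis
  define S where "S = (\<lambda>(i,j). x^i * y^j) ` ({..<r} \<times> {..<t})"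
  have fin: "finite S" by (simp add: S_def)
  have mem: "x^i * y^j \<in> S" if "i < r" "j < t" for i j using that unfolding S_def by force
  have ag: "add_subgroup (lincomb \<int> S)" by (simp add: add_subgroup_lincomb add_subgroup_Ints)
  have one: "1 \<in> S" using mem[of 0 0] r t by simp
  have incl: "S \<subseteq> lincomb \<int> S" by (rule lincomb_incl) (auto simp: fin)
  have x: "x * s \<in> lincomb \<int> S" if sS: "s \<in> S" for s
  proof -
    obtain i j where ij: "i < r" "j < t" "s = x^i * y^j" using sS by (auto simp: S_def)
    show ?thesis
    proof (cases "Suc i < r")
      case True
      then show ?thesis using mem[of "Suc i" j] ij incl by (auto simp: mult.assoc)
    next
      case False
      then have "Suc i = r" using ij by simp
      then have "x * s = (\<Sum>i<r. of_int (c i) * (x^i * y^j))" unfolding ij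
        using r(2) by (simp flip: power_Suc mult.assoc add: sum_distrib_right)
      also have "\<dots> \<in> lincomb \<int> S"
        using ij mem incl by (intro add_subgroup_sum[OF ag] add_subgroup_of_int_mult[OF ag]) auto
      finally show ?thesis .
    qed
  qed
  have y: "y * s \<in> lincomb \<int> S" if sS: "s \<in> S" for s
  proof -
    obtain i j where ij: "i < r" "j < t" "s = x^i * y^j" using sS by (auto simp: S_def)
    show ?thesis
    proof (cases "Suc j < t")
      case True
      then show ?thesis using mem[of i "Suc j"] ij incl by (auto simp: mult_ac)
    next
      case False
      then have "Suc j = t" using ij by simp
      then have "y * s = x^i * (\<Sum>j<t. of_int (d j) * y^j)" unfolding ij
        using t(2) by (metis mult.left_commute power_Suc)
      also have "\<dots> = (\<Sum>j<t. of_int (d j) * (x^i * y^j))"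
        by (simp add: sum_distrib_left mult_ac)
      also have "\<dots> \<in> lincomb \<int> S"
        using ij mem incl by (intro add_subgroup_sum[OF ag] add_subgroup_of_int_mult[OF ag]) auto
      finally show ?thesis .
    qed
  qed
  show "algebraic_int (x + y)"
    by (rule algebraic_int_if_stable[OF fin one]) (auto simp: ring_distribs x y add_subgroupD(4)[OF ag])
  show "algebraic_int (x * y)"
  proof (rule algebraic_int_if_stable[OF fin one])
    show "x * y * s \<in> lincomb \<int> S" if "s \<in> S" for s
      using mult_lincomb_Ints[of S x "y * s"] x y[OF that] by (simp add: mult.assoc)
  qed simp
qed

lemma algebraic_int_sum:
  "(\<And>i. i \<in> A \<Longrightarrow> algebraic_int (f i :: complex)) \<Longrightarrow> algebraic_int (sum f A)"
  by (induction A rule: infinite_finite_induct) (auto intro: algebraic_int_add_mult)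

section \<open>The index of an additive subgroup\<close>

text \<open>Cosets have the shape used in \<open>ideal_norm\<close>, so that the norm of an ideal is
  an index by mere unfolding.\<close>

definition idx_cosets :: "complex set \<Rightarrow> complex set \<Rightarrow> complex set set" where
  "idx_cosets G H = (\<lambda>x. {y \<in> G. x - y \<in> H}) ` G"

definition idx :: "complex set \<Rightarrow> complex set \<Rightarrow> nat" where
  "idx G H = card (idx_cosets G H)"

definition fin_idx :: "complex set \<Rightarrow> complex set \<Rightarrow> bool" where
  "fin_idx G H \<longleftrightarrow> finite (idx_cosets G H)"

lemma coset_eq_iff:
  assumes "add_subgroup H" "x \<in> G" "z \<in> G"
  shows "{y \<in> G. x - y \<in> H} = {y \<in> G. z - y \<in> H} \<longleftrightarrow> x - z \<in> H"
proof
  assume "{y \<in> G. x - y \<in> H} = {y \<in> G. z - y \<in> H}"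
  moreover have "z \<in> {y \<in> G. z - y \<in> H}" using assms by (simp add: add_subgroupD)
  ultimately show "x - z \<in> H" by blast
next
  assume d: "x - z \<in> H"
  have "x - y \<in> H \<longleftrightarrow> z - y \<in> H" for y
  proof -
    have "x - y = (x - z) + (z - y)" "z - y = (x - y) - (x - z)" by simp_all
    then show ?thesis using d add_subgroupD(2,4)[OF assms(1)] by metis
  qed
  then show "{y \<in> G. x - y \<in> H} = {y \<in> G. z - y \<in> H}" by auto
qed

lemma bij_betw_idx_cosets:
  assumes "add_subgroup H" "\<And>x y. x \<in> G \<Longrightarrow> y \<in> G \<Longrightarrow> f x = f y \<longleftrightarrow> x - y \<in> H"
  shows "\<exists>h. bij_betw h (idx_cosets G H) (f ` G)"
proof -
  let ?q = "\<lambda>x. {y \<in> G. x - y \<in> H}"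
  have q: "?q x = ?q y \<longleftrightarrow> f x = f y" if "x \<in> G" "y \<in> G" for x y
    using coset_eq_iff[OF assms(1) that] assms(2)[OF that] by simp
  define h where "h C = f (SOME x. x \<in> G \<and> ?q x = C)" for C
  have h: "h (?q x) = f x" if "x \<in> G" for x
  proof -
    have "(SOME z. z \<in> G \<and> ?q z = ?q x) \<in> G \<and> ?q (SOME z. z \<in> G \<and> ?q z = ?q x) = ?q x"
      by (rule someI[of _ x]) (simp add: that)
    then show ?thesis unfolding h_def using q that by blast
  qed
  have "bij_betw h (idx_cosets G H) (f ` G)"
    unfolding bij_betw_def idx_cosets_def
  proof
    show "inj_on h (?q ` G)"
    proof (rule inj_onI)
      fix C D assume "C \<in> ?q ` G" "D \<in> ?q ` G" and e: "h C = h D"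
      then obtain x y where xy: "x \<in> G" "y \<in> G" "C = ?q x" "D = ?q y" by blast
      with e h have "f x = f y" by metis
      then show "C = D" using q[OF xy(1,2)] xy(3,4) by blast
    qed
    have "h ` ?q ` G = (\<lambda>x. h (?q x)) ` G" by (simp add: image_image)
    also have "\<dots> = f ` G" using h by (intro image_cong) auto
    finally show "h ` ?q ` G = f ` G" .
  qed
  then show ?thesis by blast
qed

text \<open>Any map on \<open>G\<close> whose fibres are the congruence classes modulo
  \<open>H\<close> is a model of the quotient. Most indices below are found by exhibiting such a
  map: residues, families of coordinates, multiplication by a fixed element.\<close>

lemma idx_eq_card:
  assumes "add_subgroup H" "\<And>x y. x \<in> G \<Longrightarrow> y \<in> G \<Longrightarrow> f x = f y \<longleftrightarrow> x - y \<in> H"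
  shows "idx G H = card (f ` G)" "fin_idx G H \<longleftrightarrow> finite (f ` G)"
proof -
  obtain h where h: "bij_betw h (idx_cosets G H) (f ` G)" using bij_betw_idx_cosets[OF assms] by blast
  then show "idx G H = card (f ` G)" "fin_idx G H \<longleftrightarrow> finite (f ` G)"
    unfolding idx_def fin_idx_def using bij_betw_same_card bij_betw_finite by blast+
qed

lemma fin_idxD:
  assumes "add_subgroup H" "fin_idx G H"
  obtains T where "finite T" "T \<subseteq> G" "\<And>x. x \<in> G \<Longrightarrow> \<exists>t\<in>T. x - t \<in> H"
proof -
  let ?q = "\<lambda>x. {y \<in> G. x - y \<in> H}"
  obtain T where T: "T \<subseteq> G" "finite T" "?q ` G = ?q ` T"
    using assms(2) finite_subset_image[of "?q ` G" ?q G] unfolding fin_idx_def idx_cosets_def by blast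
  have "\<exists>t\<in>T. x - t \<in> H" if x: "x \<in> G" for x
  proof -
    from x T obtain t where t: "t \<in> T" "?q x = ?q t" by blast
    have "t \<in> G" using t T by blast
    then have "x - t \<in> H" using coset_eq_iff[OF assms(1) x, of t] t(2) by blast
    with t(1) show ?thesis by blast
  qed
  with T that show ?thesis by blast
qed

text \<open>Representatives may be taken from outside \<open>G\<close>. Hence sums of
  representatives serve in \<open>fin_idx_trans\<close>, and passing to a smaller \<open>G\<close>
  in \<open>fin_idx_mono\<close> keeps the old ones.\<close>

lemma fin_idxI:
  assumes "add_subgroup H" "finite T" "\<And>x. x \<in> G \<Longrightarrow> \<exists>t\<in>T. x - t \<in> H"
  shows "fin_idx G H"
proof -
  let ?q = "\<lambda>x. {y \<in> G. x - y \<in> H}"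
  have "?q ` G \<subseteq> (\<lambda>t. {y \<in> G. t - y \<in> H}) ` T"
  proof
    fix C assume "C \<in> ?q ` G"
    then obtain x where x: "x \<in> G" "C = ?q x" by blast
    obtain t where t: "t \<in> T" "x - t \<in> H" using assms(3)[OF x(1)] by blast
    have "x - y \<in> H \<longleftrightarrow> t - y \<in> H" for y
    proof -
      have "x - y = (x - t) + (t - y)" "t - y = (x - y) - (x - t)" by simp_all
      then show ?thesis using t(2) add_subgroupD(2,4)[OF assms(1)] by metis
    qed
    then show "C \<in> (\<lambda>t. {y \<in> G. t - y \<in> H}) ` T" using x t by auto
  qed
  then show ?thesis unfolding fin_idx_def idx_cosets_def using assms(2) finite_subset by blast
qed

lemma fin_idx_trans:
  assumes "add_subgroup L" "add_subgroup H" "fin_idx G L" "fin_idx L H"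
  shows "fin_idx G H"
proof -
  obtain T where T: "finite T" "T \<subseteq> G" "\<And>x. x \<in> G \<Longrightarrow> \<exists>t\<in>T. x - t \<in> L"
    using fin_idxD[OF assms(1,3)] by metis
  obtain U where U: "finite U" "U \<subseteq> L" "\<And>x. x \<in> L \<Longrightarrow> \<exists>t\<in>U. x - t \<in> H"
    using fin_idxD[OF assms(2,4)] by metis
  show ?thesis
  proof (rule fin_idxI[OF assms(2), of "(\<lambda>(a,b). a + b) ` (T \<times> U)"])
    show "finite ((\<lambda>(a,b). a + b) ` (T \<times> U))" using T U by auto
    fix x assume "x \<in> G"
    then obtain t u where "t \<in> T" "u \<in> U" "x - t - u \<in> H" using T(3) U(3) by blast
    then show "\<exists>t\<in>(\<lambda>(a,b). a + b) ` (T \<times> U). x - t \<in> H"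
      by (intro bexI[of _ "t + u"]) (auto simp: algebra_simps)
  qed
qed

lemma fin_idx_mono:
  assumes "add_subgroup H" "add_subgroup H'" "G' \<subseteq> G" "H \<subseteq> H'" "fin_idx G H" shows "fin_idx G' H'"
proof -
  obtain T where T: "finite T" "T \<subseteq> G" "\<And>x. x \<in> G \<Longrightarrow> \<exists>t\<in>T. x - t \<in> H"
    using fin_idxD[OF assms(1,5)] by metis
  show ?thesis by (rule fin_idxI[OF assms(2) T(1)]) (use T assms in blast)
qed

text \<open>Send each coset of \<open>H\<close> to the coset of \<open>L\<close> around it: the
  fibre over \<open>x + L\<close> is a translate of \<open>L\<close> modulo \<open>H\<close>, so all
  fibres have the same size.\<close>

lemma idx_tower:
  assumes "add_subgroup G" "add_subgroup L" "add_subgroup H" "H \<subseteq> L" "L \<subseteq> G" "fin_idx G H"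
  shows "idx G H = idx G L * idx L H"
proof -
  define q where "q = (\<lambda>x. {y \<in> G. x - y \<in> H})"
  define p where "p = (\<lambda>x. {y \<in> G. x - y \<in> L})"
  have q: "q x = q y \<longleftrightarrow> x - y \<in> H" if "x \<in> G" "y \<in> G" for x y
    unfolding q_def using coset_eq_iff[OF assms(3) that] .
  have p: "p x = p y \<longleftrightarrow> x - y \<in> L" if "x \<in> G" "y \<in> G" for x y
    unfolding p_def using coset_eq_iff[OF assms(2) that] .
  have finq: "finite (q ` G)" using assms(6) unfolding fin_idx_def idx_cosets_def q_def .
  \<comment> \<open>The choice of a representative is harmless: elements congruent modulo
    \<open>H\<close> are congruent modulo \<open>L\<close>.\<close>
  define r where "r C = p (SOME x. x \<in> G \<and> q x = C)" for C
  have r: "r (q x) = p x" if x: "x \<in> G" for x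
  proof -
    define s where "s = (SOME z. z \<in> G \<and> q z = q x)"
    have "s \<in> G \<and> q s = q x" unfolding s_def by (rule someI[of _ x]) (simp add: x)
    then have "p s = p x" using p q x assms(4) by blast
    then show ?thesis unfolding r_def s_def .
  qed
  have rq: "r ` (q ` G) = p ` G" using r by (simp add: image_image cong: image_cong)
  have fib: "card {C \<in> q ` G. r C = p x} = idx L H" if x: "x \<in> G" for x
  proof -
    have "{C \<in> q ` G. r C = p x} = (\<lambda>l. q (x + l)) ` L"
    proof (intro equalityI subsetI)
      fix C assume "C \<in> {C \<in> q ` G. r C = p x}"
      then obtain y where y: "y \<in> G" "r (q y) = p x" "C = q y" by blast
      then have "y - x \<in> L" using r p x by metis
      then show "C \<in> (\<lambda>l. q (x + l)) ` L" using y by (intro image_eqI[of _ _ "y - x"]) auto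
    next
      fix C assume "C \<in> (\<lambda>l. q (x + l)) ` L"
      then obtain l where l: "l \<in> L" "C = q (x + l)" by blast
      then have xl: "x + l \<in> G" using assms x add_subgroupD(4) by blast
      have "x + l - x \<in> L" using l by simp
      then have "r (q (x + l)) = p x" using r[OF xl] p[OF xl x] by simp
      then show "C \<in> {C \<in> q ` G. r C = p x}" using xl l by blast
    qed
    moreover have "q (x + l) = q (x + l') \<longleftrightarrow> l - l' \<in> H" if "l \<in> L" "l' \<in> L" for l l'
    proof -
      have "x + l \<in> G" "x + l' \<in> G" using assms x that add_subgroupD(4) by blast+
      then show ?thesis using q by simp
    qed
    ultimately show ?thesis using idx_eq_card(1)[OF assms(3), of L "\<lambda>l. q (x + l)"] by simp
  qed
  have "card (q ` G) = (\<Sum>P\<in>p ` G. card {C \<in> q ` G. r C = P})"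
    using card_eq_sum sum.group[of "q ` G" "p ` G" r "\<lambda>_. 1::nat"] finq rq
    by (metis (no_types, lifting) finite_imageI order_refl sum.cong)
  also have "\<dots> = (\<Sum>P\<in>p ` G. idx L H)" using fib by (intro sum.cong) auto
  finally show ?thesis unfolding idx_def[of G] idx_cosets_def p_def q_def by simp
qed

lemma idx_pos: "fin_idx G H \<Longrightarrow> 0 \<in> G \<Longrightarrow> idx G H > 0"
  unfolding idx_def fin_idx_def idx_cosets_def by (auto simp: card_gt_0_iff)

lemma idx_eq_1D:
  assumes "add_subgroup G" "add_subgroup H" "idx G H = 1" shows "G \<subseteq> H"
proof
  fix x assume x: "x \<in> G"
  have z: "0 \<in> G" using assms add_subgroupD by blast
  obtain C where C: "(\<lambda>x. {y \<in> G. x - y \<in> H}) ` G = {C}" using assms(3) unfolding idx_def idx_cosets_def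
    by (auto simp: card_1_singleton_iff)
  have "{y \<in> G. x - y \<in> H} \<in> {C}" "{y \<in> G. 0 - y \<in> H} \<in> {C}"
    unfolding C[symmetric] by (rule imageI[OF x], rule imageI[OF z])
  then have "x - 0 \<in> H" using coset_eq_iff[OF assms(2) x z] by (metis singletonD)
  then show "x \<in> H" by simp
qed

lemma idx_self:
  assumes "add_subgroup G" shows "idx G G = 1" "fin_idx G G"
proof -
  have *: "(0::nat) = 0 \<longleftrightarrow> x - y \<in> G" if "x \<in> G" "y \<in> G" for x y
    using that assms by (simp add: add_subgroupD)
  have "(\<lambda>_. 0::nat) ` G = {0}" using add_subgroupD(1)[OF assms] by auto
  then show "idx G G = 1" "fin_idx G G"
    using idx_eq_card[OF assms, where f = "\<lambda>_. 0::nat", OF *] by simp_all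
qed

lemma add_subgroup_mult: "add_subgroup G \<Longrightarrow> add_subgroup ((*) c ` G)"
  by (auto simp: add_subgroup_def image_iff) (metis right_diff_distrib)

lemma idx_mult:
  assumes "c \<noteq> 0" "add_subgroup H"
  shows "idx ((*) c ` G) ((*) c ` H) = idx G H" "fin_idx ((*) c ` G) ((*) c ` H) \<longleftrightarrow> fin_idx G H"
proof -
  let ?q = "\<lambda>x. {y \<in> (*) c ` G. x - y \<in> (*) c ` H}"
  have ag: "add_subgroup ((*) c ` H)" using assms add_subgroup_mult by simp
  have *: "?q (c * x) = ?q (c * y) \<longleftrightarrow> x - y \<in> H" if "x \<in> G" "y \<in> G" for x y
    using coset_eq_iff[OF ag, of "c * x" "(*) c ` G" "c * y"] that assms(1)
    by (auto simp flip: right_diff_distrib)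
  show "idx ((*) c ` G) ((*) c ` H) = idx G H"
    using idx_eq_card(1)[OF assms(2) *] by (simp add: idx_def idx_cosets_def image_image)
  show "fin_idx ((*) c ` G) ((*) c ` H) \<longleftrightarrow> fin_idx G H"
    using idx_eq_card(2)[OF assms(2) *] by (simp add: fin_idx_def idx_cosets_def image_image)
qed

lemma idx_mono_left:
  assumes "add_subgroup G" "add_subgroup L" "add_subgroup H" "H \<subseteq> L" "L \<subseteq> G" "fin_idx G H"
  shows "idx L H \<le> idx G H" "idx G L \<le> idx G H"
    "idx G L dvd idx G H"
proof -
  have "fin_idx G L" "fin_idx L H" using assms fin_idx_mono by blast+
  then have "idx G L > 0" "idx L H > 0" using idx_pos add_subgroupD assms by blast+
  then show "idx L H \<le> idx G H" "idx G L \<le> idx G H" "idx G L dvd idx G H"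
    using idx_tower[OF assms] by auto
qed

lemma idx_pigeonhole:
  assumes "add_subgroup H" "fin_idx G H" "finite A" "A \<subseteq> G" "card A > idx G H"
  obtains x y where "x \<in> A" "y \<in> A" "x \<noteq> y" "x - y \<in> H"
proof -
  let ?q = "\<lambda>x. {y \<in> G. x - y \<in> H}"
  have "card (?q ` A) \<le> idx G H" unfolding idx_def idx_cosets_def
    using assms by (intro card_mono) (auto simp: fin_idx_def idx_cosets_def)
  then have "\<not> inj_on ?q A" using assms(5) pigeonhole[of ?q A] by linarith
  then obtain x y where xy: "x \<in> A" "y \<in> A" "x \<noteq> y" "?q x = ?q y" unfolding inj_on_def by blast
  then have "x - y \<in> H" using coset_eq_iff[OF assms(1), of x G y] assms(4) by blast
  with xy that show ?thesis by blast
qed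

text \<open>Adding one representative for each of the finitely many cosets turns generators of the
  subgroup into generators of \<open>G\<close>. This yields finite generation of ideals, on which
  the determinant trick rests.\<close>

lemma lincomb_Ints_fin_gen:
  assumes "add_subgroup G" "finite S" "lincomb \<int> S \<subseteq> G" "fin_idx G (lincomb \<int> S)"
  obtains S' where "finite S'" "S' \<subseteq> G" "S \<subseteq> S'" "G = lincomb \<int> S'"
proof -
  have ag: "add_subgroup (lincomb \<int> A)" for A by (simp add: add_subgroup_lincomb add_subgroup_Ints)
  obtain T where T: "finite T" "T \<subseteq> G" "\<And>x. x \<in> G \<Longrightarrow> \<exists>t\<in>T. x - t \<in> lincomb \<int> S"
    using fin_idxD[OF ag assms(4)] by metis
  have incl: "A \<subseteq> lincomb \<int> A" if "finite A" for A using lincomb_incl[OF that] by simp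
  let ?S = "S \<union> T"
  have fin: "finite ?S" using assms T by simp
  have S: "lincomb \<int> S \<subseteq> lincomb \<int> ?S" using incl[OF fin] by (intro lincomb_Ints_subset ag) auto
  have "S \<subseteq> G" using incl[OF assms(2)] assms(3) by blast
  then have "lincomb \<int> ?S \<subseteq> G" using T by (intro lincomb_Ints_subset assms) auto
  moreover have "G \<subseteq> lincomb \<int> ?S"
  proof
    fix x assume "x \<in> G"
    then obtain t where t: "t \<in> T" "x - t \<in> lincomb \<int> S" using T by blast
    then have "t \<in> lincomb \<int> ?S" "x - t \<in> lincomb \<int> ?S" using incl[OF fin] S by auto
    then show "x \<in> lincomb \<int> ?S" using add_subgroupD(4)[OF ag, of "x - t" ?S t] by simp
  qed
  ultimately show ?thesis using that[of ?S] fin T \<open>S \<subseteq> G\<close> by blast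
qed

text \<open>Independence over \<open>F\<close> makes \<open>lincomb G B\<close> a direct sum of
  copies of \<open>G\<close>, so a coset modulo \<open>lincomb H B\<close> is a family, indexed by
  \<open>B\<close>, of cosets of \<open>G\<close> modulo \<open>H\<close>.\<close>

lemma idx_lincomb:
  assumes "add_subgroup H" "H \<subseteq> G" "finite B"
    and ind: "\<And>c. (\<forall>b\<in>B. c b \<in> F) \<Longrightarrow> (\<Sum>b\<in>B. c b * b) = 0 \<Longrightarrow> (\<forall>b\<in>B. c b = 0)"
    and GF: "add_subgroup F" "G \<subseteq> F" and zG: "add_subgroup G" and fin: "fin_idx G H"
  shows "idx (lincomb G B) (lincomb H B) = idx G H ^ card B" "fin_idx (lincomb G B) (lincomb H B)"
proof -
  let ?q = "\<lambda>x. {y \<in> G. x - y \<in> H}"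
  define co where "co x = (SOME c. (\<forall>b\<in>B. c b \<in> G) \<and> x = (\<Sum>b\<in>B. c b * b))" for x
  have co1: "(\<forall>b\<in>B. co x b \<in> G) \<and> x = (\<Sum>b\<in>B. co x b * b)" if x: "x \<in> lincomb G B" for x
  proof -
    obtain c where "(\<forall>b\<in>B. c b \<in> G) \<and> x = (\<Sum>b\<in>B. c b * b)" using x unfolding lincomb_def by blast
    then show ?thesis unfolding co_def
      by (rule someI[where P = "\<lambda>c. (\<forall>b\<in>B. c b \<in> G) \<and> x = (\<Sum>b\<in>B. c b * b)"])
  qed
  have uniq: "\<forall>b\<in>B. c b = d b" if "\<forall>b\<in>B. c b \<in> F" "\<forall>b\<in>B. d b \<in> F" "(\<Sum>b\<in>B. c b * b) = (\<Sum>b\<in>B. d b * b)" for c d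
  proof -
    have "\<forall>b\<in>B. c b - d b = 0"
    proof (rule ind)
      show "\<forall>b\<in>B. c b - d b \<in> F" using that(1,2) by (metis add_subgroupD(2)[OF GF(1)])
      show "(\<Sum>b\<in>B. (c b - d b) * b) = 0" using that(3) by (simp add: left_diff_distrib sum_subtractf)
    qed
    then show ?thesis by simp
  qed
  define f where "f x = (\<lambda>b\<in>B. ?q (co x b))" for x
  have ag: "add_subgroup (lincomb H B)" by (rule add_subgroup_lincomb[OF assms(1)])
  have dif: "(\<Sum>b\<in>B. (co x b - co y b) * b) = x - y" if x: "x \<in> lincomb G B" and y: "y \<in> lincomb G B" for x y
  proof -
    have "(\<Sum>b\<in>B. (co x b - co y b) * b) = (\<Sum>b\<in>B. co x b * b) - (\<Sum>b\<in>B. co y b * b)"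
      by (simp add: left_diff_distrib sum_subtractf)
    then show ?thesis using co1[OF x] co1[OF y] by metis
  qed
  have *: "f x = f y \<longleftrightarrow> x - y \<in> lincomb H B" if x: "x \<in> lincomb G B" and y: "y \<in> lincomb G B" for x y
  proof -
    have "f x = f y \<longleftrightarrow> (\<forall>b\<in>B. ?q (co x b) = ?q (co y b))"
      unfolding f_def restrict_def fun_eq_iff by auto
    also have "\<dots> \<longleftrightarrow> (\<forall>b\<in>B. co x b - co y b \<in> H)"
      using co1[OF x] co1[OF y] coset_eq_iff[OF assms(1)] by (intro ball_cong) auto
    also have "\<dots> \<longleftrightarrow> x - y \<in> lincomb H B"
    proof
      assume a: "\<forall>b\<in>B. co x b - co y b \<in> H"
      show "x - y \<in> lincomb H B" unfolding dif[OF x y, symmetric] using a by (intro lincombI) simp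
    next
      assume "x - y \<in> lincomb H B"
      then obtain c where c: "\<forall>b\<in>B. c b \<in> H" "x - y = (\<Sum>b\<in>B. c b * b)" unfolding lincomb_def by blast
      have e: "(\<Sum>b\<in>B. (co x b - co y b) * b) = (\<Sum>b\<in>B. c b * b)" using dif[OF x y] c(2) by simp
      have "\<forall>b\<in>B. co x b - co y b = c b"
      proof (rule uniq[OF _ _ e])
        show "\<forall>b\<in>B. co x b - co y b \<in> F"
          using co1[OF x] co1[OF y] GF(2) by (metis add_subgroupD(2)[OF GF(1)] subsetD)
        show "\<forall>b\<in>B. c b \<in> F" using c(1) assms(2) GF(2) by blast
      qed
      then show "\<forall>b\<in>B. co x b - co y b \<in> H" using c by metis
    qed
    finally show ?thesis .
  qed
  have im: "f ` lincomb G B = PiE B (\<lambda>_. idx_cosets G H)"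
  proof
    show "f ` lincomb G B \<subseteq> PiE B (\<lambda>_. idx_cosets G H)"
      using co1 by (force simp: f_def idx_cosets_def)
    show "PiE B (\<lambda>_. idx_cosets G H) \<subseteq> f ` lincomb G B"
    proof
      fix h assume h: "h \<in> PiE B (\<lambda>_. idx_cosets G H)"
      have "\<forall>b\<in>B. \<exists>x\<in>G. h b = ?q x" using h unfolding PiE_def Pi_def idx_cosets_def by auto
      then obtain c where c: "\<forall>b\<in>B. c b \<in> G \<and> h b = ?q (c b)" by metis
      define x where "x = (\<Sum>b\<in>B. c b * b)"
      have x: "x \<in> lincomb G B" unfolding x_def using c by (auto intro: lincombI)
      have "\<forall>b\<in>B. co x b = c b"
      proof (rule uniq)
        show "\<forall>b\<in>B. co x b \<in> F" using co1[OF x] GF by blast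
        show "\<forall>b\<in>B. c b \<in> F" using c GF by blast
        show "(\<Sum>b\<in>B. co x b * b) = (\<Sum>b\<in>B. c b * b)" using co1[OF x] x_def by simp
      qed
      then have "f x = h" using c h unfolding f_def by (auto simp: fun_eq_iff restrict_def PiE_def extensional_def)
      then show "h \<in> f ` lincomb G B" using x by blast
    qed
  qed
  show "idx (lincomb G B) (lincomb H B) = idx G H ^ card B"
    using idx_eq_card(1)[OF ag *] im assms(3) by (simp add: card_PiE idx_def)
  show "fin_idx (lincomb G B) (lincomb H B)"
    using idx_eq_card(2)[OF ag *] im assms(3) fin by (simp add: fin_idx_def finite_PiE)
qed

lemma idx_Ints:
  assumes "n > 0"
  shows "idx \<int> ((*) (of_nat n) ` \<int>) = n" "fin_idx \<int> ((*) (of_nat n) ` \<int>)"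
proof -
  have ag: "add_subgroup ((*) (of_nat n) ` \<int> :: complex set)" by (rule add_subgroup_mult[OF add_subgroup_Ints])
  define f where "f x = (SOME i. x = complex_of_int i) mod int n" for x
  have f: "f (of_int i) = i mod int n" for i unfolding f_def by simp
  have *: "f x = f y \<longleftrightarrow> x - y \<in> (*) (of_nat n) ` \<int>" if "x \<in> \<int>" "y \<in> \<int>" for x y
  proof -
    from that obtain i j where ij: "x = of_int i" "y = of_int j" by (metis Ints_cases)
    have "f x = f y \<longleftrightarrow> int n dvd i - j" unfolding ij f by (rule mod_eq_dvd_iff)
    also have "\<dots> \<longleftrightarrow> x - y \<in> (*) (of_nat n) ` \<int>"
    proof
      assume "int n dvd i - j"
      then obtain k where k: "i - j = int n * k" by blast
      have "x - y = of_int (i - j)" unfolding ij by simp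
      then have "x - y = of_nat n * of_int k" unfolding k by simp
      then show "x - y \<in> (*) (of_nat n) ` \<int>" by (simp add: image_eqI[of _ _ "of_int k"])
    next
      assume "x - y \<in> (*) (of_nat n) ` \<int>"
      then obtain z where z: "z \<in> \<int>" "x - y = of_nat n * z" by blast
      then obtain k where "x - y = of_nat n * of_int k" by (metis Ints_cases)
      then have "complex_of_int (i - j) = of_int (int n * k)" unfolding ij by simp
      then have "i - j = int n * k" by (metis of_int_eq_iff)
      then show "int n dvd i - j" by simp
    qed
    finally show ?thesis .
  qed
  have im: "f ` \<int> = {0..<int n}"
  proof
    show "f ` \<int> \<subseteq> {0..<int n}" using assms by (auto simp: f elim!: Ints_cases)
    show "{0..<int n} \<subseteq> f ` \<int>"
    proof
      fix i assume "i \<in> {0..<int n}"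
      then have "f (of_int i) = i" by (simp add: f)
      then show "i \<in> f ` \<int>" by (metis Ints_of_int image_eqI)
    qed
  qed
  show "idx \<int> ((*) (of_nat n) ` \<int>) = n" using idx_eq_card(1)[OF ag *] im by simp
  show "fin_idx \<int> ((*) (of_nat n) ` \<int>)" using idx_eq_card(2)[OF ag *] im by simp
qed

section \<open>Ideals of an integrally closed ring with finite residue rings\<close>

text \<open>\<open>fin_R\<close> stands for the Noetherian condition and for dimension one at once.
  \<open>int_closed\<close> expresses integral closedness through multipliers: a complex number that
  maps a nonzero ideal into itself lies in \<open>R\<close>. This form mentions neither the fraction
  field nor an equation of integrality.\<close>

locale dedekind_ring =
  fixes R :: "complex set"
  assumes zero_R [simp]: "0 \<in> R" and one_R [simp]: "1 \<in> R"
    and diff_R: "x \<in> R \<Longrightarrow> y \<in> R \<Longrightarrow> x - y \<in> R"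
    and mult_R [simp]: "x \<in> R \<Longrightarrow> y \<in> R \<Longrightarrow> x * y \<in> R"
    and fin_R: "a \<in> R \<Longrightarrow> a \<noteq> 0 \<Longrightarrow> fin_idx R (principal_ideal R a)"
    and int_closed: "is_ideal R I \<Longrightarrow> I \<noteq> {0} \<Longrightarrow> (\<And>y. y \<in> I \<Longrightarrow> x * y \<in> I) \<Longrightarrow> x \<in> R"
begin

abbreviation imult (infixl "\<odot>" 70) where "I \<odot> J \<equiv> ideal_mult R I J"
abbreviation nzi where "nzi I \<equiv> is_ideal R I \<and> I \<noteq> {0}"
abbreviation pr where "pr P \<equiv> is_prime_ideal R P"
abbreviation pri where "pri a \<equiv> principal_ideal R a"
abbreviation N where "N I \<equiv> ideal_norm R I"

lemma ag_R: "add_subgroup R" by (auto simp: add_subgroup_def diff_R)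

lemma norm_idx: "N I = idx R I" by (simp add: ideal_norm_def idx_def idx_cosets_def)

lemma idealD:
  assumes "is_ideal R I"
  shows "I \<subseteq> R" "0 \<in> I" "x \<in> I \<Longrightarrow> x \<in> R" "x \<in> I \<Longrightarrow> y \<in> I \<Longrightarrow> x + y \<in> I"
    "r \<in> R \<Longrightarrow> x \<in> I \<Longrightarrow> r * x \<in> I" "r \<in> R \<Longrightarrow> x \<in> I \<Longrightarrow> x * r \<in> I"
  using assms by (auto simp: is_ideal_def mult.commute)

lemma ideal_ag: "is_ideal R I \<Longrightarrow> add_subgroup I"
proof -
  assume I: "is_ideal R I"
  have "x - y \<in> I" if "x \<in> I" "y \<in> I" for x y
  proof -
    have "(0 - 1) * y \<in> I" using idealD(5)[OF I diff_R[OF zero_R one_R] that(2)] .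
    then show ?thesis using idealD(4)[OF I that(1)] by fastforce
  qed
  then show ?thesis using idealD[OF I] by (auto simp: add_subgroup_def)
qed

lemma ideal_R: "is_ideal R R"
  using add_subgroupD[OF ag_R] by (auto simp: is_ideal_def)

lemma nzi_R: "nzi R" using ideal_R one_R by force

lemma ideal_one: "is_ideal R I \<Longrightarrow> 1 \<in> I \<Longrightarrow> I = R"
  using idealD(5)[of I _ 1] idealD(1) by fastforce

lemma ideal_pri:
  assumes "a \<in> R" shows "is_ideal R (pri a)"
  unfolding is_ideal_def principal_ideal_def
proof (intro conjI ballI)
  show "{a * y |y. y \<in> R} \<subseteq> R" using assms by auto
  show "0 \<in> {a * y |y. y \<in> R}" by (auto intro: exI[of _ 0])
  show "x + y \<in> {a * y |y. y \<in> R}" if xy: "x \<in> {a * y |y. y \<in> R}" "y \<in> {a * y |y. y \<in> R}" for x y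
  proof -
    obtain u v where "u \<in> R" "v \<in> R" "x = a * u" "y = a * v" using xy by blast
    then show ?thesis by (intro CollectI exI[of _ "u + v"]) (simp add: ring_distribs add_subgroupD(4)[OF ag_R])
  qed
  show "r * x \<in> {a * y |y. y \<in> R}" if rx: "r \<in> R" "x \<in> {a * y |y. y \<in> R}" for r x
  proof -
    obtain u where "u \<in> R" "x = a * u" using rx by blast
    then show ?thesis using rx(1) by (intro CollectI exI[of _ "r * u"]) simp
  qed
qed

lemma pri_self: "a \<in> pri a" unfolding principal_ideal_def using one_R by force

lemma nzi_pri: "a \<in> R \<Longrightarrow> a \<noteq> 0 \<Longrightarrow> nzi (pri a)"
  using ideal_pri pri_self by blast

lemma pri_image: "pri a = (*) a ` R" by (auto simp: principal_ideal_def)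

lemma pri_subset: "is_ideal R I \<Longrightarrow> a \<in> I \<Longrightarrow> pri a \<subseteq> I"
  by (auto simp: principal_ideal_def idealD)

lemma ideal_colon: "is_ideal R I \<Longrightarrow> is_ideal R {r \<in> R. r * x \<in> I}"
  unfolding is_ideal_def using add_subgroupD(4)[OF ag_R] by (auto simp: ring_distribs mult.assoc)

lemma fin_nzi: "nzi I \<Longrightarrow> fin_idx R I"
proof -
  assume I: "nzi I"
  then obtain a where a: "a \<in> I" "a \<noteq> 0" using idealD(2) by blast
  then have aR: "a \<in> R" using I idealD by blast
  show ?thesis
    by (rule fin_idx_mono[OF ideal_ag[OF ideal_pri[OF aR]] ideal_ag _ _ fin_R[OF aR a(2)]])
      (use I a pri_subset in auto)
qed

lemma nzi_mono: "nzi I \<Longrightarrow> I \<subseteq> J \<Longrightarrow> is_ideal R J \<Longrightarrow> nzi J"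
  using idealD(2) by blast

lemma norm_pos: "nzi I \<Longrightarrow> N I > 0"
  unfolding norm_idx by (rule idx_pos) (auto simp: fin_nzi)

lemma norm_tower: "nzi I \<Longrightarrow> is_ideal R J \<Longrightarrow> I \<subseteq> J \<Longrightarrow> N I = N J * idx J I"
  unfolding norm_idx by (rule idx_tower) (auto simp: ag_R ideal_ag idealD fin_nzi)

lemma norm_mono: "nzi I \<Longrightarrow> is_ideal R J \<Longrightarrow> I \<subseteq> J \<Longrightarrow> N J \<le> N I"
  using norm_tower[of I J] norm_pos[of I] by (cases "idx J I") auto

text \<open>This descent makes the norm a measure for the inductions on ideals: strictly larger
  ideals are handled first. It holds because a subgroup of index 1 is the whole group.\<close>

lemma norm_strict: "nzi I \<Longrightarrow> is_ideal R J \<Longrightarrow> I \<subset> J \<Longrightarrow> N J < N I"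
proof -
  assume *: "nzi I" "is_ideal R J" "I \<subset> J"
  have t: "N I = N J * idx J I" using norm_tower * by blast
  have "idx J I \<noteq> 1" using idx_eq_1D[of J I] ideal_ag * by blast
  moreover have "idx J I \<noteq> 0" using t norm_pos * by (metis mult_0_right less_numeral_extra(3))
  moreover have "N J > 0" using norm_pos nzi_mono * by blast
  ultimately show ?thesis unfolding t by simp
qed

lemma norm_R: "N R = 1" unfolding norm_idx by (rule idx_self[OF ag_R])

lemma norm_eq_1: "nzi I \<Longrightarrow> N I = 1 \<Longrightarrow> I = R"
  using idx_eq_1D[OF ag_R ideal_ag] idealD(1) unfolding norm_idx by blast

lemma imult_ideal:
  assumes "I \<subseteq> R" "J \<subseteq> R" shows "is_ideal R (I \<odot> J)"
proof -
  have "R \<in> {L. is_ideal R L \<and> {a * b |a b. a \<in> I \<and> b \<in> J} \<subseteq> L}" using assms ideal_R mult_R by blast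
  then show ?thesis unfolding ideal_mult_def ideal_gen_def by (auto simp: is_ideal_def)
qed

lemma imult_I: "a \<in> I \<Longrightarrow> b \<in> J \<Longrightarrow> a * b \<in> I \<odot> J"
  unfolding ideal_mult_def ideal_gen_def by blast

lemma imult_least:
  assumes "is_ideal R L" "\<And>a b. a \<in> I \<Longrightarrow> b \<in> J \<Longrightarrow> a * b \<in> L" shows "I \<odot> J \<subseteq> L"
  unfolding ideal_mult_def ideal_gen_def using assms by blast

lemma imult_commute: "I \<odot> J = J \<odot> I"
proof -
  have "{a * b |a b. a \<in> I \<and> b \<in> J} = {a * b |a b. a \<in> J \<and> b \<in> I}" by (auto, (metis mult.commute)+)
  then show ?thesis unfolding ideal_mult_def by simp
qed

lemma imult_assoc1:
  assumes "is_ideal R I" "is_ideal R J" "is_ideal R L"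
  shows "(I \<odot> J) \<odot> L \<subseteq> I \<odot> (J \<odot> L)"
proof (rule imult_least)
  have JL: "is_ideal R (J \<odot> L)" using imult_ideal idealD(1) assms by blast
  show T: "is_ideal R (I \<odot> (J \<odot> L))" using imult_ideal idealD(1) assms JL by blast
  fix a b assume a: "a \<in> I \<odot> J" and b: "b \<in> L"
  \<comment> \<open>For a fixed \<open>b\<close>, the \<open>r\<close> whose product with
    \<open>b\<close> lies in the target form an ideal, so it is enough to check generators of
    \<open>I \<odot> J\<close>.\<close>
  have "I \<odot> J \<subseteq> {r \<in> R. r * b \<in> I \<odot> (J \<odot> L)}"
  proof (rule imult_least[OF ideal_colon[OF T]])
    fix x y assume xy: "x \<in> I" "y \<in> J"
    then have "x * (y * b) \<in> I \<odot> (J \<odot> L)" using b by (intro imult_I)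
    then show "x * y \<in> {r \<in> R. r * b \<in> I \<odot> (J \<odot> L)}"
      using xy idealD(3)[OF assms(1)] idealD(3)[OF assms(2)] by (auto simp: mult.assoc)
  qed
  then show "a * b \<in> I \<odot> (J \<odot> L)" using a by blast
qed

lemma imult_assoc:
  assumes "is_ideal R I" "is_ideal R J" "is_ideal R L"
  shows "(I \<odot> J) \<odot> L = I \<odot> (J \<odot> L)"
proof -
  have "I \<odot> (J \<odot> L) = (L \<odot> J) \<odot> I"
    unfolding imult_commute[of J L] by (rule imult_commute)
  moreover have "(I \<odot> J) \<odot> L = L \<odot> (J \<odot> I)"
    unfolding imult_commute[of I J] by (rule imult_commute)
  ultimately show ?thesis using imult_assoc1[OF assms] imult_assoc1[OF assms(3,2,1)] by simp
qed

lemma imult_mono: "I \<subseteq> I' \<Longrightarrow> J \<subseteq> J' \<Longrightarrow> I \<odot> J \<subseteq> I' \<odot> J'"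
  unfolding ideal_mult_def ideal_gen_def by blast

lemma imult_le: "is_ideal R I \<Longrightarrow> is_ideal R J \<Longrightarrow> I \<odot> J \<subseteq> I" "is_ideal R I \<Longrightarrow> is_ideal R J \<Longrightarrow> I \<odot> J \<subseteq> J"
  by (rule imult_least; auto intro: idealD)+

lemma imult_R: "is_ideal R I \<Longrightarrow> I \<odot> R = I" "is_ideal R I \<Longrightarrow> R \<odot> I = I"
proof -
  assume I: "is_ideal R I"
  have "x \<in> I \<odot> R" if "x \<in> I" for x using imult_I[OF that one_R] by simp
  then show "I \<odot> R = I" using imult_le(1)[OF I ideal_R] by blast
  then show "R \<odot> I = I" by (simp add: imult_commute)
qed

lemma imult_nzi:
  assumes "nzi I" "nzi J" shows "nzi (I \<odot> J)"
proof -
  obtain a b where "a \<in> I" "a \<noteq> 0" "b \<in> J" "b \<noteq> 0" using assms idealD(2) by blast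
  then have "a * b \<in> I \<odot> J" "a * b \<noteq> 0" using imult_I by auto
  then show ?thesis using imult_ideal idealD(1) assms by blast
qed

lemma pri_imult:
  assumes "a \<in> R" "is_ideal R I" shows "pri a \<odot> I = (*) a ` I"
proof
  have "is_ideal R ((*) a ` I)" unfolding is_ideal_def
  proof (intro conjI ballI)
    show "(*) a ` I \<subseteq> R" using assms idealD(3) by auto
    show "0 \<in> (*) a ` I" using idealD(2)[OF assms(2)] by force
    show "x + y \<in> (*) a ` I" if "x \<in> (*) a ` I" "y \<in> (*) a ` I" for x y
      using that idealD(4)[OF assms(2)] by (auto simp flip: distrib_left)
    show "r * x \<in> (*) a ` I" if "r \<in> R" "x \<in> (*) a ` I" for r x
      using that idealD(5)[OF assms(2)] by (auto simp: mult.left_commute[of r a])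
  qed
  then show "pri a \<odot> I \<subseteq> (*) a ` I"
  proof (rule imult_least)
    fix u b assume "u \<in> pri a" and b: "b \<in> I"
    then obtain y where y: "y \<in> R" "u = a * y" unfolding principal_ideal_def by blast
    then have "u * b = a * (y * b)" "y * b \<in> I" using idealD(5)[OF assms(2) y(1) b] by simp_all
    then show "u * b \<in> (*) a ` I" by blast
  qed
  show "(*) a ` I \<subseteq> pri a \<odot> I" using imult_I[OF pri_self] by blast
qed

lemma mult_image_cancel: "(a::complex) \<noteq> 0 \<Longrightarrow> (*) a ` I \<subseteq> (*) a ` J \<Longrightarrow> I \<subseteq> J"
  by (auto simp: image_iff subset_iff)

lemma prD:
  assumes "pr P" shows "is_ideal R P" "P \<noteq> R" "P \<noteq> {0}" "nzi P" "1 \<notin> P" "a \<in> R \<Longrightarrow> b \<in> R \<Longrightarrow> a * b \<in> P \<Longrightarrow> a \<in> P \<or> b \<in> P"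
  using assms ideal_one unfolding is_prime_ideal_def by blast+

lemma pr_power: "pr P \<Longrightarrow> x \<in> R \<Longrightarrow> x ^ i \<in> P \<Longrightarrow> x \<in> P"
proof (induction i)
  case (Suc i)
  have "x ^ i \<in> R" using Suc(3) by (induction i) auto
  with Suc prD(6)[OF Suc(2), of x "x^i"] show ?case by auto
qed (simp add: prD)

lemma pow_R: "x \<in> R \<Longrightarrow> x ^ i \<in> R" by (induction i) auto

text \<open>The powers of \<open>x \<in> J - P\<close> cannot be pairwise incongruent modulo \<open>P\<close>.\<close>
lemma pr_maximal:
  assumes P: "pr P" and J: "is_ideal R J" "P \<subseteq> J" "J \<noteq> P" shows "J = R"
proof -
  obtain x where x: "x \<in> J" "x \<notin> P" using J by blast
  have xR: "x \<in> R" using x J idealD by blast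
  let ?q = "\<lambda>i. {y \<in> R. x ^ i - y \<in> P}"
  have "range ?q \<subseteq> idx_cosets R P" unfolding idx_cosets_def using pow_R[OF xR] by blast
  then have "finite (range ?q)" using fin_nzi[OF prD(4)[OF P]] unfolding fin_idx_def by (rule finite_subset)
  then have "\<not> inj ?q" using finite_imageD infinite_UNIV_nat by blast
  then obtain i j where ij: "i \<noteq> j" "?q i = ?q j" unfolding inj_on_def by blast
  obtain i j where ij: "i < j" "?q i = ?q j"
  proof (cases "i < j")
    case True then show ?thesis using that ij by blast
  next
    case False then show ?thesis using that[of j i] ij by simp
  qed
  have d: "x ^ i - x ^ j \<in> P" using coset_eq_iff[OF ideal_ag[OF prD(1)[OF P]], of "x^i" R "x^j"] pow_R[OF xR] ij by blast
  have "x ^ i - x ^ j = x ^ i * (1 - x ^ (j - i))" using ij by (simp add: right_diff_distrib flip: power_add)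
  then have "x ^ i \<in> P \<or> 1 - x ^ (j - i) \<in> P" using d prD(6)[OF P, of "x^i" "1 - x^(j-i)"] pow_R[OF xR] diff_R by simp
  then have "1 - x ^ (j - i) \<in> J" using pr_power[OF P xR] x(2) J by blast
  moreover have "x ^ (j - i) \<in> J"
  proof -
    obtain l where "j - i = Suc l" using ij by (metis Suc_diff_Suc)
    then show ?thesis using idealD(6)[OF J(1) pow_R[OF xR] x(1)] by simp
  qed
  ultimately have "1 \<in> J" using idealD(4)[OF J(1)] by fastforce
  then show ?thesis using ideal_one J by blast
qed

lemma not_prE:
  assumes "nzi I" "I \<noteq> R" "\<not> pr I"
  obtains x y where "x \<in> R" "y \<in> R" "x \<notin> I" "y \<notin> I" "x * y \<in> I"
  using assms unfolding is_prime_ideal_def by blast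

lemma colon_strict:
  assumes "nzi I" "x \<in> R" "y \<in> R" "y \<notin> I" "y * x \<in> I"
  shows "nzi {r \<in> R. r * x \<in> I}" "N {r \<in> R. r * x \<in> I} < N I"
proof -
  have i: "is_ideal R {r \<in> R. r * x \<in> I}" using assms ideal_colon by blast
  have s: "I \<subset> {r \<in> R. r * x \<in> I}" using assms idealD(3,6) by blast
  show "nzi {r \<in> R. r * x \<in> I}" by (rule nzi_mono[OF assms(1) _ i]) (use s in blast)
  show "N {r \<in> R. r * x \<in> I} < N I" by (rule norm_strict[OF assms(1) i s])
qed

text \<open>If \<open>I\<close> is not prime, two elements outside \<open>I\<close> with product in
  \<open>I\<close> give a colon ideal that is strictly larger and still proper, hence of smaller
  norm.\<close>

lemma ex_pr:
  assumes "nzi I" "I \<noteq> R" shows "\<exists>P. pr P \<and> I \<subseteq> P"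
  using assms
proof (induction "N I" arbitrary: I rule: less_induct)
  case less
  show ?case
  proof (cases "pr I")
    case False
    then obtain x y where xy: "x \<in> R" "y \<in> R" "x \<notin> I" "y \<notin> I" "x * y \<in> I" using not_prE less by blast
    let ?J = "{r \<in> R. r * x \<in> I}"
    have J: "nzi ?J" "N ?J < N I" using colon_strict[of I x y] less xy by (auto simp: mult.commute)
    have "1 \<notin> ?J" using xy by simp
    then have "?J \<noteq> R" using one_R by blast
    then obtain P where P: "pr P" "?J \<subseteq> P" using less(1)[OF J(2) J(1)] by blast
    have "I \<subseteq> ?J" using idealD(3,6)[OF less(2)[THEN conjunct1]] xy(1) by blast
    then show ?thesis using P by blast
  qed blast
qed

text \<open>The witness \<open>b\<close> spans a copy of R/P inside R/I. It plays the part that a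
  product of primes contained in \<open>I\<close> has in the classical proof that primes are
  invertible.\<close>

lemma ex_annihilator:
  assumes P: "pr P" and I: "nzi I" "I \<subseteq> P"
  shows "\<exists>b\<in>R. b \<notin> I \<and> (\<forall>p\<in>P. b * p \<in> I)"
  using I
proof (induction "N I" arbitrary: I rule: less_induct)
  case less
  show ?case
  proof (cases "I = P")
    case True
    then show ?thesis using prD(5)[OF P] by (intro bexI[of _ 1]) auto
  next
    case False
    have IR: "I \<noteq> R" using less prD[OF P] idealD(1)[OF prD(1)[OF P]] by blast
    have "\<not> pr I" using pr_maximal[of I P] prD[OF P] less False by blast
    then obtain x y where xy: "x \<in> R" "y \<in> R" "x \<notin> I" "y \<notin> I" "x * y \<in> I" using not_prE less IR by blast
    \<comment> \<open>Pass to the colon ideal of \<open>I\<close> by \<open>j\<close>, which has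
      smaller norm; if \<open>c\<close> is a witness there, then \<open>c * j\<close> is one for
      \<open>I\<close>.\<close>
    have step: ?thesis if j: "j \<in> R" "j \<notin> I" "z \<in> R" "z \<notin> I" "z * j \<in> I" and s: "{r \<in> R. r * j \<in> I} \<subseteq> P" for j z
    proof -
      have J: "nzi {r \<in> R. r * j \<in> I}" "N {r \<in> R. r * j \<in> I} < N I" using colon_strict[of I j z] less j by auto
      obtain c where c: "c \<in> R" "c \<notin> {r \<in> R. r * j \<in> I}" "\<forall>p\<in>P. c * p \<in> {r \<in> R. r * j \<in> I}"
        using less(1)[OF J(2) J(1) s] by blast
      have "c * j * p = c * p * j" for p by simp
      then have "\<forall>p\<in>P. c * j * p \<in> I" using c(3) by (metis (no_types, lifting) mem_Collect_eq)
      then show ?thesis using c(1,2) j(1) mult_R by blast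
    qed
    show ?thesis
    proof (cases "{r \<in> R. r * x \<in> I} \<subseteq> P")
      case True
      then show ?thesis using step[of x y] xy by (simp add: mult.commute)
    next
      case F: False
      \<comment> \<open>Since \<open>j\<close> is outside \<open>P\<close> and \<open>I\<close> is
        inside, \<open>r * j\<close> in \<open>I\<close> forces \<open>r\<close> into
        \<open>P\<close>: the colon ideal by \<open>j\<close> is contained in \<open>P\<close>, as
        the induction demands.\<close>
      then obtain j where j: "j \<in> R" "j * x \<in> I" "j \<notin> P" by blast
      have "{r \<in> R. r * j \<in> I} \<subseteq> P" using prD(6)[OF P _ j(1)] j(3) less(3) by blast
      then show ?thesis using step[of j x] j xy less(3) by (auto simp: mult.commute)
    qed
  qed
qed

text \<open>\<open>P'\<close> is \<open>a\<close> times the inverse of \<open>P\<close>. The ideal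
  \<open>J\<close> of all \<open>y\<close> with \<open>y * a\<close> in \<open>P \<odot> P'\<close>
  lies between \<open>P\<close> and \<open>R\<close>. If it were \<open>P\<close>, multiplication by
  \<open>b / a\<close> would preserve \<open>P\<close>, so \<open>b / a\<close> would be in
  \<open>R\<close>, against the choice of \<open>b\<close> outside \<open>pri a\<close>.\<close>

lemma pr_invertible:
  assumes P: "pr P" shows "\<exists>P' a. nzi P' \<and> a \<in> R \<and> a \<noteq> 0 \<and> P \<odot> P' = pri a"
proof -
  note Pi = prD(1)[OF P]
  obtain a where a: "a \<in> P" "a \<noteq> 0" using prD(4)[OF P] idealD(2) by blast
  have aR: "a \<in> R" using a idealD Pi by blast
  have ai: "is_ideal R (pri a)" by (rule ideal_pri[OF aR])
  obtain b where b: "b \<in> R" "b \<notin> pri a" "\<forall>p\<in>P. b * p \<in> pri a"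
    using ex_annihilator[OF P nzi_pri[OF aR a(2)] pri_subset[OF Pi a(1)]] by blast
  define P' where "P' = {x \<in> R. \<forall>p\<in>P. x * p \<in> pri a}"
  have aP': "a \<in> P'" unfolding P'_def using aR idealD(6)[OF ai _ pri_self] idealD(3)[OF Pi] by blast
  have bP': "b \<in> P'" using b unfolding P'_def by blast
  have P'i: "is_ideal R P'" unfolding is_ideal_def P'_def
    using add_subgroupD(4)[OF ag_R] idealD[OF ai] by (auto simp: ring_distribs mult.assoc)
  have PP': "is_ideal R (P \<odot> P')" using imult_ideal idealD(1) Pi P'i by blast
  have le: "P \<odot> P' \<subseteq> pri a" by (rule imult_least[OF ai]) (auto simp: P'_def mult.commute)
  define J where "J = {y \<in> R. y * a \<in> P \<odot> P'}"
  have Ji: "is_ideal R J" unfolding J_def by (rule ideal_colon[OF PP'])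
  have "P \<subseteq> J" unfolding J_def using imult_I[OF _ aP'] idealD(3)[OF Pi] by blast
  moreover have "J \<noteq> P"
  proof
    assume JP: "J = P"
    have "b / a \<in> R"
    proof (rule int_closed[OF Pi prD(3)[OF P]])
      fix p assume p: "p \<in> P"
      obtain y where y: "y \<in> R" "b * p = a * y" using b p unfolding principal_ideal_def by blast
      have "y * a \<in> P \<odot> P'" using imult_I[OF p bP'] y by (simp add: mult.commute)
      then have "y \<in> P" using y JP J_def by blast
      moreover have "b / a * p = y" using y a(2) by (simp add: field_simps)
      ultimately show "b / a * p \<in> P" by simp
    qed
    then have "b \<in> pri a" unfolding principal_ideal_def using a(2) by (intro CollectI exI[of _ "b/a"]) auto
    with b show False by simp
  qed
  ultimately have "J = R" using pr_maximal[OF P Ji] by blast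
  then have "a \<in> P \<odot> P'" using one_R unfolding J_def by (metis (no_types, lifting) mem_Collect_eq mult_1)
  then have "P \<odot> P' = pri a" using le pri_subset[OF PP'] by blast
  moreover have "nzi P'" using P'i aP' a(2) by blast
  ultimately show ?thesis using aR a(2) by blast
qed

text \<open>\<open>C\<close> is \<open>J\<close> divided by a prime containing it. It is strictly
  larger than \<open>J\<close>: otherwise every \<open>y / a\<close> with \<open>y\<close> in
  \<open>P'\<close> would preserve \<open>J\<close> and hence lie in \<open>R\<close>, which would
  put 1 into \<open>P\<close>. So the norm drops and the induction applies to
  \<open>C\<close>.\<close>

lemma invertible:
  assumes "nzi J" shows "\<exists>J' a. nzi J' \<and> a \<in> R \<and> a \<noteq> 0 \<and> J \<odot> J' = pri a"
  using assms
proof (induction "N J" arbitrary: J rule: less_induct)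
  case less
  show ?case
  proof (cases "J = R")
    case True
    have "R \<odot> R = pri 1" using imult_R(1)[OF ideal_R] by (simp add: pri_image)
    then show ?thesis using nzi_R True one_R zero_neq_one by metis
  next
    case False
    then obtain P where P: "pr P" "J \<subseteq> P" using ex_pr less by blast
    obtain P' a where P': "nzi P'" "a \<in> R" "a \<noteq> 0" "P \<odot> P' = pri a" using pr_invertible P by blast
    have Ji: "is_ideal R J" and P'i: "is_ideal R P'" using less P' by auto
    note Pi = prD(1)[OF P(1)]
    have JP'i: "is_ideal R (J \<odot> P')" using imult_ideal idealD(1) Ji P'i by blast
    define C where "C = {x \<in> R. x * a \<in> J \<odot> P'}"
    have Ci: "is_ideal R C" unfolding C_def by (rule ideal_colon[OF JP'i])
    have "J \<odot> P' \<subseteq> pri a" using imult_mono[OF P(2) order_refl, of P'] P' by simp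
    then have aC: "J \<odot> P' = (*) a ` C" unfolding C_def principal_ideal_def by (auto simp: mult.commute)
    have "(*) a ` (P \<odot> C) = pri a \<odot> (P \<odot> C)" using pri_imult[OF P'(2)] imult_ideal idealD(1) Pi Ci by metis
    also have "\<dots> = P \<odot> (pri a \<odot> C)" using imult_assoc ideal_pri[OF P'(2)] Pi Ci imult_commute by metis
    also have "\<dots> = P \<odot> (J \<odot> P')" using aC pri_imult[OF P'(2) Ci] by simp
    also have "\<dots> = (P \<odot> P') \<odot> J" using imult_assoc Pi Ji P'i imult_commute by metis
    also have "\<dots> = (*) a ` J" using P' pri_imult[OF P'(2) Ji] by simp
    finally have PC: "P \<odot> C = J" using mult_image_cancel[OF P'(3)] by blast
    have "a \<in> P'" using imult_le(2)[OF Pi P'i] P'(4) pri_self by blast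
    then have JC: "J \<subseteq> C" unfolding C_def using imult_I idealD(3)[OF Ji] by blast
    have "C \<noteq> J"
    proof
      assume CJ: "C = J"
      have "P' \<subseteq> pri a"
      proof
        fix y assume y: "y \<in> P'"
        have "y / a \<in> R"
        proof (rule int_closed[OF Ji])
          show "J \<noteq> {0}" using less by simp
          fix x assume "x \<in> J"
          then have "x * y \<in> (*) a ` J" using imult_I[of x J y P'] y aC CJ by simp
          then show "y / a * x \<in> J" using P'(3) by (auto simp: field_simps)
        qed
        then show "y \<in> pri a" unfolding principal_ideal_def using P'(3) by (intro CollectI exI[of _ "y/a"]) auto
      qed
      then have "pri a \<subseteq> P \<odot> pri a" using imult_mono[of P P P' "pri a"] P'(4) by simp
      also have "\<dots> = (*) a ` P" using pri_imult[OF P'(2) Pi] imult_commute by simp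
      finally have "a \<in> (*) a ` P" using pri_self by blast
      then have "1 \<in> P" using P'(3) by auto
      then show False using prD(5)[OF P(1)] by simp
    qed
    then have "N C < N J" using norm_strict[of J C] less JC Ci by blast
    moreover have "nzi C" by (rule nzi_mono[OF less(2) JC Ci])
    ultimately obtain C' c where C': "nzi C'" "c \<in> R" "c \<noteq> 0" "C \<odot> C' = pri c" using less(1) by blast
    have C'i: "is_ideal R C'" using C' by simp
    have "J \<odot> (P' \<odot> C') = (J \<odot> P') \<odot> C'" using imult_assoc[OF Ji P'i C'i] by simp
    also have "\<dots> = (pri a \<odot> C) \<odot> C'" using aC pri_imult[OF P'(2) Ci] by simp
    also have "\<dots> = pri a \<odot> pri c" using imult_assoc[OF ideal_pri[OF P'(2)] Ci C'i] C' by simp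
    also have "\<dots> = pri (a * c)" using pri_imult[OF P'(2) ideal_pri[OF C'(2)]]
      by (simp add: pri_image image_image mult.assoc)
    finally show ?thesis using imult_nzi[OF P'(1) C'(1)] P'(2,3) C'(2,3)
      by (intro exI[of _ "P' \<odot> C'"] exI[of _ "a * c"]) auto
  qed
qed

lemma imult_cancel_le:
  assumes "nzi J" "is_ideal R C" "is_ideal R C'" "J \<odot> C \<subseteq> J \<odot> C'" shows "C \<subseteq> C'"
proof -
  obtain J' a where J': "nzi J'" "a \<in> R" "a \<noteq> 0" "J \<odot> J' = pri a" using invertible[OF assms(1)] by blast
  have Ji: "is_ideal R J" "is_ideal R J'" using J' assms by auto
  have *: "J' \<odot> (J \<odot> X) = (*) a ` X" if X: "is_ideal R X" for X
    using imult_assoc[OF Ji(2) Ji(1) X] J' pri_imult[OF J'(2) X] imult_commute by metis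
  have "(*) a ` C \<subseteq> (*) a ` C'" using imult_mono[OF order_refl assms(4), of J'] * assms by simp
  then show ?thesis using mult_image_cancel J' by blast
qed

lemma imult_cancel:
  assumes "nzi J" "is_ideal R C" "is_ideal R C'" "J \<odot> C = J \<odot> C'" shows "C = C'"
  using imult_cancel_le[OF assms(1-3)] imult_cancel_le[OF assms(1,3,2)] assms(4) by blast

text \<open>To contain is to divide: with \<open>J \<odot> J' = pri a\<close>, the cofactor is
  \<open>I \<odot> J'\<close> divided by \<open>a\<close>.\<close>

lemma ideal_dvdE:
  assumes "nzi J" "is_ideal R I" "I \<subseteq> J"
  obtains C where "is_ideal R C" "J \<odot> C = I"
proof -
  obtain J' a where J': "nzi J'" "a \<in> R" "a \<noteq> 0" "J \<odot> J' = pri a" using invertible[OF assms(1)] by blast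
  have Ji: "is_ideal R J" "is_ideal R J'" using J' assms by auto
  have IJ': "is_ideal R (I \<odot> J')" using imult_ideal idealD(1) assms Ji by blast
  define C where "C = {x \<in> R. x * a \<in> I \<odot> J'}"
  have Ci: "is_ideal R C" unfolding C_def by (rule ideal_colon[OF IJ'])
  have "I \<odot> J' \<subseteq> pri a" using imult_mono[OF assms(3) order_refl, of J'] J' by simp
  then have aC: "I \<odot> J' = (*) a ` C" unfolding C_def principal_ideal_def by (auto simp: mult.commute)
  have "(*) a ` (J \<odot> C) = pri a \<odot> (J \<odot> C)" using pri_imult[OF J'(2)] imult_ideal idealD(1) Ji Ci by metis
  also have "\<dots> = J \<odot> (pri a \<odot> C)" using imult_assoc ideal_pri[OF J'(2)] Ji Ci imult_commute by metis
  also have "\<dots> = J \<odot> (I \<odot> J')" using aC pri_imult[OF J'(2) Ci] by simp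
  also have "\<dots> = (J \<odot> J') \<odot> I" using imult_assoc Ji assms(2) imult_commute by metis
  also have "\<dots> = (*) a ` I" using J' pri_imult[OF J'(2) assms(2)] by simp
  finally have "J \<odot> C = I" using mult_image_cancel[OF J'(3)] by blast
  with Ci that show ?thesis by blast
qed

text \<open>I/IP is a line over the field R/P. For \<open>x\<close> in \<open>I\<close> outside
  \<open>I \<odot> P\<close>, the map from r to r x has kernel exactly \<open>P\<close> because
  \<open>P\<close> is maximal, and it is onto because no ideal lies strictly between
  \<open>I \<odot> P\<close> and \<open>I\<close>.\<close>

lemma norm_imult_pr:
  assumes I: "nzi I" and P: "pr P" shows "N (I \<odot> P) = N I * N P"
proof -
  note Pi = prD(1)[OF P] and Ii = I[THEN conjunct1]
  have IP: "nzi (I \<odot> P)" using imult_nzi I prD(4)[OF P] by blast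
  then have IPi: "is_ideal R (I \<odot> P)" by simp
  have le: "I \<odot> P \<subseteq> I" using imult_le(1)[OF Ii Pi] .
  have "I \<odot> P \<noteq> I" using imult_cancel[OF I Pi ideal_R] imult_R(1)[OF Ii] prD(2)[OF P] by auto
  then obtain x where x: "x \<in> I" "x \<notin> I \<odot> P" using le by blast
  have xR: "x \<in> R" using x Ii idealD by blast
  have "{r \<in> R. r * x \<in> I \<odot> P} = P"
  proof (rule ccontr)
    assume "{r \<in> R. r * x \<in> I \<odot> P} \<noteq> P"
    moreover have "P \<subseteq> {r \<in> R. r * x \<in> I \<odot> P}"
      using imult_I[OF x(1), of _ P] idealD(3)[OF Pi] by (auto simp: mult.commute)
    ultimately have "{r \<in> R. r * x \<in> I \<odot> P} = R" using pr_maximal[OF P ideal_colon[OF IPi]] by blast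
    then have "1 \<in> {r \<in> R. r * x \<in> I \<odot> P}" by simp
    then show False using x by simp
  qed
  then have ker: "r * x \<in> I \<odot> P \<longleftrightarrow> r \<in> P" if "r \<in> R" for r using that by blast
  \<comment> \<open>\<open>L\<close> is R x + IP. Written as \<open>I \<odot> L'\<close> it makes
    \<open>L'\<close> strictly larger than \<open>P\<close>, so that \<open>L'\<close> is
    \<open>R\<close>.\<close>
  define L where "L = {y \<in> I. \<exists>r\<in>R. y - r * x \<in> I \<odot> P}"
  have Li: "is_ideal R L" unfolding is_ideal_def
  proof (intro conjI ballI)
    show "L \<subseteq> R" using idealD(1)[OF Ii] L_def by blast
    show "0 \<in> L" unfolding L_def using idealD(2)[OF Ii] idealD(2)[OF IPi] by (auto intro: bexI[of _ 0])
    show "y + z \<in> L" if yz: "y \<in> L" "z \<in> L" for y z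
    proof -
      obtain r s where rs: "y \<in> I" "z \<in> I" "r \<in> R" "s \<in> R" "y - r * x \<in> I \<odot> P" "z - s * x \<in> I \<odot> P"
        using yz unfolding L_def by blast
      have "y + z - (r + s) * x = (y - r * x) + (z - s * x)" by (simp add: algebra_simps)
      then have "y + z - (r + s) * x \<in> I \<odot> P" using idealD(4)[OF IPi rs(5,6)] by metis
      then show ?thesis unfolding L_def using rs idealD(4)[OF Ii] add_subgroupD(4)[OF ag_R] by blast
    qed
    show "t * y \<in> L" if ty: "t \<in> R" "y \<in> L" for t y
    proof -
      obtain r where rs: "y \<in> I" "r \<in> R" "y - r * x \<in> I \<odot> P" using ty unfolding L_def by blast
      have "t * y - (t * r) * x = t * (y - r * x)" by (simp add: algebra_simps)
      then have "t * y - (t * r) * x \<in> I \<odot> P" using idealD(5)[OF IPi ty(1) rs(3)] by metis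
      then show ?thesis unfolding L_def using rs idealD(5)[OF Ii ty(1)] mult_R[OF ty(1)] by blast
    qed
  qed
  have LI: "L \<subseteq> I" unfolding L_def by blast
  have IPL: "I \<odot> P \<subseteq> L" unfolding L_def using le by (auto intro: bexI[of _ 0])
  have xL: "x \<in> L" unfolding L_def using x idealD(2)[OF IPi] by (auto intro!: bexI[of _ 1])
  obtain L' where L': "is_ideal R L'" "I \<odot> L' = L" using ideal_dvdE[OF I Li LI] by blast
  have "P \<subseteq> L'" using imult_cancel_le[OF I Pi L'(1)] IPL L'(2) by simp
  moreover have "L' \<noteq> P" using L' xL x by blast
  ultimately have "L' = R" using pr_maximal[OF P L'(1)] by blast
  then have LI: "L = I" using L' imult_R(1)[OF Ii] by simp
  define f where "f r = {y \<in> I. r * x - y \<in> I \<odot> P}" for r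
  have rxI: "r * x \<in> I" if "r \<in> R" for r using idealD(5)[OF Ii that x(1)] .
  have *: "f r = f s \<longleftrightarrow> r - s \<in> P" if "r \<in> R" "s \<in> R" for r s
    unfolding f_def coset_eq_iff[OF ideal_ag[OF IPi] rxI[OF that(1)] rxI[OF that(2)]]
    using ker[OF diff_R[OF that]] by (simp add: left_diff_distrib)
  have "f ` R = idx_cosets I (I \<odot> P)"
  proof
    show "f ` R \<subseteq> idx_cosets I (I \<odot> P)" unfolding f_def idx_cosets_def using rxI by blast
    show "idx_cosets I (I \<odot> P) \<subseteq> f ` R"
    proof
      fix C assume "C \<in> idx_cosets I (I \<odot> P)"
      then obtain z where z: "z \<in> I" "C = {y \<in> I. z - y \<in> I \<odot> P}" unfolding idx_cosets_def by blast
      then have "z \<in> L" using LI by simp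
      then obtain r where r: "r \<in> R" "z - r * x \<in> I \<odot> P" unfolding L_def by blast
      then have "C = f r" unfolding f_def z(2) using coset_eq_iff[OF ideal_ag[OF IPi] z(1) rxI[OF r(1)]] by blast
      then show "C \<in> f ` R" using r by blast
    qed
  qed
  then have "idx R P = idx I (I \<odot> P)" using idx_eq_card(1)[OF ideal_ag[OF Pi], of R f] * by (simp add: idx_def)
  then show ?thesis using norm_tower[OF IP Ii le] by (simp add: norm_idx)
qed

lemma ideal_factor_pr:
  assumes "nzi I" "I \<noteq> R"
  obtains P C where "pr P" "nzi C" "I = C \<odot> P" "N C < N I"
proof -
  obtain P where P: "pr P" "I \<subseteq> P" using ex_pr assms by blast
  have Ii: "is_ideal R I" using assms by simp
  obtain C where C: "is_ideal R C" "P \<odot> C = I" using ideal_dvdE[OF prD(4)[OF P(1)] Ii P(2)] by blast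
  have "I \<subseteq> C" using imult_le(2)[OF prD(1)[OF P(1)] C(1)] C(2) by simp
  then have nC: "nzi C" using nzi_mono assms C by blast
  have "C \<noteq> I" using imult_cancel[OF nC prD(1)[OF P(1)] ideal_R] imult_R(1)[OF C(1)] C(2) imult_commute prD(2)[OF P(1)]
    by metis
  then have "N C < N I" using norm_strict assms C \<open>I \<subseteq> C\<close> by blast
  then show ?thesis using that[OF P(1) nC] C(2) imult_commute by metis
qed

lemma norm_imult:
  assumes I: "nzi I" and J: "nzi J" shows "N (I \<odot> J) = N I * N J"
  using J
proof (induction "N J" arbitrary: J rule: less_induct)
  case less
  show ?case
  proof (cases "J = R")
    case True
    then show ?thesis using imult_R(1)[OF I[THEN conjunct1]] norm_R by simp
  next
    case False
    obtain P C where PC: "pr P" "nzi C" "J = C \<odot> P" "N C < N J" using ideal_factor_pr[OF less(2) False] by metis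
    have "I \<odot> J = (I \<odot> C) \<odot> P" using imult_assoc[of I C P] I PC prD(1)[OF PC(1)] by simp
    then have "N (I \<odot> J) = N (I \<odot> C) * N P" using norm_imult_pr[OF imult_nzi[OF I PC(2)] PC(1)] by simp
    also have "\<dots> = N I * (N C * N P)" using less(1)[OF PC(4,2)] by simp
    also have "N C * N P = N J" using norm_imult_pr[OF PC(2,1)] PC(3) by simp
    finally show ?thesis .
  qed
qed

end

section \<open>Exponents of prime ideals and unique factorization\<close>

context dedekind_ring begin

abbreviation ipow (infixr "\<up>" 80) where "P \<up> m \<equiv> ideal_pow R P m"

text \<open>The exponent of \<open>P\<close> in \<open>I\<close>. The maximum exists for nonzero
  \<open>I\<close> by \<open>ipow_bound\<close>: the norm of the m-th power of \<open>P\<close> is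
  at least 2^m, hence above m.\<close>

definition vl :: "complex set \<Rightarrow> complex set \<Rightarrow> nat" where
  "vl P I = (GREATEST m. I \<subseteq> P \<up> m)"

lemma ipow_nzi: "nzi P \<Longrightarrow> nzi (P \<up> m)"
  by (induction m) (use nzi_R imult_nzi in auto)

lemma norm_ipow: "nzi P \<Longrightarrow> N (P \<up> m) = N P ^ m"
  by (induction m) (auto simp: norm_R norm_imult ipow_nzi)

lemma norm_pr_ge_2: "pr P \<Longrightarrow> N P \<ge> 2"
  using norm_pos[of P] norm_eq_1[of P] prD[of P] by (cases "N P = 1") auto

lemma ipow_le: "nzi P \<Longrightarrow> m \<le> n \<Longrightarrow> P \<up> n \<subseteq> P \<up> m"
proof (induction n)
  case (Suc n)
  have "P \<up> Suc n \<subseteq> P \<up> n" using imult_le(2)[of P "P \<up> n"] ipow_nzi Suc by simp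
  then show ?case using Suc by (cases "m = Suc n") auto
qed simp

lemma ipow_bound:
  assumes "pr P" "nzi I" "I \<subseteq> P \<up> m" shows "m \<le> N I"
proof -
  have "m < 2 ^ m" by (rule less_exp)
  also have "\<dots> \<le> N P ^ m" using norm_pr_ge_2[OF assms(1)] by (intro power_mono) auto
  also have "\<dots> = N (P \<up> m)" using norm_ipow prD assms by simp
  also have "\<dots> \<le> N I" by (rule norm_mono[OF assms(2) ipow_nzi[OF prD(4)[OF assms(1)], THEN conjunct1] assms(3)])
  finally show ?thesis by simp
qed

lemma vl_ge_iff:
  assumes "pr P" "nzi I" shows "m \<le> vl P I \<longleftrightarrow> I \<subseteq> P \<up> m"
proof -
  have 0: "I \<subseteq> P \<up> 0" using idealD(1) assms by simp
  have b: "y \<le> N I" if "I \<subseteq> P \<up> y" for y using ipow_bound[OF assms that] .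
  have v: "I \<subseteq> P \<up> vl P I" unfolding vl_def by (rule GreatestI_nat[where P = "\<lambda>m. I \<subseteq> P \<up> m", OF 0 b])
  show ?thesis
  proof
    assume "m \<le> vl P I"
    then show "I \<subseteq> P \<up> m" using v ipow_le[OF prD(4)[OF assms(1)]] by blast
  next
    assume "I \<subseteq> P \<up> m"
    then show "m \<le> vl P I" unfolding vl_def by (rule Greatest_le_nat[where P = "\<lambda>m. I \<subseteq> P \<up> m", OF _ b])
  qed
qed

lemma ipow_1: "is_ideal R P \<Longrightarrow> P \<up> 1 = P" by (simp add: imult_R)

lemma vl_pos_iff: "pr P \<Longrightarrow> nzi I \<Longrightarrow> vl P I > 0 \<longleftrightarrow> I \<subseteq> P"
  using vl_ge_iff[of P I 1] ipow_1[of P] prD(1)[of P] by (simp add: Suc_le_eq)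

lemma vl_factor:
  assumes "pr P" "nzi I"
  obtains C where "nzi C" "\<not> C \<subseteq> P" "I = P \<up> vl P I \<odot> C"
proof -
  note Pn = ipow_nzi[OF prD(4)[OF assms(1)]]
  have Ii: "is_ideal R I" using assms by simp
  have "I \<subseteq> P \<up> vl P I" using vl_ge_iff[OF assms] by blast
  then obtain C where C: "is_ideal R C" "P \<up> vl P I \<odot> C = I" using ideal_dvdE[OF Pn Ii] by blast
  have "I \<subseteq> C" using imult_le(2)[of "P \<up> vl P I" C] Pn C by simp
  then have nC: "nzi C" using nzi_mono assms C by blast
  have "\<not> C \<subseteq> P"
  proof
    assume "C \<subseteq> P"
    then have "I \<subseteq> P \<up> vl P I \<odot> P" using imult_mono[of "P \<up> vl P I" _ C P] C by blast
    then have "I \<subseteq> P \<up> (Suc (vl P I))" using imult_commute by simp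
    then show False using vl_ge_iff[OF assms, of "Suc (vl P I)"] by simp
  qed
  then show ?thesis using that nC C by blast
qed

lemma pr_imult_subset:
  assumes "pr P" "is_ideal R I" "is_ideal R J" "I \<odot> J \<subseteq> P" shows "I \<subseteq> P \<or> J \<subseteq> P"
proof (rule ccontr)
  assume "\<not> ?thesis"
  then obtain a b where "a \<in> I" "b \<in> J" "a \<notin> P" "b \<notin> P" by blast
  then show False using prD(6)[OF assms(1), of a b] imult_I[of a I b J] assms idealD(3) by blast
qed

lemma ipow_add: "nzi P \<Longrightarrow> P \<up> (m + n) = P \<up> m \<odot> P \<up> n"
  by (induction m) (auto simp: imult_R ipow_nzi imult_assoc)

lemma vl_unique:
  assumes "pr P" "nzi C" "\<not> C \<subseteq> P" shows "vl P (P \<up> m \<odot> C) = m"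
proof -
  note Pn = ipow_nzi[OF prD(4)[OF assms(1)]]
  have n: "nzi (P \<up> m \<odot> C)" by (rule imult_nzi[OF Pn assms(2)])
  have "m \<le> vl P (P \<up> m \<odot> C)" using vl_ge_iff[OF assms(1) n, of m] imult_le(1)[of "P \<up> m" C] Pn[of m] assms(2) by simp
  moreover have "\<not> Suc m \<le> vl P (P \<up> m \<odot> C)"
  proof
    assume "Suc m \<le> vl P (P \<up> m \<odot> C)"
    then have "P \<up> m \<odot> C \<subseteq> P \<up> (Suc m)" using vl_ge_iff[OF assms(1) n] by blast
    then have "P \<up> m \<odot> C \<subseteq> P \<up> m \<odot> P" using imult_commute[of P "P \<up> m"] by simp
    then have "C \<subseteq> P" using imult_cancel_le[OF Pn[of m] assms(2)[THEN conjunct1] prD(1)[OF assms(1)]] by simp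
    then show False using assms by simp
  qed
  ultimately show ?thesis by simp
qed

text \<open>Two cofactors not contained in \<open>P\<close> have a product not contained in
  \<open>P\<close>, so the exponents add without correction.\<close>

lemma vl_imult:
  assumes "pr P" "nzi I" "nzi J" shows "vl P (I \<odot> J) = vl P I + vl P J"
proof -
  note Pn = ipow_nzi[OF prD(4)[OF assms(1)]]
  obtain C where C: "nzi C" "\<not> C \<subseteq> P" "I = P \<up> vl P I \<odot> C" using vl_factor assms by metis
  obtain C' where C': "nzi C'" "\<not> C' \<subseteq> P" "J = P \<up> vl P J \<odot> C'" using vl_factor assms by metis
  define A A' where "A = P \<up> vl P I" and "A' = P \<up> vl P J"
  have i: "is_ideal R C" "is_ideal R C'" "is_ideal R A" "is_ideal R A'"
    using C C' Pn A_def A'_def by auto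
  have CC: "is_ideal R (C \<odot> C')" using imult_nzi[OF C(1) C'(1)] by simp
  have "I \<odot> J = (A \<odot> C) \<odot> (A' \<odot> C')" using C C' A_def A'_def by simp
  also have "\<dots> = A \<odot> (C \<odot> (A' \<odot> C'))"
    using imult_assoc[OF i(3,1)] imult_ideal[of A' C'] i(2,4) idealD(1) by blast
  also have "C \<odot> (A' \<odot> C') = A' \<odot> (C \<odot> C')"
    using imult_assoc[OF i(1,4,2)] imult_assoc[OF i(4,1,2)] imult_commute[of C A'] by simp
  also have "A \<odot> (A' \<odot> (C \<odot> C')) = P \<up> (vl P I + vl P J) \<odot> (C \<odot> C')"
    using ipow_add[OF prD(4)[OF assms(1)], of "vl P I" "vl P J"] imult_assoc[OF i(3,4) CC]
    by (simp add: A_def A'_def)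
  finally have "I \<odot> J = P \<up> (vl P I + vl P J) \<odot> (C \<odot> C')" .
  moreover have "\<not> C \<odot> C' \<subseteq> P" using pr_imult_subset[OF assms(1)] C C' by blast
  ultimately show ?thesis using vl_unique[OF assms(1) imult_nzi[OF C(1) C'(1)]] by simp
qed

lemma vl_R: "pr P \<Longrightarrow> vl P R = 0"
  using vl_pos_iff[of P R] nzi_R prD(2)[of P] idealD(1)[OF prD(1)[of P]] by blast

lemma pr_subset_eq: "pr P \<Longrightarrow> pr Q \<Longrightarrow> P \<subseteq> Q \<Longrightarrow> P = Q"
  using pr_maximal[of P Q] prD(1,2)[of Q] by blast

lemma vl_pr: "pr P \<Longrightarrow> pr Q \<Longrightarrow> vl P Q = (if P = Q then 1 else 0)"
proof -
  assume P: "pr P" and Q: "pr Q"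
  show ?thesis
  proof (cases "P = Q")
    case True
    have "\<not> R \<subseteq> P" using prD(1,2)[OF P] idealD(1) by blast
    then have "vl P (P \<up> 1 \<odot> R) = 1" using vl_unique[OF P nzi_R] by blast
    then show ?thesis using True prD(1)[OF P] imult_R ipow_1 by simp
  next
    case False
    then have "\<not> Q \<subseteq> P" using pr_subset_eq[OF Q P] by blast
    then show ?thesis using vl_pos_iff[OF P prD(4)[OF Q]] False by simp
  qed
qed

lemma vl_antimono: "pr P \<Longrightarrow> nzi I \<Longrightarrow> is_ideal R J \<Longrightarrow> I \<subseteq> J \<Longrightarrow> vl P J \<le> vl P I"
  using vl_ge_iff[of P I "vl P J"] vl_ge_iff[of P J "vl P J"] nzi_mono by blast

text \<open>This is unique factorization in the form of an order: a prime of \<open>J\<close> also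
  divides \<open>I\<close>, is cancelled from both, and the norm of \<open>J\<close> drops.\<close>

lemma vl_subsetI:
  assumes "nzi I" "nzi J" "\<And>P. pr P \<Longrightarrow> vl P J \<le> vl P I" shows "I \<subseteq> J"
  using assms
proof (induction "N J" arbitrary: I J rule: less_induct)
  case less
  show ?case
  proof (cases "J = R")
    case True
    then show ?thesis using less idealD(1) by blast
  next
    case False
    obtain P C where PC: "pr P" "nzi C" "J = C \<odot> P" "N C < N J" using ideal_factor_pr[OF less(3) False] by metis
    note Pn = prD(4)[OF PC(1)]
    have "vl P J \<ge> 1" unfolding PC(3) vl_imult[OF PC(1,2) Pn] by (simp add: vl_pr PC(1))
    then have "vl P I > 0" using less(4)[OF PC(1)] by simp
    then have "I \<subseteq> P" using vl_pos_iff[OF PC(1) less(2)] by blast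
    then obtain I' where I': "is_ideal R I'" "P \<odot> I' = I" using ideal_dvdE[OF Pn] less(2) by blast
    have nI': "nzi I'" using nzi_mono[OF less(2) _ I'(1)] imult_le(2)[OF prD(1)[OF PC(1)] I'(1)] I'(2) by blast
    have "I' \<subseteq> C"
    proof (rule less(1)[OF PC(4) nI' PC(2)])
      fix Q assume Q: "pr Q"
      have "vl Q J = vl Q C + vl Q P" "vl Q I = vl Q P + vl Q I'"
        using PC(3) I'(2) vl_imult[OF Q PC(2) Pn] vl_imult[OF Q Pn nI'] by simp_all
      then show "vl Q C \<le> vl Q I'" using less(4)[OF Q] by simp
    qed
    then have "P \<odot> I' \<subseteq> P \<odot> C" by (intro imult_mono) auto
    then show ?thesis using I'(2) PC(3) imult_commute by simp
  qed
qed

lemma vl_eqI: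
  assumes "nzi I" "nzi J" "\<And>P. pr P \<Longrightarrow> vl P I = vl P J" shows "I = J"
  using vl_subsetI[of I J] vl_subsetI[of J I] assms by auto

lemma ideal_add_ideal:
  assumes "is_ideal R I" "is_ideal R J" shows "is_ideal R (ideal_add I J)"
  unfolding is_ideal_def
proof (intro conjI ballI)
  show "ideal_add I J \<subseteq> R" using assms idealD(3) add_subgroupD(4)[OF ag_R] unfolding ideal_add_def by blast
  show "0 \<in> ideal_add I J" using assms idealD(2) unfolding ideal_add_def by force
  show "x + y \<in> ideal_add I J" if xy: "x \<in> ideal_add I J" "y \<in> ideal_add I J" for x y
  proof -
    obtain a b c d where *: "x = a + b" "y = c + d" "a \<in> I" "b \<in> J" "c \<in> I" "d \<in> J"
      using xy unfolding ideal_add_def by blast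
    have "x + y = (a + c) + (b + d)" using * by simp
    then show ?thesis using * idealD(4)[OF assms(1)] idealD(4)[OF assms(2)] unfolding ideal_add_def by blast
  qed
  show "r * x \<in> ideal_add I J" if rx: "r \<in> R" "x \<in> ideal_add I J" for r x
  proof -
    obtain a b where *: "x = a + b" "a \<in> I" "b \<in> J" using rx unfolding ideal_add_def by blast
    have "r * x = r * a + r * b" using * by (simp add: ring_distribs)
    then show ?thesis using * idealD(5)[OF assms(1) rx(1)] idealD(5)[OF assms(2) rx(1)] unfolding ideal_add_def by blast
  qed
qed

lemma ideal_add_sup:
  assumes "is_ideal R I" "is_ideal R J"
  shows "I \<subseteq> ideal_add I J" "J \<subseteq> ideal_add I J" "is_ideal R L \<Longrightarrow> ideal_add I J \<subseteq> L \<longleftrightarrow> I \<subseteq> L \<and> J \<subseteq> L"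
proof -
  show 1: "I \<subseteq> ideal_add I J" unfolding ideal_add_def using idealD(2)[OF assms(2)] by force
  show 2: "J \<subseteq> ideal_add I J" unfolding ideal_add_def using idealD(2)[OF assms(1)] by force
  show "ideal_add I J \<subseteq> L \<longleftrightarrow> I \<subseteq> L \<and> J \<subseteq> L" if L: "is_ideal R L"
  proof
    show "I \<subseteq> L \<and> J \<subseteq> L" if "ideal_add I J \<subseteq> L" using 1 2 that by blast
    show "ideal_add I J \<subseteq> L" if "I \<subseteq> L \<and> J \<subseteq> L"
      using that idealD(4)[OF L] unfolding ideal_add_def by auto
  qed
qed

lemma vl_add:
  assumes P: "pr P" and "nzi I" "nzi J" shows "vl P (ideal_add I J) = min (vl P I) (vl P J)"
proof -
  have i: "is_ideal R I" "is_ideal R J" using assms by auto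
  have n: "nzi (ideal_add I J)" using nzi_mono[OF assms(2) ideal_add_sup(1)[OF i] ideal_add_ideal[OF i]] .
  have "m \<le> vl P (ideal_add I J) \<longleftrightarrow> m \<le> min (vl P I) (vl P J)" for m
    using vl_ge_iff[OF P] n assms(2,3) ideal_add_sup(3)[OF i, of "P \<up> m"] ipow_nzi[OF prD(4)[OF P], of m] by simp
  then show ?thesis by (metis order_antisym order_refl)
qed

lemma finite_pr: "nzi I \<Longrightarrow> finite {P. pr P \<and> I \<subseteq> P}"
proof (induction "N I" arbitrary: I rule: less_induct)
  case less
  show ?case
  proof (cases "I = R")
    case True
    have "{P. pr P \<and> I \<subseteq> P} = {}" using True prD(1,2) idealD(1) by blast
    then show ?thesis by (metis finite.emptyI)
  next
    case False
    obtain P C where PC: "pr P" "nzi C" "I = C \<odot> P" "N C < N I" using ideal_factor_pr[OF less(2) False] by metis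
    have "{P. pr P \<and> I \<subseteq> P} \<subseteq> insert P {P. pr P \<and> C \<subseteq> P}"
      using pr_imult_subset[of _ C P] PC prD(1)[OF PC(1)] pr_subset_eq[OF PC(1)] by blast
    then show ?thesis using less(1)[OF PC(4,2)] finite_subset by blast
  qed
qed

text \<open>\<open>T\<close> may exceed the set of primes dividing \<open>I\<close>. So one index
  set serves all divisors of a fixed ideal simultaneously.\<close>

lemma norm_vl:
  assumes "nzi I" "finite T" "\<And>P. P \<in> T \<Longrightarrow> pr P" "\<And>P. pr P \<Longrightarrow> I \<subseteq> P \<Longrightarrow> P \<in> T"
  shows "N I = (\<Prod>P\<in>T. N P ^ vl P I)"
  using assms
proof (induction "N I" arbitrary: I rule: less_induct)
  case less
  show ?case
  proof (cases "I = R")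
    case True
    have "(\<Prod>P\<in>T. N P ^ vl P I) = 1" using True less(4) vl_R by (intro prod.neutral) auto
    then show ?thesis using True norm_R by simp
  next
    case False
    obtain P C where PC: "pr P" "nzi C" "I = C \<odot> P" "N C < N I" using ideal_factor_pr[OF less(2) False] by metis
    note Pn = prD(4)[OF PC(1)]
    have i: "is_ideal R C" "is_ideal R P" using PC Pn by auto
    have sub: "I \<subseteq> C" "I \<subseteq> P" unfolding PC(3) using imult_le[OF i] by auto
    have PT: "P \<in> T" using less(5)[OF PC(1) sub(2)] .
    have "N C = (\<Prod>Q\<in>T. N Q ^ vl Q C)"
      by (rule less(1)[OF PC(4,2) less(3)]) (use less(4,5) sub in blast)+
    moreover have "(\<Prod>Q\<in>T. N Q ^ vl Q P) = N P"
    proof -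
      have "(\<Prod>Q\<in>T. N Q ^ vl Q P) = (\<Prod>Q\<in>T. if Q = P then N P else 1)"
        using less(4) PC(1) vl_pr by (intro prod.cong) auto
      then show ?thesis using less(3) PT by simp
    qed
    ultimately have "N I = (\<Prod>Q\<in>T. N Q ^ vl Q C * N Q ^ vl Q P)"
      using norm_imult[OF PC(2) Pn] PC(3) by (simp add: prod.distrib)
    also have "\<dots> = (\<Prod>Q\<in>T. N Q ^ vl Q I)"
      unfolding PC(3) using less(4) vl_imult[OF _ PC(2) Pn] by (intro prod.cong) (auto simp: power_add)
    finally show ?thesis .
  qed
qed

lemma ex_ideal_vl:
  assumes "finite T" "\<And>P. P \<in> T \<Longrightarrow> pr P"
  shows "\<exists>I. nzi I \<and> (\<forall>P. pr P \<longrightarrow> vl P I = (if P \<in> T then b P else 0))"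
  using assms
proof (induction T rule: finite_induct)
  case empty
  then show ?case using nzi_R vl_R by (intro exI[of _ R]) auto
next
  case (insert Q T)
  then obtain I where I: "nzi I" "\<forall>P. pr P \<longrightarrow> vl P I = (if P \<in> T then b P else 0)" by auto
  have Q: "pr Q" using insert by simp
  note Qn = prD(4)[OF Q]
  have pw: "vl P (Q \<up> m) = (if P = Q then m else 0)" if "pr P" for P m
    by (induction m) (auto simp: vl_R vl_imult vl_pr ipow_nzi Qn that Q)
  show ?case
  proof (intro exI[of _ "Q \<up> b Q \<odot> I"] conjI allI impI)
    show "is_ideal R (Q \<up> b Q \<odot> I)" "Q \<up> b Q \<odot> I \<noteq> {0}" using imult_nzi[OF ipow_nzi[OF Qn] I(1)] by blast+
    show "vl P (Q \<up> b Q \<odot> I) = (if P \<in> insert Q T then b P else 0)" if "pr P" for P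
      using vl_imult[OF that ipow_nzi[OF Qn] I(1)] pw[OF that] I(2) that insert(2) by auto
  qed
qed

text \<open>A divisor is its vector of exponents, and every vector below that of \<open>D\<close>
  occurs. Sums over divisors thereby become sums over a box, which factor.\<close>

lemma bij_betw_divisors:
  assumes D: "nzi D" and T: "finite T" "\<And>P. P \<in> T \<Longrightarrow> pr P" "\<And>P. pr P \<Longrightarrow> D \<subseteq> P \<Longrightarrow> P \<in> T"
  shows "bij_betw (\<lambda>B. \<lambda>P\<in>T. vl P B) {B. is_ideal R B \<and> D \<subseteq> B} (PiE T (\<lambda>P. {..vl P D}))"
    "finite {B. is_ideal R B \<and> D \<subseteq> B}"
proof -
  have nT: "vl P B = 0" if "pr P" "P \<notin> T" "is_ideal R B" "D \<subseteq> B" for P B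
    using vl_antimono[OF that(1) D that(3,4)] vl_pos_iff[OF that(1) D] T(3)[OF that(1)] that(2) by auto
  show bij: "bij_betw (\<lambda>B. \<lambda>P\<in>T. vl P B) {B. is_ideal R B \<and> D \<subseteq> B} (PiE T (\<lambda>P. {..vl P D}))"
    unfolding bij_betw_def
  proof
    show "inj_on (\<lambda>B. \<lambda>P\<in>T. vl P B) {B. is_ideal R B \<and> D \<subseteq> B}"
    proof (rule inj_onI)
      fix B C assume *: "B \<in> {B. is_ideal R B \<and> D \<subseteq> B}" "C \<in> {B. is_ideal R B \<and> D \<subseteq> B}"
        and e: "(\<lambda>P\<in>T. vl P B) = (\<lambda>P\<in>T. vl P C)"
      show "B = C"
      proof (rule vl_eqI)
        show "nzi B" "nzi C" using * nzi_mono[OF D] by blast+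
        fix P assume P: "pr P"
        show "vl P B = vl P C"
        proof (cases "P \<in> T")
          case True then show ?thesis using fun_cong[OF e, of P] by simp
        next
          case False then show ?thesis using nT[OF P False] * by simp
        qed
      qed
    qed
    show "(\<lambda>B. \<lambda>P\<in>T. vl P B) ` {B. is_ideal R B \<and> D \<subseteq> B} = PiE T (\<lambda>P. {..vl P D})"
    proof (intro equalityI subsetI)
      fix h assume "h \<in> (\<lambda>B. \<lambda>P\<in>T. vl P B) ` {B. is_ideal R B \<and> D \<subseteq> B}"
      then show "h \<in> PiE T (\<lambda>P. {..vl P D})" using vl_antimono[OF T(2) D] by auto
    next
      fix h assume h: "h \<in> PiE T (\<lambda>P. {..vl P D})"
      obtain I where I: "nzi I" "\<forall>P. pr P \<longrightarrow> vl P I = (if P \<in> T then h P else 0)" using ex_ideal_vl[OF T(1,2)] by metis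
      have "D \<subseteq> I" using I h by (intro vl_subsetI[OF D]) auto
      moreover have "h = (\<lambda>P\<in>T. vl P I)" using I T(2) h by (auto simp: fun_eq_iff PiE_def extensional_def restrict_def)
      ultimately show "h \<in> (\<lambda>B. \<lambda>P\<in>T. vl P B) ` {B. is_ideal R B \<and> D \<subseteq> B}" using I by blast
    qed
  qed
  have "finite (PiE T (\<lambda>P. {..vl P D}))" using T(1) by (intro finite_PiE) auto
  then show "finite {B. is_ideal R B \<and> D \<subseteq> B}" using bij_betw_finite[OF bij] by simp
qed

lemma ival_vl: "a \<in> R \<Longrightarrow> pr P \<Longrightarrow> ival R P a = vl P (pri a)"
proof -
  assume a: "a \<in> R" and P: "pr P"
  have "a \<in> P \<up> m \<longleftrightarrow> pri a \<subseteq> P \<up> m" for m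
    using ipow_nzi[OF prD(4)[OF P], of m] pri_subset[of "P \<up> m" a] pri_self[of a] by blast
  then show ?thesis unfolding ival_def vl_def by simp
qed

lemma pri_mult: "a \<in> R \<Longrightarrow> b \<in> R \<Longrightarrow> pri a \<odot> pri b = pri (a * b)"
  using pri_imult[of a "pri b"] ideal_pri[of b] by (simp add: pri_image image_image mult.assoc)

lemma vl_pri_mult: "a \<in> R \<Longrightarrow> b \<in> R \<Longrightarrow> a \<noteq> 0 \<Longrightarrow> b \<noteq> 0 \<Longrightarrow> pr P \<Longrightarrow> vl P (pri (a * b)) = vl P (pri a) + vl P (pri b)"
  using vl_imult[of P "pri a" "pri b"] nzi_pri pri_mult by simp

text \<open>\<open>pval\<close> picks an arbitrary presentation as a fraction; cross-multiplying two
  presentations and comparing exponents shows that the choice does not matter.\<close>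

lemma pval_div:
  assumes "a \<in> R" "b \<in> R" "a \<noteq> 0" "b \<noteq> 0" "pr P"
  shows "pval R P (a / b) = int (vl P (pri a)) - int (vl P (pri b))"
proof -
  let ?Q = "\<lambda>(c, d). c \<in> R \<and> d \<in> R \<and> d \<noteq> 0 \<and> a / b = c / d"
  obtain c d where cd: "Eps ?Q = (c, d)" by (rule prod.exhaust)
  have "?Q (Eps ?Q)" by (rule someI[of ?Q "(a, b)"]) (use assms in simp)
  then have *: "c \<in> R" "d \<in> R" "d \<noteq> 0" "a / b = c / d" unfolding cd by auto
  then have e: "a * d = c * b" using assms by (simp add: field_simps)
  have "c \<noteq> 0" using * assms by auto
  then have "vl P (pri a) + vl P (pri d) = vl P (pri c) + vl P (pri b)"
    using vl_pri_mult assms * e by metis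
  moreover have "pval R P (a / b) = int (vl P (pri c)) - int (vl P (pri d))"
    unfolding pval_def Let_def cd using ival_vl assms(5) *(1,2) by simp
  ultimately show ?thesis by simp
qed

lemma pval_R: "a \<in> R \<Longrightarrow> a \<noteq> 0 \<Longrightarrow> pr P \<Longrightarrow> pval R P a = int (vl P (pri a))"
  using pval_div[of a 1 P] vl_R[of P] one_R by (simp add: pri_image)

text \<open>A prime of exponent 2 or more makes both sides vanish; otherwise the sign counts the
  primes of exponent 1.\<close>

lemma moebius_vl:
  assumes A: "nzi A" and T: "finite T" "\<And>P. P \<in> T \<Longrightarrow> pr P" "\<And>P. pr P \<Longrightarrow> A \<subseteq> P \<Longrightarrow> P \<in> T"
  shows "ideal_moebius R A = (\<Prod>P\<in>T. if vl P A = 0 then 1 else if vl P A = 1 then -1 else 0)"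
proof (cases "\<exists>P\<in>T. vl P A \<ge> 2")
  case True
  then obtain P where P: "P \<in> T" "vl P A \<ge> 2" by blast
  have "A \<subseteq> P \<odot> P" using vl_ge_iff[OF T(2)[OF P(1)] A, of 2] P(2) imult_R prD(1)[OF T(2)[OF P(1)]]
    by (simp add: numeral_2_eq_2)
  then have "ideal_moebius R A = 0" unfolding ideal_moebius_def ideal_dvd_def using T(2)[OF P(1)] by auto
  moreover have "(\<Prod>P\<in>T. if vl P A = 0 then 1 else if vl P A = 1 then -1 else 0::int) = 0"
    using P T(1) by (intro prod_zero) (auto intro!: bexI[of _ P])
  ultimately show ?thesis by simp
next
  case False
  have no: "\<not> (\<exists>P. pr P \<and> ideal_dvd (P \<odot> P) A)"
  proof
    assume "\<exists>P. pr P \<and> ideal_dvd (P \<odot> P) A"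
    then obtain P where P: "pr P" "A \<subseteq> P \<odot> P" unfolding ideal_dvd_def by blast
    have "A \<subseteq> P \<up> 2" using P imult_R prD(1)[OF P(1)] by (simp add: numeral_2_eq_2)
    then have "2 \<le> vl P A" using vl_ge_iff[OF P(1) A] by blast
    moreover have "P \<in> T" using T(3)[OF P(1)] P(2) imult_le(1) prD(1)[OF P(1)] by blast
    ultimately show False using False by blast
  qed
  have eq: "{P. pr P \<and> ideal_dvd P A} = {P\<in>T. vl P A \<noteq> 0}"
    unfolding ideal_dvd_def using vl_pos_iff[OF _ A] T(2,3) by blast
  have "(\<Prod>P\<in>T. if vl P A = 0 then 1 else if vl P A = 1 then -1 else 0::int) = (\<Prod>P\<in>T. if vl P A \<noteq> 0 then -1 else 1)"
    using False by (intro prod.cong) force+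
  also have "\<dots> = (\<Prod>P\<in>{P\<in>T. vl P A \<noteq> 0}. -1)" using T(1) by (simp add: prod.If_cases Int_def)
  also have "\<dots> = ideal_moebius R A" unfolding ideal_moebius_def if_not_P[OF no] eq by simp
  finally show ?thesis by simp
qed

lemma ideal_quot_mult:
  assumes "nzi D" "is_ideal R B" "D \<subseteq> B"
  shows "nzi (ideal_quot R D B)" "B \<odot> ideal_quot R D B = D"
proof -
  have nB: "nzi B" using nzi_mono assms by blast
  obtain C where C: "is_ideal R C" "B \<odot> C = D" using ideal_dvdE[OF nB] assms by blast
  have *: "is_ideal R (ideal_quot R D B) \<and> B \<odot> ideal_quot R D B = D"
    unfolding ideal_quot_def by (rule someI[of _ C]) (use C in simp)
  then show "B \<odot> ideal_quot R D B = D" by simp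
  show "nzi (ideal_quot R D B)"
    using nzi_mono[OF assms(1)] imult_le(2)[of B "ideal_quot R D B"] * assms(2) by metis
qed

lemma vl_ideal_quot:
  assumes "nzi D" "is_ideal R B" "D \<subseteq> B" "pr P"
  shows "vl P (ideal_quot R D B) = vl P D - vl P B"
proof -
  have nB: "nzi B" using nzi_mono assms by blast
  have "vl P D = vl P B + vl P (ideal_quot R D B)"
    using vl_imult[OF assms(4) nB ideal_quot_mult(1)[OF assms(1-3)]] ideal_quot_mult(2)[OF assms(1-3)] by simp
  then show ?thesis by simp
qed

end

section \<open>Subfields and minimal polynomials\<close>

lemma subfieldD:
  assumes "subfield_C F"
  shows "0 \<in> F" "1 \<in> F" "x \<in> F \<Longrightarrow> y \<in> F \<Longrightarrow> x + y \<in> F" "x \<in> F \<Longrightarrow> y \<in> F \<Longrightarrow> x - y \<in> F"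
    "x \<in> F \<Longrightarrow> y \<in> F \<Longrightarrow> x * y \<in> F" "x \<in> F \<Longrightarrow> inverse x \<in> F" "x \<in> F \<Longrightarrow> - x \<in> F" "x \<in> F \<Longrightarrow> y \<in> F \<Longrightarrow> x / y \<in> F"
    "x \<in> F \<Longrightarrow> x ^ n \<in> F"
proof -
  show b: "0 \<in> F" "1 \<in> F" "x \<in> F \<Longrightarrow> y \<in> F \<Longrightarrow> x + y \<in> F" "x \<in> F \<Longrightarrow> y \<in> F \<Longrightarrow> x - y \<in> F" for x y
    using assms unfolding subfield_C_def by auto
  show m: "x \<in> F \<Longrightarrow> y \<in> F \<Longrightarrow> x * y \<in> F" for x y using assms unfolding subfield_C_def by auto
  show i: "x \<in> F \<Longrightarrow> inverse x \<in> F" for x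
    using assms unfolding subfield_C_def by (cases "x = 0") auto
  show "x \<in> F \<Longrightarrow> - x \<in> F" using b(4)[OF b(1), where y = x] by simp
  show "x \<in> F \<Longrightarrow> y \<in> F \<Longrightarrow> x / y \<in> F" using m i by (simp add: divide_inverse)
  show "x \<in> F \<Longrightarrow> x ^ n \<in> F" by (induction n) (auto intro: b m)
qed

lemma subfield_ag: "subfield_C F \<Longrightarrow> add_subgroup F"
  by (auto simp: add_subgroup_def subfieldD)

lemma subfield_of_nat: "subfield_C F \<Longrightarrow> of_nat n \<in> F"
  by (induction n) (auto simp: subfieldD)

lemma subfield_Rats: "subfield_C F \<Longrightarrow> \<rat> \<subseteq> F"
proof
  fix x :: complex assume F: "subfield_C F" and "x \<in> \<rat>"
  then obtain a b where "x = of_int a / of_int b" by (metis Rats_cases')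
  moreover have "of_int i \<in> F" for i
    by (cases i rule: int_cases2) (use subfield_of_nat[OF F] subfieldD(7)[OF F] in auto)
  ultimately show "x \<in> F" using subfieldD(8)[OF F] by simp
qed

lemma subfield_Rats_C: "subfield_C \<rat>" by (auto simp: subfield_C_def)

definition Fpoly :: "complex set \<Rightarrow> complex poly \<Rightarrow> bool" where
  "Fpoly F p \<longleftrightarrow> (\<forall>i. coeff p i \<in> F)"

lemma Fpoly_ops:
  assumes "subfield_C F"
  shows "Fpoly F 0" "Fpoly F 1" "c \<in> F \<Longrightarrow> Fpoly F [:c:]" "c \<in> F \<Longrightarrow> Fpoly F (monom c n)"
    "Fpoly F p \<Longrightarrow> Fpoly F q \<Longrightarrow> Fpoly F (p + q)" "Fpoly F p \<Longrightarrow> Fpoly F q \<Longrightarrow> Fpoly F (p - q)"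
    "Fpoly F p \<Longrightarrow> Fpoly F q \<Longrightarrow> Fpoly F (p * q)" "c \<in> F \<Longrightarrow> Fpoly F p \<Longrightarrow> Fpoly F (smult c p)"
    "Fpoly F p \<Longrightarrow> Fpoly F (pderiv p)"
proof -
  note s = subfieldD[OF assms]
  show "Fpoly F 0" "Fpoly F 1" "c \<in> F \<Longrightarrow> Fpoly F [:c:]" "c \<in> F \<Longrightarrow> Fpoly F (monom c n)"
    "Fpoly F p \<Longrightarrow> Fpoly F q \<Longrightarrow> Fpoly F (p + q)" "Fpoly F p \<Longrightarrow> Fpoly F q \<Longrightarrow> Fpoly F (p - q)"
    "c \<in> F \<Longrightarrow> Fpoly F p \<Longrightarrow> Fpoly F (smult c p)"
    by (auto simp: Fpoly_def s coeff_pCons coeff_1 split: nat.split)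
  show "Fpoly F p \<Longrightarrow> Fpoly F q \<Longrightarrow> Fpoly F (p * q)"
    unfolding Fpoly_def coeff_mult by (intro allI add_subgroup_sum subfield_ag assms s) auto
  show "Fpoly F p \<Longrightarrow> Fpoly F (pderiv p)"
    unfolding Fpoly_def coeff_pderiv by (intro allI s subfield_of_nat assms) auto
qed

text \<open>The coefficients stay in the subset \<open>F\<close> because each step only divides
  leading coefficients, inside the field \<open>F\<close>, and lowers the degree.\<close>

lemma Fpoly_division:
  assumes F: "subfield_C F" and q: "Fpoly F q" "q \<noteq> 0"
  shows "Fpoly F p \<Longrightarrow> \<exists>s r. Fpoly F s \<and> Fpoly F r \<and> p = q * s + r \<and> (r = 0 \<or> degree r < degree q)"
proof (induction "degree p" arbitrary: p rule: less_induct)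
  case less
  note ops = Fpoly_ops[OF F]
  show ?case
  proof (cases "p = 0 \<or> degree p < degree q")
    case True
    then show ?thesis using less ops by (intro exI[of _ 0] exI[of _ p]) auto
  next
    case False
    define m where "m = monom (lead_coeff p / lead_coeff q) (degree p - degree q)"
    have m: "Fpoly F m" unfolding m_def using q less(2) by (intro ops subfieldD[OF F]) (auto simp: Fpoly_def)
    have lc: "lead_coeff p \<noteq> 0" "lead_coeff q \<noteq> 0" using False q by auto
    have dm: "degree (q * m) = degree p" "coeff (q * m) (degree p) = coeff p (degree p)"
    proof -
      have mn: "m \<noteq> 0" using lc unfolding m_def by simp
      have dd: "degree m = degree p - degree q" using lc unfolding m_def by (simp add: degree_monom_eq)
      show d: "degree (q * m) = degree p" using q(2) mn dd False by (simp add: degree_mult_eq)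
      have "coeff (q * m) (degree (q * m)) = lead_coeff q * lead_coeff m" by (rule lead_coeff_mult)
      also have "\<dots> = lead_coeff p" using lc unfolding m_def by (simp add: degree_monom_eq)
      finally show "coeff (q * m) (degree p) = coeff p (degree p)" unfolding d .
    qed
    define p' where "p' = p - q * m"
    have p': "Fpoly F p'" unfolding p'_def using less(2) m q ops by simp
    have "degree p' \<le> degree p" unfolding p'_def using degree_diff_le_max[of p "q * m"] dm by simp
    moreover have "coeff p' (degree p) = 0" unfolding p'_def using dm by simp
    ultimately have "p' = 0 \<or> degree p' < degree p" by (rule eq_zero_or_degree_less)
    then have "\<exists>s r. Fpoly F s \<and> Fpoly F r \<and> p' = q * s + r \<and> (r = 0 \<or> degree r < degree q)"
    proof
      assume "p' = 0"
      then show ?thesis using ops by (intro exI[of _ 0]) auto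
    next
      assume "degree p' < degree p"
      then show ?thesis using less(1) p' by blast
    qed
    then obtain s r where sr: "Fpoly F s" "Fpoly F r" "p' = q * s + r" "r = 0 \<or> degree r < degree q" by blast
    have "p = q * (s + m) + r" using sr(3) unfolding p'_def by (simp add: algebra_simps)
    then show ?thesis using sr(2,4) ops(5)[OF sr(1) m] by (intro exI[of _ "s + m"] exI[of _ r]) simp
  qed
qed

text \<open>Minimal polynomials, normalised only by minimality of the degree.\<close>
definition minp :: "complex set \<Rightarrow> complex \<Rightarrow> complex poly \<Rightarrow> bool" where
  "minp F x p \<longleftrightarrow> Fpoly F p \<and> p \<noteq> 0 \<and> poly p x = 0 \<and>
     (\<forall>q. Fpoly F q \<longrightarrow> poly q x = 0 \<longrightarrow> q = 0 \<or> degree p \<le> degree q)"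

lemma ex_minp:
  assumes "Fpoly F p" "p \<noteq> 0" "poly p x = 0"
  obtains q where "minp F x q"
proof -
  let ?P = "\<lambda>q. Fpoly F q \<and> q \<noteq> 0 \<and> poly q x = 0"
  define q where "q = arg_min degree ?P"
  have "?P q" unfolding q_def by (rule arg_min_natI[where P = ?P]) (use assms in blast)
  moreover have "\<forall>r. ?P r \<longrightarrow> degree q \<le> degree r" unfolding q_def by (blast intro: arg_min_nat_le[where P = ?P])
  ultimately have "minp F x q" unfolding minp_def by blast
  then show ?thesis by (rule that)
qed

lemma minp_dvd:
  assumes F: "subfield_C F" and p: "minp F x p" and q: "Fpoly F q" "poly q x = 0"
  obtains s where "Fpoly F s" "q = p * s"
proof -
  obtain s r where sr: "Fpoly F s" "Fpoly F r" "q = p * s + r" "r = 0 \<or> degree r < degree p"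
    using Fpoly_division[OF F, of p q] p q unfolding minp_def by blast
  have "poly r x = 0" using sr p q unfolding minp_def by simp
  then have "r = 0" using sr p unfolding minp_def by (metis leD)
  then show ?thesis using that sr by simp
qed

lemma minp_degree_pos: "minp F x p \<Longrightarrow> degree p > 0"
  unfolding minp_def by (cases "degree p = 0") (auto elim!: degree_eq_zeroE)

lemma poly_lincomb_powers:
  assumes "inj_on (\<lambda>i. x ^ i) {..<e}"
  shows "(\<Sum>b\<in>(\<lambda>i. x ^ i) ` {..<e}. c b * b) = (\<Sum>i<e. c (x^i) * x ^ i)"
  using sum.reindex[OF assms, of "\<lambda>b. c b * b"] by (simp add: o_def)

definition padjoin :: "complex set \<Rightarrow> complex \<Rightarrow> complex set" where
  "padjoin F x = {poly p x |p. Fpoly F p}"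

lemma padjoin_minp:
  assumes F: "subfield_C F" and p: "minp F x p"
  shows "padjoin F x = {poly q x |q. Fpoly F q \<and> (q = 0 \<or> degree q < degree p)}"
proof
  show "padjoin F x \<subseteq> {poly q x |q. Fpoly F q \<and> (q = 0 \<or> degree q < degree p)}"
  proof
    fix y assume "y \<in> padjoin F x"
    then obtain q where q: "Fpoly F q" "y = poly q x" unfolding padjoin_def by blast
    obtain s r where sr: "Fpoly F s" "Fpoly F r" "q = p * s + r" "r = 0 \<or> degree r < degree p"
      using Fpoly_division[OF F, of p q] p q unfolding minp_def by blast
    then have "y = poly r x" using q p unfolding minp_def by simp
    then show "y \<in> {poly q x |q. Fpoly F q \<and> (q = 0 \<or> degree q < degree p)}" using sr by blast
  qed
qed (auto simp: padjoin_def)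

lemma padjoin_basic:
  assumes F: "subfield_C F"
  shows "F \<subseteq> padjoin F x" "x \<in> padjoin F x" "y \<in> padjoin F x \<Longrightarrow> z \<in> padjoin F x \<Longrightarrow> y + z \<in> padjoin F x"
    "y \<in> padjoin F x \<Longrightarrow> z \<in> padjoin F x \<Longrightarrow> y - z \<in> padjoin F x"
    "y \<in> padjoin F x \<Longrightarrow> z \<in> padjoin F x \<Longrightarrow> y * z \<in> padjoin F x"
proof -
  note ops = Fpoly_ops[OF F]
  have "Fpoly F (monom 1 1)" using ops subfieldD[OF F] by blast
  then have "Fpoly F [:0, 1:]" by (simp add: monom_Suc monom_0 One_nat_def)
  then show "x \<in> padjoin F x" unfolding padjoin_def by force
  show "F \<subseteq> padjoin F x" unfolding padjoin_def using ops(3) by force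
  {
    assume "y \<in> padjoin F x" "z \<in> padjoin F x"
    then obtain p q where pq: "Fpoly F p" "Fpoly F q" "y = poly p x" "z = poly q x" unfolding padjoin_def by blast
    have I: "poly r x \<in> padjoin F x" if "Fpoly F r" for r using that unfolding padjoin_def by blast
    show "y + z \<in> padjoin F x" "y - z \<in> padjoin F x" "y * z \<in> padjoin F x"
      using I[OF ops(5)[OF pq(1,2)]] I[OF ops(6)[OF pq(1,2)]] I[OF ops(7)[OF pq(1,2)]] pq(3,4) by simp_all
  }
qed

text \<open>If \<open>y = q(x) \<noteq> 0\<close>, take \<open>0 \<noteq> s\<close> of least degree among polynomials with \<open>s(x) \<in> y F[x]\<close>;
  division of the minimal polynomial by \<open>s\<close> shows that \<open>s\<close> is constant.\<close>
lemma padjoin_inverse: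
  assumes F: "subfield_C F" and p: "minp F x p" and y: "y \<in> padjoin F x" "y \<noteq> 0"
  shows "inverse y \<in> padjoin F x"
proof -
  note ops = Fpoly_ops[OF F]
  let ?P = "\<lambda>s. Fpoly F s \<and> poly s x \<noteq> 0 \<and> (\<exists>t. Fpoly F t \<and> poly s x = y * poly t x)"
  obtain q where q: "Fpoly F q" "y = poly q x" "q = 0 \<or> degree q < degree p"
    using y(1) unfolding padjoin_minp[OF F p] by blast
  have "?P q" using q y ops(2) by (auto intro: exI[of _ 1])
  define s where "s = arg_min degree ?P"
  have s: "?P s" unfolding s_def by (rule arg_min_natI[where P = ?P]) (use \<open>?P q\<close> in blast)
  have min: "degree s \<le> degree r" if "?P r" for r unfolding s_def by (rule arg_min_nat_le[where P = ?P]) (use that in blast)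
  obtain t where t: "Fpoly F t" "poly s x = y * poly t x" using s by blast
  have s0: "s \<noteq> 0" using s by auto
  have "degree s = 0"
  proof (rule ccontr)
    assume ds: "degree s \<noteq> 0"
    obtain u r where ur: "Fpoly F u" "Fpoly F r" "p = s * u + r" "r = 0 \<or> degree r < degree s"
      using Fpoly_division[OF F, of s p] p s s0 unfolding minp_def by blast
    have px: "poly p x = 0" "p \<noteq> 0" using p unfolding minp_def by auto
    have ru: "poly r x = - (poly s x * poly u x)" using ur px by (simp add: eq_neg_iff_add_eq_0 add.commute)
    show False
    proof (cases "poly u x = 0")
      case True
      have "degree s \<le> degree q" using min \<open>?P q\<close> by blast
      moreover have "degree q < degree p" using q y by auto
      moreover have "r = 0 \<or> degree p \<le> degree r" using ur p ru True unfolding minp_def by auto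
      ultimately have "r = 0" using ur(4) by auto
      then have pu: "p = s * u" "u \<noteq> 0" using ur px by auto
      then have "degree p \<le> degree u" using True ur p unfolding minp_def by blast
      then show False using pu s0 ds by (simp add: degree_mult_eq)
    next
      case False
      then have "poly r x \<noteq> 0" using ru s by simp
      moreover have "poly r x = y * poly (- (t * u)) x" using ru t by simp
      moreover have "Fpoly F (0 - t * u)" using ops t ur by blast
      ultimately have "?P r" using ur by (auto intro!: exI[of _ "- (t * u)"])
      then have "degree s \<le> degree r" by (rule min)
      moreover have "r \<noteq> 0" using \<open>poly r x \<noteq> 0\<close> by auto
      ultimately show False using ur by simp
    qed
  qed
  then obtain c where c: "s = [:c:]" by (rule degree_eq_zeroE)
  have cF: "c \<in> F" "c \<noteq> 0" using s c unfolding Fpoly_def by (auto dest: spec[of _ 0])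
  have "inverse y = inverse c * poly t x" using t c cF y by (simp add: field_simps)
  also have "\<dots> \<in> padjoin F x" using padjoin_basic(5)[OF F] padjoin_basic(1)[OF F] subfieldD(6)[OF F] cF t
    unfolding padjoin_def by blast
  finally show ?thesis .
qed

lemma subfield_padjoin:
  assumes F: "subfield_C F" and p: "minp F x p" shows "subfield_C (padjoin F x)"
  unfolding subfield_C_def
  by (intro conjI ballI impI padjoin_basic(3-5)[OF F] padjoin_inverse[OF F p])
    (use padjoin_basic(1)[OF F] subfieldD(1,2)[OF F] in auto)

lemma adjoin_eq_padjoin:
  assumes F: "subfield_C F" and p: "minp F x p" shows "adjoin F x = padjoin F x"
proof
  show "adjoin F x \<subseteq> padjoin F x"
    unfolding adjoin_def using subfield_padjoin[OF assms] padjoin_basic[OF F] by blast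
  show "padjoin F x \<subseteq> adjoin F x"
  proof
    fix y assume "y \<in> padjoin F x"
    then obtain q where q: "Fpoly F q" "y = poly q x" unfolding padjoin_def by blast
    have "y \<in> L" if L: "subfield_C L" "F \<subseteq> L" "x \<in> L" for L
    proof -
      have "coeff q i \<in> L" for i using q L unfolding Fpoly_def by blast
      then show ?thesis unfolding q(2) poly_altdef
        by (intro add_subgroup_sum[OF subfield_ag] subfieldD L) auto
    qed
    then show "y \<in> adjoin F x" unfolding adjoin_def by blast
  qed
qed

text \<open>Bases are sets here, so distinctness of the powers is part of the claim. A coincidence
  x^i = x^j is a relation of degree below that of \<open>p\<close>, as is any linear
  dependence.\<close>

lemma adjoin_basis:
  assumes F: "subfield_C F" and p: "minp F x p"
  shows "is_basis_over F (padjoin F x) ((\<lambda>i. x ^ i) ` {..<degree p})" "inj_on (\<lambda>i. x ^ i) {..<degree p}"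
proof -
  define e where "e = degree p"
  note ops = Fpoly_ops[OF F]
  have zero: "\<forall>i<e. c i = 0" if c: "\<And>i. i < e \<Longrightarrow> c i \<in> F" "(\<Sum>i<e. c i * x ^ i) = 0" for c
  proof -
    define q where "q = (\<Sum>i<e. monom (c i) i)"
    have co: "coeff q i = (if i < e then c i else 0)" for i
      unfolding q_def by (simp add: coeff_sum sum.delta if_distrib cong: if_cong)
    have "coeff q i \<in> F" for i by (cases "i < e") (simp_all add: co c(1) subfieldD(1)[OF F])
    then have "Fpoly F q" unfolding Fpoly_def by blast
    moreover have "poly q x = 0" unfolding q_def by (simp add: poly_sum poly_monom c(2))
    ultimately have "q = 0 \<or> e \<le> degree q" using p unfolding minp_def e_def by blast
    moreover have "q = 0 \<or> degree q < e"
    proof (rule ccontr)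
      assume a: "\<not> (q = 0 \<or> degree q < e)"
      then have "coeff q (degree q) = 0" using co by simp
      then show False using a by simp
    qed
    ultimately have "q = 0" by linarith
    then show ?thesis using co by (metis coeff_0)
  qed
  show inj: "inj_on (\<lambda>i. x ^ i) {..<degree p}"
  proof (rule inj_onI, rule ccontr)
    fix i j assume ij: "i \<in> {..<degree p}" "j \<in> {..<degree p}" "x ^ i = x ^ j" "i \<noteq> j"
    let ?c = "\<lambda>l. if l = i then 1 else if l = j then -1 else 0"
    have "(\<Sum>l<e. ?c l * x ^ l) = (\<Sum>l<e. (if l = i then x ^ i else 0) + (if l = j then - (x ^ j) else 0))"
      using ij(4) by (intro sum.cong) auto
    also have "\<dots> = 0" using ij unfolding e_def sum.distrib by (simp add: sum.delta)
    finally have "\<forall>l<e. ?c l = (0::complex)" using subfieldD(1,2,7)[OF F] by (intro zero) auto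
    then show False using ij unfolding e_def by force
  qed
  show "is_basis_over F (padjoin F x) ((\<lambda>i. x ^ i) ` {..<degree p})"
    unfolding is_basis_over_def
  proof (intro conjI allI impI ballI)
    show "finite ((\<lambda>i. x ^ i) ` {..<degree p})" by simp
    show "(\<lambda>i. x ^ i) ` {..<degree p} \<subseteq> padjoin F x"
      using subfieldD(9)[OF subfield_padjoin[OF assms] padjoin_basic(2)[OF F]] by blast
  next
    fix c b assume c: "\<forall>b\<in>(\<lambda>i. x ^ i) ` {..<degree p}. c b \<in> F" "(\<Sum>b\<in>(\<lambda>i. x ^ i) ` {..<degree p}. c b * b) = 0"
      and b: "b \<in> (\<lambda>i. x ^ i) ` {..<degree p}"
    have "\<forall>i<e. c (x ^ i) = 0" by (rule zero) (use c poly_lincomb_powers[OF inj] in \<open>auto simp: e_def\<close>)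
    then show "c b = 0" using b unfolding e_def by auto
  next
    fix y assume "y \<in> padjoin F x"
    then obtain q where q: "y = poly q x" "Fpoly F q" "q = 0 \<or> degree q < e"
      unfolding padjoin_minp[OF assms] e_def by blast
    define c where "c b = coeff q (the_inv_into {..<degree p} (\<lambda>i. x ^ i) b)" for b
    have ci: "c (x ^ i) = coeff q i" if "i < e" for i
      unfolding c_def using the_inv_into_f_f[OF inj, of i] that e_def by simp
    have "y = (\<Sum>i<e. coeff q i * x ^ i)"
    proof (cases "q = 0")
      case False
      then have "{..degree q} \<subseteq> {..<e}" using q by auto
      then show ?thesis unfolding q(1) poly_altdef
        by (intro sum.mono_neutral_left) (auto simp: coeff_eq_0)
    qed (simp add: q)
    also have "\<dots> = (\<Sum>i<e. c (x^i) * x ^ i)" using ci by (intro sum.cong) auto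
    also have "\<dots> = (\<Sum>b\<in>(\<lambda>i. x ^ i) ` {..<degree p}. c b * b)"
      unfolding poly_lincomb_powers[OF inj] e_def ..
    finally show "\<exists>c. (\<forall>b\<in>(\<lambda>i. x ^ i) ` {..<degree p}. c b \<in> F) \<and> y = (\<Sum>b\<in>(\<lambda>i. x ^ i) ` {..<degree p}. c b * b)"
      using q(2) unfolding Fpoly_def c_def by (intro exI[of _ c]) (auto simp: c_def)
  qed
qed

text \<open>Two change-of-basis matrices \<open>M\<close>, \<open>N\<close> with \<open>M N = 1\<close> and \<open>N M = 1\<close> have
  \<open>card B = tr (M N) = tr (N M) = card C\<close>.\<close>
lemma basis_card_unique:
  assumes F: "subfield_C F" and B: "is_basis_over F L B" and C: "is_basis_over F L C"
  shows "card B = card C"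
proof -
  have tr: "\<exists>M N. (\<forall>b\<in>B. (\<Sum>c\<in>C. M b c * N c b) = (1::complex)) \<and> (\<forall>c\<in>C. (\<Sum>b\<in>B. N c b * M b c) = 1)"
  proof -
    have fin: "finite B" "finite C" using B C unfolding is_basis_over_def by auto
    have "\<forall>b\<in>B. \<exists>m. (\<forall>c\<in>C. m c \<in> F) \<and> b = (\<Sum>c\<in>C. m c * c)"
      using B C unfolding is_basis_over_def by blast
    then obtain M where M: "\<forall>b\<in>B. (\<forall>c\<in>C. M b c \<in> F) \<and> b = (\<Sum>c\<in>C. M b c * c)" by metis
    have "\<forall>c\<in>C. \<exists>m. (\<forall>b\<in>B. m b \<in> F) \<and> c = (\<Sum>b\<in>B. m b * b)"
      using B C unfolding is_basis_over_def by blast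
    then obtain N where N: "\<forall>c\<in>C. (\<forall>b\<in>B. N c b \<in> F) \<and> c = (\<Sum>b\<in>B. N c b * b)" by metis
    have main: "(\<Sum>c\<in>C. M b c * N c b) = 1"
      if b: "b \<in> B" and fin: "finite B" "finite C"
        and M: "\<forall>b\<in>B. (\<forall>c\<in>C. M b c \<in> F) \<and> b = (\<Sum>c\<in>C. M b c * c)"
        and N: "\<forall>c\<in>C. (\<forall>b\<in>B. N c b \<in> F) \<and> c = (\<Sum>b\<in>B. N c b * b)"
        and ind: "\<And>c. (\<forall>b\<in>B. c b \<in> F) \<Longrightarrow> (\<Sum>b\<in>B. c b * b) = 0 \<Longrightarrow> (\<forall>b\<in>B. c b = 0)"
      for B C M N b
    proof -
      \<comment> \<open>Row \<open>b\<close> of M N - 1. It is the coordinate vector of b - b with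
        respect to \<open>B\<close>, so independence makes it vanish.\<close>
      define co where "co d = (\<Sum>c\<in>C. M b c * N c d) - (if d = b then 1 else 0)" for d
      have "(\<Sum>d\<in>B. (\<Sum>c\<in>C. M b c * N c d) * d) = (\<Sum>c\<in>C. M b c * (\<Sum>d\<in>B. N c d * d))"
        by (simp add: sum_distrib_left sum_distrib_right mult.assoc) (rule sum.swap)
      also have "\<dots> = (\<Sum>c\<in>C. M b c * c)" using N by (intro sum.cong) auto
      also have "\<dots> = b" using M b by auto
      finally have e: "(\<Sum>d\<in>B. (\<Sum>c\<in>C. M b c * N c d) * d) = b" .
      have "(\<Sum>d\<in>B. co d * d) = b - (\<Sum>d\<in>B. (if d = b then 1 else 0) * d)"
        unfolding co_def left_diff_distrib sum_subtractf e ..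
      also have "(\<Sum>d\<in>B. (if d = b then 1 else 0) * d) = (\<Sum>d\<in>B. if d = b then b else 0)" by (intro sum.cong) auto
      also have "\<dots> = b" using b fin by simp
      finally have "(\<Sum>d\<in>B. co d * d) = 0" by simp
      moreover have "\<forall>d\<in>B. co d \<in> F"
      proof
        fix d assume d: "d \<in> B"
        have "(\<Sum>c\<in>C. M b c * N c d) \<in> F"
          by (rule add_subgroup_sum[OF subfield_ag[OF F]], rule subfieldD(5)[OF F]) (use M N b d in auto)
        then show "co d \<in> F" unfolding co_def by (intro subfieldD(4)[OF F]) (auto simp: subfieldD[OF F])
      qed
      ultimately have "co b = 0" using ind b by blast
      then show ?thesis unfolding co_def by simp
    qed
    show ?thesis
    proof (rule exI[of _ M], rule exI[of _ N], intro conjI ballI)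
      show "(\<Sum>c\<in>C. M b c * N c b) = 1" if "b \<in> B" for b
        by (rule main[OF that fin M N]) (use B in \<open>auto simp: is_basis_over_def\<close>)
      show "(\<Sum>b\<in>B. N c b * M b c) = 1" if "c \<in> C" for c
        by (rule main[OF that fin(2,1) N M]) (use C in \<open>auto simp: is_basis_over_def\<close>)
    qed
  qed
  then obtain M N where MN: "\<forall>b\<in>B. (\<Sum>c\<in>C. M b c * N c b) = (1::complex)" "\<forall>c\<in>C. (\<Sum>b\<in>B. N c b * M b c) = 1"
    by blast
  have "of_nat (card B) = (\<Sum>b\<in>B. \<Sum>c\<in>C. M b c * N c b)" using MN(1) by simp
  also have "\<dots> = (\<Sum>c\<in>C. \<Sum>b\<in>B. N c b * M b c)" by (subst sum.swap) (simp add: mult.commute)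
  also have "\<dots> = of_nat (card C)" using MN(2) by simp
  finally have "complex_of_nat (card B) = of_nat (card C)" .
  then show ?thesis by (simp only: of_nat_eq_iff)
qed

lemma ext_degree_eq:
  assumes "subfield_C F" "is_basis_over F L B" shows "ext_degree F L = card B"
proof -
  have "is_basis_over F L (SOME B. is_basis_over F L B)" by (rule someI[where P = "is_basis_over F L", OF assms(2)])
  then show ?thesis unfolding ext_degree_def using basis_card_unique[OF assms(1)] assms(2) by blast
qed

section \<open>Embeddings\<close>

lemma map_poly_const: "f 0 = 0 \<Longrightarrow> map_poly f [:c:] = [:f c:]"
  by (intro poly_eqI) (simp add: coeff_map_poly coeff_pCons split: nat.split)

lemma embD:
  assumes "\<sigma> \<in> embeddings F"
  shows "x \<notin> F \<Longrightarrow> \<sigma> x = 0" "\<sigma> 1 = 1" "x \<in> F \<Longrightarrow> y \<in> F \<Longrightarrow> \<sigma> (x + y) = \<sigma> x + \<sigma> y"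
    "x \<in> F \<Longrightarrow> y \<in> F \<Longrightarrow> \<sigma> (x * y) = \<sigma> x * \<sigma> y"
  using assms by (auto simp: embeddings_def)

lemma emb_field:
  assumes s: "\<sigma> \<in> embeddings F" and F: "subfield_C F"
  shows "\<sigma> 0 = 0" "x \<in> F \<Longrightarrow> \<sigma> (- x) = - \<sigma> x" "x \<in> F \<Longrightarrow> y \<in> F \<Longrightarrow> \<sigma> (x - y) = \<sigma> x - \<sigma> y"
    "x \<in> F \<Longrightarrow> x \<noteq> 0 \<Longrightarrow> \<sigma> x \<noteq> 0" "x \<in> F \<Longrightarrow> \<sigma> (x ^ n) = \<sigma> x ^ n"
    "(\<And>i. i \<in> A \<Longrightarrow> f i \<in> F) \<Longrightarrow> \<sigma> (sum f A) = (\<Sum>i\<in>A. \<sigma> (f i))" "\<sigma> (of_nat n) = of_nat n"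
    "q \<in> \<rat> \<Longrightarrow> \<sigma> q = q"
proof -
  note e = embD[OF s] and f = subfieldD[OF F]
  show z: "\<sigma> 0 = 0" using e(3)[of 0 0] f(1) by simp
  show m: "x \<in> F \<Longrightarrow> \<sigma> (- x) = - \<sigma> x" for x
    using e(3)[of x "- x"] f(7)[of x] z by (simp add: eq_neg_iff_add_eq_0 add.commute)
  show "x \<in> F \<Longrightarrow> y \<in> F \<Longrightarrow> \<sigma> (x - y) = \<sigma> x - \<sigma> y" using e(3)[of x "- y"] f(7)[of y] m[of y] by simp
  show n0: "x \<in> F \<Longrightarrow> x \<noteq> 0 \<Longrightarrow> \<sigma> x \<noteq> 0" for x using e(4)[of x "inverse x"] f(6)[of x] e(2) by auto
  show "x \<in> F \<Longrightarrow> \<sigma> (x ^ n) = \<sigma> x ^ n" by (induction n) (auto simp: e f)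
  show "(\<And>i. i \<in> A \<Longrightarrow> f i \<in> F) \<Longrightarrow> \<sigma> (sum f A) = (\<Sum>i\<in>A. \<sigma> (f i))"
    by (induction A rule: infinite_finite_induct) (auto simp: z e add_subgroup_sum[OF subfield_ag[OF F]])
  show nat: "\<sigma> (of_nat n) = of_nat n" for n
    by (induction n) (auto simp: z e subfield_of_nat[OF F] f)
  show "q \<in> \<rat> \<Longrightarrow> \<sigma> q = q"
  proof -
    assume "q \<in> \<rat>"
    then obtain a b where ab: "b > 0" "q = of_int a / of_int b" by (metis Rats_cases')
    have F': "of_int i \<in> F" for i using subfield_Rats[OF F] by auto
    have int: "\<sigma> (of_int i) = of_int i" for i
      by (cases i rule: int_cases2) (auto simp: nat m subfield_of_nat[OF F])
    have "\<sigma> q * of_int b = \<sigma> (q * of_int b)" using e(4)[of q "of_int b"] subfield_Rats[OF F] \<open>q \<in> \<rat>\<close> int[of b] F' by auto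
    also have "q * of_int b = of_int a" using ab by simp
    finally have "\<sigma> q * of_int b = of_int a" using int by simp
    moreover have "complex_of_int b \<noteq> 0" using ab by simp
    ultimately show "\<sigma> q = q" using ab(2) by (metis nonzero_eq_divide_eq)
  qed
qed

definition ext :: "complex set \<Rightarrow> complex set \<Rightarrow> (complex \<Rightarrow> complex) \<Rightarrow> (complex \<Rightarrow> complex) set" where
  "ext F L \<sigma> = {\<tau> \<in> embeddings L. restrict_emb F \<tau> = \<sigma>}"

lemma restrict_emb_embedding:
  assumes "subfield_C F" "F \<subseteq> L" "\<tau> \<in> embeddings L" shows "restrict_emb F \<tau> \<in> embeddings F"
proof -
  have "restrict_emb F \<tau> (x + y) = restrict_emb F \<tau> x + restrict_emb F \<tau> y \<and>
      restrict_emb F \<tau> (x * y) = restrict_emb F \<tau> x * restrict_emb F \<tau> y" if "x \<in> F" "y \<in> F" for x y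
    using that assms(2) embD(3,4)[OF assms(3), of x y] subfieldD(3,5)[OF assms(1) that]
    unfolding restrict_emb_def by auto
  then show ?thesis using subfieldD(2)[OF assms(1)] embD(2)[OF assms(3)]
    unfolding embeddings_def by (auto simp: restrict_emb_def)
qed

lemma restrict_restrict: "F \<subseteq> L \<Longrightarrow> restrict_emb F (restrict_emb L \<tau>) = restrict_emb F \<tau>"
  by (auto simp: restrict_emb_def fun_eq_iff)

lemma map_poly_emb:
  assumes s: "\<sigma> \<in> embeddings F" and F: "subfield_C F"
  shows "Fpoly F p \<Longrightarrow> Fpoly F q \<Longrightarrow> map_poly \<sigma> (p + q) = map_poly \<sigma> p + map_poly \<sigma> q"
    "Fpoly F p \<Longrightarrow> Fpoly F q \<Longrightarrow> map_poly \<sigma> (p - q) = map_poly \<sigma> p - map_poly \<sigma> q"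
    "Fpoly F p \<Longrightarrow> Fpoly F q \<Longrightarrow> map_poly \<sigma> (p * q) = map_poly \<sigma> p * map_poly \<sigma> q"
    "Fpoly F p \<Longrightarrow> map_poly \<sigma> (pderiv p) = pderiv (map_poly \<sigma> p)"
    "Fpoly F p \<Longrightarrow> degree (map_poly \<sigma> p) = degree p"
    "Fpoly F p \<Longrightarrow> \<tau> \<in> ext F L \<sigma> \<Longrightarrow> subfield_C L \<Longrightarrow> F \<subseteq> L \<Longrightarrow> x \<in> L \<Longrightarrow> \<tau> (poly p x) = poly (map_poly \<sigma> p) (\<tau> x)"
proof -
  note f = emb_field[OF s F]
  have co: "coeff (map_poly \<sigma> p) i = \<sigma> (coeff p i)" for p i using f(1) by (simp add: coeff_map_poly)
  show "Fpoly F p \<Longrightarrow> Fpoly F q \<Longrightarrow> map_poly \<sigma> (p + q) = map_poly \<sigma> p + map_poly \<sigma> q"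
    by (intro poly_eqI) (auto simp: co embD[OF s] Fpoly_def)
  show "Fpoly F p \<Longrightarrow> Fpoly F q \<Longrightarrow> map_poly \<sigma> (p - q) = map_poly \<sigma> p - map_poly \<sigma> q"
    by (intro poly_eqI) (auto simp: co f Fpoly_def)
  show "Fpoly F p \<Longrightarrow> Fpoly F q \<Longrightarrow> map_poly \<sigma> (p * q) = map_poly \<sigma> p * map_poly \<sigma> q"
  proof (intro poly_eqI)
    fix n assume pq: "Fpoly F p" "Fpoly F q"
    have "\<sigma> (\<Sum>i\<le>n. coeff p i * coeff q (n - i)) = (\<Sum>i\<le>n. \<sigma> (coeff p i * coeff q (n - i)))"
      using pq subfieldD(5)[OF F] unfolding Fpoly_def by (intro f(6)) auto
    also have "\<dots> = (\<Sum>i\<le>n. \<sigma> (coeff p i) * \<sigma> (coeff q (n - i)))"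
      using pq embD(4)[OF s] unfolding Fpoly_def by (intro sum.cong) auto
    finally show "coeff (map_poly \<sigma> (p * q)) n = coeff (map_poly \<sigma> p * map_poly \<sigma> q) n"
      by (simp add: co coeff_mult)
  qed
  show "Fpoly F p \<Longrightarrow> map_poly \<sigma> (pderiv p) = pderiv (map_poly \<sigma> p)"
  proof (intro poly_eqI)
    fix n assume p: "Fpoly F p"
    have "\<sigma> (of_nat (Suc n) * coeff p (Suc n)) = of_nat (Suc n) * \<sigma> (coeff p (Suc n))"
      using embD(4)[OF s subfield_of_nat[OF F], of "coeff p (Suc n)" "Suc n"] p f(7)[of "Suc n"] unfolding Fpoly_def by metis
    then show "coeff (map_poly \<sigma> (pderiv p)) n = coeff (pderiv (map_poly \<sigma> p)) n"
      by (simp only: co coeff_pderiv)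
  qed
  show "degree (map_poly \<sigma> p) = degree p" if p: "Fpoly F p"
  proof (cases "p = 0")
    case False
    then have "\<sigma> (lead_coeff p) \<noteq> 0" using p f(4) unfolding Fpoly_def by simp
    then show ?thesis by (rule map_poly_degree_eq)
  qed simp
  show "\<tau> (poly p x) = poly (map_poly \<sigma> p) (\<tau> x)"
    if p: "Fpoly F p" and t: "\<tau> \<in> ext F L \<sigma>" and L: "subfield_C L" "F \<subseteq> L" "x \<in> L"
  proof -
    have te: "\<tau> \<in> embeddings L" and ts: "\<And>y. y \<in> F \<Longrightarrow> \<tau> y = \<sigma> y"
      using t unfolding ext_def restrict_emb_def by auto
    have c: "coeff p i \<in> F" "coeff p i \<in> L" for i using p L unfolding Fpoly_def by auto
    have "\<tau> (poly p x) = (\<Sum>i\<le>degree p. \<tau> (coeff p i * x ^ i))"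
      unfolding poly_altdef by (rule emb_field(6)[OF te L(1)]) (auto intro: subfieldD[OF L(1)] c L)
    also have "\<dots> = (\<Sum>i\<le>degree p. \<sigma> (coeff p i) * \<tau> x ^ i)"
    proof (rule sum.cong)
      fix i assume "i \<in> {..degree p}"
      have "\<tau> (coeff p i * x ^ i) = \<tau> (coeff p i) * \<tau> (x ^ i)"
        by (rule embD(4)[OF te c(2) subfieldD(9)[OF L(1,3)]])
      then show "\<tau> (coeff p i * x ^ i) = \<sigma> (coeff p i) * \<tau> x ^ i"
        using ts[OF c(1)] emb_field(5)[OF te L(1,3)] by simp
    qed simp
    also have "\<dots> = poly (map_poly \<sigma> p) (\<tau> x)"
      unfolding poly_altdef co by (rule sum.mono_neutral_right)
        (auto intro: map_poly_degree_leq f simp: coeff_eq_0 le_degree co[symmetric])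
    finally show ?thesis .
  qed
qed

text \<open>Separability: a double root of \<open>\<sigma> p\<close> would yield a proper factor of \<open>p\<close> over \<open>F\<close>,
  namely a polynomial \<open>q\<close> of least degree with \<open>(\<sigma> q)(\<rho>) = 0\<close>.\<close>
lemma card_roots_emb_minp:
  assumes s: "\<sigma> \<in> embeddings F" and F: "subfield_C F" and p: "minp F x p"
  shows "card {\<rho>. poly (map_poly \<sigma> p) \<rho> = 0} = degree p" "finite {\<rho>. poly (map_poly \<sigma> p) \<rho> = 0}"
    "smult (\<sigma> (lead_coeff p)) (\<Prod>\<rho>|poly (map_poly \<sigma> p) \<rho> = 0. [:-\<rho>, 1:]) = map_poly \<sigma> p"
proof -
  note m = map_poly_emb[OF s F]
  have pF: "Fpoly F p" "p \<noteq> 0" "poly p x = 0" using p unfolding minp_def by auto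
  have d: "degree (map_poly \<sigma> p) = degree p" by (rule m(5)[OF pF(1)])
  have n0: "map_poly \<sigma> p \<noteq> 0" using d minp_degree_pos[OF p] by auto
  have dp: "pderiv p \<noteq> 0" using minp_degree_pos[OF p] by (simp add: pderiv_eq_0_iff)
  have "rsquarefree (map_poly \<sigma> p)" unfolding rsquarefree_roots
  proof (intro allI notI)
    fix \<rho> assume r: "poly (map_poly \<sigma> p) \<rho> = 0 \<and> poly (pderiv (map_poly \<sigma> p)) \<rho> = 0"
    let ?P = "\<lambda>q. Fpoly F q \<and> q \<noteq> 0 \<and> poly (map_poly \<sigma> q) \<rho> = 0"
    have P: "?P (pderiv p)" using r m(4)[OF pF(1)] Fpoly_ops(9)[OF F pF(1)] dp by simp
    define q where "q = arg_min degree ?P"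
    have q: "?P q" unfolding q_def by (rule arg_min_natI[where P = ?P, OF P])
    have min: "degree q \<le> degree t" if "?P t" for t unfolding q_def by (rule arg_min_nat_le[where P = ?P, OF that])
    obtain u t where ut: "Fpoly F u" "Fpoly F t" "p = q * u + t" "t = 0 \<or> degree t < degree q"
      using Fpoly_division[OF F, of q p] q pF by blast
    have "map_poly \<sigma> p = map_poly \<sigma> q * map_poly \<sigma> u + map_poly \<sigma> t"
      using ut(3) m(1)[OF Fpoly_ops(7)[OF F] ut(2), of q u] m(3)[of q u] q ut(1) by simp
    then have "poly (map_poly \<sigma> t) \<rho> = 0" using r q by simp
    then have "t = 0" using min[of t] ut by (metis leD)
    then have pq: "p = q * u" using ut by simp
    have "degree q \<le> degree (pderiv p)" by (rule min[OF P])
    then have dq: "degree q < degree p" using minp_degree_pos[OF p] by (simp add: degree_pderiv)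
    have "degree q > 0"
    proof (rule ccontr)
      assume "\<not> degree q > 0"
      then obtain c where c: "q = [:c:]" by (auto elim: degree_eq_zeroE)
      then have "\<sigma> c = 0" using q emb_field(1)[OF s F] by (simp add: map_poly_const)
      moreover have "c \<in> F" "c \<noteq> 0" using q c unfolding Fpoly_def by (auto dest: spec[of _ 0])
      ultimately show False using emb_field(4)[OF s F] by blast
    qed
    moreover have "u \<noteq> 0" "q \<noteq> 0" using pq pF by auto
    ultimately have du: "degree u < degree p" using pq by (simp add: degree_mult_eq)
    have "poly q x = 0 \<or> poly u x = 0" using pq pF(3) by simp
    then show False using p q ut(1) \<open>u \<noteq> 0\<close> dq du unfolding minp_def by auto
  qed
  then have dec: "smult (lead_coeff (map_poly \<sigma> p)) (\<Prod>\<rho>|poly (map_poly \<sigma> p) \<rho> = 0. [:-\<rho>, 1:]) = map_poly \<sigma> p"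
    by (rule complex_poly_decompose_rsquarefree)
  have lc: "lead_coeff (map_poly \<sigma> p) = \<sigma> (lead_coeff p)"
    unfolding d using emb_field(1)[OF s F] by (simp add: coeff_map_poly)
  show "smult (\<sigma> (lead_coeff p)) (\<Prod>\<rho>|poly (map_poly \<sigma> p) \<rho> = 0. [:-\<rho>, 1:]) = map_poly \<sigma> p"
    using dec lc by simp
  show "finite {\<rho>. poly (map_poly \<sigma> p) \<rho> = 0}" by (rule poly_roots_finite[OF n0])
  have "degree (map_poly \<sigma> p) = degree (\<Prod>\<rho>|poly (map_poly \<sigma> p) \<rho> = 0. [:-\<rho>, 1:])"
    using arg_cong[OF dec, of degree] n0 by simp
  also have "\<dots> = card {\<rho>. poly (map_poly \<sigma> p) \<rho> = 0}"
    by (subst degree_prod_eq_sum_degree) auto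
  finally show "card {\<rho>. poly (map_poly \<sigma> p) \<rho> = 0} = degree p" using d by simp
qed

text \<open>An extension is determined by the image of \<open>x\<close>, which must be a root of the
  transported minimal polynomial. Conversely each root \<open>r\<close> gives an extension, sending
  q(x) to the value at \<open>r\<close> of the transported q.\<close>

lemma ext_simple:
  assumes s: "\<sigma> \<in> embeddings F" and F: "subfield_C F" and p: "minp F x p"
  shows "bij_betw (\<lambda>\<tau>. \<tau> x) (ext F (adjoin F x) \<sigma>) {\<rho>. poly (map_poly \<sigma> p) \<rho> = 0}"
proof -
  define L where "L = adjoin F x"
  have L: "L = padjoin F x" unfolding L_def by (rule adjoin_eq_padjoin[OF F p])
  have sL: "subfield_C L" unfolding L by (rule subfield_padjoin[OF F p])
  have FL: "F \<subseteq> L" "x \<in> L" unfolding L using padjoin_basic[OF F] by auto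
  have pF: "Fpoly F p" "p \<noteq> 0" "poly p x = 0" using p unfolding minp_def by auto
  note m = map_poly_emb[OF s F]
  have inj: "inj_on (\<lambda>\<tau>. \<tau> x) (ext F L \<sigma>)"
  proof (rule inj_onI, rule ext)
    fix t u y assume tu: "t \<in> ext F L \<sigma>" "u \<in> ext F L \<sigma>" "t x = u x"
    show "t y = u y"
    proof (cases "y \<in> L")
      case True
      then obtain q where q: "Fpoly F q" "y = poly q x" unfolding L padjoin_def by blast
      show ?thesis unfolding q(2) using m(6)[OF q(1) tu(1) sL FL] m(6)[OF q(1) tu(2) sL FL] tu(3) by simp
    next
      case False
      then show ?thesis using tu embD(1) unfolding ext_def by (metis (no_types, lifting) mem_Collect_eq)
    qed
  qed
  have "(\<lambda>\<tau>. \<tau> x) ` ext F L \<sigma> = {\<rho>. poly (map_poly \<sigma> p) \<rho> = 0}"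
  proof (intro equalityI subsetI)
    fix r assume "r \<in> (\<lambda>\<tau>. \<tau> x) ` ext F L \<sigma>"
    then obtain t where t: "t \<in> ext F L \<sigma>" "r = t x" by blast
    have "t 0 = 0" using t emb_field(1)[OF _ sL] unfolding ext_def by blast
    then show "r \<in> {\<rho>. poly (map_poly \<sigma> p) \<rho> = 0}" using m(6)[OF pF(1) t(1) sL FL] pF(3) t(2) by simp
  next
    fix r assume r: "r \<in> {\<rho>. poly (map_poly \<sigma> p) \<rho> = 0}"
    have wd: "poly (map_poly \<sigma> q) r = poly (map_poly \<sigma> q') r"
      if q: "Fpoly F q" "Fpoly F q'" "poly q x = poly q' x" for q q'
    proof -
      have "poly (q - q') x = 0" using q by simp
      then obtain u where u: "Fpoly F u" "q - q' = p * u" using minp_dvd[OF F p] Fpoly_ops(6)[OF F q(1,2)] by metis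
      have "map_poly \<sigma> q - map_poly \<sigma> q' = map_poly \<sigma> p * map_poly \<sigma> u"
        using m(2)[OF q(1,2)] m(3)[OF pF(1) u(1)] u(2) by simp
      then have "poly (map_poly \<sigma> q) r - poly (map_poly \<sigma> q') r = 0" using r by (simp flip: poly_diff)
      then show ?thesis by simp
    qed
    \<comment> \<open>The polynomial representing \<open>y\<close> is picked by choice;
      \<open>wd\<close> makes the value independent of it, since two representatives differ by a
      multiple of \<open>p\<close>. Outside \<open>L\<close> the value is 0, as
      \<open>embeddings\<close> demands.\<close>
    define t where "t y = (if y \<in> L then poly (map_poly \<sigma> (SOME q. Fpoly F q \<and> poly q x = y)) r else 0)" for y
    have tq: "t (poly q x) = poly (map_poly \<sigma> q) r" if q: "Fpoly F q" for q
    proof -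
      define q' where "q' = (SOME q'. Fpoly F q' \<and> poly q' x = poly q x)"
      have q': "Fpoly F q' \<and> poly q' x = poly q x" unfolding q'_def
        by (rule someI[where P = "\<lambda>q'. Fpoly F q' \<and> poly q' x = poly q x" and x = q]) (use q in simp)
      have "poly q x \<in> L" unfolding L padjoin_def using q by blast
      then have "t (poly q x) = poly (map_poly \<sigma> q') r" unfolding t_def q'_def by simp
      then show ?thesis using wd[OF _ q] q' by metis
    qed
    have tF: "t c = \<sigma> c" if "c \<in> F" for c
      using tq[OF Fpoly_ops(3)[OF F that]] emb_field(1)[OF s F] by (simp add: map_poly_const)
    have "Fpoly F (monom 1 1)" using Fpoly_ops(4)[OF F subfieldD(2)[OF F]] .
    from tq[OF this] have tx: "t x = r" using emb_field(1)[OF s F] embD(2)[OF s] by (simp add: map_poly_monom poly_monom)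
    have hom: "t (y + z) = t y + t z \<and> t (y * z) = t y * t z" if yz: "y \<in> L" "z \<in> L" for y z
    proof -
      obtain q q' where q: "Fpoly F q" "y = poly q x" "Fpoly F q'" "z = poly q' x" using yz unfolding L padjoin_def by blast
      have "y + z = poly (q + q') x" "y * z = poly (q * q') x" using q by simp_all
      then show ?thesis using tq[OF Fpoly_ops(5)[OF F q(1,3)]] tq[OF Fpoly_ops(7)[OF F q(1,3)]] tq[OF q(1)] tq[OF q(3)]
          m(1)[OF q(1,3)] m(3)[OF q(1,3)] q by simp
    qed
    have "t 1 = 1" using tF[OF subfieldD(2)[OF F]] embD(2)[OF s] by simp
    moreover have "t y = 0" if "y \<notin> L" for y using that unfolding t_def by simp
    ultimately have "t \<in> embeddings L" unfolding embeddings_def using hom by blast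
    moreover have "restrict_emb F t = \<sigma>" unfolding restrict_emb_def using tF embD(1)[OF s] by (auto simp: fun_eq_iff)
    ultimately have "t \<in> ext F L \<sigma>" unfolding ext_def by blast
    then show "r \<in> (\<lambda>\<tau>. \<tau> x) ` ext F L \<sigma>" using tx by blast
  qed
  then show ?thesis using inj unfolding bij_betw_def L_def by blast
qed

section \<open>Towers of fields: degrees and numbers of embeddings\<close>

lemma tower_basis:
  assumes B: "is_basis_over F L B" and C: "is_basis_over L M C" and sub: "L \<subseteq> M" "F \<subseteq> L"
    and F: "subfield_C F" and sL: "subfield_C L" and M: "subfield_C M"
  shows "is_basis_over F M ((\<lambda>(b,c). b * c) ` (B \<times> C))" "card ((\<lambda>(b,c). b * c) ` (B \<times> C)) = card B * card C"
proof -
  have fin: "finite B" "finite C" using B C unfolding is_basis_over_def by auto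
  have BL: "B \<subseteq> L" and CM: "C \<subseteq> M" using B C unfolding is_basis_over_def by auto
  have indB: "\<forall>b\<in>B. c b = 0" if "\<forall>b\<in>B. c b \<in> F" "(\<Sum>b\<in>B. c b * b) = 0" for c
    using B that unfolding is_basis_over_def by blast
  have indC: "\<forall>b\<in>C. c b = 0" if "\<forall>b\<in>C. c b \<in> L" "(\<Sum>b\<in>C. c b * b) = 0" for c
    using C that unfolding is_basis_over_def by blast
  have zero: "\<forall>b\<in>B. \<forall>c\<in>C. m b c = 0"
    if m: "\<forall>b\<in>B. \<forall>c\<in>C. m b c \<in> F" "(\<Sum>b\<in>B. \<Sum>c\<in>C. m b c * (b * c)) = 0" for m
  proof -
    have "(\<Sum>c\<in>C. (\<Sum>b\<in>B. m b c * b) * c) = 0"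
      using m(2) by (subst (asm) sum.swap) (simp add: sum_distrib_right mult.assoc)
    moreover have "\<forall>c\<in>C. (\<Sum>b\<in>B. m b c * b) \<in> L"
    proof
      fix c assume "c \<in> C"
      then show "(\<Sum>b\<in>B. m b c * b) \<in> L"
        using m(1) BL sub by (intro add_subgroup_sum[OF subfield_ag[OF sL]] subfieldD(5)[OF sL]) auto
    qed
    ultimately have z: "\<forall>c\<in>C. (\<Sum>b\<in>B. m b c * b) = 0" using indC[of "\<lambda>c. \<Sum>b\<in>B. m b c * b"] by blast
    show ?thesis
    proof (intro ballI)
      fix b c assume bc: "b \<in> B" "c \<in> C"
      have "\<forall>b\<in>B. m b c = 0" using indB[of "\<lambda>b. m b c"] m(1) z bc(2) by blast
      then show "m b c = 0" using bc by blast
    qed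
  qed
  have n0: "0 \<notin> C"
  proof
    assume "0 \<in> C"
    moreover have "\<forall>b\<in>C. (if b = 0 then 1 else 0::complex) = 0"
      by (rule indC) (use subfieldD[OF sL] in \<open>auto intro!: sum.neutral\<close>)
    ultimately show False by force
  qed
  have inj: "inj_on (\<lambda>(b,c). b * c) (B \<times> C)"
  proof (rule inj_onI, clarify)
    fix b c b' c' assume bc: "b \<in> B" "c \<in> C" "b' \<in> B" "c' \<in> C" and e: "b * c = b' * c'"
    show "b = b' \<and> c = c'"
    proof (rule ccontr)
      assume ne: "\<not> (b = b' \<and> c = c')"
      \<comment> \<open>The coefficients of the relation b c - b' c' = 0: a coincidence of two
        products would be a nontrivial dependence.\<close>
      define m where "m x y = (if x = b \<and> y = c then 1 else 0) - (if x = b' \<and> y = c' then 1 else (0::complex))" for x y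
      have d: "(\<Sum>x\<in>B. \<Sum>y\<in>C. (if x = u \<and> y = v then 1 else 0) * (x * y)) = u * v" if "u \<in> B" "v \<in> C" for u v
      proof -
        have "(\<Sum>x\<in>B. \<Sum>y\<in>C. (if x = u \<and> y = v then 1 else 0) * (x * y)) = (\<Sum>x\<in>B. if x = u then u * v else 0)"
        proof (rule sum.cong)
          fix x assume "x \<in> B"
          have "(\<Sum>y\<in>C. (if x = u \<and> y = v then 1 else 0) * (x * y)) = (\<Sum>y\<in>C. if y = v then (if x = u then u * v else 0) else 0)"
            by (intro sum.cong) auto
          then show "(\<Sum>y\<in>C. (if x = u \<and> y = v then 1 else 0) * (x * y)) = (if x = u then u * v else 0)"
            using fin that by simp
        qed simp
        then show ?thesis using fin that by simp
      qed
      have "(\<Sum>x\<in>B. \<Sum>y\<in>C. m x y * (x * y)) = 0"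
        unfolding m_def left_diff_distrib sum_subtractf using d bc e by simp
      moreover have "\<forall>x\<in>B. \<forall>y\<in>C. m x y \<in> F"
      proof -
        have 01: "(0::complex) \<in> F" "(1::complex) \<in> F" "(-1::complex) \<in> F" using subfieldD(1,2,7)[OF F] by auto
        then show ?thesis unfolding m_def by auto
      qed
      ultimately have "m b c = 0" using zero bc by blast
      then show False using ne unfolding m_def by (auto split: if_splits)
    qed
  qed
  have sum: "(\<Sum>x\<in>(\<lambda>(b,c). b * c) ` (B \<times> C). f x * x) = (\<Sum>b\<in>B. \<Sum>c\<in>C. f (b * c) * (b * c))" for f
    using sum.reindex[OF inj, of "\<lambda>x. f x * x"]
    by (simp add: sum.cartesian_product case_prod_beta o_def)
  show "card ((\<lambda>(b,c). b * c) ` (B \<times> C)) = card B * card C"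
    by (simp add: card_image[OF inj] card_cartesian_product)
  show "is_basis_over F M ((\<lambda>(b,c). b * c) ` (B \<times> C))"
    unfolding is_basis_over_def
  proof (intro conjI allI impI ballI)
    show "finite ((\<lambda>(b,c). b * c) ` (B \<times> C))" using fin by simp
    show "(\<lambda>(b,c). b * c) ` (B \<times> C) \<subseteq> M"
      using subsetD[OF BL] subsetD[OF CM] subsetD[OF sub(1)] by (auto intro!: subfieldD(5)[OF M])
  next
    fix f x assume f: "\<forall>b\<in>(\<lambda>(b,c). b * c) ` (B \<times> C). f b \<in> F" "(\<Sum>b\<in>(\<lambda>(b,c). b * c) ` (B \<times> C). f b * b) = 0"
      and x: "x \<in> (\<lambda>(b,c). b * c) ` (B \<times> C)"
    have "\<forall>b\<in>B. \<forall>c\<in>C. f (b * c) = 0" by (rule zero) (use f sum in auto)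
    then show "f x = 0" using x by auto
  next
    fix x assume "x \<in> M"
    then obtain d where d: "\<forall>c\<in>C. d c \<in> L" "x = (\<Sum>c\<in>C. d c * c)" using C unfolding is_basis_over_def by blast
    have "\<forall>c\<in>C. \<exists>m. (\<forall>b\<in>B. m b \<in> F) \<and> d c = (\<Sum>b\<in>B. m b * b)" using d(1) B unfolding is_basis_over_def by blast
    then obtain m where m: "\<forall>c\<in>C. (\<forall>b\<in>B. m c b \<in> F) \<and> d c = (\<Sum>b\<in>B. m c b * b)" by metis
    define f where "f y = (case the_inv_into (B \<times> C) (\<lambda>(b,c). b * c) y of (b,c) \<Rightarrow> m c b)" for y
    have fbc: "f (b * c) = m c b" if "b \<in> B" "c \<in> C" for b c
      unfolding f_def using the_inv_into_f_f[OF inj, of "(b,c)"] that by simp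
    have "x = (\<Sum>c\<in>C. \<Sum>b\<in>B. m c b * (b * c))" unfolding d(2)
      by (rule sum.cong) (use m in \<open>simp_all add: sum_distrib_right mult.assoc\<close>)
    also have "\<dots> = (\<Sum>b\<in>B. \<Sum>c\<in>C. f (b * c) * (b * c))" by (subst sum.swap) (intro sum.cong, simp_all add: fbc)
    finally show "\<exists>c. (\<forall>b\<in>(\<lambda>(b,c). b * c) ` (B \<times> C). c b \<in> F) \<and> x = (\<Sum>b\<in>(\<lambda>(b,c). b * c) ` (B \<times> C). c b * b)"
      using fbc m sum by (intro exI[of _ f]) auto
  qed
qed

text \<open>Degree and number of embeddings are recorded together because each simple adjunction
  multiplies both by the same factor, so their equality passes up a tower.\<close>

definition nfd :: "complex set \<Rightarrow> nat \<Rightarrow> bool" where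
  "nfd F d \<longleftrightarrow> subfield_C F \<and> (\<exists>B. is_basis_over \<rat> F B \<and> card B = d) \<and>
     finite (embeddings F) \<and> card (embeddings F) = d"

lemma nfd_Rats: "nfd \<rat> 1"
proof -
  have "is_basis_over \<rat> \<rat> {1}" unfolding is_basis_over_def by (auto intro: exI[of _ "\<lambda>_. _"])
  moreover have "embeddings \<rat> = {\<lambda>x. if x \<in> \<rat> then x else 0}"
  proof (intro equalityI subsetI)
    fix s assume s: "s \<in> embeddings \<rat>"
    have "s = (\<lambda>x. if x \<in> \<rat> then x else 0)"
      using emb_field(8)[OF s subfield_Rats_C] embD(1)[OF s] by (auto simp: fun_eq_iff)
    then show "s \<in> {\<lambda>x. if x \<in> \<rat> then x else 0}" by simp
  next
    fix s :: "complex \<Rightarrow> complex" assume "s \<in> {\<lambda>x. if x \<in> \<rat> then x else 0}"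
    then show "s \<in> embeddings \<rat>" unfolding embeddings_def by auto
  qed
  ultimately show ?thesis unfolding nfd_def using subfield_Rats_C by auto
qed

lemma algebraic_minp:
  assumes "algebraic x" "subfield_C F" obtains p where "minp F x p"
proof -
  obtain p where p: "\<And>i. coeff p i \<in> \<int>" "p \<noteq> 0" "poly p x = 0" using assms(1) unfolding algebraic_def by blast
  have "Fpoly F p" unfolding Fpoly_def using p(1) subfield_Rats[OF assms(2)] Ints_subset_Rats by blast
  then show ?thesis using ex_minp p that by metis
qed

lemma ext_cover:
  assumes "subfield_C F" "F \<subseteq> L"
  shows "embeddings L = (\<Union>\<sigma>\<in>embeddings F. ext F L \<sigma>)"
  using restrict_emb_embedding[OF assms] unfolding ext_def by auto

lemma card_ext_cover:
  assumes "subfield_C F" "F \<subseteq> L" "finite (embeddings F)"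
    "\<And>\<sigma>. \<sigma> \<in> embeddings F \<Longrightarrow> finite (ext F L \<sigma>) \<and> card (ext F L \<sigma>) = e"
  shows "finite (embeddings L)" "card (embeddings L) = card (embeddings F) * e"
proof -
  show "finite (embeddings L)" unfolding ext_cover[OF assms(1,2)] using assms by blast
  have "card (embeddings L) = (\<Sum>\<sigma>\<in>embeddings F. card (ext F L \<sigma>))"
    unfolding ext_cover[OF assms(1,2)] by (rule card_UN_disjoint) (use assms in \<open>auto simp: ext_def\<close>)
  also have "\<dots> = (\<Sum>\<sigma>\<in>embeddings F. e)" using assms(4) by (intro sum.cong) auto
  finally show "card (embeddings L) = card (embeddings F) * e" by simp
qed

lemma adjoin_facts:
  assumes F: "subfield_C F" and x: "algebraic x"
  obtains e B where "e > 0" "subfield_C (adjoin F x)" "F \<subseteq> adjoin F x" "x \<in> adjoin F x"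
    "is_basis_over F (adjoin F x) B" "card B = e"
    "\<And>\<sigma>. \<sigma> \<in> embeddings F \<Longrightarrow> finite (ext F (adjoin F x) \<sigma>) \<and> card (ext F (adjoin F x) \<sigma>) = e"
    "\<And>L. subfield_C L \<Longrightarrow> F \<subseteq> L \<Longrightarrow> x \<in> L \<Longrightarrow> adjoin F x \<subseteq> L"
proof -
  obtain p where p: "minp F x p" using algebraic_minp[OF x F] .
  note eq = adjoin_eq_padjoin[OF F p]
  show ?thesis
  proof (rule that[of "degree p" "(\<lambda>i. x ^ i) ` {..<degree p}"])
    show "degree p > 0" by (rule minp_degree_pos[OF p])
    show "subfield_C (adjoin F x)" unfolding eq by (rule subfield_padjoin[OF F p])
    show "F \<subseteq> adjoin F x" "x \<in> adjoin F x" unfolding eq using padjoin_basic[OF F] by auto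
    show "is_basis_over F (adjoin F x) ((\<lambda>i. x ^ i) ` {..<degree p})" unfolding eq by (rule adjoin_basis[OF F p])
    show "card ((\<lambda>i. x ^ i) ` {..<degree p}) = degree p" by (simp add: card_image adjoin_basis(2)[OF F p])
    show "finite (ext F (adjoin F x) \<sigma>) \<and> card (ext F (adjoin F x) \<sigma>) = degree p" if s: "\<sigma> \<in> embeddings F" for \<sigma>
      using bij_betw_same_card[OF ext_simple[OF s F p]] bij_betw_finite[OF ext_simple[OF s F p]]
        card_roots_emb_minp(1,2)[OF s F p] by simp
    show "adjoin F x \<subseteq> L" if "subfield_C L" "F \<subseteq> L" "x \<in> L" for L
      unfolding adjoin_def using that by blast
  qed
qed

lemma nfd_adjoin:
  assumes F: "nfd F d" and x: "algebraic x"
  obtains e where "e > 0" "nfd (adjoin F x) (d * e)" "ext_degree F (adjoin F x) = e"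
proof -
  have sF: "subfield_C F" using F unfolding nfd_def by blast
  obtain e B where eB: "e > 0" "subfield_C (adjoin F x)" "F \<subseteq> adjoin F x"
    "is_basis_over F (adjoin F x) B" "card B = e"
    "\<And>\<sigma>. \<sigma> \<in> embeddings F \<Longrightarrow> finite (ext F (adjoin F x) \<sigma>) \<and> card (ext F (adjoin F x) \<sigma>) = e"
    using adjoin_facts[OF sF x] by metis
  obtain A where A: "is_basis_over \<rat> F A" "card A = d" using F unfolding nfd_def by blast
  note tb = tower_basis[OF A(1) eB(4,3) subfield_Rats[OF sF] subfield_Rats_C sF eB(2)]
  have "finite (embeddings F)" "card (embeddings F) = d" using F unfolding nfd_def by auto
  then have "nfd (adjoin F x) (d * e)"
    unfolding nfd_def using tb A(2) eB(2,5) card_ext_cover[OF sF eB(3) _ eB(6)] by metis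
  moreover have "ext_degree F (adjoin F x) = e" using ext_degree_eq[OF sF eB(4)] eB(5) by simp
  ultimately show ?thesis using that eB(1) by blast
qed

text \<open>Iterated simple adjunction. A number field is generated by the list of elements of a
  rational basis, and induction over the list takes the place of a primitive element.\<close>

fun adjs :: "complex set \<Rightarrow> complex list \<Rightarrow> complex set" where
  "adjs F [] = F"
| "adjs F (x # xs) = adjs (adjoin F x) xs"

lemma ext_tower:
  assumes "subfield_C F" "subfield_C L" "F \<subseteq> L" "L \<subseteq> M"
  shows "ext F M \<sigma> = (\<Union>\<tau>\<in>ext F L \<sigma>. ext L M \<tau>)"
  using restrict_emb_embedding[OF assms(2,4)] restrict_restrict[OF assms(3)] unfolding ext_def by fastforce

text \<open>The number \<open>r\<close> of extensions is the same for all \<open>\<sigma>\<close>.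
  This uniformity later makes every conjugate occur equally often.\<close>

lemma adjs_facts:
  assumes "nfd F d" "\<And>x. x \<in> set xs \<Longrightarrow> algebraic x"
  shows "\<exists>r>0. nfd (adjs F xs) (d * r) \<and> F \<subseteq> adjs F xs \<and> set xs \<subseteq> adjs F xs \<and>
    (\<forall>\<sigma>\<in>embeddings F. finite (ext F (adjs F xs) \<sigma>) \<and> card (ext F (adjs F xs) \<sigma>) = r) \<and>
    (\<forall>L. subfield_C L \<longrightarrow> F \<subseteq> L \<longrightarrow> set xs \<subseteq> L \<longrightarrow> adjs F xs \<subseteq> L)"
  using assms
proof (induction xs arbitrary: F d)
  case Nil
  have sF: "subfield_C F" using Nil unfolding nfd_def by blast
  have "ext F F \<sigma> = {\<sigma>}" if "\<sigma> \<in> embeddings F" for \<sigma>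
  proof -
    have "restrict_emb F \<tau> = \<tau>" if "\<tau> \<in> embeddings F" for \<tau>
      using embD(1)[OF that] unfolding restrict_emb_def by (auto simp: fun_eq_iff)
    then show ?thesis using that unfolding ext_def by auto
  qed
  then show ?case using Nil by (intro exI[of _ 1]) auto
next
  case (Cons x xs)
  have sF: "subfield_C F" using Cons unfolding nfd_def by blast
  have x: "algebraic x" using Cons by simp
  define L where "L = adjoin F x"
  obtain e where e: "e > 0" "nfd L (d * e)" "ext_degree F L = e" unfolding L_def by (rule nfd_adjoin[OF Cons(2) x])
  obtain e' B where eB: "subfield_C L" "F \<subseteq> L" "x \<in> L" "is_basis_over F L B" "card B = e'"
    "\<And>\<sigma>. \<sigma> \<in> embeddings F \<Longrightarrow> finite (ext F L \<sigma>) \<and> card (ext F L \<sigma>) = e'"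
    "\<And>L'. subfield_C L' \<Longrightarrow> F \<subseteq> L' \<Longrightarrow> x \<in> L' \<Longrightarrow> L \<subseteq> L'"
    using adjoin_facts[OF sF x] unfolding L_def by metis
  have ee: "e' = e" using ext_degree_eq[OF sF eB(4)] e(3) eB(5) by simp
  obtain r where r: "r > 0" "nfd (adjs L xs) (d * e * r)" "L \<subseteq> adjs L xs" "set xs \<subseteq> adjs L xs"
    "\<And>\<tau>. \<tau> \<in> embeddings L \<Longrightarrow> finite (ext L (adjs L xs) \<tau>) \<and> card (ext L (adjs L xs) \<tau>) = r"
    "\<And>L'. subfield_C L' \<Longrightarrow> L \<subseteq> L' \<Longrightarrow> set xs \<subseteq> L' \<Longrightarrow> adjs L xs \<subseteq> L'"
    using Cons(1)[OF e(2)] Cons(3) by auto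
  have "finite (ext F (adjs L xs) \<sigma>) \<and> card (ext F (adjs L xs) \<sigma>) = e * r" if s: "\<sigma> \<in> embeddings F" for \<sigma>
  proof -
    note t = ext_tower[OF sF eB(1,2) r(3), of \<sigma>]
    have em: "\<tau> \<in> embeddings L" if "\<tau> \<in> ext F L \<sigma>" for \<tau> using that unfolding ext_def by blast
    have f: "finite (ext F L \<sigma>)" "card (ext F L \<sigma>) = e" using eB(6)[OF s] ee by auto
    have "card (ext F (adjs L xs) \<sigma>) = (\<Sum>\<tau>\<in>ext F L \<sigma>. card (ext L (adjs L xs) \<tau>))"
      unfolding t
    proof (rule card_UN_disjoint)
      show "finite (ext F L \<sigma>)" by (rule f(1))
      show "\<forall>\<tau>\<in>ext F L \<sigma>. finite (ext L (adjs L xs) \<tau>)" using r(5)[OF em] by blast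
      show "\<forall>\<tau>\<in>ext F L \<sigma>. \<forall>\<tau>'\<in>ext F L \<sigma>. \<tau> \<noteq> \<tau>' \<longrightarrow> ext L (adjs L xs) \<tau> \<inter> ext L (adjs L xs) \<tau>' = {}"
        unfolding ext_def[of L "adjs L xs"] by blast
    qed
    also have "\<dots> = (\<Sum>\<tau>\<in>ext F L \<sigma>. r)" using r(5)[OF em] by (intro sum.cong) auto
    finally have "card (ext F (adjs L xs) \<sigma>) = e * r" using f by simp
    moreover have "finite (ext F (adjs L xs) \<sigma>)" unfolding t using f(1) r(5)[OF em] by blast
    ultimately show ?thesis by blast
  qed
  moreover have "F \<subseteq> adjs L xs" "set (x # xs) \<subseteq> adjs L xs" using r eB by auto
  moreover have "nfd (adjs L xs) (d * (e * r))" using r(2) by (simp add: mult.assoc)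
  moreover have "adjs L xs \<subseteq> L'" if "subfield_C L'" "F \<subseteq> L'" "set (x # xs) \<subseteq> L'" for L'
    using r(6)[OF that(1) eB(7)[OF that(1,2)]] that(3) by simp
  moreover have "e * r > 0" using e(1) r(1) by simp
  ultimately show ?case unfolding adjs.simps L_def[symmetric] by (intro exI[of _ "e * r"]) blast
qed

text \<open>If \<open>N\<close> clears the denominators of the matrix of multiplication by \<open>x\<close>, then \<open>N x\<close> stabilises
  the integral combinations of \<open>B\<close>.\<close>
lemma clear_denominators:
  assumes k: "subfield_C k" and B: "is_basis_over \<rat> k B" and x: "x \<in> k"
  shows "\<exists>N::nat. N > 0 \<and> algebraic_int (of_nat N * x)"
proof -
  have fin: "finite B" and Bk: "B \<subseteq> k" using B unfolding is_basis_over_def by auto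
  have "\<forall>b\<in>B. \<exists>c. (\<forall>a\<in>B. c a \<in> \<rat>) \<and> x * b = (\<Sum>a\<in>B. c a * a)"
    using B x Bk subfieldD(5)[OF k] unfolding is_basis_over_def by blast
  then obtain c where c: "\<And>b. b \<in> B \<Longrightarrow> (\<forall>a\<in>B. c b a \<in> \<rat>) \<and> x * b = (\<Sum>a\<in>B. c b a * a)" by metis
  have "\<exists>N::nat. N > 0 \<and> (\<forall>z\<in>A. of_nat N * z \<in> \<int>)" if "finite A" "A \<subseteq> (\<rat>::complex set)" for A
    using that
  proof (induction A rule: finite_induct)
    case empty then show ?case by (auto intro: exI[of _ 1])
  next
    case (insert z A)
    then obtain N where N: "N > 0" "\<forall>z\<in>A. of_nat N * z \<in> \<int>" by auto
    obtain a b where ab: "b > 0" "z = of_int a / of_int b" using insert(4) by (auto elim: Rats_cases')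
    have "of_nat (N * nat b) * z = of_nat N * of_int a" using ab by simp
    then have "of_nat (N * nat b) * z \<in> \<int>" by (metis Ints_mult Ints_of_nat Ints_of_int)
    moreover have "of_nat (N * nat b) * y \<in> \<int>" if "y \<in> A" for y
    proof -
      have "of_nat (N * nat b) * y = of_nat (nat b) * (of_nat N * y)" by simp
      then show ?thesis using N(2) that by (metis Ints_mult Ints_of_nat)
    qed
    ultimately show ?case using N(1) ab(1) by (intro exI[of _ "N * nat b"]) auto
  qed
  moreover have "finite ((\<lambda>(b,a). c b a) ` (B \<times> B))" "(\<lambda>(b,a). c b a) ` (B \<times> B) \<subseteq> \<rat>" using fin c by auto
  ultimately obtain N :: nat where N: "N > 0" "\<forall>z\<in>(\<lambda>(b,a). c b a) ` (B \<times> B). of_nat N * z \<in> \<int>" by blast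
  have st: "of_nat N * x * b \<in> lincomb \<int> B" if b: "b \<in> B" for b
  proof -
    have "of_nat N * x * b = (\<Sum>a\<in>B. (of_nat N * c b a) * a)"
      using c[OF b] by (simp add: mult.assoc sum_distrib_left)
    also have "\<dots> \<in> lincomb \<int> B" by (rule lincombI) (use N b in auto)
    finally show ?thesis .
  qed
  obtain b where b: "b \<in> B" "b \<noteq> 0"
  proof (rule ccontr)
    assume "\<not> thesis"
    then have "\<And>b. b \<in> B \<Longrightarrow> b = 0" using that by blast
    moreover obtain d where "1 = (\<Sum>a\<in>B. d a * a)" using B subfieldD(2)[OF k] unfolding is_basis_over_def by blast
    moreover have "(\<Sum>a\<in>B. d a * a) = 0" using \<open>\<And>b. b \<in> B \<Longrightarrow> b = 0\<close> by (intro sum.neutral) simp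
    ultimately show False by simp
  qed
  show ?thesis using algebraic_int_if_stable[OF fin b st] N(1) by blast
qed

lemma algebraic_of_nat_mult:
  assumes "algebraic_int (of_nat N * x)" "N > 0" shows "algebraic (x::complex)"
proof -
  obtain p where p: "\<And>i. coeff p i \<in> \<int>" "p \<noteq> 0" "poly p (of_nat N * x) = 0"
    using algebraic_int_imp_algebraic[OF assms(1)] unfolding algebraic_def by blast
  have "poly (pcompose p [:0, of_nat N:]) x = 0" using p(3) by (simp add: poly_pcompose mult.commute)
  moreover have "pcompose p [:0, of_nat N:] \<noteq> 0" using p(2) assms(2) by (simp add: pcompose_eq_0_iff)
  moreover have "coeff (pcompose p [:0, of_nat N:]) i \<in> \<int>" for i
    using p(1)[of i] by (simp add: coeff_pcompose_linear)
  ultimately show ?thesis by (intro algebraicI[of "pcompose p [:0, of_nat N:]"]) auto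
qed

text \<open>\<open>number_field\<close> only grants a finite rational basis. Adjoining its elements
  one at a time recovers the field together with the number of its embeddings.\<close>

lemma number_field_nfd:
  assumes "number_field k"
  obtains d bs where "nfd k d" "k = adjs \<rat> bs" "\<And>x. x \<in> k \<Longrightarrow> algebraic x" "set bs \<subseteq> k" "d > 0"
proof -
  obtain B where k: "subfield_C k" and B: "is_basis_over \<rat> k B" using assms unfolding number_field_def by blast
  have alg: "algebraic x" if "x \<in> k" for x
    using clear_denominators[OF k B that] algebraic_of_nat_mult by blast
  have Bk: "finite B" "B \<subseteq> k" using B unfolding is_basis_over_def by auto
  then obtain bs where bs: "set bs = B" using finite_list by blast
  have alg': "\<And>x. x \<in> set bs \<Longrightarrow> algebraic x" using alg Bk bs by blast
  obtain r where r: "r > 0" "nfd (adjs \<rat> bs) (1 * r)" "\<rat> \<subseteq> adjs \<rat> bs" "set bs \<subseteq> adjs \<rat> bs"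
     "\<forall>L. subfield_C L \<longrightarrow> \<rat> \<subseteq> L \<longrightarrow> set bs \<subseteq> L \<longrightarrow> adjs \<rat> bs \<subseteq> L"
    using adjs_facts[where xs = bs, OF nfd_Rats alg'] by blast
  have sa: "subfield_C (adjs \<rat> bs)" using r(2) unfolding nfd_def by blast
  have "k \<subseteq> adjs \<rat> bs"
  proof
    fix x assume "x \<in> k"
    then obtain c where "\<forall>b\<in>B. c b \<in> \<rat>" "x = (\<Sum>b\<in>B. c b * b)" using B unfolding is_basis_over_def by blast
    then show "x \<in> adjs \<rat> bs" using r(3,4) bs
      by (auto intro!: add_subgroup_sum[OF subfield_ag[OF sa]] subfieldD(5)[OF sa])
  qed
  moreover have "adjs \<rat> bs \<subseteq> k" using r(5) k subfield_Rats[OF k] bs Bk by blast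
  ultimately have "k = adjs \<rat> bs" by blast
  then show ?thesis using that[of "1 * r" bs] r(1,2) alg bs Bk by simp
qed

lemma nfd_number_field: "nfd k d \<Longrightarrow> number_field k"
  unfolding nfd_def number_field_def by blast

lemma number_field_adjoin:
  assumes k: "number_field k" and x: "algebraic x"
  shows "number_field (adjoin k x)" "ext_degree k (adjoin k x) > 0" "k \<subseteq> adjoin k x" "x \<in> adjoin k x"
    "\<sigma> \<in> embeddings k \<Longrightarrow> finite (ext k (adjoin k x) \<sigma>) \<and> card (ext k (adjoin k x) \<sigma>) = ext_degree k (adjoin k x)"
    "\<exists>B. is_basis_over k (adjoin k x) B \<and> card B = ext_degree k (adjoin k x)"
proof -
  obtain d where d: "nfd k d" using number_field_nfd[OF k] by metis
  have sk: "subfield_C k" using k unfolding number_field_def by blast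
  obtain e where e: "e > 0" "nfd (adjoin k x) (d * e)" "ext_degree k (adjoin k x) = e" using nfd_adjoin[OF d x] by metis
  show "number_field (adjoin k x)" using nfd_number_field e by blast
  show "ext_degree k (adjoin k x) > 0" using e by simp
  obtain e' B where f: "k \<subseteq> adjoin k x" "x \<in> adjoin k x" "is_basis_over k (adjoin k x) B" "card B = e'"
    "\<And>\<sigma>. \<sigma> \<in> embeddings k \<Longrightarrow> finite (ext k (adjoin k x) \<sigma>) \<and> card (ext k (adjoin k x) \<sigma>) = e'"
    using adjoin_facts[OF sk x] by metis
  have "e' = ext_degree k (adjoin k x)" using ext_degree_eq[OF sk f(3)] f(4) by simp
  then show "k \<subseteq> adjoin k x" "x \<in> adjoin k x" "\<exists>B. is_basis_over k (adjoin k x) B \<and> card B = ext_degree k (adjoin k x)"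
    "\<sigma> \<in> embeddings k \<Longrightarrow> finite (ext k (adjoin k x) \<sigma>) \<and> card (ext k (adjoin k x) \<sigma>) = ext_degree k (adjoin k x)"
    using f by blast+
qed

section \<open>Conjugates, norms of elements and finiteness of bounded integers\<close>

lemma coeff_linear_mult:
  "coeff ([:-r, 1:] * p) i = - r * coeff p i + (case i of 0 \<Rightarrow> 0 | Suc j \<Rightarrow> coeff p j)" for r :: complex
  by (simp add: coeff_pCons split: nat.split)

lemma algebraic_int_coeff_prod_linear:
  assumes "finite A" "\<And>r. r \<in> A \<Longrightarrow> algebraic_int (r::complex)"
  shows "algebraic_int (coeff (\<Prod>r\<in>A. [:-r, 1:]) i)"
  using assms
proof (induction A arbitrary: i rule: finite_induct)
  case empty
  show ?case by (cases i) (auto simp: coeff_1)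
next
  case (insert r A)
  have IH: "algebraic_int (coeff (\<Prod>r\<in>A. [:-r, 1:]) i)" for i using insert.IH insert.prems by blast
  have r: "algebraic_int (- r)" using insert.prems[of r] by auto
  show ?case unfolding prod.insert[OF insert(1,2)] coeff_linear_mult
    by (rule algebraic_int_add_mult(1)[OF algebraic_int_add_mult(2)[OF r IH]]) (use IH in \<open>auto split: nat.split\<close>)
qed

lemma norm_coeff_prod_linear:
  assumes "finite A" "\<And>r. r \<in> A \<Longrightarrow> cmod r \<le> C" "C \<ge> 0"
  shows "cmod (coeff (\<Prod>r\<in>A. [:-r, 1:]) i) \<le> (1 + C) ^ card A"
  using assms
proof (induction A arbitrary: i rule: finite_induct)
  case empty
  show ?case by (cases i) (auto simp: coeff_1)
next
  case (insert r A)
  have IH: "cmod (coeff (\<Prod>r\<in>A. [:-r, 1:]) i) \<le> (1 + C) ^ card A" for i using insert.IH insert.prems by blast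
  have r: "cmod r \<le> C" using insert.prems(1)[of r] by simp
  have "cmod (coeff (\<Prod>r\<in>insert r A. [:-r, 1:]) i) \<le> cmod (- r * coeff (\<Prod>r\<in>A. [:-r, 1:]) i) +
      cmod (case i of 0 \<Rightarrow> 0 | Suc j \<Rightarrow> coeff (\<Prod>r\<in>A. [:-r, 1:]) j)"
    unfolding prod.insert[OF insert(1,2)] coeff_linear_mult by (rule norm_triangle_ineq)
  also have "\<dots> \<le> C * (1 + C) ^ card A + (1 + C) ^ card A"
  proof (rule add_mono)
    show "cmod (- r * coeff (\<Prod>r\<in>A. [:-r, 1:]) i) \<le> C * (1 + C) ^ card A"
      unfolding norm_mult norm_minus_cancel by (rule mult_mono[OF r IH]) (use insert.prems in auto)
    show "cmod (case i of 0 \<Rightarrow> 0 | Suc j \<Rightarrow> coeff (\<Prod>r\<in>A. [:-r, 1:]) j) \<le> (1 + C) ^ card A"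
      using IH insert.prems by (cases i) auto
  qed
  also have "\<dots> = (1 + C) ^ card (insert r A)" using insert(1,2) by (simp add: algebra_simps)
  finally show ?case .
qed

lemma emb_algebraic_int:
  assumes s: "\<sigma> \<in> embeddings k" and k: "subfield_C k" and c: "c \<in> k" "algebraic_int c"
  shows "algebraic_int (\<sigma> c)"
proof -
  obtain p where p: "lead_coeff p = 1" "\<And>i. coeff p i \<in> \<int>" "poly p c = 0" using c(2) by (auto simp: algebraic_int.simps)
  have "coeff p i \<in> \<rat>" for i using p(2) Ints_subset_Rats by blast
  then have cf: "coeff p i \<in> k" "\<sigma> (coeff p i) = coeff p i" for i
    using subfield_Rats[OF k] emb_field(8)[OF s k] by auto
  have "\<sigma> (poly p c) = poly p (\<sigma> c)"
  proof -
    have "\<sigma> (poly p c) = (\<Sum>i\<le>degree p. \<sigma> (coeff p i * c ^ i))" unfolding poly_altdef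
      by (rule emb_field(6)[OF s k]) (auto intro: subfieldD[OF k] cf c)
    also have "\<dots> = (\<Sum>i\<le>degree p. coeff p i * \<sigma> c ^ i)"
      using embD(4)[OF s cf(1) subfieldD(9)[OF k c(1)]] emb_field(5)[OF s k c(1)] cf(2) by (intro sum.cong) auto
    finally show ?thesis unfolding poly_altdef .
  qed
  then have "poly p (\<sigma> c) = 0" using p(3) emb_field(1)[OF s k] by simp
  then show ?thesis using p by (auto simp: algebraic_int.simps)
qed

text \<open>The monic minimal polynomial over the rationals, presented through its complex roots;
  each root is hit equally often by the embeddings.\<close>
lemma conjugates:
  assumes k: "number_field k" and c: "c \<in> k"
  obtains A r where "finite A" "r > 0" "\<forall>\<sigma>\<in>embeddings k. \<sigma> c \<in> A"
    "\<forall>\<rho>\<in>A. card {\<sigma> \<in> embeddings k. \<sigma> c = \<rho>} = r"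
    "\<forall>i. coeff (\<Prod>\<rho>\<in>A. [:-\<rho>, 1:]) i \<in> \<rat>" "poly (\<Prod>\<rho>\<in>A. [:-\<rho>, 1:]) c = 0"
proof -
  obtain d bs where d: "nfd k d" "k = adjs \<rat> bs" "\<And>x. x \<in> k \<Longrightarrow> algebraic x" "set bs \<subseteq> k"
    using number_field_nfd[OF k] by metis
  have sk: "subfield_C k" using k unfolding number_field_def by blast
  define L where "L = adjoin \<rat> c"
  obtain e where e: "nfd L (1 * e)" using nfd_adjoin[OF nfd_Rats d(3)[OF c]] unfolding L_def by metis
  have L: "subfield_C L" "\<rat> \<subseteq> L" "c \<in> L" "\<And>L'. subfield_C L' \<Longrightarrow> \<rat> \<subseteq> L' \<Longrightarrow> c \<in> L' \<Longrightarrow> L \<subseteq> L'"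
    using adjoin_facts[OF subfield_Rats_C d(3)[OF c]] unfolding L_def by metis+
  have Lk: "L \<subseteq> k" by (rule L(4)[OF sk subfield_Rats[OF sk] c])
  have alg: "\<And>x. x \<in> set bs \<Longrightarrow> algebraic x" using d(3,4) by blast
  obtain r where r: "r > 0" "nfd (adjs L bs) (1 * e * r)" "L \<subseteq> adjs L bs" "set bs \<subseteq> adjs L bs"
    "\<forall>\<sigma>\<in>embeddings L. finite (ext L (adjs L bs) \<sigma>) \<and> card (ext L (adjs L bs) \<sigma>) = r"
    "\<forall>L'. subfield_C L' \<longrightarrow> L \<subseteq> L' \<longrightarrow> set bs \<subseteq> L' \<longrightarrow> adjs L bs \<subseteq> L'"
    using adjs_facts[where xs = bs, OF e alg] by blast
  \<comment> \<open>Rebuilding \<open>k\<close> on top of Q(c) by the same generators exhibits the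
    embeddings with a given value at \<open>c\<close> as the extensions of one embedding of Q(c),
    and these are \<open>r\<close> in number.\<close>
  have kL: "adjs L bs = k"
  proof
    show "adjs L bs \<subseteq> k" using r(6) sk Lk d(4) by blast
    have sa: "subfield_C (adjs L bs)" using r(2) unfolding nfd_def by blast
    have "\<forall>L. subfield_C L \<longrightarrow> \<rat> \<subseteq> L \<longrightarrow> set bs \<subseteq> L \<longrightarrow> adjs \<rat> bs \<subseteq> L"
      using adjs_facts[where xs = bs, OF nfd_Rats alg] by blast
    then show "k \<subseteq> adjs L bs" using sa subfield_Rats[OF sa] r(4) d(2) by blast
  qed
  obtain p where p: "minp \<rat> c p" using algebraic_minp[OF d(3)[OF c] subfield_Rats_C] .
  \<comment> \<open>Embeddings are 0 outside their field, so the only embedding of the rationals is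
    the truncated identity.\<close>
  define s0 where "s0 = (\<lambda>x::complex. if x \<in> \<rat> then x else 0)"
  have s0: "s0 \<in> embeddings \<rat>" unfolding s0_def embeddings_def by auto
  have all0: "restrict_emb \<rat> \<tau> = s0" if "\<tau> \<in> embeddings M" "subfield_C M" for \<tau> M
    using emb_field(8)[OF that] unfolding restrict_emb_def s0_def by (auto simp: fun_eq_iff)
  have mp: "map_poly s0 p = p"
  proof (rule poly_eqI)
    fix i
    have "coeff p i \<in> \<rat>" using p unfolding minp_def Fpoly_def by blast
    then show "coeff (map_poly s0 p) i = coeff p i" by (simp add: coeff_map_poly s0_def)
  qed
  define A where "A = {\<rho>. poly p \<rho> = 0}"
  have bij: "bij_betw (\<lambda>\<tau>. \<tau> c) (embeddings L) A"
  proof -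
    have "ext \<rat> L s0 = embeddings L" unfolding ext_def using all0[OF _ L(1)] by blast
    then show ?thesis using ext_simple[OF s0 subfield_Rats_C p] unfolding mp A_def L_def by simp
  qed
  have res: "restrict_emb L \<sigma> \<in> embeddings L" "restrict_emb L \<sigma> c = \<sigma> c" if "\<sigma> \<in> embeddings k" for \<sigma>
    using restrict_emb_embedding[OF L(1) Lk that] L(3) unfolding restrict_emb_def by auto
  have lc: "lead_coeff p \<in> \<rat>" "lead_coeff p \<noteq> 0" using p unfolding minp_def Fpoly_def by auto
  have dec: "smult (lead_coeff p) (\<Prod>\<rho>\<in>A. [:-\<rho>, 1:]) = p"
    using card_roots_emb_minp(3)[OF s0 subfield_Rats_C p] lc(1) unfolding mp A_def by (simp add: s0_def)
  show ?thesis
  proof (rule that[of A r])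
    show "finite A" using card_roots_emb_minp(2)[OF s0 subfield_Rats_C p] unfolding mp A_def .
    show "r > 0" by (rule r(1))
    show "\<forall>\<sigma>\<in>embeddings k. \<sigma> c \<in> A" using res bij unfolding bij_betw_def by (metis imageI)
    show "\<forall>\<rho>\<in>A. card {\<sigma> \<in> embeddings k. \<sigma> c = \<rho>} = r"
    proof
      fix \<rho> assume "\<rho> \<in> A"
      obtain \<tau> where t: "\<tau> \<in> embeddings L" "\<tau> c = \<rho>" using bij \<open>\<rho> \<in> A\<close> unfolding bij_betw_def by blast
      have "{\<sigma> \<in> embeddings k. \<sigma> c = \<rho>} = ext L k \<tau>"
      proof (intro equalityI subsetI)
        fix \<sigma> assume "\<sigma> \<in> {\<sigma> \<in> embeddings k. \<sigma> c = \<rho>}"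
        then have s: "\<sigma> \<in> embeddings k" "\<sigma> c = \<rho>" by auto
        then have "restrict_emb L \<sigma> = \<tau>" using res[OF s(1)] t bij unfolding bij_betw_def inj_on_def by metis
        then show "\<sigma> \<in> ext L k \<tau>" using s unfolding ext_def by blast
      next
        fix \<sigma> assume "\<sigma> \<in> ext L k \<tau>"
        then have "\<sigma> \<in> embeddings k" "restrict_emb L \<sigma> = \<tau>" unfolding ext_def by auto
        then show "\<sigma> \<in> {\<sigma> \<in> embeddings k. \<sigma> c = \<rho>}" using res(2) t(2) by auto
      qed
      then show "card {\<sigma> \<in> embeddings k. \<sigma> c = \<rho>} = r" using r(5) t(1) kL by simp
    qed
    show "\<forall>i. coeff (\<Prod>\<rho>\<in>A. [:-\<rho>, 1:]) i \<in> \<rat>"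
    proof
      fix i
      have "lead_coeff p * coeff (\<Prod>\<rho>\<in>A. [:-\<rho>, 1:]) i = coeff p i" using dec by (metis coeff_smult)
      then have "coeff (\<Prod>\<rho>\<in>A. [:-\<rho>, 1:]) i = coeff p i / lead_coeff p" using lc(2) by (simp add: field_simps)
      moreover have "coeff p i \<in> \<rat>" using p unfolding minp_def Fpoly_def by blast
      ultimately show "coeff (\<Prod>\<rho>\<in>A. [:-\<rho>, 1:]) i \<in> \<rat>" using lc(1) by simp
    qed
    have "poly (smult (lead_coeff p) (\<Prod>\<rho>\<in>A. [:-\<rho>, 1:])) c = 0" unfolding dec using p unfolding minp_def by blast
    then show "poly (\<Prod>\<rho>\<in>A. [:-\<rho>, 1:]) c = 0" using lc(2) by simp
  qed
qed

text \<open>The roots are conjugates of the algebraic integer \<open>c\<close>, so the coefficients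
  are algebraic integers; being rational as well, they lie in Z.\<close>

lemma conjugates_int:
  assumes k: "number_field k" and c: "c \<in> k" "algebraic_int c"
    and A: "finite A" "r > 0" "\<forall>\<rho>\<in>A. card {\<sigma> \<in> embeddings k. \<sigma> c = \<rho>} = r"
      "\<forall>i. coeff (\<Prod>\<rho>\<in>A. [:-\<rho>, 1:]) i \<in> \<rat>"
  shows "coeff (\<Prod>\<rho>\<in>A. [:-\<rho>, 1:]) i \<in> \<int>"
proof -
  have sk: "subfield_C k" using k unfolding number_field_def by blast
  have "algebraic_int \<rho>" if "\<rho> \<in> A" for \<rho>
  proof -
    have "{\<sigma> \<in> embeddings k. \<sigma> c = \<rho>} \<noteq> {}" using A(2) bspec[OF A(3) that] by (metis card.empty less_irrefl)
    then show ?thesis using emb_algebraic_int[OF _ sk c] by blast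
  qed
  then show ?thesis using algebraic_int_coeff_prod_linear[OF A(1)] A(4) by (intro rational_algebraic_int_is_int) auto
qed

text \<open>The absolute value of the norm from \<open>k\<close> to the rationals.\<close>

definition cnorm :: "complex set \<Rightarrow> complex \<Rightarrow> real" where
  "cnorm k c = (\<Prod>\<sigma>\<in>embeddings k. cmod (\<sigma> c))"

text \<open>The polynomial f with the conjugates as roots has a nonzero integer \<open>z\<close> as
  constant term. The norm of \<open>c\<close> is a power of |z|, and f(c) = 0, read as z + c g(c) =
  0, shows that \<open>c\<close> divides \<open>z\<close>.\<close>

lemma cnorm_ge_1:
  assumes k: "number_field k" and c: "c \<in> ring_of_integers k" "c \<noteq> 0"
  shows "cnorm k c \<ge> 1" "\<exists>a n. a \<in> ring_of_integers k \<and> n > 0 \<and> c * a = of_nat n"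
proof -
  have sk: "subfield_C k" using k unfolding number_field_def by blast
  obtain d where d: "nfd k d" using number_field_nfd[OF k] by metis
  then have fe: "finite (embeddings k)" unfolding nfd_def by blast
  have ck: "c \<in> k" "algebraic_int c" using c unfolding ring_of_integers_def by auto
  obtain A r where A: "finite A" "r > 0" "\<forall>\<sigma>\<in>embeddings k. \<sigma> c \<in> A"
    "\<forall>\<rho>\<in>A. card {\<sigma> \<in> embeddings k. \<sigma> c = \<rho>} = r"
    "\<forall>i. coeff (\<Prod>\<rho>\<in>A. [:-\<rho>, 1:]) i \<in> \<rat>" "poly (\<Prod>\<rho>\<in>A. [:-\<rho>, 1:]) c = 0"
    using conjugates[OF k ck(1)] by blast
  define f where "f = (\<Prod>\<rho>\<in>A. [:-\<rho>, 1:])"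
  have int: "coeff f i \<in> \<int>" for i unfolding f_def by (rule conjugates_int[OF k ck A(1,2,4,5)])
  have f0: "coeff f 0 = (\<Prod>\<rho>\<in>A. - \<rho>)" unfolding f_def poly_0_coeff_0[symmetric] by (simp add: poly_prod)
  have nz: "0 \<notin> A"
  proof
    assume "0 \<in> A"
    then have "{\<sigma> \<in> embeddings k. \<sigma> c = 0} \<noteq> {}" using A(2) bspec[OF A(4) \<open>0 \<in> A\<close>] by (metis card.empty less_irrefl)
    then show False using emb_field(4)[OF _ sk ck(1) c(2)] by blast
  qed
  then have "coeff f 0 \<noteq> 0" unfolding f0 using A(1) by auto
  then have ge: "cmod (coeff f 0) \<ge> 1" using int[of 0] by (auto elim!: Ints_cases)
  have "cnorm k c = (\<Prod>\<rho>\<in>A. \<Prod>\<sigma>\<in>{\<sigma> \<in> embeddings k. \<sigma> c = \<rho>}. cmod (\<sigma> c))"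
    unfolding cnorm_def by (rule prod.group[symmetric, OF fe A(1)]) (use A(3) in blast)
  also have "\<dots> = (\<Prod>\<rho>\<in>A. cmod \<rho> ^ r)" using A(4) by (intro prod.cong) auto
  also have "\<dots> = cmod (coeff f 0) ^ r" unfolding f0 by (simp add: prod_power_distrib flip: prod_norm)
  finally show "cnorm k c \<ge> 1" using ge by simp
  obtain f0' g where fg: "f = pCons f0' g" by (cases f)
  obtain z where z: "f0' = of_int z" using int[of 0] fg by (auto elim: Ints_cases)
  have zn: "z \<noteq> 0" using \<open>coeff f 0 \<noteq> 0\<close> fg z by simp
  have e: "of_int z + c * poly g c = 0" using A(6) fg z unfolding f_def by simp
  have gi: "coeff g i \<in> \<int>" for i using int[of "Suc i"] fg by simp
  have "algebraic_int (c ^ i)" for i using ck(2) by (induction i) (auto intro: algebraic_int_add_mult)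
  then have "algebraic_int (poly g c)" unfolding poly_altdef
    by (intro algebraic_int_sum algebraic_int_add_mult) (auto intro: int_imp_algebraic_int gi)
  moreover have "poly g c \<in> k" unfolding poly_altdef
    using gi Ints_subset_Rats subfield_Rats[OF sk] by (intro add_subgroup_sum[OF subfield_ag] subfieldD sk ck) blast
  ultimately have gO: "poly g c \<in> ring_of_integers k" "- poly g c \<in> ring_of_integers k"
    unfolding ring_of_integers_def using subfieldD(7)[OF sk] by auto
  show "\<exists>a n. a \<in> ring_of_integers k \<and> n > 0 \<and> c * a = of_nat n"
  proof (cases "z > 0")
    case True
    have "c * (- poly g c) = of_nat (nat z)" using e True by (simp add: add_eq_0_iff)
    then show ?thesis using gO True by (intro exI[of _ "- poly g c"] exI[of _ "nat z"]) auto
  next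
    case False
    have "c * poly g c = of_nat (nat (- z))" using e False by (simp add: add_eq_0_iff)
    then show ?thesis using gO False zn by (intro exI[of _ "poly g c"] exI[of _ "nat (- z)"]) auto
  qed
qed

lemma finite_poly_coeffs:
  assumes "finite (S :: 'a::zero set)" shows "finite {p. degree p \<le> n \<and> (\<forall>i. coeff p i \<in> S)}"
proof -
  have "p \<in> Poly ` {xs. set xs \<subseteq> S \<and> length xs = Suc n}" if "degree p \<le> n" "\<forall>i. coeff p i \<in> S" for p
  proof (rule image_eqI)
    show "p = Poly (map (coeff p) [0..<Suc n])"
    proof (rule poly_eqI)
      fix i show "coeff p i = coeff (Poly (map (coeff p) [0..<Suc n])) i"
        using that(1) by (cases "i < Suc n") (auto simp: nth_default_def coeff_eq_0 simp del: upt_Suc)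
    qed
    show "map (coeff p) [0..<Suc n] \<in> {xs. set xs \<subseteq> S \<and> length xs = Suc n}" using that(2) by auto
  qed
  then have "{p. degree p \<le> n \<and> (\<forall>i. coeff p i \<in> S)} \<subseteq> Poly ` {xs. set xs \<subseteq> S \<and> length xs = Suc n}" by blast
  then show ?thesis by (rule finite_subset) (intro finite_imageI finite_lists_length_eq assms)
qed

text \<open>Such an element is a root of a monic polynomial with integer coefficients whose degree
  and coefficients are bounded in terms of \<open>C\<close> and the degree of \<open>k\<close>;
  there are finitely many of these.\<close>

lemma finite_bounded_conjugates:
  assumes k: "number_field k"
  shows "finite {c \<in> ring_of_integers k. \<forall>\<sigma>\<in>embeddings k. cmod (\<sigma> c) \<le> C}"
proof -
  obtain d where d: "nfd k d" using number_field_nfd[OF k] by metis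
  then have fe: "finite (embeddings k)" "card (embeddings k) = d" unfolding nfd_def by auto
  define C' where "C' = max C 0"
  define M where "M = \<lceil>(1 + C') ^ d\<rceil>"
  define S where "S = of_int ` {-M..M} \<union> {0, 1::complex}"
  define P where "P = {p. degree p \<le> d \<and> (\<forall>i. coeff p i \<in> S)} - {0}"
  have "{c \<in> ring_of_integers k. \<forall>\<sigma>\<in>embeddings k. cmod (\<sigma> c) \<le> C} \<subseteq> (\<Union>p\<in>P. {x. poly p x = 0})"
  proof
    fix c assume "c \<in> {c \<in> ring_of_integers k. \<forall>\<sigma>\<in>embeddings k. cmod (\<sigma> c) \<le> C}"
    then have c: "c \<in> k" "algebraic_int c" and b: "\<And>\<sigma>. \<sigma> \<in> embeddings k \<Longrightarrow> cmod (\<sigma> c) \<le> C"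
      unfolding ring_of_integers_def by auto
    obtain A r where A: "finite A" "r > 0" "\<forall>\<sigma>\<in>embeddings k. \<sigma> c \<in> A"
    "\<forall>\<rho>\<in>A. card {\<sigma> \<in> embeddings k. \<sigma> c = \<rho>} = r"
    "\<forall>i. coeff (\<Prod>\<rho>\<in>A. [:-\<rho>, 1:]) i \<in> \<rat>" "poly (\<Prod>\<rho>\<in>A. [:-\<rho>, 1:]) c = 0"
      using conjugates[OF k c(1)] by blast
    define f where "f = (\<Prod>\<rho>\<in>A. [:-\<rho>, 1:])"
    have ex: "\<exists>\<sigma>\<in>embeddings k. \<sigma> c = \<rho>" if "\<rho> \<in> A" for \<rho>
    proof -
      have "{\<sigma> \<in> embeddings k. \<sigma> c = \<rho>} \<noteq> {}" using A(2) bspec[OF A(4) that] by (metis card.empty less_irrefl)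
      then show ?thesis by blast
    qed
    then have bA: "cmod \<rho> \<le> C'" if "\<rho> \<in> A" for \<rho> using b that unfolding C'_def by fastforce
    have "A \<subseteq> (\<lambda>\<sigma>. \<sigma> c) ` embeddings k" using ex by blast
    then have cA: "card A \<le> d" using fe surj_card_le by blast
    have "degree f = card A" unfolding f_def by (subst degree_prod_eq_sum_degree) auto
    moreover have "coeff f i \<in> S" for i
    proof -
      obtain m where m: "coeff f i = of_int m" using conjugates_int[OF k c A(1,2,4,5)] unfolding f_def by (metis Ints_cases)
      have "cmod (coeff f i) \<le> (1 + C') ^ card A" unfolding f_def
        by (rule norm_coeff_prod_linear[OF A(1) bA]) (auto simp: C'_def)
      also have "\<dots> \<le> (1 + C') ^ d" using cA by (intro power_increasing) (auto simp: C'_def)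
      finally have "\<bar>real_of_int m\<bar> \<le> (1 + C') ^ d" unfolding m by simp
      then have "\<bar>m\<bar> \<le> M" unfolding M_def by linarith
      then have "m \<in> {-M..M}" by auto
      then show ?thesis unfolding S_def m by blast
    qed
    moreover have "f \<noteq> 0" unfolding f_def using A(1) by auto
    ultimately have "f \<in> P" unfolding P_def using cA by simp
    then show "c \<in> (\<Union>p\<in>P. {x. poly p x = 0})" using A(6) unfolding f_def by blast
  qed
  moreover have "finite P" unfolding P_def S_def by (intro finite_Diff finite_poly_coeffs) auto
  moreover have "finite {x. poly p x = 0}" if "p \<in> P" for p using poly_roots_finite[of p] that unfolding P_def by auto
  ultimately show ?thesis using finite_subset by blast
qed

section \<open>Rings of integers\<close>

lemma lincomb_mult: "(*) t ` lincomb G B = lincomb ((*) t ` G) B" for t :: complex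
proof (intro equalityI subsetI)
  fix x assume "x \<in> (*) t ` lincomb G B"
  then obtain c where c: "\<forall>b\<in>B. c b \<in> G" "x = t * (\<Sum>b\<in>B. c b * b)" unfolding lincomb_def by blast
  have "x = (\<Sum>b\<in>B. (t * c b) * b)" unfolding c(2) by (simp add: sum_distrib_left mult.assoc)
  then show "x \<in> lincomb ((*) t ` G) B" using c(1) by (auto intro!: lincombI)
next
  fix x assume "x \<in> lincomb ((*) t ` G) B"
  then obtain c where c: "\<forall>b\<in>B. c b \<in> (*) t ` G" "x = (\<Sum>b\<in>B. c b * b)" unfolding lincomb_def by blast
  then have "\<forall>b\<in>B. \<exists>d. d \<in> G \<and> c b = t * d" by blast
  from bchoice[OF this] obtain d where d: "\<forall>b\<in>B. d b \<in> G \<and> c b = t * d b" by blast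
  have "x = t * (\<Sum>b\<in>B. d b * b)" unfolding c(2) using d by (simp add: sum_distrib_left mult.assoc)
  then show "x \<in> (*) t ` lincomb G B" using d by (auto intro!: imageI lincombI)
qed

lemma basis_independent:
  assumes "is_basis_over F L B" "\<forall>b\<in>B. c b \<in> F" "(\<Sum>b\<in>B. c b * b) = 0" shows "\<forall>b\<in>B. c b = 0"
proof -
  have "\<forall>c. (\<forall>b\<in>B. c b \<in> F) \<longrightarrow> (\<Sum>b\<in>B. c b * b) = 0 \<longrightarrow> (\<forall>b\<in>B. c b = 0)"
    using assms(1) unfolding is_basis_over_def by (elim conjE)
  then show ?thesis using assms(2,3) by simp
qed

text \<open>Used with \<open>t\<close> a positive integer that clears denominators, to make a basis
  integral.\<close>

lemma basis_scale:
  assumes F: "subfield_C F" and k: "subfield_C k" and B: "is_basis_over F k B" and t: "t \<noteq> 0" "t \<in> k"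
  shows "is_basis_over F k ((*) t ` B)" "card ((*) t ` B) = card B"
proof -
  have inj: "inj_on ((*) t) B" using t(1) by (auto simp: inj_on_def)
  show "card ((*) t ` B) = card B" by (rule card_image[OF inj])
  have fin: "finite B" and Bk: "B \<subseteq> k" using B unfolding is_basis_over_def by auto
  have sum: "(\<Sum>b\<in>(*) t ` B. c b * b) = t * (\<Sum>b\<in>B. c (t * b) * b)" for c
    using sum.reindex[OF inj, of "\<lambda>b. c b * b"] by (simp add: sum_distrib_left mult_ac)
  show "is_basis_over F k ((*) t ` B)" unfolding is_basis_over_def
  proof (intro conjI allI impI ballI)
    show "finite ((*) t ` B)" using fin by simp
    show "(*) t ` B \<subseteq> k" using Bk subfieldD(5)[OF k t(2)] by auto
  next
    fix c x assume c: "\<forall>b\<in>(*) t ` B. c b \<in> F" "(\<Sum>b\<in>(*) t ` B. c b * b) = 0" and x: "x \<in> (*) t ` B"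
    have "(\<Sum>b\<in>B. c (t * b) * b) = 0" using c(2) sum t(1) by simp
    moreover have "\<forall>b\<in>B. c (t * b) \<in> F" using c(1) by blast
    ultimately have "\<forall>b\<in>B. c (t * b) = 0" using basis_independent[OF B, of "\<lambda>b. c (t * b)"] by blast
    then show "c x = 0" using x by blast
  next
    fix x assume x: "x \<in> k"
    then have "x / t \<in> k" using subfieldD(8)[OF k _ t(2)] by simp
    then obtain d where d: "\<forall>b\<in>B. d b \<in> F" "x / t = (\<Sum>b\<in>B. d b * b)" using B unfolding is_basis_over_def by blast
    have "x = t * (\<Sum>b\<in>B. d b * b)" using d(2) t(1) by (simp add: field_simps)
    also have "\<dots> = (\<Sum>b\<in>(*) t ` B. d (b / t) * b)" unfolding sum using t(1) by simp
    finally show "\<exists>c. (\<forall>b\<in>(*) t ` B. c b \<in> F) \<and> x = (\<Sum>b\<in>(*) t ` B. c b * b)"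
      using d(1) t(1) by (intro exI[of _ "\<lambda>b. d (b / t)"]) auto
  qed
qed

lemma integers_ring:
  assumes k: "number_field k"
  shows "0 \<in> ring_of_integers k" "1 \<in> ring_of_integers k"
    "x \<in> ring_of_integers k \<Longrightarrow> y \<in> ring_of_integers k \<Longrightarrow> x - y \<in> ring_of_integers k"
    "x \<in> ring_of_integers k \<Longrightarrow> y \<in> ring_of_integers k \<Longrightarrow> x * y \<in> ring_of_integers k"
    "add_subgroup (ring_of_integers k)" "z \<in> \<int> \<Longrightarrow> z \<in> ring_of_integers k"
proof -
  have sk: "subfield_C k" using k unfolding number_field_def by blast
  show d: "x \<in> ring_of_integers k \<Longrightarrow> y \<in> ring_of_integers k \<Longrightarrow> x - y \<in> ring_of_integers k" for x y
    using algebraic_int_add_mult(1)[of x "- y"] subfieldD(4)[OF sk] unfolding ring_of_integers_def by auto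
  show "x \<in> ring_of_integers k \<Longrightarrow> y \<in> ring_of_integers k \<Longrightarrow> x * y \<in> ring_of_integers k"
    using algebraic_int_add_mult(2)[of x y] subfieldD(5)[OF sk] unfolding ring_of_integers_def by auto
  show z: "z \<in> \<int> \<Longrightarrow> z \<in> ring_of_integers k" for z
    unfolding ring_of_integers_def using int_imp_algebraic_int Ints_subset_Rats subfield_Rats[OF sk] by blast
  show "0 \<in> ring_of_integers k" "1 \<in> ring_of_integers k" using z by auto
  then show "add_subgroup (ring_of_integers k)" unfolding add_subgroup_def using d by blast
qed

lemma integral_multiple:
  assumes k: "number_field k" and x: "x \<in> k"
  shows "\<exists>N::nat. N > 0 \<and> of_nat N * x \<in> ring_of_integers k"
proof -
  obtain B where sk: "subfield_C k" and B: "is_basis_over \<rat> k B" using k unfolding number_field_def by blast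
  obtain N :: nat where N: "N > 0" "algebraic_int (of_nat N * x)" using clear_denominators[OF sk B x] by blast
  then show ?thesis unfolding ring_of_integers_def using subfieldD(5)[OF sk subfield_of_nat[OF sk] x] by blast
qed

lemma integral_multiple_finite:
  assumes k: "number_field k" and B: "finite B" "B \<subseteq> k"
  shows "\<exists>N::nat. N > 0 \<and> (*) (of_nat N) ` B \<subseteq> ring_of_integers k"
  using B
proof (induction B rule: finite_induct)
  case empty then show ?case by (intro exI[of _ 1]) auto
next
  case (insert b B)
  then obtain N where N: "N > 0" "(*) (of_nat N) ` B \<subseteq> ring_of_integers k" by auto
  obtain M :: nat where M: "M > 0" "of_nat M * b \<in> ring_of_integers k" using integral_multiple[OF k] insert by blast
  have i: "of_nat j \<in> ring_of_integers k" for j using integers_ring(6)[OF k] by simp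
  have "of_nat (N * M) * x \<in> ring_of_integers k" if "x \<in> insert b B" for x
  proof (cases "x = b")
    case True
    have "of_nat (N * M) * b = of_nat N * (of_nat M * b)" by simp
    then show ?thesis using integers_ring(4)[OF k i M(2)] True by metis
  next
    case False
    then have "of_nat N * x \<in> ring_of_integers k" using that N by auto
    moreover have "of_nat (N * M) * x = of_nat M * (of_nat N * x)" by simp
    ultimately show ?thesis using integers_ring(4)[OF k i] by metis
  qed
  then show ?case using N M by (intro exI[of _ "N * M"]) auto
qed

text \<open>Subtracting integral combinations of the basis leaves elements with bounded conjugates.\<close>
lemma lattice_fin_idx:
  assumes k: "number_field k" and B: "is_basis_over \<rat> k B" and BR: "B \<subseteq> ring_of_integers k"
  shows "lincomb \<int> B \<subseteq> ring_of_integers k" "fin_idx (ring_of_integers k) (lincomb \<int> B)"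
proof -
  define R where "R = ring_of_integers k"
  have sk: "subfield_C k" using k unfolding number_field_def by blast
  have fB: "finite B" using B unfolding is_basis_over_def by blast
  have BO: "B \<subseteq> R" using BR unfolding R_def .
  have agO: "add_subgroup R" unfolding R_def by (rule integers_ring(5)[OF k])
  have M: "lincomb \<int> B \<subseteq> R" by (rule lincomb_Ints_subset[OF agO BO])
  have agM: "add_subgroup (lincomb \<int> B)" by (simp add: add_subgroup_lincomb add_subgroup_Ints)
  have Bk: "B \<subseteq> k" using B unfolding is_basis_over_def by auto
  obtain d where d: "nfd k d" using number_field_nfd[OF k] by metis
  have fe: "finite (embeddings k)" using d unfolding nfd_def by blast
  define C where "C = (\<Sum>b\<in>B. \<Sum>\<sigma>\<in>embeddings k. cmod (\<sigma> b))"
  define T where "T = {c \<in> R. \<forall>\<sigma>\<in>embeddings k. cmod (\<sigma> c) \<le> C}"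
  have "fin_idx R (lincomb \<int> B)"
  proof (rule fin_idxI[OF agM])
    show "finite T" unfolding T_def R_def by (rule finite_bounded_conjugates[OF k])
    fix x assume x: "x \<in> R"
    then have "x \<in> k" unfolding R_def ring_of_integers_def by blast
    then obtain q where q: "\<forall>b\<in>B. q b \<in> \<rat>" "x = (\<Sum>b\<in>B. q b * b)" using B unfolding is_basis_over_def by blast
    \<comment> \<open>Rational coordinates are real, so the floor of the real part leaves remainders
      of absolute value at most 1.\<close>
    define m where "m b = \<lfloor>Re (q b)\<rfloor>" for b
    define y where "y = (\<Sum>b\<in>B. of_int (m b) * b)"
    have y: "y \<in> lincomb \<int> B" unfolding y_def by (rule lincombI) simp
    have xy: "x - y = (\<Sum>b\<in>B. (q b - of_int (m b)) * b)" unfolding q(2) y_def by (simp add: sum_subtractf left_diff_distrib)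
    have qm: "q b - of_int (m b) \<in> \<rat>" "cmod (q b - of_int (m b)) \<le> 1" if "b \<in> B" for b
    proof -
      show "q b - of_int (m b) \<in> \<rat>" using q(1) that by simp
      have "q b \<in> \<rat>" using q(1) that by simp
      then obtain i j where "q b = of_int i / of_int j" by (metis Rats_cases')
      then have "q b = of_real (real_of_int i / real_of_int j)" by simp
      then have "q b = of_real (Re (q b))" by (metis Re_complex_of_real)
      then have "q b - of_int (m b) = of_real (Re (q b) - of_int (m b))" by simp
      then have "cmod (q b - of_int (m b)) = \<bar>Re (q b) - of_int (m b)\<bar>" by (metis norm_of_real)
      also have "\<dots> \<le> 1" unfolding m_def by linarith
      finally show "cmod (q b - of_int (m b)) \<le> 1" .
    qed
    have "x - y \<in> T" unfolding T_def
    proof (intro CollectI conjI ballI)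
      show "x - y \<in> R" using add_subgroupD(2)[OF agO x] M y by blast
      fix \<sigma> assume s: "\<sigma> \<in> embeddings k"
      have kk: "q b - of_int (m b) \<in> k" if "b \<in> B" for b using qm(1)[OF that] subfield_Rats[OF sk] by blast
      have "\<sigma> (x - y) = (\<Sum>b\<in>B. \<sigma> ((q b - of_int (m b)) * b))" unfolding xy
        by (rule emb_field(6)[OF s sk]) (use kk Bk subfieldD(5)[OF sk] in blast)
      also have "\<dots> = (\<Sum>b\<in>B. (q b - of_int (m b)) * \<sigma> b)"
        using embD(4)[OF s kk] emb_field(8)[OF s sk qm(1)] Bk by (intro sum.cong) auto
      finally have "cmod (\<sigma> (x - y)) \<le> (\<Sum>b\<in>B. cmod ((q b - of_int (m b)) * \<sigma> b))" using norm_sum by metis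
      also have "\<dots> \<le> (\<Sum>b\<in>B. \<Sum>\<sigma>\<in>embeddings k. cmod (\<sigma> b))"
      proof (rule sum_mono)
        fix b assume b: "b \<in> B"
        have "cmod ((q b - of_int (m b)) * \<sigma> b) \<le> 1 * cmod (\<sigma> b)" unfolding norm_mult
          by (rule mult_right_mono) (use qm(2)[OF b] in auto)
        also have "\<dots> \<le> (\<Sum>\<sigma>\<in>embeddings k. cmod (\<sigma> b))" using member_le_sum[OF s, of "\<lambda>\<sigma>. cmod (\<sigma> b)"] fe by simp
        finally show "cmod ((q b - of_int (m b)) * \<sigma> b) \<le> (\<Sum>\<sigma>\<in>embeddings k. cmod (\<sigma> b))" .
      qed
      finally show "cmod (\<sigma> (x - y)) \<le> C" unfolding C_def .
    qed
    then show "\<exists>t\<in>T. x - t \<in> lincomb \<int> B" using y by (intro bexI[of _ "x - y"]) auto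
  qed
  then show "lincomb \<int> B \<subseteq> ring_of_integers k" "fin_idx (ring_of_integers k) (lincomb \<int> B)"
    using M unfolding R_def by blast+
qed

lemma ex_integral_basis:
  assumes k: "number_field k" and sL: "subfield_C L" "k \<subseteq> L" "number_field L" and B0: "is_basis_over k L B0"
  obtains B where "is_basis_over k L B" "B \<subseteq> ring_of_integers L" "card B = card B0"
proof -
  have sk: "subfield_C k" using k unfolding number_field_def by blast
  have fB0: "finite B0" "B0 \<subseteq> L" using B0 unfolding is_basis_over_def by auto
  obtain N :: nat where N: "N > 0" "(*) (of_nat N) ` B0 \<subseteq> ring_of_integers L"
    using integral_multiple_finite[OF sL(3) fB0] by blast
  show ?thesis
    by (rule that[of "(*) (of_nat N) ` B0"])
      (use N basis_scale[OF sk sL(1) B0, of "of_nat N"] subfield_of_nat[OF sL(1)] in auto)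
qed

lemma number_field_Rats: "number_field \<rat>"
  using nfd_number_field[OF nfd_Rats] .

lemma integral_basis_lattice:
  assumes k: "number_field k"
  obtains B where "is_basis_over \<rat> k B" "B \<subseteq> ring_of_integers k" "lincomb \<int> B \<subseteq> ring_of_integers k"
    "fin_idx (ring_of_integers k) (lincomb \<int> B)"
proof -
  obtain B0 where sk: "subfield_C k" and B0: "is_basis_over \<rat> k B0" using k unfolding number_field_def by blast
  obtain B where "is_basis_over \<rat> k B" "B \<subseteq> ring_of_integers k"
    using ex_integral_basis[OF number_field_Rats sk subfield_Rats[OF sk] k B0] by blast
  then show ?thesis using that lattice_fin_idx[OF k] by blast
qed

text \<open>On a free sublattice M of finite index, multiplication by n has index n^d. The chains R,
  M, nM and R, nR, nM have the same total index, and nR modulo nM has the size of R modulo M; so the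
  value carries over to R.\<close>

lemma idx_of_nat_multiple:
  assumes k: "number_field k" and d: "nfd k d" and n: "n > 0"
  shows "idx (ring_of_integers k) ((*) (of_nat n) ` ring_of_integers k) = n ^ d"
    "fin_idx (ring_of_integers k) ((*) (of_nat n) ` ring_of_integers k)"
proof -
  define R where "R = ring_of_integers k"
  obtain B where B: "is_basis_over \<rat> k B" "B \<subseteq> R" "lincomb \<int> B \<subseteq> R" "fin_idx R (lincomb \<int> B)"
    using integral_basis_lattice[OF k] unfolding R_def by blast
  obtain B' where "is_basis_over \<rat> k B'" "card B' = d" using d unfolding nfd_def by blast
  then have cB: "card B = d" using basis_card_unique[OF subfield_Rats_C B(1)] by simp
  have fB: "finite B" using B(1) unfolding is_basis_over_def by blast
  have ind: "\<forall>b\<in>B. c b = 0" if "\<forall>b\<in>B. c b \<in> \<rat>" "(\<Sum>b\<in>B. c b * b) = 0" for c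
    using basis_independent[OF B(1) that] .
  define M where "M = lincomb \<int> B"
  let ?n = "complex_of_nat n"
  have n0: "?n \<noteq> 0" using n by simp
  have nM: "(*) ?n ` M = lincomb ((*) ?n ` \<int>) B" unfolding M_def by (rule lincomb_mult)
  have agZ: "add_subgroup ((*) ?n ` \<int>)" by (rule add_subgroup_mult[OF add_subgroup_Ints])
  have sZ: "(*) ?n ` \<int> \<subseteq> \<int>" by (auto intro: Ints_mult)
  have agM: "add_subgroup M" unfolding M_def by (simp add: add_subgroup_lincomb add_subgroup_Ints)
  have agO: "add_subgroup R" unfolding R_def by (rule integers_ring(5)[OF k])
  note l = idx_lincomb[OF agZ sZ fB ind subfield_ag[OF subfield_Rats_C] Ints_subset_Rats add_subgroup_Ints idx_Ints(2)[OF n]]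
  have i1: "idx M ((*) ?n ` M) = n ^ d" unfolding nM unfolding M_def using l(1) idx_Ints(1)[OF n] cB by simp
  have f1: "fin_idx M ((*) ?n ` M)" unfolding nM unfolding M_def using l(2) .
  have agnM: "add_subgroup ((*) ?n ` M)" and agnO: "add_subgroup ((*) ?n ` R)" using add_subgroup_mult agM agO by auto
  have f2: "fin_idx R ((*) ?n ` M)" by (rule fin_idx_trans[OF agM agnM _ f1]) (use B(4) in \<open>simp add: M_def\<close>)
  have MO: "M \<subseteq> R" using B(3) M_def by simp
  then have s1: "(*) ?n ` M \<subseteq> (*) ?n ` R" by blast
  have s2: "(*) ?n ` R \<subseteq> R" unfolding R_def using integers_ring(4,6)[OF k] by (auto intro: integers_ring)
  have s3: "(*) ?n ` M \<subseteq> M" using add_subgroup_of_nat_mult[OF agM] by auto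
  have t1: "idx R ((*) ?n ` M) = idx R M * idx M ((*) ?n ` M)" by (rule idx_tower[OF agO agM agnM s3 MO f2])
  have t2: "idx R ((*) ?n ` M) = idx R ((*) ?n ` R) * idx ((*) ?n ` R) ((*) ?n ` M)"
    by (rule idx_tower[OF agO agnO agnM s1 s2 f2])
  have "idx ((*) ?n ` R) ((*) ?n ` M) = idx R M" by (rule idx_mult(1)[OF n0 agM])
  moreover have "idx R M > 0" using idx_pos[OF B(4)] add_subgroupD(1)[OF agO] M_def by simp
  ultimately have "idx R ((*) ?n ` R) = n ^ d" using t1 t2 i1 by simp
  then show "idx (ring_of_integers k) ((*) (of_nat n) ` ring_of_integers k) = n ^ d" unfolding R_def .
  show "fin_idx (ring_of_integers k) ((*) (of_nat n) ` ring_of_integers k)"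
    using fin_idx_mono[OF agnM agnO order_refl s1 f2] unfolding R_def .
qed

text \<open>Residue rings are finite because every nonzero element divides a positive integer. For
  integral closedness, \<open>a\<close> times a rational basis of integers generates a subgroup of
  finite index in \<open>I\<close>; hence \<open>I\<close> is finitely generated over Z, and the
  determinant trick applies to any \<open>x\<close> that preserves it.\<close>

lemma dedekind_ring_integers:
  assumes k: "number_field k" shows "dedekind_ring (ring_of_integers k)"
proof -
  define R where "R = ring_of_integers k"
  note ring = integers_ring[OF k, folded R_def]
  have sk: "subfield_C k" using k unfolding number_field_def by blast
  obtain d where d: "nfd k d" using number_field_nfd[OF k] by metis
  have mult: "\<exists>a'\<in>R. \<exists>n>0. a * a' = of_nat n" if "a \<in> R" "a \<noteq> 0" for a
    using cnorm_ge_1(2)[OF k, of a] that unfolding R_def by blast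
  have pn: "principal_ideal R c = (*) c ` R" for c unfolding principal_ideal_def by auto
  have "dedekind_ring R"
  proof
    show "0 \<in> R" "1 \<in> R" by (rule ring)+
    show "x - y \<in> R" "x * y \<in> R" if "x \<in> R" "y \<in> R" for x y using ring(3,4) that by blast+
    show fin: "fin_idx R (principal_ideal R a)" if a: "a \<in> R" "a \<noteq> 0" for a
    proof -
      obtain a' n where a': "a' \<in> R" "n > 0" "a * a' = of_nat n" using mult[OF a] by blast
      have "(*) (of_nat n) ` R \<subseteq> (*) a ` R"
      proof
        fix x assume "x \<in> (*) (of_nat n) ` R"
        then obtain y where "y \<in> R" "x = a * (a' * y)" using a'(3) by (auto simp: mult.assoc[symmetric])
        then show "x \<in> (*) a ` R" using ring(4)[OF a'(1)] by blast
      qed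
      then show ?thesis unfolding pn
        using fin_idx_mono[OF add_subgroup_mult[OF ring(5)] add_subgroup_mult[OF ring(5)] order_refl _ idx_of_nat_multiple(2)[OF k d a'(2), folded R_def]]
        by blast
    qed
    show "x \<in> R" if I: "is_ideal R I" "I \<noteq> {0}" "\<And>y. y \<in> I \<Longrightarrow> x * y \<in> I" for I x
    proof -
      have IO: "I \<subseteq> R" "0 \<in> I" using I(1) unfolding is_ideal_def by auto
      then obtain a where a: "a \<in> I" "a \<noteq> 0" using I(2) by blast
      obtain a' n where a': "a' \<in> R" "n > 0" "a * a' = of_nat n" using mult[of a] a IO by blast
      have agI: "add_subgroup I"
      proof -
        have "u - v \<in> I" if "u \<in> I" "v \<in> I" for u v
        proof -
          have "(0 - 1) * v \<in> I" using I(1) that(2) ring(1,2,3) unfolding is_ideal_def by blast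
          then have "u + (0 - 1) * v \<in> I" using I(1) that(1) unfolding is_ideal_def by blast
          then show ?thesis by simp
        qed
        then show ?thesis using IO(2) unfolding add_subgroup_def by blast
      qed
      have xk: "x \<in> k"
      proof -
        have "a \<in> k" "x * a \<in> k" using a I(3)[OF a(1)] IO(1) unfolding R_def ring_of_integers_def by auto
        then have "x * a / a \<in> k" using subfieldD(8)[OF sk] by blast
        then show ?thesis using a(2) by simp
      qed
      obtain B where B: "is_basis_over \<rat> k B" "B \<subseteq> R" "lincomb \<int> B \<subseteq> R" "fin_idx R (lincomb \<int> B)"
        using integral_basis_lattice[OF k] unfolding R_def by blast
      have fB: "finite B" using B(1) unfolding is_basis_over_def by blast
      define S where "S = (*) a ` B"
      have agL: "add_subgroup (lincomb \<int> X)" for X by (simp add: add_subgroup_lincomb add_subgroup_Ints)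
      have SI: "S \<subseteq> I"
      proof
        fix s assume "s \<in> S"
        then obtain b where "b \<in> B" "s = b * a" unfolding S_def by (auto simp: mult.commute)
        then show "s \<in> I" using B(2) I(1) a(1) unfolding is_ideal_def by blast
      qed
      then have LS: "lincomb \<int> S \<subseteq> I" by (rule lincomb_Ints_subset[OF agI])
      have "(*) a ` lincomb \<int> B \<subseteq> lincomb \<int> S"
      proof
        fix y assume "y \<in> (*) a ` lincomb \<int> B"
        then obtain c where c: "\<forall>b\<in>B. c b \<in> \<int>" "y = a * (\<Sum>b\<in>B. c b * b)" unfolding lincomb_def by blast
        have "y = (\<Sum>b\<in>B. c b * (a * b))" unfolding c(2) by (simp add: sum_distrib_left mult_ac)
        also have "\<dots> \<in> lincomb \<int> S"
          by (intro add_subgroup_sum[OF agL] lincomb_single) (use c(1) fB in \<open>auto simp: S_def\<close>)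
        finally show "y \<in> lincomb \<int> S" .
      qed
      moreover have "fin_idx I ((*) a ` lincomb \<int> B)"
      proof -
        have "fin_idx ((*) a ` R) ((*) a ` lincomb \<int> B)" using idx_mult(2)[OF a(2) agL] B(4) by blast
        then have "fin_idx R ((*) a ` lincomb \<int> B)"
          using fin_idx_trans[OF add_subgroup_mult[OF ring(5)] add_subgroup_mult[OF agL]] fin[of a] a IO(1) unfolding pn by blast
        then show ?thesis
          using fin_idx_mono[OF add_subgroup_mult[OF agL] add_subgroup_mult[OF agL] IO(1) order_refl] by blast
      qed
      ultimately have "fin_idx I (lincomb \<int> S)"
        using fin_idx_mono[OF add_subgroup_mult[OF agL] agL order_refl] by blast
      then obtain S' where S': "finite S'" "S' \<subseteq> I" "S \<subseteq> S'" "I = lincomb \<int> S'"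
        using lincomb_Ints_fin_gen[OF agI _ LS] fB unfolding S_def by blast
      have "\<exists>s\<in>S'. s \<noteq> 0"
      proof (rule ccontr)
        assume "\<not> (\<exists>s\<in>S'. s \<noteq> 0)"
        then have "lincomb \<int> S' \<subseteq> {0}" unfolding lincomb_def by (auto intro: sum.neutral)
        then show False using S'(4) a by blast
      qed
      then obtain s0 where s0: "s0 \<in> S'" "s0 \<noteq> 0" by blast
      have "algebraic_int x"
        by (rule algebraic_int_if_stable[OF S'(1) s0]) (use S'(2,4) I(3) in blast)
      then show ?thesis using xk unfolding R_def ring_of_integers_def by blast
    qed
  qed
  then show ?thesis unfolding R_def .
qed

text \<open>Taking j-th roots and letting j grow removes the constant. Applied to multiplicative
  quantities, this turns a comparison up to a constant into an exact inequality.\<close>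

lemma power_bound_imp_le:
  fixes x y :: real
  assumes "x \<ge> 0" "y > 0" "\<And>j::nat. x ^ j \<le> C * y ^ j" shows "x \<le> y"
proof (rule ccontr)
  assume "\<not> x \<le> y"
  then have "1 < x / y" using assms by simp
  then obtain n where n: "C < (x / y) ^ n" using real_arch_pow by blast
  have "(x / y) ^ n \<le> C" using assms(3)[of n] assms(2) by (simp add: power_divide divide_le_eq)
  with n show False by simp
qed

lemma cnorm_mult:
  assumes "x \<in> k" "y \<in> k" shows "cnorm k (x * y) = cnorm k x * cnorm k y"
  unfolding cnorm_def prod.distrib[symmetric]
  by (rule prod.cong) (auto simp: embD(4)[OF _ assms] norm_mult)

lemma cnorm_of_nat:
  assumes "subfield_C k" "nfd k d" shows "cnorm k (of_nat n) = real n ^ d"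
proof -
  have "cnorm k (of_nat n) = (\<Prod>\<sigma>\<in>embeddings k. real n)"
    unfolding cnorm_def by (rule prod.cong) (simp_all add: emb_field(7)[OF _ assms(1)])
  then show ?thesis using assms(2) unfolding nfd_def by simp
qed

text \<open>Minkowski's pigeonhole argument: among the combinations of a basis with coefficients in \<open>{0..t}\<close>,
  \<open>t \<approx> N(a)\<^sup>1\<^sup>/\<^sup>d\<close>, two are congruent modulo \<open>a\<close>; their difference is a multiple of \<open>a\<close>.\<close>
lemma cnorm_le_ideal_norm:
  assumes k: "number_field k"
  shows "\<exists>C>0. \<forall>a\<in>ring_of_integers k. a \<noteq> 0 \<longrightarrow> cnorm k a \<le> C * real (ideal_norm (ring_of_integers k) (principal_ideal (ring_of_integers k) a))"
proof -
  define R where "R = ring_of_integers k"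
  interpret dedekind_ring R unfolding R_def by (rule dedekind_ring_integers[OF k])
  have sk: "subfield_C k" using k unfolding number_field_def by blast
  have Rk: "R \<subseteq> k" unfolding R_def ring_of_integers_def by blast
  obtain d where d: "nfd k d" "d > 0" using number_field_nfd[OF k] by metis
  obtain B where B: "is_basis_over \<rat> k B" "B \<subseteq> R" "lincomb \<int> B \<subseteq> R" "fin_idx R (lincomb \<int> B)"
    using integral_basis_lattice[OF k] unfolding R_def by blast
  obtain B' where "is_basis_over \<rat> k B'" "card B' = d" using d unfolding nfd_def by blast
  then have cB: "card B = d" using basis_card_unique[OF subfield_Rats_C B(1)] by simp
  have fe: "finite (embeddings k)" "card (embeddings k) = d" using d unfolding nfd_def by auto
  have fB: "finite B" using B(1) unfolding is_basis_over_def by blast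
  define c0 where "c0 = 1 + (\<Sum>b\<in>B. \<Sum>\<sigma>\<in>embeddings k. cmod (\<sigma> b))"
  have c0: "c0 > 0" unfolding c0_def by (intro add_pos_nonneg sum_nonneg) auto
  have main: "cnorm k a \<le> c0 ^ d * real (N (pri a))" if a: "a \<in> R" "a \<noteq> 0" for a
  proof -
    have np: "N (pri a) > 0" using norm_pos nzi_pri a by blast
    \<comment> \<open>The integer part of the d-th root of the norm: the strict bound at t + 1 feeds
      the pigeonhole principle, the bound at t controls the conjugates of the difference.\<close>
    define t where "t = (GREATEST t. t ^ d \<le> N (pri a))"
    have bd: "t \<le> N (pri a)" if "t ^ d \<le> N (pri a)" for t
      using that self_le_power[of t d] d(2) by (cases "t = 0") auto
    have "(0::nat) ^ d \<le> N (pri a)" using d(2) by (simp add: zero_power)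
    then have t1: "t ^ d \<le> N (pri a)" unfolding t_def
      by (rule GreatestI_nat[where P = "\<lambda>t. t ^ d \<le> N (pri a)"]) (use bd in blast)
    have t2: "N (pri a) < Suc t ^ d"
    proof (rule ccontr)
      assume "\<not> ?thesis"
      then have "Suc t \<le> t" unfolding t_def by (intro Greatest_le_nat[where P = "\<lambda>t. t ^ d \<le> N (pri a)"]) (use bd in auto)
      then show False by simp
    qed
    define F where "F = PiE B (\<lambda>_. {0..t})"
    define g where "g f = (\<Sum>b\<in>B. of_nat (f b) * b)" for f :: "complex \<Rightarrow> nat"
    have inj: "inj_on g F"
    proof (rule inj_onI)
      fix f f' assume f: "f \<in> F" "f' \<in> F" "g f = g f'"
      have z: "(\<Sum>b\<in>B. (of_nat (f b) - of_nat (f' b)) * b) = 0" using f(3) unfolding g_def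
        by (simp add: left_diff_distrib sum_subtractf)
      have "\<forall>b\<in>B. of_nat (f b) - of_nat (f' b) = (0::complex)"
        by (rule basis_independent[OF B(1) _ z]) simp
      then show "f = f'" using f(1,2) unfolding F_def by (intro PiE_ext) auto
    qed
    have "card (g ` F) = Suc t ^ d" using card_image[OF inj] cB fB unfolding F_def by (simp add: card_PiE)
    then have cd: "card (g ` F) > idx R (pri a)" using t2 norm_idx by simp
    have gR: "g ` F \<subseteq> R"
    proof
      fix x assume "x \<in> g ` F"
      then obtain f where "x = (\<Sum>b\<in>B. of_nat (f b) * b)" unfolding g_def by blast
      then have "x \<in> lincomb \<int> B" by (auto intro: lincombI)
      then show "x \<in> R" using B(3) by blast
    qed
    have fF: "finite (g ` F)" unfolding F_def using fB by (intro finite_imageI finite_PiE) auto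
    obtain x y where xy: "x \<in> g ` F" "y \<in> g ` F" "x \<noteq> y" "x - y \<in> pri a"
      by (rule idx_pigeonhole[OF ideal_ag[OF ideal_pri[OF a(1)]] fin_R[OF a] fF gR cd])
    obtain f f' where ff: "f \<in> F" "f' \<in> F" "x = g f" "y = g f'" using xy by blast
    obtain z where z: "z \<in> R" "x - y = a * z" using xy(4) unfolding principal_ideal_def by blast
    have z0: "z \<noteq> 0" using z xy(3) by auto
    have "cmod (\<sigma> (x - y)) \<le> real t * c0" if s: "\<sigma> \<in> embeddings k" for \<sigma>
    proof -
      have e: "x - y = (\<Sum>b\<in>B. (of_nat (f b) - of_nat (f' b)) * b)" unfolding ff g_def
        by (simp add: left_diff_distrib sum_subtractf)
      have kk: "of_nat (f b) - of_nat (f' b) \<in> k" for b using subfield_of_nat[OF sk] subfieldD(4)[OF sk] by blast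
      have bk: "b \<in> k" if "b \<in> B" for b using B(2) Rk that by blast
      have sn: "\<sigma> (of_nat (f b) - of_nat (f' b)) = of_nat (f b) - of_nat (f' b)" for b
        using emb_field(3)[OF s sk subfield_of_nat[OF sk] subfield_of_nat[OF sk]] emb_field(7)[OF s sk] by simp
      have "\<sigma> (x - y) = (\<Sum>b\<in>B. \<sigma> ((of_nat (f b) - of_nat (f' b)) * b))" unfolding e
        by (rule emb_field(6)[OF s sk]) (use kk bk subfieldD(5)[OF sk] in blast)
      also have "\<dots> = (\<Sum>b\<in>B. (of_nat (f b) - of_nat (f' b)) * \<sigma> b)"
        using embD(4)[OF s kk bk] sn by (intro sum.cong) auto
      finally have "cmod (\<sigma> (x - y)) \<le> (\<Sum>b\<in>B. cmod ((of_nat (f b) - of_nat (f' b)) * \<sigma> b))" using norm_sum by metis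
      also have "\<dots> \<le> (\<Sum>b\<in>B. real t * (\<Sum>\<sigma>\<in>embeddings k. cmod (\<sigma> b)))"
      proof (rule sum_mono)
        fix b assume b: "b \<in> B"
        have "f b \<le> t" "f' b \<le> t" using ff(1,2) b unfolding F_def by auto
        moreover have "cmod (of_nat (f b) - of_nat (f' b)) = \<bar>real (f b) - real (f' b)\<bar>"
          by (metis norm_of_real of_real_diff of_real_of_nat_eq)
        ultimately have "cmod (of_nat (f b) - of_nat (f' b)) \<le> real t" by linarith
        moreover have "cmod (\<sigma> b) \<le> (\<Sum>\<sigma>\<in>embeddings k. cmod (\<sigma> b))"
          using member_le_sum[OF s, of "\<lambda>\<sigma>. cmod (\<sigma> b)"] fe by simp
        ultimately show "cmod ((of_nat (f b) - of_nat (f' b)) * \<sigma> b) \<le> real t * (\<Sum>\<sigma>\<in>embeddings k. cmod (\<sigma> b))"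
          unfolding norm_mult by (intro mult_mono) auto
      qed
      also have "\<dots> \<le> real t * c0" unfolding c0_def sum_distrib_left[symmetric] by (simp add: mult_left_mono)
      finally show ?thesis .
    qed
    then have "cnorm k (x - y) \<le> (\<Prod>\<sigma>\<in>embeddings k. real t * c0)" unfolding cnorm_def by (intro prod_mono) auto
    also have "\<dots> = real t ^ d * c0 ^ d" using fe by (simp add: power_mult_distrib)
    also have "\<dots> \<le> real (N (pri a)) * c0 ^ d"
      using t1 c0 by (intro mult_right_mono) (auto simp flip: of_nat_power)
    finally have le: "cnorm k (a * z) \<le> c0 ^ d * real (N (pri a))" unfolding z(2) by (simp add: mult.commute)
    have "cnorm k a * 1 \<le> cnorm k a * cnorm k z"
      using cnorm_ge_1(1)[OF k, of z] z z0 unfolding R_def by (intro mult_left_mono) (auto simp: cnorm_def prod_nonneg)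
    also have "\<dots> = cnorm k (a * z)" using cnorm_mult a z Rk by (metis subsetD)
    finally show ?thesis using le by simp
  qed
  then show ?thesis unfolding R_def using c0[unfolded c0_def] c0 by (intro exI[of _ "c0 ^ d"]) auto
qed

text \<open>Powers of \<open>a\<close> remove the constant in \<open>cnorm_le_ideal_norm\<close>.
  For the reverse inequality write a a' = n: at n both quantities equal n^d, so the inequalities for
  \<open>a\<close> and \<open>a'\<close> multiply to an equality and neither can be strict.\<close>

lemma ideal_norm_principal:
  assumes k: "number_field k" and a: "a \<in> ring_of_integers k" "a \<noteq> 0"
  shows "real (ideal_norm (ring_of_integers k) (principal_ideal (ring_of_integers k) a)) = cnorm k a"
proof -
  define R where "R = ring_of_integers k"
  interpret dedekind_ring R unfolding R_def by (rule dedekind_ring_integers[OF k])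
  have sk: "subfield_C k" using k unfolding number_field_def by blast
  have Rk: "R \<subseteq> k" unfolding R_def ring_of_integers_def by blast
  obtain d where d: "nfd k d" using number_field_nfd[OF k] by metis
  obtain C where C: "C > 0" "\<And>a. a \<in> R \<Longrightarrow> a \<noteq> 0 \<Longrightarrow> cnorm k a \<le> C * real (N (pri a))"
    using cnorm_le_ideal_norm[OF k] unfolding R_def by blast
  have mult: "N (pri (a * b)) = N (pri a) * N (pri b)" if "a \<in> R" "b \<in> R" "a \<noteq> 0" "b \<noteq> 0" for a b
    using norm_imult[of "pri a" "pri b"] nzi_pri that pri_mult by simp
  have pow: "N (pri (a ^ j)) = N (pri a) ^ j" "cnorm k (a ^ j) = cnorm k a ^ j" if "a \<in> R" "a \<noteq> 0" for a j
  proof -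
    show "N (pri (a ^ j)) = N (pri a) ^ j"
    proof (induction j)
      case 0
      have "pri 1 = R" unfolding pri_image by simp
      then show ?case using norm_R by simp
    next
      case (Suc j) then show ?case using mult[of a "a ^ j"] that pow_R by simp
    qed
    show "cnorm k (a ^ j) = cnorm k a ^ j"
    proof (induction j)
      case 0 then show ?case using cnorm_of_nat[OF sk d, of 1] by simp
    next
      case (Suc j) then show ?case using cnorm_mult[of a k "a ^ j"] that pow_R[of a j] Rk by (simp add: subsetD)
    qed
  qed
  have le: "cnorm k a \<le> real (N (pri a))" if a: "a \<in> R" "a \<noteq> 0" for a
  proof (rule power_bound_imp_le)
    show "cnorm k a \<ge> 0" unfolding cnorm_def by (simp add: prod_nonneg)
    show "real (N (pri a)) > 0" using norm_pos nzi_pri a by simp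
    show "cnorm k a ^ j \<le> C * real (N (pri a)) ^ j" for j
      using C(2)[of "a ^ j"] pow_R a pow[OF a] by simp
  qed
  obtain a' n where a': "a' \<in> R" "n > 0" "a * a' = of_nat n" using cnorm_ge_1(2)[OF k a] unfolding R_def by blast
  have aR: "a \<in> R" using a unfolding R_def by simp
  have a'0: "a' \<noteq> 0" using a' by auto
  have "N (pri (of_nat n)) = n ^ d" unfolding norm_idx pri_image
    using idx_of_nat_multiple(1)[OF k d a'(2)] unfolding R_def .
  then have "real (N (pri a) * N (pri a')) = real n ^ d" using mult[OF aR a'(1) a(2) a'0] a'(3)
    by (simp flip: of_nat_mult of_nat_power)
  moreover have "cnorm k a * cnorm k a' = real n ^ d"
    using cnorm_mult[of a k a'] cnorm_of_nat[OF sk d, of n] aR a' Rk by (metis subsetD)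
  ultimately have eq: "real (N (pri a)) * real (N (pri a')) = cnorm k a * cnorm k a'" by simp
  have "cnorm k a' > 0" using cnorm_ge_1(1)[OF k, of a'] a' a'0 unfolding R_def by simp
  have "real (N (pri a)) \<le> cnorm k a"
  proof (rule ccontr)
    assume "\<not> ?thesis"
    then have "cnorm k a * cnorm k a' < real (N (pri a)) * cnorm k a'" using \<open>cnorm k a' > 0\<close> by simp
    also have "\<dots> \<le> real (N (pri a)) * real (N (pri a'))" using le[OF a'(1) a'0] by (intro mult_left_mono) auto
    finally show False using eq by simp
  qed
  then show ?thesis using le[OF aR a(2)] unfolding R_def by simp
qed

section \<open>Extension of ideals\<close>

locale simple_extension =
  fixes k :: "complex set" and \<theta> :: complex
  assumes number_field_k: "number_field k" and algebraic_\<theta>: "algebraic \<theta>"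
begin

definition "K = adjoin k \<theta>"
definition "R = ring_of_integers k"
definition "S = ring_of_integers K"
definition "m = ext_degree k K"
definition ex :: "complex set \<Rightarrow> complex set" where "ex I = ideal_gen S I"

lemmas adj = number_field_adjoin[OF number_field_k algebraic_\<theta>, folded K_def, folded m_def]

lemma subfield_k: "subfield_C k" and subfield_K: "subfield_C K"
  using number_field_k adj(1) unfolding number_field_def by blast+

sublocale R: dedekind_ring R unfolding R_def by (rule dedekind_ring_integers[OF number_field_k])
sublocale S: dedekind_ring S unfolding S_def by (rule dedekind_ring_integers[OF adj(1)])

lemma R_subset_S: "R \<subseteq> S" and S_inter_k: "S \<inter> k = R" and R_subset_k: "R \<subseteq> k" and S_subset_K: "S \<subseteq> K"
  using adj(3) unfolding R_def S_def ring_of_integers_def by auto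

lemma ideal_inter_R: "is_ideal S L \<Longrightarrow> is_ideal R (L \<inter> R)"
  using R_subset_S unfolding is_ideal_def by (auto simp: add_subgroupD(4)[OF R.ag_R])

lemma ex_ideal: "I \<subseteq> S \<Longrightarrow> is_ideal S (ex I)"
  unfolding ex_def ideal_gen_def using S.ideal_R by (auto simp: is_ideal_def)

lemma ex_incl: "I \<subseteq> ex I" unfolding ex_def ideal_gen_def by blast

lemma ex_least: "is_ideal S L \<Longrightarrow> I \<subseteq> L \<Longrightarrow> ex I \<subseteq> L"
  unfolding ex_def ideal_gen_def by blast

lemma ideal_R_subset_S: "is_ideal R I \<Longrightarrow> I \<subseteq> S" using R.idealD(1) R_subset_S by blast

lemma ex_ideal': "is_ideal R I \<Longrightarrow> is_ideal S (ex I)" using ex_ideal ideal_R_subset_S by blast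

lemma ex_nz: "is_ideal R I \<and> I \<noteq> {0} \<Longrightarrow> is_ideal S (ex I) \<and> ex I \<noteq> {0}"
  using ex_ideal' ex_incl R.idealD(2) by blast

text \<open>Generation and multiplication are reconciled one factor at a time: with one factor
  fixed, the elements whose product with it lands in the target form an ideal, and this is tested on
  generators.\<close>

lemma ex_imult:
  assumes I: "is_ideal R I" and J: "is_ideal R J"
  shows "ex (ideal_mult R I J) = ideal_mult S (ex I) (ex J)"
proof
  note i = ex_ideal'[OF I] and j = ex_ideal'[OF J]
  have p: "is_ideal S (ideal_mult S (ex I) (ex J))" using S.imult_ideal S.idealD(1) i j by blast
  have "ideal_mult R I J \<subseteq> ideal_mult S (ex I) (ex J) \<inter> R"
  proof (rule R.imult_least[OF ideal_inter_R[OF p]])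
    fix a b assume ab: "a \<in> I" "b \<in> J"
    then have "a * b \<in> ideal_mult S (ex I) (ex J)" using ex_incl by (intro S.imult_I) blast+
    moreover have "a * b \<in> R" using ab R.idealD(3)[OF I] R.idealD(3)[OF J] R.mult_R by blast
    ultimately show "a * b \<in> ideal_mult S (ex I) (ex J) \<inter> R" by blast
  qed
  then show "ex (ideal_mult R I J) \<subseteq> ideal_mult S (ex I) (ex J)" by (intro ex_least[OF p]) blast
  have IJ: "is_ideal R (ideal_mult R I J)" using R.imult_ideal R.idealD(1) I J by blast
  define L where "L = ex (ideal_mult R I J)"
  have L: "is_ideal S L" unfolding L_def by (rule ex_ideal'[OF IJ])
  have 1: "a * b \<in> L" if "a \<in> ex I" "b \<in> J" for a b
  proof -
    have "ex I \<subseteq> {r \<in> S. r * b \<in> L}"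
    proof (rule ex_least[OF S.ideal_colon[OF L]])
      show "I \<subseteq> {r \<in> S. r * b \<in> L}" unfolding L_def
        using R.imult_I[OF _ \<open>b \<in> J\<close>, of _ I] ex_incl[of "ideal_mult R I J"] ideal_R_subset_S[OF I] by blast
    qed
    then show ?thesis using that by blast
  qed
  show "ideal_mult S (ex I) (ex J) \<subseteq> ex (ideal_mult R I J)" unfolding L_def[symmetric]
  proof (rule S.imult_least[OF L])
    fix a b assume ab: "a \<in> ex I" "b \<in> ex J"
    have "ex J \<subseteq> {r \<in> S. r * a \<in> L}"
    proof (rule ex_least[OF S.ideal_colon[OF L]])
      show "J \<subseteq> {r \<in> S. r * a \<in> L}" using 1[OF ab(1)] ideal_R_subset_S[OF J] by (auto simp: mult.commute)
    qed
    then show "a * b \<in> L" using ab(2) by (auto simp: mult.commute)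
  qed
qed

lemma ex_pri: "a \<in> R \<Longrightarrow> ex (principal_ideal R a) = principal_ideal S a"
proof
  assume a: "a \<in> R"
  then have aS: "a \<in> S" using R_subset_S by blast
  show "ex (principal_ideal R a) \<subseteq> principal_ideal S a"
    using R_subset_S by (intro ex_least S.ideal_pri aS) (auto simp: principal_ideal_def)
  show "principal_ideal S a \<subseteq> ex (principal_ideal R a)"
    using ex_incl R.pri_self by (intro S.pri_subset ex_ideal' R.ideal_pri a) blast
qed

lemma ex_R: "ex R = S"
  using S.ideal_one[OF ex_ideal'[OF R.ideal_R]] ex_incl[of R] R.one_R by blast

text \<open>Each embedding of \<open>k\<close> has exactly \<open>m\<close> extensions to
  \<open>K\<close>, all with the same value at \<open>a\<close>.\<close>

lemma cnorm_K:
  assumes a: "a \<in> k" shows "cnorm K a = cnorm k a ^ m"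
proof -
  obtain d where "nfd k d" using number_field_nfd[OF number_field_k] by metis
  then have fe: "finite (embeddings k)" unfolding nfd_def by blast
  have "cnorm K a = (\<Prod>\<sigma>\<in>embeddings k. \<Prod>\<tau>\<in>ext k K \<sigma>. cmod (\<tau> a))"
    unfolding cnorm_def ext_cover[OF subfield_k adj(3)]
    by (rule prod.UNION_disjoint) (use fe adj(5) in \<open>auto simp: ext_def\<close>)
  also have "\<dots> = (\<Prod>\<sigma>\<in>embeddings k. cmod (\<sigma> a) ^ m)"
  proof (rule prod.cong)
    fix \<sigma> assume s: "\<sigma> \<in> embeddings k"
    have "(\<Prod>\<tau>\<in>ext k K \<sigma>. cmod (\<tau> a)) = (\<Prod>\<tau>\<in>ext k K \<sigma>. cmod (\<sigma> a))"
      by (rule prod.cong) (use a in \<open>auto simp: ext_def restrict_emb_def\<close>)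
    then show "(\<Prod>\<tau>\<in>ext k K \<sigma>. cmod (\<tau> a)) = cmod (\<sigma> a) ^ m" using adj(5)[OF s] by simp
  qed simp
  finally show ?thesis unfolding cnorm_def by (simp add: prod_power_distrib)
qed

text \<open>The free module M spanned over R by a basis of K consisting of integers has finite index
  in S. Since I M has index N(I)^m in M and lies in the extension of I, the index of M is an
  admissible constant.\<close>

lemma norm_ex_bound: "\<exists>C. \<forall>I. is_ideal R I \<and> I \<noteq> {0} \<longrightarrow> ideal_norm S (ex I) \<le> C * ideal_norm R I ^ m"
proof -
  obtain B0 where B0: "is_basis_over k K B0" "card B0 = m" using adj(6) by blast
  obtain B where B: "is_basis_over k K B" "B \<subseteq> S" "card B = m"
    using ex_integral_basis[OF number_field_k subfield_K adj(3) adj(1) B0(1)] B0(2) unfolding S_def by metis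
  obtain A where A: "is_basis_over \<rat> k A" "A \<subseteq> R" "lincomb \<int> A \<subseteq> R" "fin_idx R (lincomb \<int> A)"
    using integral_basis_lattice[OF number_field_k] unfolding R_def by blast
  define E where "E = (\<lambda>(b,c). b * c) ` (A \<times> B)"
  have E: "is_basis_over \<rat> K E" unfolding E_def
    by (rule tower_basis(1)[OF A(1) B(1) adj(3) subfield_Rats[OF subfield_k] subfield_Rats_C subfield_k subfield_K])
  have ES: "E \<subseteq> S" unfolding E_def using A(2) B(2) R_subset_S by (auto intro!: S.mult_R)
  have fE: "fin_idx S (lincomb \<int> E)" using lattice_fin_idx(2)[OF adj(1) E] ES unfolding S_def by blast
  have fB: "finite B" using B(1) unfolding is_basis_over_def by blast
  define M where "M = lincomb R B"
  have agM: "add_subgroup M" unfolding M_def by (rule add_subgroup_lincomb[OF R.ag_R])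
  have agE: "add_subgroup (lincomb \<int> E)" by (simp add: add_subgroup_lincomb add_subgroup_Ints)
  have "E \<subseteq> M"
  proof
    fix x assume "x \<in> E"
    then obtain a b where "a \<in> A" "b \<in> B" "x = a * b" unfolding E_def by auto
    then show "x \<in> M" unfolding M_def using lincomb_single[OF fB, of b a R] A(2) R.zero_R by blast
  qed
  then have "lincomb \<int> E \<subseteq> M" by (rule lincomb_Ints_subset[OF agM])
  then have fM: "fin_idx S M" using fin_idx_mono[OF agE agM order_refl _ fE] by blast
  have MS: "M \<subseteq> S" unfolding M_def
    by (rule lincomb_subset[OF S.ag_R]) (use B(2) R_subset_S S.mult_R in blast)
  have "ideal_norm S (ex I) \<le> idx S M * ideal_norm R I ^ m" if I: "is_ideal R I \<and> I \<noteq> {0}" for I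
  proof -
    have Ii: "is_ideal R I" using I by simp
    have agI: "add_subgroup I" by (rule R.ideal_ag[OF Ii])
    have ind: "\<forall>b\<in>B. c b = 0" if "\<forall>b\<in>B. c b \<in> k" "(\<Sum>b\<in>B. c b * b) = 0" for c
      by (rule basis_independent[OF B(1) that])
    note l = idx_lincomb[OF agI R.idealD(1)[OF Ii] fB ind subfield_ag[OF subfield_k] R_subset_k R.ag_R R.fin_nzi[OF I]]
    define IM where "IM = lincomb I B"
    have agIM: "add_subgroup IM" unfolding IM_def by (rule add_subgroup_lincomb[OF agI])
    have i1: "idx M IM = ideal_norm R I ^ m" unfolding M_def IM_def using l(1) B(3) R.norm_idx by simp
    have fIM: "fin_idx S IM" by (rule fin_idx_trans[OF agM agIM fM]) (use l(2) in \<open>simp add: M_def IM_def\<close>)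
    have IMM: "IM \<subseteq> M" unfolding IM_def M_def lincomb_def using R.idealD(1)[OF Ii] by blast
    note exI = ex_ideal'[OF Ii]
    have IMex: "IM \<subseteq> ex I" unfolding IM_def
    proof (rule lincomb_subset[OF S.ideal_ag[OF exI]])
      fix c b assume "c \<in> I" "b \<in> B"
      then show "c * b \<in> ex I" using S.idealD(6)[OF exI] ex_incl B(2) by blast
    qed
    have "idx S (ex I) \<le> idx S IM"
      by (rule idx_mono_left(2)[OF S.ag_R S.ideal_ag[OF exI] agIM IMex S.idealD(1)[OF exI] fIM])
    also have "\<dots> = idx S M * idx M IM" by (rule idx_tower[OF S.ag_R agM agIM IMM MS fIM])
    finally show ?thesis using i1 S.norm_idx by simp
  qed
  then show ?thesis by blast
qed

text \<open>The ratio of both sides is bounded and multiplicative, hence at most \<open>1\<close>;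
  it is \<open>1\<close> on principal ideals, and every ideal divides one.\<close>
lemma norm_ex:
  assumes I: "is_ideal R I \<and> I \<noteq> {0}"
  shows "ideal_norm S (ex I) = ideal_norm R I ^ m"
proof -
  obtain C where C: "\<And>I. is_ideal R I \<and> I \<noteq> {0} \<Longrightarrow> ideal_norm S (ex I) \<le> C * ideal_norm R I ^ m"
    using norm_ex_bound by blast
  have mult: "ideal_norm S (ex (ideal_mult R I J)) = ideal_norm S (ex I) * ideal_norm S (ex J)"
    if "is_ideal R I \<and> I \<noteq> {0}" "is_ideal R J \<and> J \<noteq> {0}" for I J
    using ex_imult[of I J] S.norm_imult[OF ex_nz[OF that(1)] ex_nz[OF that(2)]] that by simp
  have le: "ideal_norm S (ex I) \<le> ideal_norm R I ^ m" if I: "is_ideal R I \<and> I \<noteq> {0}" for I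
  proof -
    have pw: "ideal_norm S (ex (ideal_pow R I j)) = ideal_norm S (ex I) ^ j" for j
    proof (induction j)
      case 0 then show ?case using ex_R S.norm_R by simp
    next
      case (Suc j) then show ?case using mult[OF I R.ipow_nzi[OF I]] by simp
    qed
    have "real (ideal_norm S (ex I)) \<le> real (ideal_norm R I ^ m)"
    proof (rule power_bound_imp_le)
      show "0 < real (ideal_norm R I ^ m)" using R.norm_pos[OF I] by simp
      fix j
      have "ideal_norm S (ex I) ^ j \<le> C * (ideal_norm R I ^ m) ^ j"
        using C[OF R.ipow_nzi[OF I], of j] pw[of j] R.norm_ipow[OF I, of j]
        by (metis power_mult mult.commute)
      then have "real (ideal_norm S (ex I) ^ j) \<le> real (C * (ideal_norm R I ^ m) ^ j)" by (rule of_nat_mono)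
      then show "real (ideal_norm S (ex I)) ^ j \<le> real C * real (ideal_norm R I ^ m) ^ j" by simp
    qed simp
    then show ?thesis by (simp only: of_nat_le_iff)
  qed
  obtain J a where J: "is_ideal R J \<and> J \<noteq> {0}" "a \<in> R" "a \<noteq> 0" "ideal_mult R I J = principal_ideal R a"
    using R.invertible[OF I] by blast
  have aS: "a \<in> S" using J R_subset_S by blast
  have "real (ideal_norm S (principal_ideal S a)) = cnorm K a"
    using ideal_norm_principal[OF adj(1)] aS J(3) unfolding S_def by blast
  also have "\<dots> = cnorm k a ^ m" using cnorm_K J(2) R_subset_k by blast
  also have "cnorm k a = real (ideal_norm R (principal_ideal R a))"
    using ideal_norm_principal[OF number_field_k] J(2,3) unfolding R_def by simp
  finally have "real (ideal_norm S (principal_ideal S a)) = real (ideal_norm R (principal_ideal R a) ^ m)" by simp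
  then have "ideal_norm S (principal_ideal S a) = ideal_norm R (principal_ideal R a) ^ m" by (simp only: of_nat_eq_iff)
  then have eq: "ideal_norm S (ex I) * ideal_norm S (ex J) = ideal_norm R I ^ m * ideal_norm R J ^ m"
    using mult[OF I J(1)] J(4) ex_pri[OF J(2)] R.norm_imult[OF I J(1)] by (simp add: power_mult_distrib)
  have pos: "ideal_norm S (ex J) > 0" using S.norm_pos[OF ex_nz[OF J(1)]] .
  show ?thesis
  proof (rule ccontr)
    assume "\<not> ?thesis"
    then have "ideal_norm S (ex I) < ideal_norm R I ^ m" using le[OF I] by simp
    then have "ideal_norm S (ex I) * ideal_norm S (ex J) < ideal_norm R I ^ m * ideal_norm S (ex J)" using pos by simp
    also have "\<dots> \<le> ideal_norm R I ^ m * ideal_norm R J ^ m" using le[OF J(1)] by simp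
    finally show False using eq by simp
  qed
qed

text \<open>A nonzero element of \<open>L\<close> divides a positive integer, which then lies in
  \<open>L\<close> and in \<open>R\<close>.\<close>

lemma nz_inter_R:
  assumes L: "is_ideal S L \<and> L \<noteq> {0}" shows "is_ideal R (L \<inter> R) \<and> L \<inter> R \<noteq> {0}"
proof -
  obtain a where a: "a \<in> L" "a \<noteq> 0" using L S.idealD(2) by blast
  then have aS: "a \<in> S" using L S.idealD(3) by blast
  obtain b n where b: "b \<in> S" "n > 0" "a * b = of_nat n" using cnorm_ge_1(2)[OF adj(1)] aS a(2) unfolding S_def by blast
  have "of_nat n \<in> L" using S.idealD(6)[OF L[THEN conjunct1] b(1) a(1)] b(3) by simp
  moreover have "of_nat n \<in> R" using integers_ring(6)[OF number_field_k] unfolding R_def by simp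
  moreover have "of_nat n \<noteq> (0::complex)" using b(2) by simp
  ultimately show ?thesis using ideal_inter_R L by blast
qed

lemma pr_below:
  assumes Q: "is_prime_ideal S Q" shows "is_prime_ideal R (Q \<inter> R)"
proof -
  have "1 \<notin> Q \<inter> R" using S.prD(5)[OF Q] by simp
  then have "Q \<inter> R \<noteq> R" using R.one_R by blast
  moreover have "a \<in> Q \<or> b \<in> Q" if "a \<in> R" "b \<in> R" "a * b \<in> Q" for a b
    using S.prD(6)[OF Q] that R_subset_S by blast
  ultimately show ?thesis using nz_inter_R[OF S.prD(4)[OF Q]] unfolding is_prime_ideal_def by blast
qed

definition above :: "complex set \<Rightarrow> complex set set" where
  "above P = {Q. is_prime_ideal S Q \<and> Q \<inter> R = P}"

lemma above_iff: "is_prime_ideal R P \<Longrightarrow> is_prime_ideal S Q \<Longrightarrow> Q \<in> above P \<longleftrightarrow> ex P \<subseteq> Q"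
proof -
  assume P: "is_prime_ideal R P" and Q: "is_prime_ideal S Q"
  have "ex P \<subseteq> Q \<longleftrightarrow> P \<subseteq> Q \<inter> R"
    using ex_least[OF S.prD(1)[OF Q]] ex_incl[of P] R.idealD(1)[OF R.prD(1)[OF P]] by blast
  also have "\<dots> \<longleftrightarrow> Q \<inter> R = P" using R.pr_subset_eq[OF P pr_below[OF Q]] by blast
  finally show ?thesis unfolding above_def using Q by blast
qed

lemma above_eq: "is_prime_ideal R P \<Longrightarrow> above P = {Q. is_prime_ideal S Q \<and> ex P \<subseteq> Q}"
  using above_iff unfolding above_def by blast

lemma finite_above: "is_prime_ideal R P \<Longrightarrow> finite (above P)"
  unfolding above_eq using S.finite_pr ex_nz R.prD(4) by blast

lemma e_pos: "is_prime_ideal R P \<Longrightarrow> Q \<in> above P \<Longrightarrow> S.vl Q (ex P) > 0"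
  using S.vl_pos_iff[of Q "ex P"] above_eq ex_nz R.prD(4) by blast

text \<open>The identity sum e f = [K:k] in multiplicative form.\<close>

lemma prod_above:
  assumes P: "is_prime_ideal R P"
  shows "(\<Prod>Q\<in>above P. ideal_norm S Q ^ S.vl Q (ex P)) = ideal_norm R P ^ m"
proof -
  have "ideal_norm S (ex P) = (\<Prod>Q\<in>above P. ideal_norm S Q ^ S.vl Q (ex P))"
    by (rule S.norm_vl[OF ex_nz[OF R.prD(4)[OF P]] finite_above[OF P]]) (auto simp: above_eq[OF P])
  then show ?thesis using norm_ex[OF R.prD(4)[OF P]] by simp
qed

lemma above_nonempty:
  assumes P: "is_prime_ideal R P" shows "above P \<noteq> {}"
proof
  assume "above P = {}"
  then have "ideal_norm R P ^ m = 1" using prod_above[OF P] by simp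
  then show False using R.norm_pr_ge_2[OF P] adj(2) by (auto simp: nat_power_eq_Suc_0_iff)
qed

text \<open>Split off the full power of P = Q \<inter> R from I. The power contributes its exponent
  times the ramification index; the cofactor is not inside P, so its extension is not inside Q and
  contributes nothing.\<close>

lemma vl_ex:
  assumes Q: "is_prime_ideal S Q" and I: "is_ideal R I \<and> I \<noteq> {0}"
  shows "S.vl Q (ex I) = R.vl (Q \<inter> R) I * S.vl Q (ex (Q \<inter> R))"
proof -
  define P where "P = Q \<inter> R"
  have P: "is_prime_ideal R P" unfolding P_def by (rule pr_below[OF Q])
  note Pn = R.prD(4)[OF P]
  obtain C where C: "is_ideal R C \<and> C \<noteq> {0}" "\<not> C \<subseteq> P" "I = ideal_mult R (ideal_pow R P (R.vl P I)) C"
    using R.vl_factor[OF P I] by metis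
  have pw: "S.vl Q (ex (ideal_pow R P j)) = j * S.vl Q (ex P)" for j
  proof (induction j)
    case 0 then show ?case using ex_R S.vl_R[OF Q] by simp
  next
    case (Suc j)
    have "ex (ideal_pow R P (Suc j)) = ideal_mult S (ex P) (ex (ideal_pow R P j))"
      using ex_imult[of P "ideal_pow R P j"] Pn R.ipow_nzi[OF Pn, of j] by simp
    then show ?case using S.vl_imult[OF Q ex_nz[OF Pn] ex_nz[OF R.ipow_nzi[OF Pn]], of j] Suc by simp
  qed
  have "\<not> ex C \<subseteq> Q" using C(1,2) ex_incl R.idealD(1) unfolding P_def by blast
  then have "S.vl Q (ex C) = 0" using S.vl_pos_iff[OF Q ex_nz[OF C(1)]] by simp
  moreover have "ex I = ideal_mult S (ex (ideal_pow R P (R.vl P I))) (ex C)"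
    using ex_imult[of "ideal_pow R P (R.vl P I)" C] C(1,3) R.ipow_nzi[OF Pn, of "R.vl P I"] by simp
  ultimately show ?thesis
    using S.vl_imult[OF Q ex_nz[OF R.ipow_nzi[OF Pn]] ex_nz[OF C(1)], of "R.vl P I"] pw unfolding P_def by simp
qed

end

section \<open>Divisor sums as Euler products\<close>

context dedekind_ring begin

lemma divisor_sum:
  fixes F :: "complex set \<Rightarrow> nat \<Rightarrow> real"
  assumes C: "nzi C" and T: "finite T" "\<And>P. P \<in> T \<Longrightarrow> pr P" "\<And>P. pr P \<Longrightarrow> C \<subseteq> P \<Longrightarrow> P \<in> T"
  shows "(\<Sum>A\<in>{A. is_ideal R A \<and> C \<subseteq> A}. \<Prod>P\<in>T. F P (vl P A)) = (\<Prod>P\<in>T. \<Sum>a\<le>vl P C. F P a)"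
proof -
  have "(\<Sum>A\<in>{A. is_ideal R A \<and> C \<subseteq> A}. \<Prod>P\<in>T. F P (vl P A)) =
      (\<Sum>A\<in>{A. is_ideal R A \<and> C \<subseteq> A}. \<Prod>P\<in>T. F P ((\<lambda>P\<in>T. vl P A) P))"
    by (intro sum.cong prod.cong) auto
  also have "\<dots> = (\<Sum>g\<in>PiE T (\<lambda>P. {..vl P C}). \<Prod>P\<in>T. F P (g P))"
    by (rule sum.reindex_bij_betw[OF bij_betw_divisors(1)[OF C T], of "\<lambda>g. \<Prod>P\<in>T. F P (g P)"])
  also have "\<dots> = (\<Prod>P\<in>T. \<Sum>a\<le>vl P C. F P a)"
    by (rule prod_sum_PiE[symmetric]) (use T in auto)
  finally show ?thesis .
qed

text \<open>All ingredients depend on the exponents a of A and b of B prime by prime; the product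
  over the primes dividing AB becomes the test a + b = 0. The weights \<open>l\<close> and
  \<open>\<rho>\<close> stay abstract, so that the norm of (D, B) is inserted only later.\<close>

lemma divisor_euler_product:
  fixes l :: "complex set \<Rightarrow> nat \<Rightarrow> real" and \<rho> :: "complex set \<Rightarrow> real"
  assumes D: "nzi D" and T: "T = {P. pr P \<and> D \<subseteq> P}"
  shows "(\<Sum>B\<in>{B. is_ideal R B \<and> ideal_dvd B D}. (\<Prod>P\<in>T. l P (vl P B)) / real (N B) *
      (\<Sum>A\<in>{A. is_ideal R A \<and> ideal_dvd A (ideal_quot R D B)}. real_of_int (ideal_moebius R A) / real (N A) *
         (\<Prod>P\<in>{P. pr P \<and> ideal_dvd P (A \<odot> B)}. \<rho> P)))
    = (\<Prod>P\<in>T. \<Sum>b\<le>vl P D. l P b / real (N P) ^ b *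
        (\<Sum>a\<le>vl P D - b. (if a = 0 then 1 else if a = 1 then -1 else 0) / real (N P) ^ a * (if a + b = 0 then 1 else \<rho> P)))"
    (is "?L = ?R")
proof -
  define mu where "mu a = (if a = 0 then 1 else if a = 1 then -1 else (0::real))" for a :: nat
  have finT: "finite T" unfolding T by (rule finite_pr[OF D])
  have Tp: "pr P" if "P \<in> T" for P using that T by simp
  have inner: "(\<Sum>A\<in>{A. is_ideal R A \<and> ideal_dvd A (ideal_quot R D B)}. real_of_int (ideal_moebius R A) / real (N A) *
         (\<Prod>P\<in>{P. pr P \<and> ideal_dvd P (A \<odot> B)}. \<rho> P)) =
      (\<Prod>P\<in>T. \<Sum>a\<le>vl P D - vl P B. mu a / real (N P) ^ a * (if a + vl P B = 0 then 1 else \<rho> P))"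
    (is "?I = _") if B: "is_ideal R B" "D \<subseteq> B" for B
  proof -
    define C where "C = ideal_quot R D B"
    have C: "nzi C" "B \<odot> C = D" using ideal_quot_mult[OF D B] unfolding C_def by blast+
    have nB: "nzi B" by (rule nzi_mono[OF D B(2,1)])
    have DC: "D \<subseteq> C" using imult_le(2)[OF B(1), of C] C by simp
    have CT: "P \<in> T" if "pr P" "C \<subseteq> P" for P using that DC T by blast
    have vC: "vl P C = vl P D - vl P B" if "P \<in> T" for P using vl_ideal_quot[OF D B Tp[OF that]] unfolding C_def .
    have trm: "real_of_int (ideal_moebius R A) / real (N A) * (\<Prod>P\<in>{P. pr P \<and> ideal_dvd P (A \<odot> B)}. \<rho> P)
       = (\<Prod>P\<in>T. mu (vl P A) / real (N P) ^ vl P A * (if vl P A + vl P B = 0 then 1 else \<rho> P))"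
      if A: "is_ideal R A" "C \<subseteq> A" for A
    proof -
      have nA: "nzi A" by (rule nzi_mono[OF C(1) A(2,1)])
      have AT: "P \<in> T" if "pr P" "A \<subseteq> P" for P using that A CT by blast
      have "ideal_moebius R A = (\<Prod>P\<in>T. if vl P A = 0 then 1 else if vl P A = 1 then -1 else 0)"
        by (rule moebius_vl[OF nA finT Tp AT])
      then have "real_of_int (ideal_moebius R A) =
          (\<Prod>P\<in>T. real_of_int (if vl P A = 0 then 1 else if vl P A = 1 then -1 else 0))" by (simp only: of_int_prod)
      also have "\<dots> = (\<Prod>P\<in>T. mu (vl P A))" by (intro prod.cong) (auto simp: mu_def)
      finally have mo: "real_of_int (ideal_moebius R A) = (\<Prod>P\<in>T. mu (vl P A))" .
      have "N A = (\<Prod>P\<in>T. N P ^ vl P A)" by (rule norm_vl[OF nA finT Tp AT])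
    then have no: "real (N A) = (\<Prod>P\<in>T. real (N P) ^ vl P A)" by simp
      have nAB: "nzi (A \<odot> B)" by (rule imult_nzi[OF nA nB])
      have "B \<odot> C \<subseteq> B \<odot> A" by (rule imult_mono[OF order_refl A(2)])
      then have DAB: "D \<subseteq> A \<odot> B" using C(2) imult_commute[of A B] by simp
      have "{P. pr P \<and> ideal_dvd P (A \<odot> B)} = {P\<in>T. vl P A + vl P B \<noteq> 0}"
      proof -
        have "pr P \<and> A \<odot> B \<subseteq> P \<longleftrightarrow> P \<in> T \<and> vl P A + vl P B \<noteq> 0" for P
          using vl_imult[of P A B] nA nB vl_pos_iff[of P "A \<odot> B"] nAB DAB T by auto
        then show ?thesis unfolding ideal_dvd_def by simp
      qed
      then have "(\<Prod>P\<in>{P. pr P \<and> ideal_dvd P (A \<odot> B)}. \<rho> P) = (\<Prod>P\<in>T. if vl P A + vl P B \<noteq> 0 then \<rho> P else 1)"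
        using prod.inter_filter[OF finT] by simp
      also have "\<dots> = (\<Prod>P\<in>T. if vl P A + vl P B = 0 then 1 else \<rho> P)" by (intro prod.cong) auto
      finally show ?thesis unfolding mo no by (simp add: prod.distrib prod_dividef)
    qed
    have "?I = (\<Sum>A\<in>{A. is_ideal R A \<and> C \<subseteq> A}. \<Prod>P\<in>T. mu (vl P A) / real (N P) ^ vl P A * (if vl P A + vl P B = 0 then 1 else \<rho> P))"
      unfolding C_def[symmetric] ideal_dvd_def[of _ C] by (rule sum.cong) (use trm in auto)
    also have "\<dots> = (\<Prod>P\<in>T. \<Sum>a\<le>vl P C. mu a / real (N P) ^ a * (if a + vl P B = 0 then 1 else \<rho> P))"
      by (rule divisor_sum[OF C(1) finT Tp CT, of "\<lambda>P a. mu a / real (N P) ^ a * (if a + vl P B = 0 then 1 else \<rho> P)"])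
    also have "\<dots> = (\<Prod>P\<in>T. \<Sum>a\<le>vl P D - vl P B. mu a / real (N P) ^ a * (if a + vl P B = 0 then 1 else \<rho> P))"
      using vC by (intro prod.cong) auto
    finally show ?thesis .
  qed
  define F where "F P b = l P b / real (N P) ^ b * (\<Sum>a\<le>vl P D - b. mu a / real (N P) ^ a * (if a + b = 0 then 1 else \<rho> P))" for P b
  have "?L = (\<Sum>B\<in>{B. is_ideal R B \<and> D \<subseteq> B}. \<Prod>P\<in>T. F P (vl P B))"
    unfolding ideal_dvd_def[of _ D]
  proof (rule sum.cong)
    fix B assume "B \<in> {B. is_ideal R B \<and> D \<subseteq> B}"
    then have B: "is_ideal R B" "D \<subseteq> B" by auto
    have nB: "nzi B" by (rule nzi_mono[OF D B(2,1)])
    have BT: "P \<in> T" if "pr P" "B \<subseteq> P" for P using that B T by blast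
    have "N B = (\<Prod>P\<in>T. N P ^ vl P B)" by (rule norm_vl[OF nB finT Tp BT])
    then have no: "real (N B) = (\<Prod>P\<in>T. real (N P) ^ vl P B)" by simp
    show "(\<Prod>P\<in>T. l P (vl P B)) / real (N B) *
      (\<Sum>A\<in>{A. is_ideal R A \<and> ideal_dvd A (ideal_quot R D B)}. real_of_int (ideal_moebius R A) / real (N A) *
         (\<Prod>P\<in>{P. pr P \<and> ideal_dvd P (A \<odot> B)}. \<rho> P)) = (\<Prod>P\<in>T. F P (vl P B))"
      unfolding inner[OF B] no F_def by (simp add: prod.distrib prod_dividef)
  qed simp
  also have "\<dots> = (\<Prod>P\<in>T. \<Sum>b\<le>vl P D. F P b)"
    by (rule divisor_sum[OF D finT Tp]) (use T in auto)
  finally show ?thesis unfolding F_def mu_def .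
qed

end

section \<open>Euler factors\<close>

text \<open>A single strict factor leaves a gap that the remaining positive upper factors cannot
  close. Both the finite and the Archimedean equality conditions become local through this.\<close>

lemma prod_le_eq_iff:
  fixes f g :: "'b \<Rightarrow> real"
  assumes "finite A" "\<And>a. a \<in> A \<Longrightarrow> 0 \<le> f a" "\<And>a. a \<in> A \<Longrightarrow> f a \<le> g a" "\<And>a. a \<in> A \<Longrightarrow> 0 < g a"
  shows "prod f A \<le> prod g A" "prod f A = prod g A \<longleftrightarrow> (\<forall>a\<in>A. f a = g a)"
proof -
  show "prod f A \<le> prod g A" using assms by (intro prod_mono) auto
  show "prod f A = prod g A \<longleftrightarrow> (\<forall>a\<in>A. f a = g a)"
  proof
    assume e: "prod f A = prod g A"
    show "\<forall>a\<in>A. f a = g a"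
    proof (rule ccontr)
      assume "\<not> (\<forall>a\<in>A. f a = g a)"
      then obtain a where a: "a \<in> A" "f a \<noteq> g a" by blast
      then have lt: "f a < g a" using assms(3)[OF a(1)] by simp
      have "prod f A = f a * prod f (A - {a})" using assms(1) a(1) by (simp add: prod.remove)
      also have "\<dots> \<le> f a * prod g (A - {a})" using assms a by (intro mult_left_mono prod_mono) auto
      also have "\<dots> < g a * prod g (A - {a})" using lt assms(4) by (intro mult_strict_right_mono prod_pos) auto
      also have "\<dots> = prod g A" using assms(1) a(1) by (simp add: prod.remove)
      finally show False using e by simp
    qed
  qed (auto intro: prod.cong)
qed


text \<open>The quotient (X^(n+1) - 1) / (X^n - 1) increases strictly for X > 1; the claim compares
  X with q, cross-multiplied. The difference of the sides is (X - 1)(q - 1) times the sum over i < n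
  of X^i q^i (q^(n-i) - X^(n-i)), whose term i = 0 is already positive for X < q.\<close>

lemma quotient_strict_mono:
  fixes X q :: real
  assumes "1 < X" "X \<le> q" "n \<ge> 1"
  shows "(X ^ Suc n - 1) * (q ^ n - 1) \<le> (X ^ n - 1) * (q ^ Suc n - 1)"
    "(X ^ Suc n - 1) * (q ^ n - 1) = (X ^ n - 1) * (q ^ Suc n - 1) \<Longrightarrow> X = q"
proof -
  define A where "A = (\<Sum>i<n. X ^ i)"
  define B where "B = (\<Sum>i<n. q ^ i)"
  have A: "X ^ n - 1 = (X - 1) * A" "X ^ Suc n - 1 = (X - 1) * (A + X ^ n)"
    unfolding A_def using power_diff_1_eq[of X n] power_diff_1_eq[of X "Suc n"] by simp_all
  have B: "q ^ n - 1 = (q - 1) * B" "q ^ Suc n - 1 = (q - 1) * (B + q ^ n)"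
    unfolding B_def using power_diff_1_eq[of q n] power_diff_1_eq[of q "Suc n"] by simp_all
  have dif: "(X ^ n - 1) * (q ^ Suc n - 1) - (X ^ Suc n - 1) * (q ^ n - 1) = (X - 1) * (q - 1) * (A * q ^ n - B * X ^ n)"
    unfolding A B by (simp add: algebra_simps)
  have AB: "A * q ^ n - B * X ^ n = (\<Sum>i<n. X ^ i * q ^ i * (q ^ (n - i) - X ^ (n - i)))"
    unfolding A_def B_def sum_distrib_right sum_subtractf[symmetric]
  proof (rule sum.cong)
    fix i assume "i \<in> {..<n}"
    then have "q ^ n = q ^ i * q ^ (n - i)" "X ^ n = X ^ i * X ^ (n - i)" by (simp_all flip: power_add)
    then show "X ^ i * q ^ n - q ^ i * X ^ n = X ^ i * q ^ i * (q ^ (n - i) - X ^ (n - i))" by (simp add: algebra_simps)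
  qed simp
  have nn: "X ^ i * q ^ i * (q ^ (n - i) - X ^ (n - i)) \<ge> 0" for i
    using assms by (intro mult_nonneg_nonneg) (auto intro: power_mono)
  have ge: "A * q ^ n - B * X ^ n \<ge> 0" unfolding AB by (rule sum_nonneg) (rule nn)
  then have "(X - 1) * (q - 1) * (A * q ^ n - B * X ^ n) \<ge> 0" using assms by (intro mult_nonneg_nonneg) auto
  then show "(X ^ Suc n - 1) * (q ^ n - 1) \<le> (X ^ n - 1) * (q ^ Suc n - 1)" using dif by linarith
  show "X = q" if eq: "(X ^ Suc n - 1) * (q ^ n - 1) = (X ^ n - 1) * (q ^ Suc n - 1)"
  proof (rule ccontr)
    assume "X \<noteq> q"
    then have lt: "X < q" using assms by simp
    have "X ^ 0 * q ^ 0 * (q ^ (n - 0) - X ^ (n - 0)) > 0" using power_strict_mono[OF lt, of n] assms by simp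
    then have "A * q ^ n - B * X ^ n > 0" unfolding AB using assms(3) nn
      by (intro sum_pos2[of "{..<n}" 0]) auto
    then have "(X - 1) * (q - 1) * (A * q ^ n - B * X ^ n) > 0" using assms by simp
    then show False using dif eq by simp
  qed
qed

text \<open>The Euler factor at a prime of norm \<open>q\<close> and exponent \<open>d\<close> in D.
  The weights enter with power n + 1, while the bound to be reached is the n-th power of the last
  one.\<close>

definition local_factor :: "nat \<Rightarrow> real \<Rightarrow> (nat \<Rightarrow> real) \<Rightarrow> nat \<Rightarrow> real" where
  "local_factor n q l d = (\<Sum>b\<le>d. l b ^ (n + 1) / q ^ b *
     (\<Sum>a\<le>d - b. (if a = 0 then 1 else if a = 1 then -1 else 0) / q ^ a *
        (if a + b = 0 then 1 else (q ^ (n + 1) - q) / (q ^ (n + 1) - 1))))"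

lemma moebius_sum:
  fixes q :: real and f :: "nat \<Rightarrow> real"
  shows "(\<Sum>a\<le>m. (if a = 0 then 1 else if a = 1 then -1 else 0) / q ^ a * f a) = f 0 - (if m = 0 then 0 else f 1 / q)"
proof (cases m)
  case (Suc j)
  have "(\<Sum>a\<le>m. (if a = 0 then 1 else if a = 1 then -1 else 0) / q ^ a * f a) =
     (\<Sum>a\<in>{0,1}. (if a = 0 then 1 else if a = 1 then -1 else 0) / q ^ a * f a)"
    by (rule sum.mono_neutral_right) (auto simp: Suc)
  then show ?thesis by (simp add: Suc)
qed simp

text \<open>Only a = 0 and a = 1 survive the Moebius weights. An exponent b < d gets the factor 1 -
  1/q, b = d the factor 1, and the summand 1 - \<rho> corrects the single pair a = b = 0, where P
  divides neither ideal.\<close>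

lemma local_factor_eq:
  fixes q :: real
  assumes q: "q > 1" and n: "n \<ge> 1" and l: "l 0 = 1"
  defines "\<rho> \<equiv> (q ^ (n + 1) - q) / (q ^ (n + 1) - 1)"
  shows "local_factor n q l d = 1 - \<rho> + \<rho> * (l d ^ (n+1) / q ^ d + (1 - 1 / q) * (\<Sum>b<d. l b ^ (n+1) / q ^ b))"
proof -
  have t: "l b ^ (n + 1) / q ^ b * (\<Sum>a\<le>d - b. (if a = 0 then 1 else if a = 1 then -1 else 0) / q ^ a * (if a + b = 0 then 1 else \<rho>))
      = (l b ^ (n+1) / q ^ b) * \<rho> * (if b = d then 1 else 1 - 1 / q) + (if b = 0 then 1 - \<rho> else 0)" if "b \<le> d" for b
  proof -
    define w where "w = l b ^ (n + 1) / q ^ b"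
    have "b = 0 \<Longrightarrow> w = 1" by (simp add: w_def l)
    then show ?thesis unfolding moebius_sum w_def[symmetric] using that by (auto simp: algebra_simps)
  qed
  have "local_factor n q l d = (\<Sum>b\<le>d. (l b ^ (n+1) / q ^ b) * \<rho> * (if b = d then 1 else 1 - 1 / q) + (if b = 0 then 1 - \<rho> else 0))"
    unfolding local_factor_def \<rho>_def[symmetric] using t by (intro sum.cong) auto
  also have "\<dots> = (\<Sum>b\<le>d. (l b ^ (n+1) / q ^ b) * \<rho> * (if b = d then 1 else 1 - 1 / q)) + (1 - \<rho>)"
    by (simp add: sum.distrib sum.delta)
  also have "(\<Sum>b\<le>d. (l b ^ (n+1) / q ^ b) * \<rho> * (if b = d then 1 else 1 - 1 / q)) =
      (\<Sum>b<d. (l b ^ (n+1) / q ^ b) * \<rho> * (1 - 1 / q)) + (l d ^ (n+1) / q ^ d) * \<rho>"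
    unfolding lessThan_Suc_atMost[symmetric] by simp
  also have "(\<Sum>b<d. (l b ^ (n+1) / q ^ b) * \<rho> * (1 - 1 / q)) = \<rho> * (1 - 1 / q) * (\<Sum>b<d. l b ^ (n+1) / q ^ b)"
    by (simp add: sum_distrib_left mult_ac)
  finally show ?thesis by (simp add: algebra_simps)
qed

text \<open>With \<open>X = l (Suc d) / l d \<in> {1..q}\<close>, passing from \<open>d\<close> to \<open>Suc d\<close> increases the factor by
  \<open>\<rho> q\<^bsup>-d-1\<^esup> l(d)\<^bsup>n+1\<^esup> (X\<^bsup>n+1\<^esup> - 1)\<close>, at most \<open>l(d)\<^sup>n (X\<^sup>n - 1)\<close> because \<open>l d \<le> q\<^sup>d\<close>.\<close>
lemma local_factor_step:
  fixes q :: real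
  assumes q: "q > 1" and n: "n \<ge> 1" and l: "l 0 = 1" and ld: "0 < l d" "l d \<le> q ^ d" "l d \<le> l (Suc d)" "l (Suc d) \<le> q * l d"
  shows "local_factor n q l (Suc d) - local_factor n q l d \<le> l (Suc d) ^ n - l d ^ n"
    "local_factor n q l (Suc d) - local_factor n q l d = l (Suc d) ^ n - l d ^ n
      \<longleftrightarrow> l (Suc d) = l d \<or> (l d = q ^ d \<and> l (Suc d) = q ^ Suc d)"
proof -
  define \<rho> where "\<rho> = (q ^ (n + 1) - q) / (q ^ (n + 1) - 1)"
  define X where "X = l (Suc d) / l d"
  have X: "1 \<le> X" "X \<le> q" unfolding X_def using ld by (simp_all add: field_simps)
  have lX: "l (Suc d) = X * l d" unfolding X_def using ld by simp
  have qn: "q ^ Suc n > 1" "q ^ n > 1"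
    by (rule one_less_power[OF q], simp) (rule one_less_power[OF q], use n in simp)
  have \<rho>: "\<rho> = q * (q ^ n - 1) / (q ^ Suc n - 1)" unfolding \<rho>_def by (simp add: algebra_simps)
  have \<rho>0: "\<rho> > 0" unfolding \<rho> using qn q by simp
  define y where "y = l d"
  have y: "y > 0" "y \<le> q ^ d" using ld y_def by auto
  have "local_factor n q l (Suc d) - local_factor n q l d =
     \<rho> * (l (Suc d) ^ (n+1) / q ^ Suc d - l d ^ (n+1) / q ^ d + (1 - 1 / q) * (l d ^ (n+1) / q ^ d))"
    unfolding local_factor_eq[where l = l, OF q n l] \<rho>_def[symmetric] by (simp add: algebra_simps)
  also have "\<dots> = \<rho> * (l (Suc d) ^ (n+1) - l d ^ (n+1)) / q ^ Suc d" using q by (simp add: field_simps)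
  also have "\<dots> = \<rho> * y ^ n * (X ^ (n+1) - 1) * (y / q ^ d) / q"
    unfolding lX power_mult_distrib y_def[symmetric] using q by (simp add: field_simps)
  finally have dif: "local_factor n q l (Suc d) - local_factor n q l d = \<rho> * y ^ n * (X ^ (n+1) - 1) * (y / q ^ d) / q" .
  have rhs: "l (Suc d) ^ n - l d ^ n = y ^ n * (X ^ n - 1)" unfolding lX power_mult_distrib y_def by (simp add: algebra_simps)
  have yq: "y / q ^ d \<le> 1" "y / q ^ d > 0" using y q by (simp_all add: field_simps)
  have X1: "X ^ (n+1) - 1 \<ge> 0" using one_le_power[OF X(1), of "n + 1"] by simp
  \<comment> \<open>\<open>Z\<close> is the increment divided by \<open>y ^ n\<close> in the extreme
    case y = q^d; in general a factor \<open>y / q ^ d\<close> is lost. The two losses, this one and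
    the one in Z \<le> X^n - 1, are tight separately, which gives the two conditions y = q^d and X =
    q unless X = 1.\<close>
  define Z where "Z = \<rho> / q * (X ^ (n+1) - 1)"
  have Z0: "Z \<ge> 0" unfolding Z_def using \<rho>0 q X1 by simp
  have dif': "local_factor n q l (Suc d) - local_factor n q l d = y ^ n * (Z * (y / q ^ d))"
    unfolding dif Z_def by (simp add: mult_ac)
  have Zeq: "Z = (q ^ n - 1) * (X ^ Suc n - 1) / (q ^ Suc n - 1)" unfolding Z_def \<rho> using q by simp
  have Z1: "Z \<le> X ^ n - 1"
  proof (cases "X = 1")
    case False
    then have "1 < X" using X by simp
    from quotient_strict_mono(1)[OF this X(2) n] show ?thesis unfolding Zeq using qn by (simp add: divide_le_eq mult.commute)
  qed (simp add: Z_def)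
  have Zy: "Z * (y / q ^ d) \<le> Z" by (rule mult_left_le[OF yq(1) Z0])
  have le: "Z * (y / q ^ d) \<le> X ^ n - 1" using Zy Z1 by (rule order_trans)
  then show "local_factor n q l (Suc d) - local_factor n q l d \<le> l (Suc d) ^ n - l d ^ n"
    unfolding dif' rhs using y by (intro mult_left_mono) auto
  have "local_factor n q l (Suc d) - local_factor n q l d = l (Suc d) ^ n - l d ^ n \<longleftrightarrow> Z * (y / q ^ d) = X ^ n - 1"
  proof -
    have "y ^ n \<noteq> 0" using y by simp
    then show ?thesis unfolding dif' rhs by (simp only: mult_cancel_left simp_thms)
  qed
  also have "\<dots> \<longleftrightarrow> X = 1 \<or> (y = q ^ d \<and> X = q)"
  proof
    assume e: "Z * (y / q ^ d) = X ^ n - 1"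
    show "X = 1 \<or> (y = q ^ d \<and> X = q)"
    proof (cases "X = 1")
      case False
      then have X1: "1 < X" using X by simp
      have eq: "Z = X ^ n - 1" using e Z1 Zy by (metis order_antisym)
      have "X ^ n - 1 > 0" using one_less_power[OF X1, of n] n by simp
      then have "Z \<noteq> 0" using eq by linarith
      moreover have "Z * (y / q ^ d) = Z * 1" using e eq by (simp only: mult_1_right)
      ultimately have "y / q ^ d = 1" by (simp only: mult_cancel_left simp_thms)
      then have "y = q ^ d" using q by simp
      moreover have "X = q"
      proof (rule quotient_strict_mono(2)[OF X1 X(2) n])
        have "(q ^ n - 1) * (X ^ Suc n - 1) / (q ^ Suc n - 1) = X ^ n - 1" using eq Zeq by simp
        then show "(X ^ Suc n - 1) * (q ^ n - 1) = (X ^ n - 1) * (q ^ Suc n - 1)"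
          using qn by (simp add: divide_eq_eq mult.commute)
      qed
      ultimately show ?thesis by simp
    qed simp
  next
    assume "X = 1 \<or> (y = q ^ d \<and> X = q)"
    then show "Z * (y / q ^ d) = X ^ n - 1"
    proof
      assume "X = 1" then show ?thesis unfolding Z_def by simp
    next
      assume "y = q ^ d \<and> X = q"
      then show ?thesis unfolding Zeq using q qn by simp
    qed
  qed
  also have "\<dots> \<longleftrightarrow> l (Suc d) = l d \<or> (l d = q ^ d \<and> l (Suc d) = q ^ Suc d)"
    unfolding lX y_def using ld(1) q by auto
  finally show "local_factor n q l (Suc d) - local_factor n q l d = l (Suc d) ^ n - l d ^ n
      \<longleftrightarrow> l (Suc d) = l d \<or> (l d = q ^ d \<and> l (Suc d) = q ^ Suc d)" .
qed

text \<open>All steps of the telescoping sum are inequalities in the same direction and start from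
  equality at d = 0, so equality at \<open>d\<close> is equality in every step. Positivity comes
  from 1 - \<rho> > 0.\<close>

lemma local_factor_bound:
  fixes q :: real
  assumes q: "q > 1" and n: "n \<ge> 1" and l: "l 0 = 1" "\<And>b. l b \<le> l (Suc b)" "\<And>b. l (Suc b) \<le> q * l b"
  shows "local_factor n q l d \<le> l d ^ n" "local_factor n q l d > 0"
    "local_factor n q l d = l d ^ n \<longleftrightarrow> (\<forall>b<d. l (Suc b) = l b \<or> (l b = q ^ b \<and> l (Suc b) = q ^ Suc b))"
proof -
  have lb: "1 \<le> l b \<and> l b \<le> q ^ b" for b
  proof (induction b)
    case (Suc b)
    have "q * l b \<le> q * q ^ b" using Suc q by simp
    then show ?case using l(2,3)[of b] Suc by simp
  qed (simp add: l)
  have pos: "0 < l b" for b using lb[of b] by linarith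
  note st = local_factor_step[where n = n and l = l and q = q, OF q n l(1) pos _ l(2,3)]
  have lf0: "local_factor n q l 0 = 1" unfolding local_factor_def by (simp add: l)
  have main: "local_factor n q l d \<le> l d ^ n \<and> (local_factor n q l d = l d ^ n \<longleftrightarrow>
      (\<forall>b<d. l (Suc b) = l b \<or> (l b = q ^ b \<and> l (Suc b) = q ^ Suc b)))"
  proof (induction d)
    case 0 then show ?case by (simp add: lf0 l(1))
  next
    case (Suc d)
    have a: "local_factor n q l (Suc d) - local_factor n q l d \<le> l (Suc d) ^ n - l d ^ n" using st(1) lb by blast
    have "local_factor n q l (Suc d) = l (Suc d) ^ n \<longleftrightarrow> local_factor n q l d = l d ^ n \<and>
        local_factor n q l (Suc d) - local_factor n q l d = l (Suc d) ^ n - l d ^ n"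
      using a Suc by linarith
    then show ?case using a Suc st(2)[of d] lb[of d] by (auto simp: less_Suc_eq)
  qed
  then show "local_factor n q l d \<le> l d ^ n" "local_factor n q l d = l d ^ n \<longleftrightarrow> (\<forall>b<d. l (Suc b) = l b \<or> (l b = q ^ b \<and> l (Suc b) = q ^ Suc b))"
    by blast+
  define \<rho> where "\<rho> = (q ^ (n + 1) - q) / (q ^ (n + 1) - 1)"
  have qn: "q ^ (n + 1) > 1" by (rule one_less_power[OF q]) simp
  have "q ^ 1 \<le> q ^ (n + 1)" using q by (intro power_increasing) auto
  then have "0 \<le> \<rho>" "\<rho> < 1" unfolding \<rho>_def using qn q by (simp_all add: divide_less_eq)
  moreover have "l d ^ (n+1) / q ^ d + (1 - 1 / q) * (\<Sum>b<d. l b ^ (n+1) / q ^ b) \<ge> 0"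
    using pos q by (intro add_nonneg_nonneg mult_nonneg_nonneg sum_nonneg divide_nonneg_nonneg zero_le_power) (auto intro: less_imp_le)
  ultimately have "1 - \<rho> + \<rho> * (l d ^ (n+1) / q ^ d + (1 - 1 / q) * (\<Sum>b<d. l b ^ (n+1) / q ^ b)) > 0"
    by (intro add_pos_nonneg mult_nonneg_nonneg) auto
  then show "local_factor n q l d > 0" unfolding local_factor_eq[where l = l, OF q n l(1)] \<rho>_def .
qed

section \<open>Volumes of height bodies\<close>

text \<open>The expression keeps the shape of the function inside \<open>V_arch\<close>, so that the
  two are identified by unfolding, while places and local degrees become an abstract index set with
  weights.\<close>

definition height_gauge :: "'w set \<Rightarrow> ('w \<Rightarrow> real) \<Rightarrow> ('w \<Rightarrow> real) \<Rightarrow> nat \<Rightarrow> (nat \<Rightarrow> real) \<Rightarrow> real" where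
  "height_gauge W t c n az = (\<Prod>w\<in>W. (Max ({az 0} \<union> {t w * az i |i. i \<in> {1..n}})) powr c w)"

definition gauge_body :: "'w set \<Rightarrow> ('w \<Rightarrow> real) \<Rightarrow> ('w \<Rightarrow> real) \<Rightarrow> nat \<Rightarrow> (nat \<Rightarrow> 'a::euclidean_space) set" where
  "gauge_body W t c n = {z \<in> {0..n} \<rightarrow>\<^sub>E UNIV. height_gauge W t c n (\<lambda>i. norm (z i)) < 1}"

definition gmean :: "'w set \<Rightarrow> ('w \<Rightarrow> real) \<Rightarrow> ('w \<Rightarrow> real) \<Rightarrow> real" where
  "gmean W t c = (\<Prod>w\<in>W. t w powr c w)"

lemma measure_PiE_lborel:
  fixes X :: "nat \<Rightarrow> 'a::euclidean_space set"
  assumes "finite I" "\<And>i. i \<in> I \<Longrightarrow> X i \<in> sets lborel" "\<And>i. i \<in> I \<Longrightarrow> emeasure lborel (X i) \<noteq> \<infinity>"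
  shows "measure (PiM I (\<lambda>_. lborel)) (PiE I X) = (\<Prod>i\<in>I. measure lborel (X i))"
    "emeasure (PiM I (\<lambda>_. lborel)) (PiE I X) \<noteq> \<infinity>" "PiE I X \<in> sets (PiM I (\<lambda>_. lborel))"
proof -
  interpret product_sigma_finite "\<lambda>_::nat. lborel :: 'a measure" by standard
  have "emeasure (PiM I (\<lambda>_. lborel)) (PiE I X) = (\<Prod>i\<in>I. emeasure lborel (X i))"
    by (rule emeasure_PiM) (use assms in auto)
  also have "\<dots> = (\<Prod>i\<in>I. ennreal (measure lborel (X i)))"
    by (rule prod.cong) (use assms(3) in \<open>auto simp: emeasure_eq_ennreal_measure\<close>)
  also have "\<dots> = ennreal (\<Prod>i\<in>I. measure lborel (X i))" by (rule prod_ennreal) simp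
  finally have e: "emeasure (PiM I (\<lambda>_. lborel)) (PiE I X) = ennreal (\<Prod>i\<in>I. measure lborel (X i))" .
  show "emeasure (PiM I (\<lambda>_. lborel)) (PiE I X) \<noteq> \<infinity>" unfolding e by simp
  show "measure (PiM I (\<lambda>_. lborel)) (PiE I X) = (\<Prod>i\<in>I. measure lborel (X i))"
    unfolding measure_def[of "PiM I (\<lambda>_. lborel)"] e by (simp add: prod_nonneg)
  show "PiE I X \<in> sets (PiM I (\<lambda>_. lborel))" by (rule sets_PiM_I_finite) (use assms in auto)
qed

lemma measure_ball_0:
  assumes "r \<ge> 0"
  shows "measure lborel (ball (0::'a::euclidean_space) r) = unit_ball_vol (real DIM('a)) * r ^ DIM('a)"
    "emeasure lborel (ball (0::'a) r) \<noteq> \<infinity>"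
  using emeasure_ball[OF assms, of "0::'a"] assms by (simp_all add: measure_def)

lemma measure_annulus_pos:
  assumes "0 < s" "s < 1" "r > 0"
  shows "measure lborel (ball (0::'a::euclidean_space) r - ball 0 (s * r)) > 0"
    "emeasure lborel (ball (0::'a) r - ball 0 (s * r)) \<noteq> \<infinity>"
proof -
  have sub: "ball (0::'a) (s * r) \<subseteq> ball 0 r" using assms by (intro subset_ball) simp
  have "measure lborel (ball (0::'a) r - ball 0 (s * r)) = measure lborel (ball (0::'a) r) - measure lborel (ball (0::'a) (s * r))"
    using sub measure_ball_0(2)[of r] assms(3) by (intro measure_Diff) (auto simp: less_top)
  also have "\<dots> = unit_ball_vol (real DIM('a)) * (r ^ DIM('a) - (s * r) ^ DIM('a))"
    using assms by (simp add: measure_ball_0 right_diff_distrib)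
  also have "(s * r) ^ DIM('a) < r ^ DIM('a)" using assms by (intro power_strict_mono) auto
  then have "unit_ball_vol (real DIM('a)) * (r ^ DIM('a) - (s * r) ^ DIM('a)) > 0" by simp
  finally show "measure lborel (ball (0::'a) r - ball 0 (s * r)) > 0" .
  have "emeasure lborel (ball (0::'a) r - ball 0 (s * r)) \<le> emeasure lborel (ball (0::'a) r)"
    by (rule emeasure_mono) auto
  then show "emeasure lborel (ball (0::'a) r - ball 0 (s * r)) \<noteq> \<infinity>"
    using measure_ball_0(2)[of r, where 'a = 'a] assms(3) by (metis infinity_ennreal_def less_imp_le neq_top_trans)
qed

section \<open>The height body at one place compared with a product of balls\<close>

context
  fixes W :: "'w set" and t c :: "'w \<Rightarrow> real" and n :: nat
  assumes W: "finite W" and t: "\<And>w. w \<in> W \<Longrightarrow> t w > 0" and c: "\<And>w. w \<in> W \<Longrightarrow> c w > 0"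
    and c1: "(\<Sum>w\<in>W. c w) = 1" and n: "n \<ge> 1"
begin

abbreviation mx :: "'w \<Rightarrow> (nat \<Rightarrow> real) \<Rightarrow> real" where
  "mx w az \<equiv> Max ({az 0} \<union> {t w * az i |i. i \<in> {1..n}})"

lemma fin_mx: "finite ({az 0} \<union> {t w * az i |i. i \<in> {1..n}})"
  by (rule finite_UnI) (auto simp: setcompr_eq_image[of "\<lambda>i. t w * az i" "\<lambda>i. i \<in> {1..n}"])

lemma mx_ge: "az 0 \<le> mx w az" "i \<in> {1..n} \<Longrightarrow> t w * az i \<le> mx w az"
  using fin_mx[of az w] by (auto intro!: Max_ge)

lemma prod_powr_const: "x \<ge> 0 \<Longrightarrow> (\<Prod>w\<in>W. x powr c w) = x"
proof -
  assume x: "x \<ge> 0"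
  show ?thesis
  proof (cases "x = 0")
    case True
    have "W \<noteq> {}" using c1 by auto
    then show ?thesis using True W by auto
  next
    case False
    then have "(\<Prod>w\<in>W. x powr c w) = x powr (\<Sum>w\<in>W. c w)" using W by (simp add: powr_sum)
    then show ?thesis using c1 x by simp
  qed
qed

lemma t_powr_pos: "w \<in> W \<Longrightarrow> t w powr c w > 0"
  using t[of w] by simp

lemma gmean_pos: "gmean W t c > 0"
  unfolding gmean_def using t_powr_pos by (intro prod_pos) blast

text \<open>For each w any nonnegative lower bound of the maximum may be chosen. Coordinate 0
  throughout, one fixed coordinate i throughout, or a mixture of both yield the three estimates
  below.\<close>

lemma gauge_ge:
  assumes "\<And>w. w \<in> W \<Longrightarrow> 0 \<le> f w \<and> f w \<le> mx w az"
  shows "(\<Prod>w\<in>W. f w powr c w) \<le> height_gauge W t c n az"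
  unfolding height_gauge_def
proof (rule prod_mono)
  fix w assume w: "w \<in> W"
  show "0 \<le> f w powr c w \<and> f w powr c w \<le> mx w az powr c w"
    using assms[OF w] c[OF w] by (auto intro!: powr_mono2)
qed

lemma gauge_ge_0: "az 0 \<ge> 0 \<Longrightarrow> az 0 \<le> height_gauge W t c n az"
  using gauge_ge[of "\<lambda>_. az 0" az] prod_powr_const[of "az 0"] mx_ge(1) by simp

lemma gauge_ge_i:
  assumes "i \<in> {1..n}" "az i \<ge> 0" shows "gmean W t c * az i \<le> height_gauge W t c n az"
proof -
  have "gmean W t c * az i = (\<Prod>w\<in>W. (t w * az i) powr c w)"
    using prod_powr_const[OF assms(2)] t assms(2) unfolding gmean_def
    by (simp add: powr_mult less_imp_le prod.distrib cong: prod.cong)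
  also have "\<dots> \<le> height_gauge W t c n az"
  proof (rule gauge_ge)
    fix w assume w: "w \<in> W"
    have "0 \<le> t w * az i" using t[OF w] assms(2) by simp
    then show "0 \<le> t w * az i \<and> t w * az i \<le> mx w az" using mx_ge(2)[OF assms(1)] by blast
  qed
  finally show ?thesis .
qed

lemma gauge_body_measurable:
  "(gauge_body W t c n :: (nat \<Rightarrow> 'a::euclidean_space) set) \<in> sets (PiM {0..n} (\<lambda>_. lborel))"
proof -
  \<comment> \<open>Coordinate 0 receives the coefficient 1 and joins the others, so that the
    maximum runs over one indexed finite family of measurable functions.\<close>
  have mx: "mx w az = Max ((\<lambda>i. (if i = 0 then 1 else t w) * az i) ` {0..n})" for w az
  proof -
    have "(\<lambda>i. (if i = 0 then 1 else t w) * az i) ` {1..n} = (\<lambda>i. t w * az i) ` {1..n}"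
      by (intro image_cong) auto
    moreover have "{0..n} = insert 0 {1..n}" by auto
    ultimately have "(\<lambda>i. (if i = 0 then 1 else t w) * az i) ` {0..n} = insert (az 0) ((\<lambda>i. t w * az i) ` {1..n})" by simp
    also have "\<dots> = {az 0} \<union> {t w * az i |i. i \<in> {1..n}}" by blast
    finally show ?thesis by simp
  qed
  have nm: "(\<lambda>z. norm (z i :: 'a)) \<in> borel_measurable (PiM {0..n} (\<lambda>_. lborel))" if "i \<in> {0..n}" for i
    by (rule measurable_compose[OF measurable_component_singleton[OF that]]) simp
  have gauge_mx: "height_gauge W t c n az = (\<Prod>w\<in>W. Max ((\<lambda>i. (if i = 0 then 1 else t w) * az i) ` {0..n}) powr c w)" for az
    unfolding height_gauge_def by (intro prod.cong refl) (simp only: mx[of az])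
  have "(\<lambda>z. height_gauge W t c n (\<lambda>i. norm (z i :: 'a))) \<in> borel_measurable (PiM {0..n} (\<lambda>_. lborel))"
    unfolding gauge_mx
    by (intro borel_measurable_prod powr_real_measurable borel_measurable_Max borel_measurable_times borel_measurable_const nm) auto
  then have "{z \<in> space (PiM {0..n} (\<lambda>_. lborel)). height_gauge W t c n (\<lambda>i. norm (z i :: 'a)) < 1} \<in> sets (PiM {0..n} (\<lambda>_. lborel))"
    by measurable
  then show ?thesis unfolding gauge_body_def space_PiM by simp
qed

definition bounding_box :: "nat \<Rightarrow> 'a::euclidean_space set" where
  "bounding_box i = (if i = 0 then ball 0 1 else ball 0 (1 / gmean W t c))"

lemma gauge_body_subset: "gauge_body W t c n \<subseteq> PiE {0..n} bounding_box"
proof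
  fix z :: "nat \<Rightarrow> 'a" assume z: "z \<in> gauge_body W t c n"
  have "norm (z 0) < 1" using z gauge_ge_0[of "\<lambda>i. norm (z i)"] unfolding gauge_body_def by simp
  moreover have "norm (z i) < 1 / gmean W t c" if "i \<in> {1..n}" for i
  proof -
    have "gmean W t c * norm (z i) < 1"
      using z gauge_ge_i[OF that, of "\<lambda>i. norm (z i)"] unfolding gauge_body_def by simp
    then show ?thesis using gmean_pos by (simp add: pos_less_divide_eq mult.commute)
  qed
  ultimately show "z \<in> PiE {0..n} bounding_box"
    using z unfolding gauge_body_def bounding_box_def by (auto simp: PiE_def Pi_def)
qed

lemma measure_bounding_box:
  "measure (PiM {0..n} (\<lambda>_. lborel)) (PiE {0..n} (bounding_box :: nat \<Rightarrow> 'a::euclidean_space set)) =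
     unit_ball_vol (real DIM('a)) ^ (n + 1) / gmean W t c ^ (n * DIM('a))"
    "emeasure (PiM {0..n} (\<lambda>_. lborel)) (PiE {0..n} (bounding_box :: nat \<Rightarrow> 'a set)) \<noteq> \<infinity>"
    "PiE {0..n} (bounding_box :: nat \<Rightarrow> 'a set) \<in> sets (PiM {0..n} (\<lambda>_. lborel))"
proof -
  define u where "u = unit_ball_vol (real DIM('a))"
  define g where "g = gmean W t c"
  have g: "g > 0" using gmean_pos g_def by simp
  have b: "bounding_box i \<in> sets (lborel :: 'a measure)" "emeasure lborel (bounding_box i :: 'a set) \<noteq> \<infinity>" for i
    unfolding bounding_box_def using measure_ball_0(2)[of 1] measure_ball_0(2)[of "1 / g"] g unfolding g_def by auto
  note m = measure_PiE_lborel[of "{0..n}" "bounding_box :: nat \<Rightarrow> 'a set", OF _ b]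
  have "measure (PiM {0..n} (\<lambda>_. lborel)) (PiE {0..n} (bounding_box :: nat \<Rightarrow> 'a set)) =
      (\<Prod>i\<in>{0..n}. measure lborel (bounding_box i :: 'a set))" by (rule m(1)) simp
  also have "\<dots> = (\<Prod>i\<in>{0..n}. if i = 0 then u else u * (1 / g) ^ DIM('a))"
    unfolding bounding_box_def u_def g_def[symmetric] using g by (intro prod.cong) (auto simp: measure_ball_0)
  also have "\<dots> = u * (u * (1 / g) ^ DIM('a)) ^ n"
    by (simp add: prod.atLeast_Suc_atMost[of 0 n])
  also have "\<dots> = u ^ (n + 1) / g ^ (n * DIM('a))" using g by (simp add: power_mult_distrib power_divide power_mult mult.commute flip: power_mult)
  finally show "measure (PiM {0..n} (\<lambda>_. lborel)) (PiE {0..n} (bounding_box :: nat \<Rightarrow> 'a set)) =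
     unit_ball_vol (real DIM('a)) ^ (n + 1) / gmean W t c ^ (n * DIM('a))" unfolding u_def g_def .
  show "emeasure (PiM {0..n} (\<lambda>_. lborel)) (PiE {0..n} (bounding_box :: nat \<Rightarrow> 'a set)) \<noteq> \<infinity>" by (rule m(2)) simp
  show "PiE {0..n} (bounding_box :: nat \<Rightarrow> 'a set) \<in> sets (PiM {0..n} (\<lambda>_. lborel))" by (rule m(3)) simp
qed

text \<open>If all \<open>t w\<close> equal the mean, the maxima are the same for all w, and since
  the weights sum to 1 the gauge is this common maximum.\<close>

lemma gauge_body_equal:
  assumes eq: "\<And>w. w \<in> W \<Longrightarrow> t w = gmean W t c"
  shows "gauge_body W t c n = PiE {0..n} bounding_box"
proof (rule antisym[OF gauge_body_subset], rule subsetI)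
  fix z :: "nat \<Rightarrow> 'a" assume z: "z \<in> PiE {0..n} bounding_box"
  define g where "g = gmean W t c"
  have g: "g > 0" using gmean_pos g_def by simp
  have z0: "norm (z 0) < 1" using z PiE_mem[OF z, of 0] unfolding bounding_box_def by simp
  have zi: "g * norm (z i) < 1" if "i \<in> {1..n}" for i
  proof -
    have "z i \<in> bounding_box i" using PiE_mem[OF z, of i] that by simp
    then have "norm (z i) < 1 / g" using that unfolding bounding_box_def g_def by simp
    then show ?thesis using g by (simp add: pos_less_divide_eq mult.commute)
  qed
  define x where "x = Max ({norm (z 0)} \<union> {g * norm (z i) |i. i \<in> {1..n}})"
  have fin: "finite ({norm (z 0)} \<union> {g * norm (z i) |i. i \<in> {1..n}})"
    by (rule finite_UnI) (auto simp: setcompr_eq_image[of "\<lambda>i. g * norm (z i)" "\<lambda>i. i \<in> {1..n}"])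
  have x: "0 \<le> x" "x < 1"
  proof -
    show "x < 1" unfolding x_def using fin z0 zi by (subst Max_less_iff) auto
    have "norm (z 0) \<le> x" unfolding x_def using fin by (intro Max_ge) auto
    then show "0 \<le> x" using norm_ge_zero order_trans by blast
  qed
  have "height_gauge W t c n (\<lambda>i. norm (z i)) = (\<Prod>w\<in>W. x powr c w)"
    unfolding height_gauge_def x_def g_def using eq by (intro prod.cong) auto
  then have "height_gauge W t c n (\<lambda>i. norm (z i)) < 1" using prod_powr_const x by simp
  then show "z \<in> gauge_body W t c n" using z unfolding gauge_body_def by (auto simp: PiE_def)
qed

text \<open>If no \<open>t w\<close> exceeded the mean, one that differs from it would be strictly
  smaller and would pull the mean below itself.\<close>

lemma ex_above_gmean:
  assumes "\<not> (\<forall>w\<in>W. t w = gmean W t c)"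
  shows "\<exists>w\<in>W. t w > gmean W t c"
proof (rule ccontr)
  define g where "g = gmean W t c"
  have g: "g > 0" using gmean_pos g_def by simp
  assume "\<not> (\<exists>w\<in>W. t w > gmean W t c)"
  then have le: "t w \<le> g" if "w \<in> W" for w using that unfolding g_def by force
  obtain w0 where w0: "w0 \<in> W" "t w0 \<noteq> g" using assms g_def by blast
  have lt: "t w0 powr c w0 < g powr c w0" using le[OF w0(1)] w0 t c by (intro powr_less_mono2) (auto intro: less_imp_le)
  have "gmean W t c = t w0 powr c w0 * (\<Prod>w\<in>W - {w0}. t w powr c w)"
    unfolding gmean_def using W w0 by (simp add: prod.remove)
  also have "\<dots> < g powr c w0 * (\<Prod>w\<in>W - {w0}. t w powr c w)"
    using lt t_powr_pos by (intro mult_strict_right_mono prod_pos) blast+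
  also have "\<dots> \<le> g powr c w0 * (\<Prod>w\<in>W - {w0}. g powr c w)"
  proof (intro mult_left_mono prod_mono conjI)
    fix w assume "w \<in> W - {w0}"
    then have w: "w \<in> W" by simp
    show "t w powr c w \<le> g powr c w" using le[OF w] t[OF w] c[OF w] by (intro powr_mono2) auto
  qed auto
  also have "\<dots> = (\<Prod>w\<in>W. g powr c w)" using W w0 by (simp add: prod.remove)
  also have "\<dots> = g" using prod_powr_const g by simp
  finally show False unfolding g_def by simp
qed

text \<open>Near the corner where all \<open>norm z\<^sub>i\<close> are maximal the gauge exceeds \<open>1\<close> if some \<open>t w\<close> exceeds the mean.\<close>
lemma gauge_body_misses_corner:
  assumes "\<not> (\<forall>w\<in>W. t w = gmean W t c)"
  obtains s where "0 < s" "s < 1"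
    "PiE {0..n} (\<lambda>i. if i = 0 then ball 0 1 - ball 0 (s * 1) else ball 0 (1 / gmean W t c) - ball 0 (s * (1 / gmean W t c)))
      \<inter> (gauge_body W t c n :: (nat \<Rightarrow> 'a::euclidean_space) set) = {}"
proof -
  define g where "g = gmean W t c"
  have g: "g > 0" using gmean_pos g_def by simp
  obtain w0 where w0: "w0 \<in> W" "t w0 > g" using ex_above_gmean[OF assms] g_def by blast
  \<comment> \<open>\<open>G\<close> is the gauge at norms 1 for coordinate 0 and 1 / g for all
    others. It exceeds 1, and by homogeneity shrinking these norms by the factor s = 1 / G still
    leaves a gauge of at least 1.\<close>
  define G where "G = (\<Prod>w\<in>W. max 1 (t w / g) powr c w)"
  have ge1: "max 1 (t w / g) powr c w \<ge> 1" if "w \<in> W" for w using c[OF that] by (intro ge_one_powr_ge_zero) auto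
  have "1 < max 1 (t w0 / g) powr c w0" using w0 g c by (intro gr_one_powr) auto
  moreover have "(\<Prod>w\<in>W - {w0}. max 1 (t w / g) powr c w) \<ge> 1" using ge1 by (intro prod_ge_1) auto
  moreover have "G = max 1 (t w0 / g) powr c w0 * (\<Prod>w\<in>W - {w0}. max 1 (t w / g) powr c w)"
    unfolding G_def using W w0 by (simp add: prod.remove)
  ultimately have G1: "G > 1" by (smt (verit, best) mult_less_cancel_left1 mult_le_cancel_left1)
  define s where "s = 1 / G"
  have s: "0 < s" "s < 1" unfolding s_def using G1 by auto
  show ?thesis
  proof (rule that[OF s], rule ccontr)
    assume "PiE {0..n} (\<lambda>i. if i = 0 then ball 0 1 - ball 0 (s * 1) else ball 0 (1 / gmean W t c) - ball 0 (s * (1 / gmean W t c)))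
      \<inter> (gauge_body W t c n :: (nat \<Rightarrow> 'a) set) \<noteq> {}"
    then obtain z :: "nat \<Rightarrow> 'a" where z: "z \<in> PiE {0..n} (\<lambda>i. if i = 0 then ball 0 1 - ball 0 (s * 1) else ball 0 (1 / g) - ball 0 (s * (1 / g)))"
      "z \<in> gauge_body W t c n" unfolding g_def by blast
    have z0: "norm (z 0) \<ge> s" using PiE_mem[OF z(1), of 0] by simp
    have z1: "norm (z 1) \<ge> s / g" using PiE_mem[OF z(1), of 1] n by simp
    have "s * G = (\<Prod>w\<in>W. s powr c w) * G" using prod_powr_const[of s] s by simp
    also have "\<dots> = (\<Prod>w\<in>W. (s * max 1 (t w / g)) powr c w)"
      unfolding G_def using s by (simp add: powr_mult prod.distrib)
    also have "\<dots> \<le> height_gauge W t c n (\<lambda>i. norm (z i))"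
    proof (rule gauge_ge)
      fix w assume w: "w \<in> W"
      have "s \<le> mx w (\<lambda>i. norm (z i))" using mx_ge(1)[of "\<lambda>i. norm (z i)" w] z0 by linarith
      moreover have "t w * (s / g) \<le> t w * norm (z 1)" using z1 t[OF w] by (intro mult_left_mono) auto
      then have "s * (t w / g) \<le> mx w (\<lambda>i. norm (z i))" using mx_ge(2)[of 1 w "\<lambda>i. norm (z i)"] n by (simp add: mult.commute)
      moreover have "s * max 1 (t w / g) = s \<or> s * max 1 (t w / g) = s * (t w / g)" by (auto simp: max_def)
      ultimately show "0 \<le> s * max 1 (t w / g) \<and> s * max 1 (t w / g) \<le> mx w (\<lambda>i. norm (z i))"
        using s by auto
    qed
    finally have "1 \<le> height_gauge W t c n (\<lambda>i. norm (z i))" unfolding s_def using G1 by simp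
    then show False using z(2) unfolding gauge_body_def by simp
  qed
qed

lemma measure_gauge_body:
  defines "M \<equiv> PiM {0..n} (\<lambda>_. lborel :: 'a::euclidean_space measure)"
  shows "measure M (gauge_body W t c n) \<le> unit_ball_vol (real DIM('a)) ^ (n + 1) / gmean W t c ^ (n * DIM('a))"
    "measure M (gauge_body W t c n) = unit_ball_vol (real DIM('a)) ^ (n + 1) / gmean W t c ^ (n * DIM('a))
      \<longleftrightarrow> (\<forall>w\<in>W. t w = gmean W t c)"
proof -
  define b where "b = (bounding_box :: nat \<Rightarrow> 'a set)"
  note box = measure_bounding_box[where 'a = 'a, folded M_def b_def]
  have meas: "gauge_body W t c n \<in> sets M" unfolding M_def by (rule gauge_body_measurable)
  have sub: "gauge_body W t c n \<subseteq> PiE {0..n} b" unfolding b_def by (rule gauge_body_subset)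
  have le: "measure M (gauge_body W t c n) \<le> measure M (PiE {0..n} b)"
    using meas box(2,3) sub by (intro measure_mono_fmeasurable) (auto simp: fmeasurable_def less_top)
  then show "measure M (gauge_body W t c n) \<le> unit_ball_vol (real DIM('a)) ^ (n + 1) / gmean W t c ^ (n * DIM('a))"
    using box(1) by simp
  have "measure M (gauge_body W t c n) = measure M (PiE {0..n} b) \<longleftrightarrow> (\<forall>w\<in>W. t w = gmean W t c)"
  proof
    assume "\<forall>w\<in>W. t w = gmean W t c"
    then show "measure M (gauge_body W t c n) = measure M (PiE {0..n} b)" unfolding b_def using gauge_body_equal by metis
  next
    assume e: "measure M (gauge_body W t c n) = measure M (PiE {0..n} b)"
    show "\<forall>w\<in>W. t w = gmean W t c"
    proof (rule ccontr)
      assume "\<not> (\<forall>w\<in>W. t w = gmean W t c)"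
      then obtain s where s: "0 < s" "s < 1"
        "PiE {0..n} (\<lambda>i. if i = 0 then ball 0 1 - ball 0 (s * 1) else ball 0 (1 / gmean W t c) - ball 0 (s * (1 / gmean W t c)))
          \<inter> (gauge_body W t c n :: (nat \<Rightarrow> 'a) set) = {}" by (rule gauge_body_misses_corner)
      \<comment> \<open>A corner of the box: a product of annuli, of positive volume, which the body
        misses entirely.\<close>
      define X where "X i = (if i = 0 then ball 0 1 - ball 0 (s * 1) else ball 0 (1 / gmean W t c) - ball (0::'a) (s * (1 / gmean W t c)))" for i :: nat
      have X: "X i \<in> sets lborel" "emeasure lborel (X i) \<noteq> \<infinity>" "measure lborel (X i) > 0" for i
        unfolding X_def using measure_annulus_pos[OF s(1,2), of 1, where 'a = 'a]
          measure_annulus_pos[OF s(1,2), of "1 / gmean W t c", where 'a = 'a] gmean_pos by auto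
      note mX = measure_PiE_lborel[of "{0..n}" X, OF _ X(1,2), folded M_def]
      have pos: "measure M (PiE {0..n} X) > 0" using mX(1) X(3) by (simp add: prod_pos)
      have Xb: "PiE {0..n} X \<subseteq> PiE {0..n} b" by (rule PiE_mono) (auto simp: X_def b_def bounding_box_def)
      have "PiE {0..n} X \<inter> gauge_body W t c n = {}" using s(3) unfolding X_def .
      then have "gauge_body W t c n \<subseteq> PiE {0..n} b - PiE {0..n} X" using sub by blast
      then have "measure M (gauge_body W t c n) \<le> measure M (PiE {0..n} b - PiE {0..n} X)"
        using meas box(2,3) mX(3) by (intro measure_mono_fmeasurable fmeasurable_Diff) (auto simp: fmeasurable_def less_top)
      also have "\<dots> = measure M (PiE {0..n} b) - measure M (PiE {0..n} X)"
        using box(2,3) mX(3) Xb by (intro measure_Diff) auto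
      finally show False using e pos by simp
    qed
  qed
  then show "measure M (gauge_body W t c n) = unit_ball_vol (real DIM('a)) ^ (n + 1) / gmean W t c ^ (n * DIM('a))
      \<longleftrightarrow> (\<forall>w\<in>W. t w = gmean W t c)" using box(1) by simp
qed

end

section \<open>Archimedean places as pairs of conjugate embeddings\<close>

lemma cnj_embedding:
  assumes "\<sigma> \<in> embeddings k" shows "cnj \<circ> \<sigma> \<in> embeddings k"
  using assms unfolding embeddings_def by auto

lemma cnj_cnj_comp: "cnj \<circ> (cnj \<circ> \<sigma>) = \<sigma>" by (auto simp: fun_eq_iff)

lemma arch_placesD:
  assumes v: "v \<in> arch_places k" and s: "\<sigma> \<in> v"
  shows "v = {\<sigma>, cnj \<circ> \<sigma>}" "\<sigma> \<in> embeddings k" "finite v" "card v = (if cnj \<circ> \<sigma> = \<sigma> then 1 else 2)"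
proof -
  obtain \<rho> where r: "\<rho> \<in> embeddings k" "v = {\<rho>, cnj \<circ> \<rho>}" using v unfolding arch_places_def by blast
  show e: "v = {\<sigma>, cnj \<circ> \<sigma>}" using r(2) s cnj_cnj_comp[of \<rho>] by auto
  show "\<sigma> \<in> embeddings k" using r s cnj_embedding by auto
  show "finite v" unfolding e by simp
  show "card v = (if cnj \<circ> \<sigma> = \<sigma> then 1 else 2)" unfolding e by auto
qed

lemma arch_place_nonempty: "v \<in> arch_places k \<Longrightarrow> place_emb v \<in> v"
proof -
  assume "v \<in> arch_places k"
  then obtain \<sigma> where "\<sigma> \<in> v" unfolding arch_places_def by blast
  then show ?thesis unfolding place_emb_def by (rule someI[of "\<lambda>\<sigma>. \<sigma> \<in> v"])
qed

lemma arch_abs_eq: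
  assumes "v \<in> arch_places k" "\<sigma> \<in> v" shows "arch_abs v x = cmod (\<sigma> x)"
proof -
  have "place_emb v \<in> {\<sigma>, cnj \<circ> \<sigma>}" using arch_place_nonempty[OF assms(1)] arch_placesD(1)[OF assms] by simp
  then show ?thesis unfolding arch_abs_def by auto
qed

lemma arch_places_disjoint:
  assumes "v \<in> arch_places k" "w \<in> arch_places k" "v \<noteq> w" shows "v \<inter> w = {}"
proof (rule ccontr)
  assume "v \<inter> w \<noteq> {}"
  then obtain \<sigma> where "\<sigma> \<in> v" "\<sigma> \<in> w" by blast
  then have "v = w" using arch_placesD(1)[OF assms(1)] arch_placesD(1)[OF assms(2)] by metis
  then show False using assms(3) by simp
qed

lemma Union_arch_places: "\<Union> (arch_places k) = embeddings k"
proof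
  show "\<Union> (arch_places k) \<subseteq> embeddings k" using arch_placesD(2) by blast
  show "embeddings k \<subseteq> \<Union> (arch_places k)" unfolding arch_places_def by blast
qed

lemma real_embedding_iff:
  assumes "\<sigma> \<in> embeddings k" shows "real_embedding k \<sigma> \<longleftrightarrow> cnj \<circ> \<sigma> = \<sigma>"
proof
  assume r: "real_embedding k \<sigma>"
  have "cnj (\<sigma> x) = \<sigma> x" for x
    using r embD(1)[OF assms] unfolding real_embedding_def by (cases "x \<in> k") (auto simp: Reals_cnj_iff)
  then show "cnj \<circ> \<sigma> = \<sigma>" by (auto simp: fun_eq_iff)
next
  assume e: "cnj \<circ> \<sigma> = \<sigma>"
  have "cnj (\<sigma> x) = \<sigma> x" for x using fun_cong[OF e, of x] by simp
  then show "real_embedding k \<sigma>" unfolding real_embedding_def by (simp add: Reals_cnj_iff)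
qed

text \<open>The normalizing constant of \<open>V_const\<close> counts real embeddings, while the
  volumes are indexed by places; this matches the two.\<close>

lemma card_real_embeddings:
  "card {\<sigma>\<in>embeddings k. real_embedding k \<sigma>} = card {v\<in>arch_places k. real_place v}"
proof -
  have "{v\<in>arch_places k. real_place v} = (\<lambda>\<sigma>. {\<sigma>}) ` {\<sigma>\<in>embeddings k. real_embedding k \<sigma>}"
  proof (intro equalityI subsetI)
    fix v assume "v \<in> {v\<in>arch_places k. real_place v}"
    then have v: "v \<in> arch_places k" "card v = 1" unfolding real_place_def by auto
    define \<sigma> where "\<sigma> = place_emb v"
    have s: "\<sigma> \<in> v" unfolding \<sigma>_def by (rule arch_place_nonempty[OF v(1)])
    have c: "cnj \<circ> \<sigma> = \<sigma>"
    proof (rule ccontr)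
      assume "cnj \<circ> \<sigma> \<noteq> \<sigma>"
      then show False using arch_placesD(4)[OF v(1) s] v(2) by simp
    qed
    have e: "\<sigma> \<in> embeddings k" by (rule arch_placesD(2)[OF v(1) s])
    have "v = {\<sigma>}" using arch_placesD(1)[OF v(1) s] unfolding c by simp
    moreover have "real_embedding k \<sigma>" using real_embedding_iff[OF e] c by simp
    ultimately show "v \<in> (\<lambda>\<sigma>. {\<sigma>}) ` {\<sigma>\<in>embeddings k. real_embedding k \<sigma>}" using e by blast
  next
    fix v assume "v \<in> (\<lambda>\<sigma>. {\<sigma>}) ` {\<sigma>\<in>embeddings k. real_embedding k \<sigma>}"
    then obtain \<sigma> where s: "\<sigma> \<in> embeddings k" "real_embedding k \<sigma>" "v = {\<sigma>}" by blast
    then have "cnj \<circ> \<sigma> = \<sigma>" using real_embedding_iff by blast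
    then have "v = {\<sigma>, cnj \<circ> \<sigma>}" using s(3) by simp
    then have "v \<in> arch_places k" unfolding arch_places_def using s(1) by blast
    then show "v \<in> {v\<in>arch_places k. real_place v}" using s(3) unfolding real_place_def by simp
  qed
  then show ?thesis by (simp add: card_image)
qed

text \<open>The rationals are dense in the reals and have their usual absolute value at every
  \<open>v\<close>, so rational approximations of \<open>x\<close> form a Cauchy sequence for
  \<open>v\<close> with limiting value \<open>x\<close>.\<close>

lemma nonneg_in_completion_abs_values:
  assumes k: "subfield_C k" and v: "v \<in> arch_places k" and x: "x \<ge> 0"
  shows "x \<in> completion_abs_values k (arch_abs v)"
proof -
  define \<sigma> where "\<sigma> = place_emb v"
  have s: "\<sigma> \<in> v" "\<sigma> \<in> embeddings k"
    unfolding \<sigma>_def using arch_place_nonempty[OF v] arch_placesD(2)[OF v] by auto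
  define r where "r j = of_int \<lfloor>x * real (Suc j)\<rfloor> / real (Suc j)" for j
  define a where "a j = complex_of_real (r j)" for j
  have aQ: "a j \<in> \<rat>" for j unfolding a_def r_def by simp
  have ab: "arch_abs v y = cmod y" if "y \<in> \<rat>" for y
    using arch_abs_eq[OF v s(1), of y] emb_field(8)[OF s(2) k that] by simp
  have "norm (x - r j) < 1 / real (Suc j)" for j
  proof -
    have "x * real (Suc j) - 1 < of_int \<lfloor>x * real (Suc j)\<rfloor>" "of_int \<lfloor>x * real (Suc j)\<rfloor> \<le> x * real (Suc j)" by linarith+
    then have "\<bar>x * real (Suc j) - of_int \<lfloor>x * real (Suc j)\<rfloor>\<bar> < 1" by linarith
    moreover have "x - r j = (x * real (Suc j) - of_int \<lfloor>x * real (Suc j)\<rfloor>) / real (Suc j)"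
      unfolding r_def by (simp add: diff_divide_distrib)
    ultimately show ?thesis by (simp add: divide_strict_right_mono)
  qed
  then have "(\<lambda>j. x - r j) \<longlonglongrightarrow> 0" by (rule LIMSEQ_norm_0)
  from tendsto_diff[OF tendsto_const[of x] this] have r: "r \<longlonglongrightarrow> x" by simp
  then have al: "a \<longlonglongrightarrow> of_real x" unfolding a_def by (rule tendsto_of_real)
  then have "Cauchy a" by (rule LIMSEQ_imp_Cauchy)
  then have "\<forall>e>0. \<exists>N. \<forall>m\<ge>N. \<forall>j\<ge>N. arch_abs v (a m - a j) < e"
    unfolding Cauchy_def dist_norm using ab aQ by simp
  moreover have "(\<lambda>j. arch_abs v (a j)) \<longlonglongrightarrow> x"
    using tendsto_norm[OF al] x ab aQ by simp
  moreover have "\<forall>j. a j \<in> k" using aQ subfield_Rats[OF k] by blast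
  ultimately show ?thesis unfolding completion_abs_values_def by blast
qed

section \<open>Archimedean places of K above a place of k\<close>

context simple_extension begin

definition "Wv v = {w\<in>arch_places K. arch_above k w v}"
definition "cw v w = real (arch_local_degree w v) / real m"

lemma restrict_cnj: "restrict_emb k (cnj \<circ> \<tau>) = cnj \<circ> restrict_emb k \<tau>"
  unfolding restrict_emb_def by (auto simp: fun_eq_iff)

lemma finite_embeddings: "finite (embeddings k)" "finite (embeddings K)"
proof -
  have "finite (embeddings F)" if "number_field F" for F
    using number_field_nfd[OF that] unfolding nfd_def by blast
  then show "finite (embeddings k)" "finite (embeddings K)" using number_field_k adj(1) by blast+
qed

lemma finite_arch_places: "finite (arch_places k)" "finite (arch_places K)"
  unfolding arch_places_def using finite_embeddings by auto

lemma above_all: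
  assumes v: "v \<in> arch_places k" and w: "w \<in> arch_places K" "arch_above k w v" and t: "\<tau> \<in> w"
  shows "restrict_emb k \<tau> \<in> v"
proof -
  obtain \<rho> where r: "\<rho> \<in> w" "restrict_emb k \<rho> \<in> v" using w(2) unfolding arch_above_def by blast
  then have "v = {restrict_emb k \<rho>, cnj \<circ> restrict_emb k \<rho>}" using arch_placesD(1)[OF v] by blast
  moreover have "\<tau> = \<rho> \<or> \<tau> = cnj \<circ> \<rho>" using arch_placesD(1)[OF w(1) r(1)] t by blast
  ultimately show ?thesis using restrict_cnj by auto
qed

lemma Union_Wv:
  assumes v: "v \<in> arch_places k"
  shows "\<Union> (Wv v) = {\<tau>\<in>embeddings K. restrict_emb k \<tau> \<in> v}"
proof (intro equalityI subsetI)
  fix \<tau> assume "\<tau> \<in> \<Union> (Wv v)"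
  then show "\<tau> \<in> {\<tau>\<in>embeddings K. restrict_emb k \<tau> \<in> v}"
    using above_all[OF v] arch_placesD(2) unfolding Wv_def by blast
next
  fix \<tau> assume "\<tau> \<in> {\<tau>\<in>embeddings K. restrict_emb k \<tau> \<in> v}"
  then have "{\<tau>, cnj \<circ> \<tau>} \<in> Wv v" unfolding Wv_def arch_places_def arch_above_def by auto
  then show "\<tau> \<in> \<Union> (Wv v)" by blast
qed

lemma card_above:
  assumes v: "v \<in> arch_places k" shows "card {\<tau>\<in>embeddings K. restrict_emb k \<tau> \<in> v} = m * card v"
proof -
  have vE: "v \<subseteq> embeddings k" using Union_arch_places v by blast
  have "{\<tau>\<in>embeddings K. restrict_emb k \<tau> \<in> v} = (\<Union>\<sigma>\<in>v. ext k K \<sigma>)" unfolding ext_def by auto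
  also have "card \<dots> = (\<Sum>\<sigma>\<in>v. card (ext k K \<sigma>))"
  proof (rule card_UN_disjoint)
    show "finite v" using vE finite_embeddings finite_subset by blast
    show "\<forall>i\<in>v. finite (ext k K i)" using adj(5) vE by blast
    show "\<forall>i\<in>v. \<forall>j\<in>v. i \<noteq> j \<longrightarrow> ext k K i \<inter> ext k K j = {}" unfolding ext_def by blast
  qed
  also have "\<dots> = (\<Sum>\<sigma>\<in>v. m)" using adj(5) vE by (intro sum.cong) auto
  finally show ?thesis by simp
qed

lemma finite_Wv: "finite (Wv v)" unfolding Wv_def using finite_arch_places by simp

text \<open>A real place is one embedding, a complex place two, and no real place lies above a
  complex one. In this form local degrees become numbers of embeddings.\<close>

lemma local_degree_card:
  assumes v: "v \<in> arch_places k" and w: "w \<in> Wv v"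
  shows "arch_local_degree w v * card v = card w"
proof -
  have w': "w \<in> arch_places K" "arch_above k w v" using w unfolding Wv_def by auto
  define \<tau> where "\<tau> = place_emb w"
  have t: "\<tau> \<in> w" unfolding \<tau>_def by (rule arch_place_nonempty[OF w'(1)])
  define \<sigma> where "\<sigma> = restrict_emb k \<tau>"
  have s: "\<sigma> \<in> v" unfolding \<sigma>_def by (rule above_all[OF v w' t])
  have imp: "cnj \<circ> \<tau> = \<tau> \<Longrightarrow> cnj \<circ> \<sigma> = \<sigma>" unfolding \<sigma>_def restrict_cnj[symmetric] by (simp only:)
  have cv: "card v = (if cnj \<circ> \<sigma> = \<sigma> then 1 else 2)" by (rule arch_placesD(4)[OF v s])
  have cw: "card w = (if cnj \<circ> \<tau> = \<tau> then 1 else 2)" by (rule arch_placesD(4)[OF w'(1) t])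
  consider "card v = 1" "card w = 1" | "card v = 1" "card w = 2" | "card v = 2" "card w = 2"
    using imp cv cw by presburger
  then show ?thesis unfolding arch_local_degree_def real_place_def by cases simp_all
qed

lemma card_place_pos: "v \<in> arch_places F \<Longrightarrow> card v > 0"
  using arch_placesD(4)[of v F "place_emb v"] arch_place_nonempty[of v F] by simp

lemma cw_eq: "v \<in> arch_places k \<Longrightarrow> w \<in> Wv v \<Longrightarrow> cw v w = real (card w) / (real m * real (card v))"
proof -
  assume v: "v \<in> arch_places k" and w: "w \<in> Wv v"
  have "real (card w) = real (arch_local_degree w v) * real (card v)"
    unfolding local_degree_card[OF v w, symmetric] by simp
  then show ?thesis unfolding cw_def using card_place_pos[OF v] by simp
qed

lemma WvD: "w \<in> Wv v \<Longrightarrow> w \<in> arch_places K" unfolding Wv_def by simp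

lemma cw_pos:
  assumes "v \<in> arch_places k" "w \<in> Wv v" shows "cw v w > 0"
proof -
  have "card v > 0" "card w > 0" "m > 0"
    using card_place_pos[OF assms(1)] card_place_pos[OF WvD[OF assms(2)]] adj(2) by auto
  then show ?thesis unfolding cw_eq[OF assms] by simp
qed

lemma disjoint_Wv: "w \<in> Wv v \<Longrightarrow> w' \<in> Wv v \<Longrightarrow> w \<noteq> w' \<Longrightarrow> w \<inter> w' = {}"
  by (rule arch_places_disjoint[OF WvD WvD])

lemma finite_place: "w \<in> arch_places F \<Longrightarrow> finite w"
  using arch_placesD(3)[of w F "place_emb w"] arch_place_nonempty[of w F] by simp

text \<open>The embeddings of K above v are m times as many as those in v; distributing them over
  the places w gives the weights.\<close>

lemma sum_cw:
  assumes v: "v \<in> arch_places k" shows "(\<Sum>w\<in>Wv v. cw v w) = 1"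
proof -
  have "(\<Sum>w\<in>Wv v. cw v w) = (\<Sum>w\<in>Wv v. real (card w)) / (real m * real (card v))"
    unfolding sum_divide_distrib by (intro sum.cong refl cw_eq[OF v])
  also have "(\<Sum>w\<in>Wv v. real (card w)) = real (card (\<Union> (Wv v)))"
  proof -
    have "pairwise disjnt (Wv v)" unfolding pairwise_def disjnt_def using disjoint_Wv by blast
    moreover have "finite w" if "w \<in> Wv v" for w using that finite_place[of w K] unfolding Wv_def by simp
    ultimately show ?thesis by (simp add: card_Union_disjoint)
  qed
  also have "\<dots> = real m * real (card v)" unfolding Union_Wv[OF v] card_above[OF v] by simp
  finally show ?thesis using card_place_pos[OF v] adj(2) by simp
qed

lemma Wv_abs_pos:
  assumes "\<theta> \<noteq> 0" "w \<in> Wv v" shows "arch_abs w \<theta> > 0"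
proof -
  have w: "w \<in> arch_places K" using assms unfolding Wv_def by simp
  note t = arch_place_nonempty[OF w]
  show ?thesis unfolding arch_abs_eq[OF w t] using emb_field(4)[OF arch_placesD(2)[OF w t] subfield_K adj(4) assms(1)] by simp
qed

definition "gm v = gmean (Wv v) (\<lambda>w. arch_abs w \<theta>) (cw v)"

text \<open>The power \<open>card v\<close>, the real dimension of the completion, removes the
  distinction between real and complex places: each embedding above v enters with the same exponent
  1 / m.\<close>

lemma gm_pow:
  assumes v: "v \<in> arch_places k" and th: "\<theta> \<noteq> 0"
  shows "gm v ^ card v = (\<Prod>\<tau>\<in>\<Union> (Wv v). cmod (\<tau> \<theta>) powr (1 / real m))"
proof -
  have "gm v ^ card v = (\<Prod>w\<in>Wv v. (arch_abs w \<theta> powr (1 / real m)) ^ card w)"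
    unfolding gm_def gmean_def prod_power_distrib
  proof (rule prod.cong)
    fix w assume w: "w \<in> Wv v"
    have p: "arch_abs w \<theta> > 0" by (rule Wv_abs_pos[OF th w])
    have "(arch_abs w \<theta> powr cw v w) ^ card v = arch_abs w \<theta> powr (cw v w * real (card v))"
      using p by (simp add: powr_powr flip: powr_realpow)
    also have "cw v w * real (card v) = (1 / real m) * real (card w)" using cw_eq[OF v w] card_place_pos[OF v] by simp
    also have "arch_abs w \<theta> powr \<dots> = (arch_abs w \<theta> powr (1 / real m)) ^ card w"
      using p by (simp add: powr_powr flip: powr_realpow)
    finally show "(arch_abs w \<theta> powr cw v w) ^ card v = (arch_abs w \<theta> powr (1 / real m)) ^ card w" .
  qed simp
  also have "\<dots> = (\<Prod>w\<in>Wv v. \<Prod>\<tau>\<in>w. cmod (\<tau> \<theta>) powr (1 / real m))"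
  proof (rule prod.cong)
    fix w assume "w \<in> Wv v"
    then have w: "w \<in> arch_places K" unfolding Wv_def by simp
    have "(\<Prod>\<tau>\<in>w. cmod (\<tau> \<theta>) powr (1 / real m)) = (\<Prod>\<tau>\<in>w. arch_abs w \<theta> powr (1 / real m))"
      using arch_abs_eq[OF w] by (intro prod.cong) auto
    then show "(arch_abs w \<theta> powr (1 / real m)) ^ card w = (\<Prod>\<tau>\<in>w. cmod (\<tau> \<theta>) powr (1 / real m))" by simp
  qed simp
  also have "\<dots> = (\<Prod>\<tau>\<in>\<Union> (Wv v). cmod (\<tau> \<theta>) powr (1 / real m))"
  proof (rule prod.Union_disjoint[symmetric, unfolded comp_def])
    show "\<forall>w\<in>Wv v. finite w" using finite_place[of _ K] unfolding Wv_def by simp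
    show "\<forall>w\<in>Wv v. \<forall>w'\<in>Wv v. w \<noteq> w' \<longrightarrow> w \<inter> w' = {}" using disjoint_Wv by blast
  qed
  finally show ?thesis .
qed

lemma prod_gm:
  assumes th: "\<theta> \<noteq> 0"
  shows "(\<Prod>v\<in>arch_places k. gm v ^ card v) = cnorm K \<theta> powr (1 / real m)"
proof -
  have "(\<Prod>v\<in>arch_places k. gm v ^ card v) =
      (\<Prod>v\<in>arch_places k. \<Prod>\<tau>\<in>{\<tau>\<in>embeddings K. restrict_emb k \<tau> \<in> v}. cmod (\<tau> \<theta>) powr (1 / real m))"
    using gm_pow[OF _ th] Union_Wv by (intro prod.cong) auto
  also have "\<dots> = (\<Prod>\<tau>\<in>(\<Union>v\<in>arch_places k. {\<tau>\<in>embeddings K. restrict_emb k \<tau> \<in> v}). cmod (\<tau> \<theta>) powr (1 / real m))"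
  proof (rule prod.UNION_disjoint[symmetric])
    show "\<forall>i\<in>arch_places k. finite {\<tau>\<in>embeddings K. restrict_emb k \<tau> \<in> i}" using finite_embeddings by simp
    show "\<forall>i\<in>arch_places k. \<forall>j\<in>arch_places k. i \<noteq> j \<longrightarrow>
        {\<tau>\<in>embeddings K. restrict_emb k \<tau> \<in> i} \<inter> {\<tau>\<in>embeddings K. restrict_emb k \<tau> \<in> j} = {}"
      using arch_places_disjoint[of _ k] by blast
  qed (rule finite_arch_places)
  also have "(\<Union>v\<in>arch_places k. {\<tau>\<in>embeddings K. restrict_emb k \<tau> \<in> v}) = embeddings K"
    using restrict_emb_embedding[OF subfield_k adj(3)] Union_arch_places[of k] by blast
  also have "(\<Prod>\<tau>\<in>embeddings K. cmod (\<tau> \<theta>) powr (1 / real m)) = cnorm K \<theta> powr (1 / real m)"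
    unfolding cnorm_def by (simp add: prod_powr_distrib)
  finally show ?thesis .
qed

lemma V_arch_gauge:
  "V_arch k \<theta> n v = (if real_place v
     then measure (Pi\<^sub>M {0..n} (\<lambda>_. (lborel :: real measure))) (gauge_body (Wv v) (\<lambda>w. arch_abs w \<theta>) (cw v) n)
     else measure (Pi\<^sub>M {0..n} (\<lambda>_. (lborel :: complex measure))) (gauge_body (Wv v) (\<lambda>w. arch_abs w \<theta>) (cw v) n))"
proof -
  have F: "(\<Prod>w\<in>{w \<in> arch_places (adjoin k \<theta>). arch_above k w v}.
        (Max ({az 0} \<union> {arch_abs w \<theta> * az i |i. i \<in> {1..n}}))
          powr (real (arch_local_degree w v) / real (ext_degree k (adjoin k \<theta>)))) =
      height_gauge (Wv v) (\<lambda>w. arch_abs w \<theta>) (cw v) n az" for az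
    unfolding height_gauge_def Wv_def cw_def m_def K_def by (rule refl)
  show ?thesis unfolding V_arch_def Let_def gauge_body_def real_norm_def F[symmetric] by (rule refl)
qed

text \<open>2 and pi are the volumes of the unit balls of R and C, and \<open>card v\<close> is the
  real dimension of the completion.\<close>

definition "Vbound n v = (if real_place v then 2 else pi) ^ (n + 1) / gm v ^ (n * card v)"

lemma V_arch_bound:
  assumes v: "v \<in> arch_places k" and th: "\<theta> \<noteq> 0" and n: "n \<ge> 1"
  shows "V_arch k \<theta> n v \<le> Vbound n v" "V_arch k \<theta> n v \<ge> 0" "Vbound n v > 0"
    "V_arch k \<theta> n v = Vbound n v \<longleftrightarrow> (\<exists>x\<in>completion_abs_values k (arch_abs v).
         \<forall>w\<in>arch_places K. arch_above k w v \<longrightarrow> arch_abs w \<theta> = x)"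
proof -
  note W = finite_Wv[of v] and t = Wv_abs_pos[OF th, of _ v] and c = cw_pos[OF v] and c1 = sum_cw[OF v]
  note mr = measure_gauge_body[where W = "Wv v" and t = "\<lambda>w. arch_abs w \<theta>" and c = "cw v" and n = n and 'a = real,
      OF W t c c1 n, folded gm_def]
  note mc = measure_gauge_body[where W = "Wv v" and t = "\<lambda>w. arch_abs w \<theta>" and c = "cw v" and n = n and 'a = complex,
      OF W t c c1 n, folded gm_def]
  have cv: "card v = (if real_place v then 1 else 2)"
    using arch_placesD(4)[OF v arch_place_nonempty[OF v]] unfolding real_place_def by auto
  have u2: "unit_ball_vol 2 = pi" by (simp add: eval_unit_ball_vol)
  have gp: "gm v > 0" unfolding gm_def using gmean_pos[OF W t c c1 n] .
  show "V_arch k \<theta> n v \<le> Vbound n v" unfolding V_arch_gauge Vbound_def using mr(1) mc(1) cv u2 by simp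
  show "V_arch k \<theta> n v \<ge> 0" unfolding V_arch_gauge by simp
  show "Vbound n v > 0" unfolding Vbound_def using gp by simp
  have eq: "V_arch k \<theta> n v = Vbound n v \<longleftrightarrow> (\<forall>w\<in>Wv v. arch_abs w \<theta> = gm v)"
    unfolding V_arch_gauge Vbound_def using mr(2) mc(2) cv u2 by simp
  show "V_arch k \<theta> n v = Vbound n v \<longleftrightarrow> (\<exists>x\<in>completion_abs_values k (arch_abs v).
         \<forall>w\<in>arch_places K. arch_above k w v \<longrightarrow> arch_abs w \<theta> = x)"
    unfolding eq
  proof
    assume "\<forall>w\<in>Wv v. arch_abs w \<theta> = gm v"
    moreover have "gm v \<in> completion_abs_values k (arch_abs v)"
      using nonneg_in_completion_abs_values[OF subfield_k v] gp by simp
    ultimately show "\<exists>x\<in>completion_abs_values k (arch_abs v).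
         \<forall>w\<in>arch_places K. arch_above k w v \<longrightarrow> arch_abs w \<theta> = x" unfolding Wv_def by blast
  next
    assume "\<exists>x\<in>completion_abs_values k (arch_abs v).
         \<forall>w\<in>arch_places K. arch_above k w v \<longrightarrow> arch_abs w \<theta> = x"
    then obtain x where x: "\<forall>w\<in>Wv v. arch_abs w \<theta> = x" unfolding Wv_def by blast
    have "Wv v \<noteq> {}" using c1 by auto
    then obtain w where w: "w \<in> Wv v" by blast
    then have x0: "x > 0" using x t[OF w] by simp
    have "gm v = (\<Prod>w\<in>Wv v. x powr cw v w)" unfolding gm_def gmean_def using x by (intro prod.cong) auto
    also have "\<dots> = x powr (\<Sum>w\<in>Wv v. cw v w)" using x0 W by (simp add: powr_sum)
    finally have "gm v = x" using c1 x0 by simp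
    then show "\<forall>w\<in>Wv v. arch_abs w \<theta> = gm v" using x by simp
  qed
qed

text \<open>The normalization cancels the ball volumes place by place. What remains of the product
  of the bounds is 1 / X^n, because the powers \<open>gm v ^ card v\<close> multiply to X.\<close>

lemma V_const_bound:
  assumes th: "\<theta> \<noteq> 0" and n: "n \<ge> 1"
  defines "X \<equiv> cnorm K \<theta> powr (1 / real m)"
  shows "V_const k \<theta> n * X ^ n \<le> 1" "V_const k \<theta> n * X ^ n \<ge> 0"
    "V_const k \<theta> n * X ^ n = 1 \<longleftrightarrow> (\<forall>v\<in>arch_places k. \<exists>x\<in>completion_abs_values k (arch_abs v).
         \<forall>w\<in>arch_places K. arch_above k w v \<longrightarrow> arch_abs w \<theta> = x)"
proof -
  define Z where "Z = (2 ^ card {\<sigma>\<in>embeddings k. real_embedding k \<sigma>} * pi ^ card {v\<in>arch_places k. \<not> real_place v}) ^ (n + 1)"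
  have Z0: "Z > 0" unfolding Z_def by simp
  have "(\<Prod>v\<in>arch_places k. if real_place v then 2 else pi) =
      2 ^ card {v\<in>arch_places k. real_place v} * pi ^ card {v\<in>arch_places k. \<not> real_place v}"
    using finite_arch_places(1) by (simp add: prod.If_cases Int_def Collect_neg_eq Diff_eq)
  then have ZZ: "Z = (\<Prod>v\<in>arch_places k. (if real_place v then 2 else pi) ^ (n + 1))"
    unfolding Z_def card_real_embeddings prod_power_distrib[symmetric] by simp
  have Xn: "X ^ n = (\<Prod>v\<in>arch_places k. gm v ^ (n * card v))"
    unfolding X_def prod_gm[OF th, symmetric] prod_power_distrib
    by (intro prod.cong refl) (simp add: power_mult[symmetric] mult.commute)
  have gp: "gm v > 0" if "v \<in> arch_places k" for v
    unfolding gm_def using gmean_pos[OF finite_Wv Wv_abs_pos[OF th] cw_pos[OF that] sum_cw[OF that] n] .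
  have X0: "X ^ n > 0" unfolding Xn using gp by (intro prod_pos) auto
  have PB: "(\<Prod>v\<in>arch_places k. Vbound n v) = Z / X ^ n"
    unfolding ZZ Xn Vbound_def by (simp add: prod_dividef)
  have V: "V_const k \<theta> n * X ^ n = (\<Prod>v\<in>arch_places k. V_arch k \<theta> n v) / (Z / X ^ n)"
    unfolding V_const_def Z_def[symmetric] by simp
  note b = V_arch_bound[OF _ th n]
  have pl: "(\<Prod>v\<in>arch_places k. V_arch k \<theta> n v) \<le> (\<Prod>v\<in>arch_places k. Vbound n v)"
    "(\<Prod>v\<in>arch_places k. V_arch k \<theta> n v) = (\<Prod>v\<in>arch_places k. Vbound n v) \<longleftrightarrow>
      (\<forall>v\<in>arch_places k. V_arch k \<theta> n v = Vbound n v)"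
    by (rule prod_le_eq_iff[OF finite_arch_places(1)]; use b(1-3) in blast)+
  have ZX: "Z / X ^ n > 0" using Z0 X0 by simp
  show "V_const k \<theta> n * X ^ n \<le> 1" unfolding V pos_divide_le_eq[OF ZX] using pl(1) unfolding PB by simp
  show "V_const k \<theta> n * X ^ n \<ge> 0" unfolding V using b(2) ZX by (intro divide_nonneg_pos prod_nonneg) auto
  have "V_const k \<theta> n * X ^ n = 1 \<longleftrightarrow> (\<Prod>v\<in>arch_places k. V_arch k \<theta> n v) = Z / X ^ n"
    unfolding V divide_eq_1_iff using ZX by (metis less_irrefl)
  also have "\<dots> \<longleftrightarrow> (\<forall>v\<in>arch_places k. V_arch k \<theta> n v = Vbound n v)" using pl(2) unfolding PB .
  also have "\<dots> \<longleftrightarrow> (\<forall>v\<in>arch_places k. \<exists>x\<in>completion_abs_values k (arch_abs v).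
         \<forall>w\<in>arch_places K. arch_above k w v \<longrightarrow> arch_abs w \<theta> = x)" using b(4) by blast
  finally show "V_const k \<theta> n * X ^ n = 1 \<longleftrightarrow> (\<forall>v\<in>arch_places k. \<exists>x\<in>completion_abs_values k (arch_abs v).
         \<forall>w\<in>arch_places K. arch_above k w v \<longrightarrow> arch_abs w \<theta> = x)" .
qed

end

section \<open>The divisor sum\<close>

text \<open>Every gap between two exponents would contribute an additional factor of at least
  2.\<close>

lemma prod_power_eq_imp:
  fixes f x y :: "'b \<Rightarrow> nat"
  assumes "finite A" "\<And>a. a \<in> A \<Longrightarrow> f a \<ge> 2" "\<And>a. a \<in> A \<Longrightarrow> x a \<le> y a"
    and e: "(\<Prod>a\<in>A. f a ^ x a) = (\<Prod>a\<in>A. f a ^ y a)"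
  shows "\<forall>a\<in>A. x a = y a"
proof
  fix a assume a: "a \<in> A"
  have "(\<Prod>a\<in>A. f a ^ y a) = (\<Prod>a\<in>A. f a ^ x a * f a ^ (y a - x a))"
    using assms(3) by (intro prod.cong) (auto simp flip: power_add)
  then have "(\<Prod>a\<in>A. f a ^ x a) * 1 = (\<Prod>a\<in>A. f a ^ x a) * (\<Prod>a\<in>A. f a ^ (y a - x a))"
    using e by (simp add: prod.distrib)
  moreover have "(\<Prod>a\<in>A. f a ^ x a) \<noteq> 0" using assms(1,2) by fastforce
  ultimately have "1 = (\<Prod>a\<in>A. f a ^ (y a - x a))" by (simp only: mult_cancel1 simp_thms)
  from this[symmetric] have "f a ^ (y a - x a) = 1" using assms(1) a by (simp only: prod_eq_1_iff) 
  then have "y a - x a = 0" using assms(2)[OF a] by (cases "y a - x a") auto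
  then show "x a = y a" using assms(3)[OF a] by simp
qed

context simple_extension begin

abbreviation nR where "nR \<equiv> ideal_norm R"
abbreviation nS where "nS \<equiv> ideal_norm S"

text \<open>\<open>ei\<close> is the ramification index of Q over the prime below it. Since the
  exponent of a sum of ideals is the minimum of the exponents, \<open>lw D P b\<close> is the P-part
  of the norm of D + P^b O_K.\<close>

definition ei where "ei Q = S.vl Q (ex (Q \<inter> R))"
definition lw where "lw D P b = (\<Prod>Q\<in>above P. nS Q ^ min (S.vl Q D) (ei Q * b))"
definition lf where "lf D P b = real (lw D P b) powr (1 / real m)"

lemma ei_above: "is_prime_ideal R P \<Longrightarrow> Q \<in> above P \<Longrightarrow> ei Q = S.vl Q (ex P) \<and> ei Q > 0 \<and> is_prime_ideal S Q"
  using e_pos[of P Q] unfolding ei_def above_def by simp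

lemma nS_ge_2: "is_prime_ideal R P \<Longrightarrow> Q \<in> above P \<Longrightarrow> nS Q \<ge> 2"
  using S.norm_pr_ge_2 unfolding above_def by simp

lemma prod_ei:
  assumes P: "is_prime_ideal R P" shows "(\<Prod>Q\<in>above P. nS Q ^ (ei Q * b)) = nR P ^ (m * b)"
proof -
  have "(\<Prod>Q\<in>above P. nS Q ^ (ei Q * b)) = (\<Prod>Q\<in>above P. nS Q ^ S.vl Q (ex P)) ^ b"
    unfolding prod_power_distrib using ei_above[OF P] by (intro prod.cong) (auto simp: power_mult)
  then show ?thesis using prod_above[OF P] by (simp add: power_mult)
qed

lemma lw_pos: "is_prime_ideal R P \<Longrightarrow> lw D P b > 0"
  unfolding lw_def using nS_ge_2 by (intro prod_pos) fastforce

lemma powr_root: "x > 0 \<Longrightarrow> (x ^ (m * b)) powr (1 / real m) = x ^ b" for x :: real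
  using adj(2) by (simp add: powr_powr flip: powr_realpow)

text \<open>When b grows by 1, each exponent grows by at most \<open>ei Q\<close>, and the product
  of the N(Q)^(ei Q) is N(P)^m, whose m-th root is N(P). The two equivalences describe the extreme
  cases: no minimum is cut off by D, or no exponent moves.\<close>

lemma lf_local:
  assumes P: "is_prime_ideal R P"
  shows "lf D P 0 = 1" "lf D P b \<le> lf D P (Suc b)" "lf D P (Suc b) \<le> real (nR P) * lf D P b"
    "lf D P b = real (nR P) ^ b \<longleftrightarrow> (\<forall>Q\<in>above P. ei Q * b \<le> S.vl Q D)"
    "lf D P (Suc b) = lf D P b \<longleftrightarrow> (\<forall>Q\<in>above P. min (S.vl Q D) (ei Q * Suc b) = min (S.vl Q D) (ei Q * b))"
proof -
  note fin = finite_above[OF P]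
  have q: "real (nR P) > 0" using R.norm_pr_ge_2[OF P] by simp
  have inj: "real x powr (1 / real m) = real y powr (1 / real m) \<longleftrightarrow> x = y" if "x > 0" "y > 0" for x y :: nat
  proof
    assume "real x powr (1 / real m) = real y powr (1 / real m)"
    then have "(real x powr (1 / real m)) powr m = (real y powr (1 / real m)) powr m" by simp
    then show "x = y" using that adj(2) by (simp add: powr_powr)
  qed simp
  show "lf D P 0 = 1" unfolding lf_def lw_def by simp
  have "lw D P b \<le> lw D P (Suc b)" unfolding lw_def
    using nS_ge_2[OF P] by (intro prod_mono) (fastforce intro!: power_increasing)
  then show "lf D P b \<le> lf D P (Suc b)" unfolding lf_def by (intro powr_mono2) auto
  have "lw D P (Suc b) \<le> (\<Prod>Q\<in>above P. nS Q ^ (min (S.vl Q D) (ei Q * b) + ei Q * 1))" unfolding lw_def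
    using nS_ge_2[OF P] by (intro prod_mono) (fastforce intro!: power_increasing)
  also have "\<dots> = lw D P b * nR P ^ (m * 1)" unfolding power_add prod.distrib prod_ei[OF P] lw_def ..
  finally have "real (lw D P (Suc b)) \<le> real (lw D P b) * real (nR P) ^ (m * 1)" by (simp flip: of_nat_mult of_nat_power)
  then have "lf D P (Suc b) \<le> (real (lw D P b) * real (nR P) ^ (m * 1)) powr (1 / real m)"
    unfolding lf_def by (intro powr_mono2) auto
  also have "\<dots> = lf D P b * real (nR P) ^ 1" unfolding lf_def
    by (subst powr_mult) (use powr_root[OF q, of 1] in auto)
  finally show "lf D P (Suc b) \<le> real (nR P) * lf D P b" by (simp add: mult.commute)
  have "lf D P b = real (nR P) ^ b \<longleftrightarrow> lw D P b = nR P ^ (m * b)"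
  proof -
    have root: "real (nR P) ^ b = real (nR P ^ (m * b)) powr (1 / real m)" using powr_root[OF q, of b] by simp
    show ?thesis unfolding lf_def root by (rule inj) (use lw_pos[OF P] q in auto)
  qed
  also have "\<dots> \<longleftrightarrow> (\<forall>Q\<in>above P. ei Q * b \<le> S.vl Q D)"
  proof
    assume "lw D P b = nR P ^ (m * b)"
    then have "(\<Prod>Q\<in>above P. nS Q ^ min (S.vl Q D) (ei Q * b)) = (\<Prod>Q\<in>above P. nS Q ^ (ei Q * b))"
      unfolding prod_ei[OF P] lw_def .
    from prod_power_eq_imp[OF fin nS_ge_2[OF P] _ this]
    have "\<forall>Q\<in>above P. min (S.vl Q D) (ei Q * b) = ei Q * b" by simp
    then show "\<forall>Q\<in>above P. ei Q * b \<le> S.vl Q D" by (metis min.cobounded1)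
  next
    assume "\<forall>Q\<in>above P. ei Q * b \<le> S.vl Q D"
    then have "\<forall>Q\<in>above P. min (S.vl Q D) (ei Q * b) = ei Q * b" by simp
    then show "lw D P b = nR P ^ (m * b)" unfolding prod_ei[OF P, symmetric] lw_def by (intro prod.cong) auto
  qed
  finally show "lf D P b = real (nR P) ^ b \<longleftrightarrow> (\<forall>Q\<in>above P. ei Q * b \<le> S.vl Q D)" .
  have "lf D P (Suc b) = lf D P b \<longleftrightarrow> lw D P b = lw D P (Suc b)"
    unfolding lf_def using inj[OF lw_pos[OF P] lw_pos[OF P]] by auto
  also have "\<dots> \<longleftrightarrow> (\<forall>Q\<in>above P. min (S.vl Q D) (ei Q * Suc b) = min (S.vl Q D) (ei Q * b))"
  proof
    assume "lw D P b = lw D P (Suc b)"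
    from prod_power_eq_imp[OF fin nS_ge_2[OF P] _ this[unfolded lw_def]]
    have "\<forall>Q\<in>above P. min (S.vl Q D) (ei Q * b) = min (S.vl Q D) (ei Q * Suc b)" by (simp add: min.coboundedI2)
    then show "\<forall>Q\<in>above P. min (S.vl Q D) (ei Q * Suc b) = min (S.vl Q D) (ei Q * b)" by simp
  next
    assume "\<forall>Q\<in>above P. min (S.vl Q D) (ei Q * Suc b) = min (S.vl Q D) (ei Q * b)"
    then show "lw D P b = lw D P (Suc b)" unfolding lw_def by (intro prod.cong) auto
  qed
  finally show "lf D P (Suc b) = lf D P b \<longleftrightarrow> (\<forall>Q\<in>above P. min (S.vl Q D) (ei Q * Suc b) = min (S.vl Q D) (ei Q * b))" .
qed

text \<open>Full growth up to b means that P^b O_K divides D at P. Once this fails, equality permits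
  no growth at all, so all Q above P are exhausted at the same b.\<close>

lemma local_equality:
  assumes P: "is_prime_ideal R P" and d: "\<And>Q. Q \<in> above P \<Longrightarrow> S.vl Q D \<le> ei Q * d"
  shows "(\<forall>b<d. lf D P (Suc b) = lf D P b \<or> (lf D P b = real (nR P) ^ b \<and> lf D P (Suc b) = real (nR P) ^ Suc b))
    \<longleftrightarrow> (\<exists>a. \<forall>Q\<in>above P. S.vl Q D = ei Q * a)"
proof
  assume a: "\<exists>a. \<forall>Q\<in>above P. S.vl Q D = ei Q * a"
  then obtain a where a: "\<And>Q. Q \<in> above P \<Longrightarrow> S.vl Q D = ei Q * a" by blast
  show "\<forall>b<d. lf D P (Suc b) = lf D P b \<or> (lf D P b = real (nR P) ^ b \<and> lf D P (Suc b) = real (nR P) ^ Suc b)"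
  proof (intro allI impI)
    fix b
    show "lf D P (Suc b) = lf D P b \<or> (lf D P b = real (nR P) ^ b \<and> lf D P (Suc b) = real (nR P) ^ Suc b)"
    proof (cases "b < a")
      case True
      then have "\<forall>Q\<in>above P. ei Q * b \<le> S.vl Q D" "\<forall>Q\<in>above P. ei Q * Suc b \<le> S.vl Q D"
        using a by (auto intro!: mult_le_mono simp del: mult_Suc_right)
      then show ?thesis using lf_local(4)[OF P, of D b] lf_local(4)[OF P, of D "Suc b"] by blast
    next
      case False
      have "min (S.vl Q D) (ei Q * Suc b) = min (S.vl Q D) (ei Q * b)" if Q: "Q \<in> above P" for Q
      proof -
        have "ei Q * a \<le> ei Q * b" "ei Q * a \<le> ei Q * Suc b" using False by (intro mult_le_mono; simp)+
        then show ?thesis unfolding a[OF Q] by (simp only: min_absorb1)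
      qed
      then show ?thesis using lf_local(5)[OF P, of D b] by blast
    qed
  qed
next
  assume st: "\<forall>b<d. lf D P (Suc b) = lf D P b \<or> (lf D P b = real (nR P) ^ b \<and> lf D P (Suc b) = real (nR P) ^ Suc b)"
  \<comment> \<open>The largest such b will be the common exponent. The clause b \<le> d bounds the
    search, and if the maximum is d itself, the hypothesis on d supplies the opposite
    inequality.\<close>
  define A where "A b \<longleftrightarrow> b \<le> d \<and> (\<forall>Q\<in>above P. ei Q * b \<le> S.vl Q D)" for b
  have A0: "A 0" unfolding A_def by simp
  have bd: "b \<le> d" if "A b" for b using that unfolding A_def by simp
  define a where "a = (GREATEST b. A b)"
  have Aa: "A a" unfolding a_def by (rule GreatestI_nat[where P = A, OF A0 bd])
  have nA: "\<not> A (Suc a)"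
  proof
    assume "A (Suc a)"
    then have "Suc a \<le> a" unfolding a_def by (rule Greatest_le_nat[where P = A, OF _ bd])
    then show False by simp
  qed
  show "\<exists>a. \<forall>Q\<in>above P. S.vl Q D = ei Q * a"
  proof (intro exI ballI)
    fix Q assume Q: "Q \<in> above P"
    show "S.vl Q D = ei Q * a"
    proof (cases "a = d")
      case True
      then show ?thesis using d[OF Q] Aa Q unfolding A_def by (simp add: order_antisym)
    next
      case False
      then have ad: "a < d" using Aa unfolding A_def by simp
      have "lf D P (Suc a) \<noteq> real (nR P) ^ Suc a"
        using nA ad lf_local(4)[OF P, of D "Suc a"] unfolding A_def by (simp del: power_Suc mult_Suc_right)
      then have "lf D P (Suc a) = lf D P a" using st ad by blast
      then have "min (S.vl Q D) (ei Q * Suc a) = min (S.vl Q D) (ei Q * a)" using lf_local(5)[OF P, of D a] Q by blast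
      moreover have "ei Q * a \<le> S.vl Q D" using Aa Q unfolding A_def by blast
      moreover have "ei Q > 0" using ei_above[OF P Q] by blast
      ultimately show ?thesis by (auto simp: min_def split: if_splits)
    qed
  qed
qed

text \<open>The sum contains D, so a prime Q dividing it lies above a prime in \<open>T\<close>, and
  the other primes contribute nothing.\<close>

lemma norm_add_ex:
  assumes D: "is_ideal S D \<and> D \<noteq> {0}" and T: "T = {P. is_prime_ideal R P \<and> D \<inter> R \<subseteq> P}" and B: "is_ideal R B \<and> B \<noteq> {0}"
  shows "nS (ideal_add D (ex B)) = (\<Prod>P\<in>T. lw D P (R.vl P B))" "finite T"
proof -
  note DR = nz_inter_R[OF D]
  show finT: "finite T" unfolding T by (rule R.finite_pr[OF DR])
  have TP: "is_prime_ideal R P" if "P \<in> T" for P using that T by simp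
  have i: "is_ideal S D" "is_ideal S (ex B)" using D ex_nz[OF B] by auto
  have nz: "is_ideal S (ideal_add D (ex B)) \<and> ideal_add D (ex B) \<noteq> {0}"
    by (rule S.nzi_mono[OF D S.ideal_add_sup(1)[OF i] S.ideal_add_ideal[OF i]])
  have finU: "finite (\<Union>P\<in>T. above P)" using finT finite_above[OF TP] by blast
  have "nS (ideal_add D (ex B)) = (\<Prod>Q\<in>(\<Union>P\<in>T. above P). nS Q ^ S.vl Q (ideal_add D (ex B)))"
  proof (rule S.norm_vl[OF nz finU])
    show "is_prime_ideal S Q" if "Q \<in> (\<Union>P\<in>T. above P)" for Q using that unfolding above_def by blast
    show "Q \<in> (\<Union>P\<in>T. above P)" if Q: "is_prime_ideal S Q" "ideal_add D (ex B) \<subseteq> Q" for Q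
    proof -
      have "D \<subseteq> Q" using Q(2) S.ideal_add_sup(1)[OF i] by blast
      then have "Q \<inter> R \<in> T" unfolding T using pr_below[OF Q(1)] by blast
      then show ?thesis using Q(1) unfolding above_def by blast
    qed
  qed
  also have "\<dots> = (\<Prod>P\<in>T. \<Prod>Q\<in>above P. nS Q ^ S.vl Q (ideal_add D (ex B)))"
    by (rule prod.UNION_disjoint) (use finT finite_above[OF TP] in \<open>auto simp: above_def\<close>)
  also have "\<dots> = (\<Prod>P\<in>T. lw D P (R.vl P B))" unfolding lw_def
  proof (intro prod.cong refl)
    fix P Q assume P: "P \<in> T" and Q: "Q \<in> above P"
    have Qp: "is_prime_ideal S Q" "Q \<inter> R = P" using Q unfolding above_def by auto
    have "S.vl Q (ideal_add D (ex B)) = min (S.vl Q D) (ei Q * R.vl P B)"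
      using S.vl_add[OF Qp(1) D ex_nz[OF B]] vl_ex[OF Qp(1) B] Qp(2) unfolding ei_def by (simp add: mult.commute)
    then show "nS Q ^ S.vl Q (ideal_add D (ex B)) = nS Q ^ min (S.vl Q D) (ei Q * R.vl P B)" by simp
  qed
  finally show "nS (ideal_add D (ex B)) = (\<Prod>P\<in>T. lw D P (R.vl P B))" .
qed

text \<open>The double sum of \<open>g_k\<close> as a function of the ideal D alone, detached from
  the volume and from the norm of \<alpha>.\<close>

definition fin_sum :: "nat \<Rightarrow> complex set \<Rightarrow> real" where
  "fin_sum n D = (\<Sum>B\<in>{B. is_ideal R B \<and> ideal_dvd B (D \<inter> R)}.
           real (nS (ideal_add D (ideal_gen S B))) powr (real (n + 1) / real m) / real (nR B) *
           (\<Sum>A\<in>{A. is_ideal R A \<and> ideal_dvd A (ideal_quot R (D \<inter> R) B)}.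
              real_of_int (ideal_moebius R A) / real (nR A) *
              (\<Prod>P\<in>{P. is_prime_ideal R P \<and> ideal_dvd P (ideal_mult R A B)}.
                 (real (nR P) ^ (n + 1) - real (nR P)) / (real (nR P) ^ (n + 1) - 1))))"

lemma powr_prod_lw:
  assumes "finite T" "\<And>P. P \<in> T \<Longrightarrow> is_prime_ideal R P"
  shows "real (\<Prod>P\<in>T. lw D P (b P)) powr (real j / real m) = (\<Prod>P\<in>T. lf D P (b P) ^ j)"
proof -
  have "real (\<Prod>P\<in>T. lw D P (b P)) powr (real j / real m) = (\<Prod>P\<in>T. real (lw D P (b P)) powr (real j / real m))"
    by (simp add: prod_powr_distrib)
  also have "\<dots> = (\<Prod>P\<in>T. lf D P (b P) ^ j)"
  proof (rule prod.cong)
    fix P assume "P \<in> T"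
    then have "real (lw D P (b P)) > 0" using lw_pos assms(2) by simp
    then show "real (lw D P (b P)) powr (real j / real m) = lf D P (b P) ^ j"
      unfolding lf_def by (simp add: powr_powr flip: powr_realpow)
  qed simp
  finally show ?thesis .
qed

lemma fin_sum_bound:
  assumes D: "is_ideal S D \<and> D \<noteq> {0}" and n: "n \<ge> 1"
  shows "fin_sum n D \<le> real (nS D) powr (real n / real m)" "fin_sum n D > 0"
    "fin_sum n D = real (nS D) powr (real n / real m) \<longleftrightarrow>
      (\<forall>P. is_prime_ideal R P \<longrightarrow> (\<exists>a. \<forall>Q\<in>above P. S.vl Q D = ei Q * a))"
proof -
  define T where "T = {P. is_prime_ideal R P \<and> D \<inter> R \<subseteq> P}"
  define d where "d P = R.vl P (D \<inter> R)" for P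
  note DR = nz_inter_R[OF D]
  note ne = norm_add_ex[OF D T_def]
  have finT: "finite T" using ne(2)[OF DR] .
  have TP: "is_prime_ideal R P" if "P \<in> T" for P using that T_def by simp
  have "fin_sum n D = (\<Sum>B\<in>{B. is_ideal R B \<and> ideal_dvd B (D \<inter> R)}.
           (\<Prod>P\<in>T. lf D P (R.vl P B) ^ (n + 1)) / real (nR B) *
           (\<Sum>A\<in>{A. is_ideal R A \<and> ideal_dvd A (ideal_quot R (D \<inter> R) B)}.
              real_of_int (ideal_moebius R A) / real (nR A) *
              (\<Prod>P\<in>{P. is_prime_ideal R P \<and> ideal_dvd P (ideal_mult R A B)}.
                 (real (nR P) ^ (n + 1) - real (nR P)) / (real (nR P) ^ (n + 1) - 1))))"
    unfolding fin_sum_def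
  proof (rule sum.cong[OF refl])
    fix B assume "B \<in> {B. is_ideal R B \<and> ideal_dvd B (D \<inter> R)}"
    then have B: "is_ideal R B \<and> B \<noteq> {0}" using R.nzi_mono[OF DR] unfolding ideal_dvd_def by blast
    have "real (nS (ideal_add D (ideal_gen S B))) powr (real (n + 1) / real m) = (\<Prod>P\<in>T. lf D P (R.vl P B) ^ (n + 1))"
      using powr_prod_lw[OF finT TP, of D "\<lambda>P. R.vl P B" "n + 1"] ne(1)[OF B] unfolding ex_def by simp
    then show "real (nS (ideal_add D (ideal_gen S B))) powr (real (n + 1) / real m) / real (nR B) *
           (\<Sum>A\<in>{A. is_ideal R A \<and> ideal_dvd A (ideal_quot R (D \<inter> R) B)}.
              real_of_int (ideal_moebius R A) / real (nR A) *
              (\<Prod>P\<in>{P. is_prime_ideal R P \<and> ideal_dvd P (ideal_mult R A B)}.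
                 (real (nR P) ^ (n + 1) - real (nR P)) / (real (nR P) ^ (n + 1) - 1))) =
        (\<Prod>P\<in>T. lf D P (R.vl P B) ^ (n + 1)) / real (nR B) *
           (\<Sum>A\<in>{A. is_ideal R A \<and> ideal_dvd A (ideal_quot R (D \<inter> R) B)}.
              real_of_int (ideal_moebius R A) / real (nR A) *
              (\<Prod>P\<in>{P. is_prime_ideal R P \<and> ideal_dvd P (ideal_mult R A B)}.
                 (real (nR P) ^ (n + 1) - real (nR P)) / (real (nR P) ^ (n + 1) - 1)))" by (simp only:)
  qed
  also have "\<dots> = (\<Prod>P\<in>T. local_factor n (real (nR P)) (lf D P) (d P))"
    unfolding local_factor_def d_def
    by (rule R.divisor_euler_product[OF DR T_def, where l = "\<lambda>P b. lf D P b ^ (n + 1)" and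
        \<rho> = "\<lambda>P. (real (nR P) ^ (n + 1) - real (nR P)) / (real (nR P) ^ (n + 1) - 1)"])
  finally have FS: "fin_sum n D = (\<Prod>P\<in>T. local_factor n (real (nR P)) (lf D P) (d P))" .
  have q: "real (nR P) > 1" if "P \<in> T" for P using R.norm_pr_ge_2[OF TP[OF that]] by simp
  have lb: "local_factor n (real (nR P)) (lf D P) (d P) \<le> lf D P (d P) ^ n" "local_factor n (real (nR P)) (lf D P) (d P) > 0"
    "local_factor n (real (nR P)) (lf D P) (d P) = lf D P (d P) ^ n \<longleftrightarrow> (\<forall>b<d P. lf D P (Suc b) = lf D P b \<or>
        (lf D P b = real (nR P) ^ b \<and> lf D P (Suc b) = real (nR P) ^ Suc b))" if P: "P \<in> T" for P
    using local_factor_bound[where l = "lf D P" and d = "d P", OF q[OF P] n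
        lf_local(1)[OF TP[OF P]] lf_local(2)[OF TP[OF P]] lf_local(3)[OF TP[OF P]]] by blast+
  have exD: "ex (D \<inter> R) \<subseteq> D" using ex_least[of D "D \<inter> R"] D by blast
  \<comment> \<open>D contains the extension of D \<inter> R, and this bounds its exponents.\<close>
  have vd: "S.vl Q D \<le> ei Q * d P" if P: "is_prime_ideal R P" and Q: "Q \<in> above P" for P Q
  proof -
    have Qp: "is_prime_ideal S Q" "Q \<inter> R = P" using Q unfolding above_def by auto
    have "S.vl Q D \<le> S.vl Q (ex (D \<inter> R))" using S.vl_antimono[OF Qp(1) ex_nz[OF DR] _ exD] D by blast
    then show ?thesis using vl_ex[OF Qp(1) DR] Qp(2) unfolding ei_def d_def by (simp add: mult.commute)
  qed
  \<comment> \<open>For B = D \<inter> R the ideal (D, B) is D, so the last weights multiply to the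
    root of the full norm of D.\<close>
  have "ideal_add D (ex (D \<inter> R)) = D"
    using S.ideal_add_sup[of D "ex (D \<inter> R)"] D ex_nz[OF DR] exD by blast
  then have "nS D = (\<Prod>P\<in>T. lw D P (d P))" using ne(1)[OF DR] unfolding d_def by simp
  then have ND: "real (nS D) powr (real n / real m) = (\<Prod>P\<in>T. lf D P (d P) ^ n)"
    using powr_prod_lw[OF finT TP, of D d n] by simp
  have lp: "lf D P (d P) ^ n > 0" if "P \<in> T" for P using lw_pos[OF TP[OF that]] unfolding lf_def by simp
  have pl: "(\<Prod>P\<in>T. local_factor n (real (nR P)) (lf D P) (d P)) \<le> (\<Prod>P\<in>T. lf D P (d P) ^ n)"
    "(\<Prod>P\<in>T. local_factor n (real (nR P)) (lf D P) (d P)) = (\<Prod>P\<in>T. lf D P (d P) ^ n) \<longleftrightarrow>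
       (\<forall>P\<in>T. local_factor n (real (nR P)) (lf D P) (d P) = lf D P (d P) ^ n)"
    by (rule prod_le_eq_iff[OF finT]; use lb(1,2) lp in \<open>blast intro: less_imp_le\<close>)+
  show "fin_sum n D \<le> real (nS D) powr (real n / real m)" unfolding FS ND by (rule pl(1))
  show "fin_sum n D > 0" unfolding FS using lb(2) by (intro prod_pos) blast
  have "fin_sum n D = real (nS D) powr (real n / real m) \<longleftrightarrow> (\<forall>P\<in>T. \<exists>a. \<forall>Q\<in>above P. S.vl Q D = ei Q * a)"
    unfolding FS ND pl(2)
  proof (rule ball_cong[OF refl])
    fix P assume P: "P \<in> T"
    show "local_factor n (real (nR P)) (lf D P) (d P) = lf D P (d P) ^ n \<longleftrightarrow> (\<exists>a. \<forall>Q\<in>above P. S.vl Q D = ei Q * a)"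
      unfolding lb(3)[OF P] by (rule local_equality[OF TP[OF P] vd[OF TP[OF P]]])
  qed
  also have "\<dots> \<longleftrightarrow> (\<forall>P. is_prime_ideal R P \<longrightarrow> (\<exists>a. \<forall>Q\<in>above P. S.vl Q D = ei Q * a))"
  proof
    assume a: "\<forall>P\<in>T. \<exists>a. \<forall>Q\<in>above P. S.vl Q D = ei Q * a"
    show "\<forall>P. is_prime_ideal R P \<longrightarrow> (\<exists>a. \<forall>Q\<in>above P. S.vl Q D = ei Q * a)"
    proof (intro allI impI)
      fix P assume P: "is_prime_ideal R P"
      show "\<exists>a. \<forall>Q\<in>above P. S.vl Q D = ei Q * a"
      proof (cases "P \<in> T")
        case False
        \<comment> \<open>P does not divide D \<inter> R, so no Q above it divides D and the common
          exponent is 0.\<close>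
        then have "d P = 0" unfolding d_def using R.vl_pos_iff[OF P DR] P unfolding T_def by simp
        then show ?thesis using vd[OF P] by (intro exI[of _ 0]) auto
      qed (use a in blast)
    qed
  qed (use TP in blast)
  finally show "fin_sum n D = real (nS D) powr (real n / real m) \<longleftrightarrow>
      (\<forall>P. is_prime_ideal R P \<longrightarrow> (\<exists>a. \<forall>Q\<in>above P. S.vl Q D = ei Q * a))" .
qed

end

section \<open>Absolute values at finite places\<close>

text \<open>A prime ideal contains a positive integer and therefore one of its prime factors; two
  different prime numbers in it would put 1 into it by Bezout. Existence and uniqueness together
  justify the \<open>THE\<close> in \<open>prime_below\<close>.\<close>

lemma prime_below_props:
  assumes F: "number_field F" and P: "is_prime_ideal (ring_of_integers F) P"
  shows "prime (prime_below P)" "of_nat (prime_below P) \<in> P"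
proof -
  define R where "R = ring_of_integers F"
  interpret dedekind_ring R unfolding R_def by (rule dedekind_ring_integers[OF F])
  have P: "pr P" using P unfolding R_def .
  note Pi = prD(1)[OF P]
  have int: "of_int i \<in> R" for i using integers_ring(6)[OF F] unfolding R_def by simp
  have nat: "of_nat i \<in> R" for i using int[of "int i"] by simp
  obtain a where a: "a \<in> P" "a \<noteq> 0" using prD(4)[OF P] idealD(2) by blast
  have "a \<in> R" using a Pi idealD(3) by blast
  then obtain b n where b: "b \<in> R" "n > 0" "a * b = of_nat n" using cnorm_ge_1(2)[OF F] a(2) unfolding R_def by blast
  have nP: "of_nat n \<in> P" using idealD(6)[OF Pi b(1) a(1)] b(3) by simp
  have "\<exists>p. prime p \<and> of_nat p \<in> P" if "n > 0" "of_nat n \<in> P" for n :: nat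
    using that
  proof (induction n rule: less_induct)
    case (less n)
    have n1: "n \<noteq> 1" using less(3) prD(5)[OF P] by auto
    then obtain p where p: "p dvd n" "prime p" using prime_divisor_exists[of n] less(2) by auto
    then obtain j where j: "n = p * j" by blast
    have "of_nat p * of_nat j \<in> P" using less(3) unfolding j by simp
    then consider "of_nat p \<in> P" | "of_nat j \<in> P" using prD(6)[OF P nat nat] by blast
    then show ?case
    proof cases
      case 2
      have "j > 0" using less(2) j by (cases j) auto
      moreover have "j < n" using j \<open>j > 0\<close> prime_gt_1_nat[OF p(2)] by simp
      ultimately show ?thesis using less(1) 2 by blast
    qed (use p in blast)
  qed
  then obtain p where p: "prime p" "of_nat p \<in> P" using b(2) nP by blast
  have uniq: "q = p" if q: "prime q" "of_nat q \<in> P" for q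
  proof (rule ccontr)
    assume "q \<noteq> p"
    then have cop: "coprime (int q) (int p)" using primes_coprime[OF q(1) p(1)] by (simp add: coprime_int_iff)
    obtain u v where "u * int q + v * int p = 1" using bezout_int[of "int q" "int p"] cop by auto
    then have "of_int (u * int q + v * int p) = (1::complex)" by simp
    then have "of_int u * of_nat q + of_int v * of_nat p = (1::complex)" by simp
    then have "1 \<in> P" using idealD(4)[OF Pi idealD(5)[OF Pi int q(2)] idealD(5)[OF Pi int p(2)]] by metis
    then show False using prD(5)[OF P] by simp
  qed
  have "prime (THE p. prime p \<and> of_nat p \<in> P) \<and> of_nat (THE p. prime p \<and> of_nat p \<in> P) \<in> P"
  proof (rule theI[of "\<lambda>p. prime p \<and> of_nat p \<in> P" p])
    show "q = p" if "prime q \<and> of_nat q \<in> P" for q using that uniq[of q] by blast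
  qed (use p in blast)
  then show "prime (prime_below P)" "of_nat (prime_below P) \<in> P" unfolding prime_below_def by blast+
qed

text \<open>Consecutive powers of P differ, and any element of the a-th power outside the next one
  has exponent exactly a. It will realize a prescribed absolute value.\<close>

lemma (in dedekind_ring) ex_vl_element:
  assumes P: "pr P" shows "\<exists>s\<in>R. s \<noteq> 0 \<and> vl P (pri s) = a"
proof -
  note Pn = prD(4)[OF P]
  have "\<not> P \<up> a \<subseteq> P \<up> Suc a"
  proof
    assume "P \<up> a \<subseteq> P \<up> Suc a"
    then have "Suc a \<le> vl P (P \<up> a)" using vl_ge_iff[OF P ipow_nzi[OF Pn]] by blast
    moreover have "vl P (P \<up> a) = a" using vl_unique[OF P nzi_R, of a] imult_R(1) ipow_nzi[OF Pn, of a] prD(2)[OF P] idealD(1)[OF prD(1)[OF P]]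
      by auto
    ultimately show False by simp
  qed
  then obtain s where s: "s \<in> P \<up> a" "s \<notin> P \<up> Suc a" by blast
  have i: "is_ideal R (P \<up> j)" for j using ipow_nzi[OF Pn, of j] by blast
  have sR: "s \<in> R" using s(1) idealD(3)[OF i] by blast
  have s0: "s \<noteq> 0" using s(2) idealD(2)[OF i, of "Suc a"] by blast
  have *: "j \<le> vl P (pri s) \<longleftrightarrow> s \<in> P \<up> j" for j
    using vl_ge_iff[OF P nzi_pri[OF sR s0], of j] pri_subset[OF i, of s j] pri_self[of s] by blast
  have "a \<le> vl P (pri s)" "\<not> Suc a \<le> vl P (pri s)" using * s by blast+
  then show ?thesis using sR s0 by (intro bexI[of _ s]) auto
qed

context simple_extension begin

lemma padic_abs_R:
  assumes P: "is_prime_ideal R P" and st: "s \<in> R" "t \<in> R" "s \<noteq> 0" "t \<noteq> 0"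
  shows "padic_abs R P (s / t) = real (prime_below P) powr
    (- (real (R.vl P (principal_ideal R s)) - real (R.vl P (principal_ideal R t))) / real (R.vl P (principal_ideal R (of_nat (prime_below P)))))"
proof -
  note pb = prime_below_props[OF number_field_k, folded R_def, OF P]
  have p0: "complex_of_nat (prime_below P) \<noteq> 0" using prime_gt_0_nat[OF pb(1)] by simp
  have pR: "of_nat (prime_below P) \<in> R" using R.idealD(3)[OF R.prD(1)[OF P] pb(2)] .
  show ?thesis unfolding padic_abs_def R.pval_R[OF pR p0 P] R.pval_div[OF st P] using st by simp
qed

lemma vl_p_pos:
  assumes P: "is_prime_ideal R P" shows "R.vl P (principal_ideal R (of_nat (prime_below P))) > 0" "prime_below P > 1"
proof -
  note pb = prime_below_props[OF number_field_k, folded R_def, OF P]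
  show "prime_below P > 1" using prime_gt_1_nat[OF pb(1)] .
  then have p0: "complex_of_nat (prime_below P) \<noteq> 0" by simp
  have pR: "of_nat (prime_below P) \<in> R" using R.idealD(3)[OF R.prD(1)[OF P] pb(2)] .
  show "R.vl P (principal_ideal R (of_nat (prime_below P))) > 0"
    using R.vl_pos_iff[OF P R.nzi_pri[OF pR p0]] R.pri_subset[OF R.prD(1)[OF P] pb(2)] by blast
qed

lemma vl_pri_R:
  assumes Q: "Q \<in> above P" and a: "a \<in> R" "a \<noteq> 0"
  shows "S.vl Q (principal_ideal S a) = ei Q * R.vl P (principal_ideal R a)"
  using vl_ex[of Q "principal_ideal R a"] R.nzi_pri[OF a] ex_pri[OF a(1)] Q unfolding above_def ei_def by auto

lemma prime_below_above:
  assumes P: "is_prime_ideal R P" and Q: "Q \<in> above P" shows "prime_below Q = prime_below P"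
proof -
  have "of_nat p \<in> Q \<longleftrightarrow> of_nat p \<in> P" for p
    using Q integers_ring(6)[OF number_field_k] unfolding above_def R_def by auto
  then show ?thesis unfolding prime_below_def by simp
qed

text \<open>The ramification index of Q over p is \<open>ei Q\<close> times that of P over p.
  Dividing by \<open>ei Q\<close> puts all Q above P on one scale, where Q enters only through the
  ratio of the exponent of \<alpha>\<theta> to \<open>ei Q\<close>.\<close>

lemma padic_abs_S:
  assumes P: "is_prime_ideal R P" and Q: "Q \<in> above P" and a: "\<alpha> \<in> R" "\<alpha> \<noteq> 0" and at: "\<alpha> * \<theta> \<in> S" "\<theta> \<noteq> 0"
  shows "padic_abs S Q \<theta> = real (prime_below P) powr
    (- (real (S.vl Q (principal_ideal S (\<alpha> * \<theta>))) / real (ei Q) - real (R.vl P (principal_ideal R \<alpha>)))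
      / real (R.vl P (principal_ideal R (of_nat (prime_below P)))))"
proof -
  have Qp: "is_prime_ideal S Q" using Q unfolding above_def by blast
  have e: "real (ei Q) > 0" using ei_above[OF P Q] by simp
  note pb = prime_below_props[OF number_field_k, folded R_def, OF P]
  have p0: "complex_of_nat (prime_below P) \<noteq> 0" using prime_gt_0_nat[OF pb(1)] by simp
  have pR: "of_nat (prime_below P) \<in> R" using R.idealD(3)[OF R.prD(1)[OF P] pb(2)] .
  have aS: "\<alpha> \<in> S" "of_nat (prime_below P) \<in> S" using a(1) pR R_subset_S by auto
  have "pval S Q (\<alpha> * \<theta> / \<alpha>) = int (S.vl Q (principal_ideal S (\<alpha> * \<theta>))) - int (S.vl Q (principal_ideal S \<alpha>))"
    by (rule S.pval_div[OF at(1) aS(1) _ a(2) Qp]) (use a at in simp)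
  then have pv: "pval S Q \<theta> = int (S.vl Q (principal_ideal S (\<alpha> * \<theta>))) - int (ei Q * R.vl P (principal_ideal R \<alpha>))"
    using a(2) vl_pri_R[OF Q a] by simp
  have pp: "pval S Q (of_nat (prime_below P)) = int (ei Q * R.vl P (principal_ideal R (of_nat (prime_below P))))"
    using S.pval_R[OF aS(2) p0 Qp] vl_pri_R[OF Q pR p0] by simp
  have "- real_of_int (pval S Q \<theta>) / real_of_int (pval S Q (of_nat (prime_below P))) =
      - (real (S.vl Q (principal_ideal S (\<alpha> * \<theta>))) / real (ei Q) - real (R.vl P (principal_ideal R \<alpha>)))
      / real (R.vl P (principal_ideal R (of_nat (prime_below P))))"
    unfolding pv pp using e vl_p_pos(1)[OF P] by (simp add: field_simps)
  then show ?thesis unfolding padic_abs_def prime_below_above[OF P Q] using at(2) by simp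
qed

text \<open>Suitably scaled, the logarithm of the absolute value is an integer at every nonzero
  element of k. The integers are closed, so limits in the completion create no new positive
  value.\<close>

lemma completion_padic_discrete:
  assumes P: "is_prime_ideal R P" and x: "x \<in> completion_abs_values k (padic_abs R P)" "x > 0"
  shows "\<exists>i::int. x = real (prime_below P) powr (- of_int i / real (R.vl P (principal_ideal R (of_nat (prime_below P)))))"
proof -
  define p where "p = real (prime_below P)"
  define w where "w = real (R.vl P (principal_ideal R (of_nat (prime_below P))))"
  have p1: "p > 1" and w0: "w > 0" using vl_p_pos[OF P] unfolding p_def w_def by simp_all
  obtain a where a: "\<And>j. a j \<in> k" "(\<lambda>j. padic_abs R P (a j)) \<longlonglongrightarrow> x"
    using x(1) unfolding completion_abs_values_def by blast
  have val: "- w * log p (padic_abs R P y) \<in> \<int>" if y: "y \<in> k" "y \<noteq> 0" for y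
  proof -
    obtain N :: nat where N: "N > 0" "of_nat N * y \<in> R" using integral_multiple[OF number_field_k y(1)] unfolding R_def by blast
    have NR: "of_nat N \<in> R" using integers_ring(6)[OF number_field_k] unfolding R_def by simp
    have "padic_abs R P (of_nat N * y / of_nat N) = p powr
      (- (real (R.vl P (principal_ideal R (of_nat N * y))) - real (R.vl P (principal_ideal R (of_nat N)))) / w)"
      unfolding p_def w_def by (rule padic_abs_R[OF P N(2) NR]) (use y N in auto)
    then have "- w * log p (padic_abs R P y) =
        real_of_int (int (R.vl P (principal_ideal R (of_nat N * y))) - int (R.vl P (principal_ideal R (of_nat N))))"
      using N(1) p1 w0 by (simp add: field_simps)
    then show ?thesis by (metis Ints_of_int)
  qed
  have "eventually (\<lambda>j. padic_abs R P (a j) > 0) sequentially" using order_tendstoD(1)[OF a(2) x(2)] .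
  then have ev: "eventually (\<lambda>j. - w * log p (padic_abs R P (a j)) \<in> \<int>) sequentially"
  proof (rule eventually_mono)
    fix j assume "padic_abs R P (a j) > 0"
    then have "a j \<noteq> 0" unfolding padic_abs_def by auto
    then show "- w * log p (padic_abs R P (a j)) \<in> \<int>" using val a(1) by blast
  qed
  have "(\<lambda>j. log p (padic_abs R P (a j))) \<longlonglongrightarrow> log p x"
    by (rule tendsto_log[OF tendsto_const a(2)]) (use p1 x(2) in auto)
  then have lim: "(\<lambda>j. - w * log p (padic_abs R P (a j))) \<longlonglongrightarrow> - w * log p x" by (rule tendsto_mult_left)
  have "- w * log p x \<in> \<int>"
    by (rule Lim_in_closed_set[OF closed_Ints ev _ lim]) simp
  then obtain i where "- w * log p x = of_int i" by (rule Ints_cases)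
  then have "log p x = - of_int i / w" using w0 by (simp add: field_simps)
  then have "p powr (- of_int i / w) = x" using powr_log_cancel[of p x] p1 x(2) by simp
  then show ?thesis unfolding p_def w_def by blast
qed

text \<open>The values at all Q above P agree exactly when the ratio of the exponent of
  \<alpha>\<theta> to \<open>ei Q\<close> does not depend on Q; membership in the value group of k
  forces this ratio to be an integer.\<close>

lemma padic_equality:
  assumes P: "is_prime_ideal R P" and a: "\<alpha> \<in> R" "\<alpha> \<noteq> 0" and at: "\<alpha> * \<theta> \<in> S" "\<theta> \<noteq> 0"
  shows "(\<exists>x\<in>completion_abs_values k (padic_abs R P). \<forall>Q. is_prime_ideal S Q \<and> Q \<inter> R = P \<longrightarrow> padic_abs S Q \<theta> = x)
    \<longleftrightarrow> (\<exists>c. \<forall>Q\<in>above P. S.vl Q (principal_ideal S (\<alpha> * \<theta>)) = ei Q * c)"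
proof -
  define p where "p = real (prime_below P)"
  define w where "w = real (R.vl P (principal_ideal R (of_nat (prime_below P))))"
  define A where "A = R.vl P (principal_ideal R \<alpha>)"
  define v where "v Q = S.vl Q (principal_ideal S (\<alpha> * \<theta>))" for Q
  have p1: "p > 1" and w0: "w > 0" using vl_p_pos[OF P] unfolding p_def w_def by simp_all
  have val: "padic_abs S Q \<theta> = p powr (- (real (v Q) / real (ei Q) - real A) / w)" if "Q \<in> above P" for Q
    using padic_abs_S[OF P that a at] unfolding p_def w_def A_def v_def .
  have e: "real (ei Q) > 0" if "Q \<in> above P" for Q using ei_above[OF P that] by simp
  show ?thesis unfolding v_def[symmetric]
  proof
    assume "\<exists>c. \<forall>Q\<in>above P. v Q = ei Q * c"
    then obtain c where c: "\<And>Q. Q \<in> above P \<Longrightarrow> v Q = ei Q * c" by blast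
    \<comment> \<open>An element of exponent c, divided by \<alpha>, has the required value already
      in k, so a constant sequence represents it in the completion.\<close>
    obtain s where s: "s \<in> R" "s \<noteq> 0" "R.vl P (principal_ideal R s) = c" using R.ex_vl_element[OF P] by blast
    define x where "x = padic_abs R P (s / \<alpha>)"
    have xv: "x = p powr (- (real c - real A) / w)"
      unfolding x_def padic_abs_R[OF P s(1) a(1) s(2) a(2)] s(3) p_def w_def A_def ..
    have sk: "s / \<alpha> \<in> k" using s(1) a(1) R_subset_k subfieldD(8)[OF subfield_k] by blast
    have "x \<in> completion_abs_values k (padic_abs R P)" unfolding completion_abs_values_def
    proof (intro CollectI exI[of _ "\<lambda>_::nat. s / \<alpha>"] conjI allI impI)
      show "s / \<alpha> \<in> k" by (rule sk)
      show "\<exists>N. \<forall>m\<ge>N. \<forall>j\<ge>N. padic_abs R P (s / \<alpha> - s / \<alpha>) < e" if "e > 0" for e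
        using that by (simp add: padic_abs_def)
      show "(\<lambda>j. padic_abs R P (s / \<alpha>)) \<longlonglongrightarrow> x" unfolding x_def by (rule tendsto_const)
    qed
    moreover have "padic_abs S Q \<theta> = x" if "is_prime_ideal S Q \<and> Q \<inter> R = P" for Q
    proof -
      have Q: "Q \<in> above P" using that unfolding above_def by blast
      show ?thesis unfolding val[OF Q] xv c[OF Q] using e[OF Q] by simp
    qed
    ultimately show "\<exists>x\<in>completion_abs_values k (padic_abs R P). \<forall>Q. is_prime_ideal S Q \<and> Q \<inter> R = P \<longrightarrow> padic_abs S Q \<theta> = x"
      by blast
  next
    assume "\<exists>x\<in>completion_abs_values k (padic_abs R P). \<forall>Q. is_prime_ideal S Q \<and> Q \<inter> R = P \<longrightarrow> padic_abs S Q \<theta> = x"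
    then obtain x where x: "x \<in> completion_abs_values k (padic_abs R P)" "\<And>Q. Q \<in> above P \<Longrightarrow> padic_abs S Q \<theta> = x"
      unfolding above_def by blast
    obtain Q0 where Q0: "Q0 \<in> above P" using above_nonempty[OF P] by blast
    have "x > 0" unfolding x(2)[OF Q0, symmetric] val[OF Q0] using p1 by simp
    then obtain i where i: "x = p powr (- of_int i / w)" using completion_padic_discrete[OF P x(1)] unfolding p_def w_def by blast
    have vi: "int (v Q) = int (ei Q) * (int A + i)" if Q: "Q \<in> above P" for Q
    proof -
      have "p powr (- (real (v Q) / real (ei Q) - real A) / w) = p powr (- of_int i / w)" using x(2)[OF Q] val[OF Q] i by simp
      then have "- (real (v Q) / real (ei Q) - real A) / w = - of_int i / w" using p1 by (simp only: powr_inj)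
      then have "real (v Q) / real (ei Q) - real A = of_int i" using w0 by (simp only: divide_cancel_right neg_equal_iff_equal) simp
      then have "real (v Q) = real (ei Q) * (real A + of_int i)" using e[OF Q] by (simp add: field_simps)
      then have "real_of_int (int (v Q)) = real_of_int (int (ei Q) * (int A + i))" by simp
      then show ?thesis by (simp only: of_int_eq_iff)
    qed
    \<comment> \<open>The exponents of an integral ideal are nonnegative, so the integer found is a
      natural number, as the claim demands.\<close>
    have "int A + i \<ge> 0"
    proof (rule ccontr)
      assume "\<not> int A + i \<ge> 0"
      then have "int (ei Q0) * (int A + i) < 0" using e[OF Q0] by (simp add: mult_pos_neg)
      then show False using vi[OF Q0] by simp
    qed
    then obtain c where c: "int A + i = int c" using nonneg_int_cases by blast
    have "v Q = ei Q * c" if "Q \<in> above P" for Q using vi[OF that] unfolding c by (simp only: of_nat_eq_iff flip: of_nat_mult)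
    then show "\<exists>c. \<forall>Q\<in>above P. v Q = ei Q * c" by blast
  qed
qed

section \<open>Combining the finite and the Archimedean bounds\<close>

lemma g_k_eq:
  "g_k k \<theta> n \<alpha> = V_const k \<theta> n / real (nR (principal_ideal R \<alpha>)) ^ n * fin_sum n (principal_ideal S (\<alpha> * \<theta>))"
  unfolding g_k_def Let_def fin_sum_def K_def[symmetric] m_def[symmetric] S_def[symmetric] R_def[symmetric] by (rule refl)

text \<open>The norm of D is N(\<alpha>)^m times the norm of \<theta>, so its power n/m splits into
  N(\<alpha>)^n, which cancels the denominator in \<open>g_k\<close>, and X^n, which belongs to the
  volumes.\<close>

lemma g_k_bound:
  assumes a: "\<alpha> \<in> R" "\<alpha> \<noteq> 0" and at: "\<alpha> * \<theta> \<in> S" "\<theta> \<noteq> 0" and n: "n \<ge> 1"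
  shows "g_k k \<theta> n \<alpha> \<le> 1 \<and> (g_k k \<theta> n \<alpha> = 1 \<longleftrightarrow> equality_condition k \<theta>)"
proof -
  define D where "D = principal_ideal S (\<alpha> * \<theta>)"
  have at0: "\<alpha> * \<theta> \<noteq> 0" using a at by simp
  have D: "is_ideal S D \<and> D \<noteq> {0}" unfolding D_def by (rule S.nzi_pri[OF at(1) at0])
  define X where "X = cnorm K \<theta> powr (1 / real m)"
  define Na where "Na = cnorm k \<alpha>"
  have Na: "real (nR (principal_ideal R \<alpha>)) = Na"
    using ideal_norm_principal[OF number_field_k a[unfolded R_def]] unfolding R_def Na_def .
  have Na0: "Na > 0" using cnorm_ge_1(1)[OF number_field_k a[unfolded R_def]] unfolding Na_def by simp
  have ak: "\<alpha> \<in> k" "\<alpha> \<in> K" using a(1) R_subset_k adj(3) by auto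
  have t0: "cnorm K \<theta> > 0" unfolding cnorm_def
    using emb_field(4)[OF _ subfield_K adj(4) at(2)] by (intro prod_pos) simp
  have X0: "X > 0" unfolding X_def using t0 by simp
  have "real (nS D) = cnorm K (\<alpha> * \<theta>)"
    using ideal_norm_principal[OF adj(1) at(1)[unfolded S_def] at0] unfolding D_def S_def .
  also have "\<dots> = Na ^ m * cnorm K \<theta>" using cnorm_mult[OF ak(2) adj(4)] cnorm_K[OF ak(1)] unfolding Na_def by simp
  finally have "real (nS D) powr (real n / real m) = (Na ^ m * cnorm K \<theta>) powr (real n / real m)" by simp
  also have "\<dots> = ((Na ^ m) powr (real n / real m)) * (cnorm K \<theta> powr (real n / real m))"
    using Na0 t0 by (simp add: powr_mult)
  also have "(Na ^ m) powr (real n / real m) = Na ^ n"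
    using Na0 adj(2) by (simp add: powr_powr flip: powr_realpow)
  also have "cnorm K \<theta> powr (real n / real m) = X ^ n"
    unfolding X_def using t0 by (simp add: powr_powr flip: powr_realpow)
  finally have ND: "real (nS D) powr (real n / real m) = Na ^ n * X ^ n" .
  define Y where "Y = Na ^ n * X ^ n"
  have Y0: "Y > 0" unfolding Y_def using Na0 X0 by simp
  note fs = fin_sum_bound[OF D n, unfolded ND, folded Y_def]
  define u where "u = V_const k \<theta> n * X ^ n"
  define r where "r = fin_sum n D / Y"
  note vb = V_const_bound[OF at(2) n, folded X_def u_def]
  have g: "g_k k \<theta> n \<alpha> = u * r"
    unfolding g_k_eq Na D_def[symmetric] u_def r_def Y_def using Na0 X0 by (simp add: field_simps)
  have r: "0 < r" "r \<le> 1" unfolding r_def using fs(1,2) Y0 by simp_all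
  have le: "u * r \<le> u * 1" using r vb(2) by (intro mult_left_mono) auto
  have "u * r \<le> 1" using le vb(1) by simp
  \<comment> \<open>Both factors are at most 1, \<open>u\<close> is nonnegative and \<open>r\<close>
    positive, so the product is 1 only if both are. The factor \<open>u\<close> carries the
    Archimedean conditions and \<open>r\<close> the finite ones.\<close>
  moreover have "u * r = 1 \<longleftrightarrow> u = 1 \<and> r = 1"
  proof
    assume "u * r = 1"
    then have "u = 1" using le vb(1) by simp
    then show "u = 1 \<and> r = 1" using \<open>u * r = 1\<close> by simp
  qed simp
  moreover have "r = 1 \<longleftrightarrow> (\<forall>P. is_prime_ideal R P \<longrightarrow> (\<exists>x\<in>completion_abs_values k (padic_abs R P).
         \<forall>Q. is_prime_ideal S Q \<and> Q \<inter> R = P \<longrightarrow> padic_abs S Q \<theta> = x))"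
  proof -
    have "r = 1 \<longleftrightarrow> fin_sum n D = Y" unfolding r_def using Y0 by (auto simp: field_simps)
    also have "\<dots> \<longleftrightarrow> (\<forall>P. is_prime_ideal R P \<longrightarrow> (\<exists>c. \<forall>Q\<in>above P. S.vl Q D = ei Q * c))" by (rule fs(3))
    also have "\<dots> \<longleftrightarrow> (\<forall>P. is_prime_ideal R P \<longrightarrow> (\<exists>x\<in>completion_abs_values k (padic_abs R P).
         \<forall>Q. is_prime_ideal S Q \<and> Q \<inter> R = P \<longrightarrow> padic_abs S Q \<theta> = x))"
      using padic_equality[OF _ a at] unfolding D_def by simp
    finally show ?thesis .
  qed
  ultimately show ?thesis unfolding g equality_condition_def Let_def K_def[symmetric] R_def[symmetric] S_def[symmetric]
    using vb(3) by simp
qed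

end

theorem theorem1p2:
  fixes k :: "complex set" and \<theta> \<alpha> :: complex and n :: nat
  assumes "number_field k"
    and "n \<ge> 1"
    and "algebraic \<theta>" and "\<theta> \<noteq> 0"
    and "\<alpha> \<in> ring_of_integers k" and "\<alpha> \<noteq> 0"
    and "\<alpha> * \<theta> \<in> ring_of_integers (adjoin k \<theta>)"
  shows "g_k k \<theta> n \<alpha> \<le> 1 \<and> (g_k k \<theta> n \<alpha> = 1 \<longleftrightarrow> equality_condition k \<theta>)"
proof -
  interpret simple_extension k \<theta> by standard (use assms in auto)
  show ?thesis
    using g_k_bound[of \<alpha> n] assms unfolding R_def S_def K_def by blast
qed

end
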